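(* (Non-unitary test for Harish-Chandra modules.) Let $X$ be a Harish-Chandra module of $G=Sp_{2n}(\mathbb{R})$ or $G=O(p,q)$, $p+q=2n+1$. (1) If for any (i.e. some) character $\mu$ of $K$ and $k=1,\dots,n$ the $\mathfrak B_k^\theta$-module $\overline{F_{\mu,k}(X)}$ is not unitary, then the Langlands quotient $\overline X$ of $X$ is not a unitary $G$-module. (2) In the case when $G$ is split, $X$ is a subrepresentation of a principal series module $X_\delta^\nu$, and $F_{\mu,k}(X)$, $F_{\underline\mu,n-k}(X)$ (with $k,\mu,\underline\mu$ attached to $\delta$ as in the context) are Hecke algebra modules. In this case, if either $\overline{F_{\mu,k}(X)}$ or $\overline{F_{\underline\mu,n-k}(X)}$ is not unitary as a Hecke algebra module, then $\overline X$ is not unitary as a $G$-module.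
   Context: Groups. $Sp_{2n}(\mathbb{R})$ preserves the form with matrix $\begin{bmatrix}0&I_n\\-I_n&0\end{bmatrix}$; $O(p,q)$, $q=\min(p,q)$, preserves $\mathrm{diag}(I_p,-I_q)$. The split cases are $Sp_{2n}(\mathbb R)$ and $O(n+1,n)$, of real rank $n$. $\mathfrak g_0$ is the Lie algebra, $\mathfrak g$ its complexification, $V$ the complexified defining matrix module with standard basis $e_j$. Let $\xi=\begin{bmatrix}0&iI_n\\-iI_n&0\end{bmatrix}$ (symplectic) or $\xi=\mathrm{diag}(I_p,-I_q)$ (orthogonal). Conjugation by $\xi$ is the Cartan involution; $K$ is its fixed group, a maximal compact subgroup, $\mathfrak g=\mathfrak k\oplus\mathfrak p$ and $\mathfrak p_0=\mathfrak p\cap\mathfrak g_0$. $K\cong U(n)$, where $\det$ differentiates to the trace on $\mathfrak k\cong\mathfrak{gl}_n$ (whose identity matrix is the element $\xi$ of $\mathfrak g$), or $K\cong O(p)\times O(q)$, with characters written $\chi_1\otimes\chi_2$. The algebra $\mathfrak B_l^\theta=\mathfrak B_l^\theta[m_0,m_1]$ (type $B/C$ VW-algebra). It is generated by $t_{i,i+1},e_{i,i+1}$ ($1\le i<l$), $z_i,\theta_i$ ($1\le i\le l$), subject to: the $t_{i,i+1}$ and $\theta_j$ generate a copy of $\mathbb C[W(B_l)]$, $W(B_l)$ the hyperoctahedral group; $e_{i,i+1}^2=m_0e_{i,i+1}$; $t_{i,i+1}e_{i,i+1}=e_{i,i+1}t_{i,i+1}=e_{i,i+1}$; $t_{i,i+1}t_{i+1,i+2}e_{i,i+1}t_{i+1,i+2}t_{i,i+1}=e_{i+1,i+2}$;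 $[t_{i,i+1},e_{j,j+1}]=0$ for $j\ne i,i+1$; $t_{i,i+1}z_i-z_{i+1}t_{i,i+1}=1+e_{i,i+1}$; $[t_{i,i+1},z_j]=[e_{i,i+1},z_j]=0$ for $j\ne i,i+1$; $e_{i,i+1}(z_i+z_{i+1})=0=(z_i+z_{i+1})e_{i,i+1}$; $[z_i,z_j]=0$; $e_{12}z_1^ae_{12}=w_ae_{12}$ for constants $w_a\in\mathbb C$; $[e_{i,i+1},\theta_j]=0$ for all $j$; $e_{i,i+1}\theta_i\theta_{i+1}=e_{i,i+1}=\theta_i\theta_{i+1}e_{i,i+1}$; $[\theta_l,z_j]=0$ for $j\ne l$; $e_{i,i+1}\theta_ie_{i,i+1}=m_1e_{i,i+1}$. Here $(m_0,m_1)=(-n,0)$ for $Sp_{2n}(\mathbb R)$ and $(\lfloor\frac{p+q}2\rfloor,p-q)$ for $O(p,q)$. Functors. $F_{\mu,l}(X)=\operatorname{Hom}_K(\mu,X\otimes V^{\otimes l})$ is a $\mathfrak B_l^\theta$-module through the following action on $X\otimes V^{\otimes l}$. Tensor factors are numbered $0$ (for $X$), $1,\dots,l$; $(g)_i$ is $g$ acting on the $i$-th factor; $\Omega_{ij}=\sum_{b\in B}(b)_i(b^* )_j$ for a basis $B$ of $\mathfrak g$ and dual basis $b\mapsto b^*$ for the Killing form. Then $z_i$ acts by $\sum_{0\le j<i}\Omega_{ji}$, $t_{i,i+1}$ by the flip of factors $i,i+1$, $\theta_i$ by $(\xi)_i$, and $e_{i,i+1}$ by $m_0$ times the projection of factors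 $i,i+1$ onto the trivial $\mathfrak g$-submodule of $V\otimes V$. Principal series (for (2); $p=n+1$, $q=n$ in the orthogonal case). $\mathfrak a\subset\mathfrak p$ is the maximal abelian subalgebra with basis $a_1,\dots,a_n$, $a_i=E_{i,n+i}+E_{n+i,i}$ (symplectic), $a_i=E_{p-i+1,p+i}+E_{p+i,p-i+1}$ (orthogonal). $G=KAN$ is the Iwasawa decomposition, with $A$ having complexified Lie algebra $\mathfrak a$ and $N$ corresponding to the positive restricted roots $\epsilon_i\pm\epsilon_j$ ($i<j$) and those proportional to $\epsilon_i$ ($\epsilon_i$ dual to $a_i$). $M$ is the centralizer of $\mathfrak a_0=\mathfrak a\cap\mathfrak g_0$ in $K$: $M\cong(\mathbb Z_2)^n$, the $i$-th generator acting by $-1$ on $e_i,e_{n+i}$ and by $1$ on the other basis vectors (symplectic); $M\cong O(p-q)\times O(1)^q$, with $O(p-q)$ acting on $e_1,\dots,e_{p-q}$ and the $i$-th generator acting by $-1$ on $e_{p-i+1},e_{p+i}$ (orthogonal). For a character $\delta$ of $M$ and $\nu\in\mathfrak a^*$, $X_\delta^\nu=\operatorname{Ind}_{MAN}^G(\delta\otimes e^\nu\otimes 1)$. Characters and constants. (S) $G=Sp_{2n}(\mathbb R)$: $\delta$ is $-1$ on the first $k$ generators of $M$ and $1$ on the last $n-k$; $\mu=\mathrm{triv}$, $\underline\mu=\det$; $c_\mu=0$, $c_{\underline\mu}=1$, $r_\mu=r_{\underline\mu}=-n$. (O1) orthogonal: $\delta=\mathrm{triv}\otimes\mathrm{triv}^k\otimes\mathrm{sgn}^{q-k}$,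 $\mu=\mathrm{triv}\otimes\det$, $\underline\mu=\mathrm{triv}\otimes\mathrm{triv}$. (O2) orthogonal: $\delta=\det\otimes\mathrm{triv}^k\otimes\mathrm{sgn}^{q-k}$, $\mu=\det\otimes\mathrm{triv}$, $\underline\mu=\det\otimes\det$. In (O1), (O2) (first factor of $\delta$ on $O(p-q)$, the others on $O(1)^q$), $c_\mu=c_{\underline\mu}=\frac{p-q}2$ and $r_\mu=r_{\underline\mu}=\frac{p+q}2$. Hecke algebra. $\mathbb{H}_l(c)$ is, as a vector space, $\mathbb{C}[\epsilon_1,\dots,\epsilon_l]\otimes\mathbb{C}[W(B_l)]$, both factors being subalgebras (reflections $s_{i,i+1}$, $s_{\epsilon_j}$), with relations $s_{i,i+1}\epsilon_i-\epsilon_{i+1}s_{i,i+1}=1$, $[s_{i,i+1},\epsilon_j]=0$ ($j\ne i,i+1$), $s_{\epsilon_l}\epsilon_l+\epsilon_ls_{\epsilon_l}=2c$, $[s_{\epsilon_l},\epsilon_j]=0$ ($j\ne l$). In (2), $F_{\mu,k}(X)$ is a module over $\mathbb{H}_k(c_\mu)$ and $F_{\underline\mu,n-k}(X)$ over $\mathbb{H}_{n-k}(c_{\underline\mu})$, with $\epsilon_i$ acting as $z_i-r_\mu$ (resp. $z_i-r_{\underline\mu}$), $s_{i,i+1}$ as $t_{i,i+1}$, $s_{\epsilon_i}$ as $\theta_i$. Forms. A Hermitian form is a map linear in the first and conjugate linear in the second variable. On a Harish-Chandra module it is invariant if $\langle gx,y\rangle=\langle x,g^*y\rangle$ for $g\in\mathfrak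 g$, where $g^*=-\bar g$ and the bar is conjugation with respect to $\mathfrak g_0$. On $\mathfrak B_l^\theta$ let $\bullet$ be the conjugate-linear antihomomorphism with $z_i^\bullet=z_i$, $e_{i,i+1}^\bullet=e_{i,i+1}$, $g^\bullet=g^{-1}$ for $g\in W(B_l)$, and $b^*=w_0b^\bullet w_0$ with $w_0=\theta_1\cdots\theta_l$; on $\mathbb{H}_l(c)$ let $\bullet$ be the conjugate-linear antihomomorphism with $\epsilon_i^\bullet=\epsilon_i$, $w^\bullet=w^{-1}$ for $w\in W(B_l)$, and $h^*=w_0h^\bullet w_0$ with $w_0=s_{\epsilon_1}\cdots s_{\epsilon_l}$. A form on a module over either algebra is invariant if $\langle hu,v\rangle=\langle u,h^*v\rangle$ for all $h$ in the algebra. A module of any of these kinds is unitary if it has a positive definite invariant Hermitian form. $V$ is given a form making it unitary with respect to $\bullet$: $\langle kv,w\rangle=\langle v,k^{-1}w\rangle$ for $k\in K$, $\langle pv,w\rangle=\langle v,pw\rangle$ for $p\in\mathfrak p_0$. Given an invariant form on $X$, $X\otimes V^{\otimes l}$ has the product form and, for a character $\mu$ of $K$, $F_{\mu,l}(X)$ the form $\langle\phi,\psi\rangle=\langle\phi(1),\psi(1)\rangle_{X\otimes V^{\otimes l}}$. The Langlands quotient $\overline Y=Y/\operatorname{rad}\langle\,,\rangle_Y$ is defined for a module $Y$ with invariant Hermitian form. *)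

theory Defs
  imports
    "HOL-Analysis.Derivative"
    "HOL-Algebra.AbelCoset"
    "Jordan_Normal_Form.VS_Connect"
    "Jordan_Normal_Form.Gauss_Jordan_Elimination"
begin

section \<open>Complex vector spaces, sesquilinear forms and quotients\<close>

text \<open>A complex vector space is a module record over \<open>class_ring\<close> (the field structure of the type
  \<^typ>\<open>complex\<close>); its ring multiplication and unit are irrelevant.\<close>

type_synonym 'v cspace = "(complex, 'v) module"

abbreviation complex_vectorspace :: "'v cspace \<Rightarrow> bool" where
  "complex_vectorspace M \<equiv> vectorspace (class_ring :: complex ring) M"

abbreviation clinear :: "'v cspace \<Rightarrow> 'w cspace \<Rightarrow> ('v \<Rightarrow> 'w) \<Rightarrow> bool" where
  "clinear M N f \<equiv> f \<in> module_hom (class_ring :: complex ring) M N"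

abbreviation cspan :: "'v cspace \<Rightarrow> 'v set \<Rightarrow> 'v set" where
  "cspan M \<equiv> module.span (class_ring :: complex ring) M"

text \<open>A Hermitian form is only asked to be linear in the first and conjugate linear in the second
  variable; a positive definite one is then automatically conjugate symmetric, by polarization.
  For a conjugate symmetric form the left radical below is the radical.\<close>

definition hermitian_form :: "'v cspace \<Rightarrow> ('v \<Rightarrow> 'v \<Rightarrow> complex) \<Rightarrow> bool" where
  "hermitian_form M h \<longleftrightarrow>
     (\<forall>x\<in>carrier M. \<forall>y\<in>carrier M. \<forall>z\<in>carrier M. \<forall>c.
        h (x \<oplus>\<^bsub>M\<^esub> y) z = h x z + h y z \<and>
        h (c \<odot>\<^bsub>M\<^esub> x) z = c * h x z \<and>
        h z (x \<oplus>\<^bsub>M\<^esub> y) = h z x + h z y \<and>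
        h z (c \<odot>\<^bsub>M\<^esub> x) = cnj c * h z x)"

definition positive_definite :: "'v cspace \<Rightarrow> ('v \<Rightarrow> 'v \<Rightarrow> complex) \<Rightarrow> bool" where
  "positive_definite M h \<longleftrightarrow>
     (\<forall>x\<in>carrier M. x \<noteq> \<zero>\<^bsub>M\<^esub> \<longrightarrow> h x x \<in> \<real> \<and> 0 < Re (h x x))"

definition radical :: "'v cspace \<Rightarrow> ('v \<Rightarrow> 'v \<Rightarrow> complex) \<Rightarrow> 'v set" where
  "radical M h = {x \<in> carrier M. \<forall>y\<in>carrier M. h x y = 0}"

definition quot_space :: "'v cspace \<Rightarrow> 'v set \<Rightarrow> 'v set cspace" where
  "quot_space M H = \<lparr> carrier = a_rcosets\<^bsub>M\<^esub> H, mult = undefined, one = undefined,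
     zero = H, add = (\<lambda>C D. C <+>\<^bsub>M\<^esub> D), smult = (\<lambda>c C. \<Union>x\<in>C. H +>\<^bsub>M\<^esub> (c \<odot>\<^bsub>M\<^esub> x)) \<rparr>"

definition quot_op :: "'v cspace \<Rightarrow> 'v set \<Rightarrow> ('v \<Rightarrow> 'v) \<Rightarrow> 'v set \<Rightarrow> 'v set" where
  "quot_op M H f C = (\<Union>x\<in>C. H +>\<^bsub>M\<^esub> f x)"


section \<open>Presented algebras with involution, and unitarity of their modules\<close>

datatype 'g ncpoly =
    Gen 'g
  | Const complex
  | Plus "'g ncpoly" "'g ncpoly" (infixl "[+]" 65)
  | Times "'g ncpoly" "'g ncpoly" (infixl "[*]" 70)

abbreviation Minus :: "'g ncpoly \<Rightarrow> 'g ncpoly \<Rightarrow> 'g ncpoly" (infixl "[-]" 65) where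
  "a [-] b \<equiv> a [+] Const (-1) [*] b"

primrec nc_eval :: "'v cspace \<Rightarrow> ('g \<Rightarrow> 'v \<Rightarrow> 'v) \<Rightarrow> 'g ncpoly \<Rightarrow> 'v \<Rightarrow> 'v" where
  "nc_eval M \<rho> (Gen g) v = \<rho> g v"
| "nc_eval M \<rho> (Const c) v = c \<odot>\<^bsub>M\<^esub> v"
| "nc_eval M \<rho> (a [+] b) v = nc_eval M \<rho> a v \<oplus>\<^bsub>M\<^esub> nc_eval M \<rho> b v"
| "nc_eval M \<rho> (a [*] b) v = nc_eval M \<rho> a (nc_eval M \<rho> b v)"

text \<open>The conjugate linear antihomomorphism fixing every generator. For both algebras below this is
  the operation \<open>\<bullet>\<close>: the generators of the hyperoctahedral group are involutions, so that
  words in them go to their inverses.\<close>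

primrec nc_bullet :: "'g ncpoly \<Rightarrow> 'g ncpoly" where
  "nc_bullet (Gen g) = Gen g"
| "nc_bullet (Const c) = Const (cnj c)"
| "nc_bullet (a [+] b) = nc_bullet a [+] nc_bullet b"
| "nc_bullet (a [*] b) = nc_bullet b [*] nc_bullet a"

record 'g presented_algebra =
  alg_gens :: "'g set"
  alg_rels :: "('g ncpoly \<times> 'g ncpoly) set"
  alg_w0 :: "'g ncpoly"

definition alg_star :: "'g presented_algebra \<Rightarrow> 'g ncpoly \<Rightarrow> 'g ncpoly" where
  "alg_star A b = alg_w0 A [*] nc_bullet b [*] alg_w0 A"

text \<open>A module over a presented algebra is given by the operators \<open>\<rho> g\<close> by which the generators act.
  The elements of the algebra are represented by noncommutative polynomials in the generators.
  Polynomials that are equal modulo the relations act in the same way on a module, so for modules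
  the last condition is invariance under all elements of the algebra; it makes sense, and is used,
  without reference to the relations.\<close>

definition unitary_alg_module :: "'g presented_algebra \<Rightarrow> 'v cspace \<Rightarrow> ('g \<Rightarrow> 'v \<Rightarrow> 'v) \<Rightarrow> bool" where
  "unitary_alg_module A M \<rho> \<longleftrightarrow>
     (\<exists>h. hermitian_form M h \<and> positive_definite M h \<and>
        (\<forall>a. set_ncpoly a \<subseteq> alg_gens A \<longrightarrow>
           (\<forall>u\<in>carrier M. \<forall>v\<in>carrier M.
              h (nc_eval M \<rho> a u) v = h u (nc_eval M \<rho> (alg_star A a) v))))"

text \<open>Coxeter presentation of the hyperoctahedral group on transpositions \<open>t i\<close>
  (of \<open>i\<close> and \<open>i + 1\<close>) and sign changes \<open>s i\<close>.\<close>

definition hyperoctahedral_rels ::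
    "nat \<Rightarrow> (nat \<Rightarrow> 'g ncpoly) \<Rightarrow> (nat \<Rightarrow> 'g ncpoly) \<Rightarrow> ('g ncpoly \<times> 'g ncpoly) set" where
  "hyperoctahedral_rels l t s =
     {(t i [*] t i, Const 1) | i. 1 \<le> i \<and> i < l}
   \<union> {(t i [*] t (i+1) [*] t i, t (i+1) [*] t i [*] t (i+1)) | i. 1 \<le> i \<and> i + 1 < l}
   \<union> {(t i [*] t j, t j [*] t i) | i j. 1 \<le> i \<and> i + 1 < j \<and> j < l}
   \<union> {(s i [*] s i, Const 1) | i. 1 \<le> i \<and> i \<le> l}
   \<union> {(s i [*] s j, s j [*] s i) | i j. 1 \<le> i \<and> i < j \<and> j \<le> l}
   \<union> {(t i [*] s i, s (i+1) [*] t i) | i. 1 \<le> i \<and> i < l}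
   \<union> {(t i [*] s j, s j [*] t i) | i j. 1 \<le> i \<and> i < l \<and> 1 \<le> j \<and> j \<le> l \<and> j \<noteq> i \<and> j \<noteq> i + 1}"

definition nc_prod :: "(nat \<Rightarrow> 'g ncpoly) \<Rightarrow> nat \<Rightarrow> 'g ncpoly" where
  "nc_prod s l = foldl (\<lambda>a i. a [*] s i) (Const 1) [1..<l+1]"

text \<open>The type \<open>B/C\<close> VW-algebra; \<open>VT i\<close> and \<open>VE i\<close> stand for the generators with index
  \<open>i,i+1\<close>.\<close>

datatype vw_gen = VT nat | VE nat | VZ nat | VTheta nat

definition vw_algebra ::
    "nat \<Rightarrow> complex \<Rightarrow> complex \<Rightarrow> (nat \<Rightarrow> complex) \<Rightarrow> vw_gen presented_algebra" where
  "vw_algebra l m0 m1 w =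
    (let t = (\<lambda>i. Gen (VT i)); e = (\<lambda>i. Gen (VE i)); z = (\<lambda>i. Gen (VZ i));
         \<theta> = (\<lambda>i. Gen (VTheta i)) in
     \<lparr> alg_gens = {VT i | i. 1 \<le> i \<and> i < l} \<union> {VE i | i. 1 \<le> i \<and> i < l}
                \<union> {VZ i | i. 1 \<le> i \<and> i \<le> l} \<union> {VTheta i | i. 1 \<le> i \<and> i \<le> l},
       alg_rels = hyperoctahedral_rels l t \<theta>
        \<union> {(e i [*] e i, Const m0 [*] e i) | i. 1 \<le> i \<and> i < l}
        \<union> {(t i [*] e i, e i) | i. 1 \<le> i \<and> i < l}
        \<union> {(e i [*] t i, e i) | i. 1 \<le> i \<and> i < l}
        \<union> {(t i [*] t (i+1) [*] e i [*] t (i+1) [*] t i, e (i+1)) | i. 1 \<le> i \<and> i + 1 < l}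
        \<union> {(t i [*] e j, e j [*] t i) | i j. 1 \<le> i \<and> i < l \<and> 1 \<le> j \<and> j < l \<and> j \<noteq> i \<and> j \<noteq> i + 1}
        \<union> {(t i [*] z i [-] z (i+1) [*] t i, Const 1 [+] e i) | i. 1 \<le> i \<and> i < l}
        \<union> {(t i [*] z j, z j [*] t i) | i j. 1 \<le> i \<and> i < l \<and> 1 \<le> j \<and> j \<le> l \<and> j \<noteq> i \<and> j \<noteq> i + 1}
        \<union> {(e i [*] z j, z j [*] e i) | i j. 1 \<le> i \<and> i < l \<and> 1 \<le> j \<and> j \<le> l \<and> j \<noteq> i \<and> j \<noteq> i + 1}
        \<union> {(e i [*] (z i [+] z (i+1)), Const 0) | i. 1 \<le> i \<and> i < l}
        \<union> {((z i [+] z (i+1)) [*] e i, Const 0) | i. 1 \<le> i \<and> i < l}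
        \<union> {(z i [*] z j, z j [*] z i) | i j. 1 \<le> i \<and> i \<le> l \<and> 1 \<le> j \<and> j \<le> l}
        \<union> {(e 1 [*] ((\<lambda>p. p [*] z 1) ^^ a) (Const 1) [*] e 1, Const (w a) [*] e 1) | a. 1 < l}
        \<union> {(e i [*] \<theta> j, \<theta> j [*] e i) | i j. 1 \<le> i \<and> i < l \<and> 1 \<le> j \<and> j \<le> l}
        \<union> {(e i [*] \<theta> i [*] \<theta> (i+1), e i) | i. 1 \<le> i \<and> i < l}
        \<union> {(\<theta> i [*] \<theta> (i+1) [*] e i, e i) | i. 1 \<le> i \<and> i < l}
        \<union> {(\<theta> l [*] z j, z j [*] \<theta> l) | j. 1 \<le> j \<and> j < l}
        \<union> {(e i [*] \<theta> i [*] e i, Const m1 [*] e i) | i. 1 \<le> i \<and> i < l},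
       alg_w0 = nc_prod \<theta> l \<rparr>)"

text \<open>The graded Hecke algebra of type \<open>B/C\<close>: \<open>HS i\<close>, \<open>HSe i\<close>, \<open>HEps i\<close> stand for
  \<open>s_{i,i+1}\<close>, \<open>s_{\<epsilon>_i}\<close>, \<open>\<epsilon>_i\<close>. By the PBW property, this presentation has
  \<open>\<complex>[\<epsilon>_1,\<dots>,\<epsilon>_l] \<otimes> \<complex>[W(B_l)]\<close> as underlying vector space.\<close>

datatype hecke_gen = HS nat | HSe nat | HEps nat

definition hecke_algebra :: "nat \<Rightarrow> complex \<Rightarrow> hecke_gen presented_algebra" where
  "hecke_algebra l c =
    (let s = (\<lambda>i. Gen (HS i)); se = (\<lambda>i. Gen (HSe i)); \<epsilon> = (\<lambda>i. Gen (HEps i)) in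
     \<lparr> alg_gens = {HS i | i. 1 \<le> i \<and> i < l} \<union> {HSe i | i. 1 \<le> i \<and> i \<le> l}
                \<union> {HEps i | i. 1 \<le> i \<and> i \<le> l},
       alg_rels = hyperoctahedral_rels l s se
        \<union> {(\<epsilon> i [*] \<epsilon> j, \<epsilon> j [*] \<epsilon> i) | i j. 1 \<le> i \<and> i \<le> l \<and> 1 \<le> j \<and> j \<le> l}
        \<union> {(s i [*] \<epsilon> i [-] \<epsilon> (i+1) [*] s i, Const 1) | i. 1 \<le> i \<and> i < l}
        \<union> {(s i [*] \<epsilon> j, \<epsilon> j [*] s i) | i j. 1 \<le> i \<and> i < l \<and> 1 \<le> j \<and> j \<le> l \<and> j \<noteq> i \<and> j \<noteq> i + 1}
        \<union> (if 1 \<le> l then {(se l [*] \<epsilon> l [+] \<epsilon> l [*] se l, Const (2 * c))} else {})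
        \<union> {(se l [*] \<epsilon> j, \<epsilon> j [*] se l) | j. 1 \<le> j \<and> j < l},
       alg_w0 = nc_prod se l \<rparr>)"


section \<open>The groups and their Lie algebras\<close>

text \<open>Real matrices are complex matrices with real entries. Matrix indices start at 0 while
  \<open>e_1, e_2, \<dots>\<close> and the tensor factors \<open>1, \<dots>, l\<close> are numbered from 1.\<close>

datatype real_group = SpR nat | OR nat nat

fun vdim :: "real_group \<Rightarrow> nat" where
  "vdim (SpR n) = n + n"
| "vdim (OR p q) = p + q"

fun form_mat :: "real_group \<Rightarrow> complex mat" where
  "form_mat (SpR n) = four_block_mat (0\<^sub>m n n) (1\<^sub>m n) (- 1\<^sub>m n) (0\<^sub>m n n)"
| "form_mat (OR p q) = four_block_mat (1\<^sub>m p) (0\<^sub>m p q) (0\<^sub>m q p) (- 1\<^sub>m q)"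

fun \<xi>_mat :: "real_group \<Rightarrow> complex mat" where
  "\<xi>_mat (SpR n) = four_block_mat (0\<^sub>m n n) (\<i> \<cdot>\<^sub>m 1\<^sub>m n) (- (\<i> \<cdot>\<^sub>m 1\<^sub>m n)) (0\<^sub>m n n)"
| "\<xi>_mat (OR p q) = four_block_mat (1\<^sub>m p) (0\<^sub>m p q) (0\<^sub>m q p) (- 1\<^sub>m q)"

fun vw_m0 :: "real_group \<Rightarrow> complex" where
  "vw_m0 (SpR n) = - of_nat n"
| "vw_m0 (OR p q) = of_nat ((p + q) div 2)"

fun vw_m1 :: "real_group \<Rightarrow> complex" where
  "vw_m1 (SpR n) = 0"
| "vw_m1 (OR p q) = of_nat p - of_nat q"

definition real_mats :: "nat \<Rightarrow> complex mat set" where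
  "real_mats N = {A \<in> carrier_mat N N. \<forall>i<N. \<forall>j<N. A $$ (i, j) \<in> \<real>}"

definition group_of :: "real_group \<Rightarrow> complex mat set" where
  "group_of G = {g \<in> real_mats (vdim G). g\<^sup>T * form_mat G * g = form_mat G}"

definition lie0 :: "real_group \<Rightarrow> complex mat set" where
  "lie0 G = {x \<in> real_mats (vdim G).
     x\<^sup>T * form_mat G + form_mat G * x = 0\<^sub>m (vdim G) (vdim G)}"

definition lie :: "real_group \<Rightarrow> complex mat set" where
  "lie G = {x + \<i> \<cdot>\<^sub>m y | x y. x \<in> lie0 G \<and> y \<in> lie0 G}"

definition K_of :: "real_group \<Rightarrow> complex mat set" where
  "K_of G = {k \<in> group_of G. \<xi>_mat G * k = k * \<xi>_mat G}"

definition k0 :: "real_group \<Rightarrow> complex mat set" where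
  "k0 G = {x \<in> lie0 G. \<xi>_mat G * x = x * \<xi>_mat G}"

definition p0 :: "real_group \<Rightarrow> complex mat set" where
  "p0 G = {x \<in> lie0 G. \<xi>_mat G * x = - (x * \<xi>_mat G)}"

definition lie_bracket :: "complex mat \<Rightarrow> complex mat \<Rightarrow> complex mat" where
  "lie_bracket x y = x * y - y * x"

definition mat_inv :: "complex mat \<Rightarrow> complex mat" where
  "mat_inv g = the (mat_inverse g)"

definition mat_exp :: "complex mat \<Rightarrow> complex mat" where
  "mat_exp A = mat (dim_row A) (dim_row A)
     (\<lambda>(i, j). \<Sum>m. (A ^\<^sub>m m) $$ (i, j) / fact m)"

text \<open>Continuity on a set of matrices, sequentially and for entrywise convergence.\<close>

definition mat_continuous_on :: "nat \<Rightarrow> complex mat set \<Rightarrow> (complex mat \<Rightarrow> complex) \<Rightarrow> bool" where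
  "mat_continuous_on N S f \<longleftrightarrow>
     (\<forall>A\<in>S. \<forall>As. (\<forall>m. As m \<in> S) \<and>
        (\<forall>i<N. \<forall>j<N. (\<lambda>m. As m $$ (i, j)) \<longlonglongrightarrow> A $$ (i, j)) \<longrightarrow> (\<lambda>m. f (As m)) \<longlonglongrightarrow> f A)"

definition lie_space :: "real_group \<Rightarrow> complex mat cspace" where
  "lie_space G = (module_mat TYPE(complex) (vdim G) (vdim G))\<lparr>carrier := lie G\<rparr>"

definition lie_basis :: "real_group \<Rightarrow> complex mat set \<Rightarrow> bool" where
  "lie_basis G B \<longleftrightarrow>
     finite B \<and> vectorspace.basis (class_ring :: complex ring) (lie_space G) B"

definition lie_coord ::
    "real_group \<Rightarrow> complex mat set \<Rightarrow> complex mat \<Rightarrow> complex mat \<Rightarrow> complex" where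
  "lie_coord G B x =
     (THE a. a \<in> B \<rightarrow>\<^sub>E UNIV \<and> module.lincomb (lie_space G) a B = x)"

text \<open>The trace of \<open>ad x ad y\<close>, computed in some basis.\<close>

definition killing_form :: "real_group \<Rightarrow> complex mat \<Rightarrow> complex mat \<Rightarrow> complex" where
  "killing_form G x y =
     (let B = (SOME B. lie_basis G B)
      in \<Sum>b\<in>B. lie_coord G B (lie_bracket x (lie_bracket y b)) b)"

definition killing_dual_bases ::
    "real_group \<Rightarrow> complex mat set \<Rightarrow> (complex mat \<Rightarrow> complex mat) \<Rightarrow> bool" where
  "killing_dual_bases G B d \<longleftrightarrow> lie_basis G B \<and> (\<forall>b\<in>B. d b \<in> lie G) \<and>
     (\<forall>b\<in>B. \<forall>b'\<in>B. killing_form G b (d b') = (if b = b' then 1 else 0))"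

text \<open>The defining module \<open>V\<close> with a positive definite form that is unitary with respect to
  \<open>\<bullet>\<close>.\<close>

abbreviation V_space :: "real_group \<Rightarrow> complex vec cspace" where
  "V_space G \<equiv> module_vec TYPE(complex) (vdim G)"

definition V_form :: "real_group \<Rightarrow> (complex vec \<Rightarrow> complex vec \<Rightarrow> complex) \<Rightarrow> bool" where
  "V_form G hV \<longleftrightarrow> hermitian_form (V_space G) hV \<and> positive_definite (V_space G) hV \<and>
     (\<forall>v\<in>carrier_vec (vdim G). \<forall>w\<in>carrier_vec (vdim G).
        (\<forall>k\<in>K_of G. hV (k *\<^sub>v v) w = hV v (mat_inv k *\<^sub>v w)) \<and>
        (\<forall>x\<in>p0 G. hV (x *\<^sub>v v) w = hV v (x *\<^sub>v w)))"

text \<open>A linear map \<open>P\<close> of \<open>V \<otimes> V\<close>, given by its matrix in the basis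
  \<open>e_a \<otimes> e_b\<close>, is the projection onto the trivial submodule: it is
  \<open>\<gg>\<close>-equivariant, has \<open>\<gg>\<close>-invariant values and fixes the invariants.\<close>

definition VV :: "real_group \<Rightarrow> (nat \<times> nat \<Rightarrow> complex) set" where
  "VV G = {u. \<forall>a b. \<not> (a < vdim G \<and> b < vdim G) \<longrightarrow> u (a, b) = 0}"

definition VV_lie :: "real_group \<Rightarrow> complex mat \<Rightarrow> (nat \<times> nat \<Rightarrow> complex) \<Rightarrow> nat \<times> nat \<Rightarrow> complex" where
  "VV_lie G x u = (\<lambda>(a, b). if a < vdim G \<and> b < vdim G
     then (\<Sum>j<vdim G. x $$ (a, j) * u (j, b)) + (\<Sum>j<vdim G. x $$ (b, j) * u (a, j)) else 0)"

definition VV_op :: "real_group \<Rightarrow> (nat \<times> nat \<Rightarrow> nat \<times> nat \<Rightarrow> complex) \<Rightarrow>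
    (nat \<times> nat \<Rightarrow> complex) \<Rightarrow> nat \<times> nat \<Rightarrow> complex" where
  "VV_op G P u = (\<lambda>(a, b). if a < vdim G \<and> b < vdim G
     then \<Sum>j\<in>{..<vdim G} \<times> {..<vdim G}. P (a, b) j * u j else 0)"

definition VV_invariants :: "real_group \<Rightarrow> (nat \<times> nat \<Rightarrow> complex) set" where
  "VV_invariants G = {u \<in> VV G. \<forall>x\<in>lie G. VV_lie G x u = (\<lambda>_. 0)}"

definition trivial_projection :: "real_group \<Rightarrow> (nat \<times> nat \<Rightarrow> nat \<times> nat \<Rightarrow> complex) \<Rightarrow> bool" where
  "trivial_projection G P \<longleftrightarrow>
     (\<forall>u\<in>VV G. VV_op G P u \<in> VV_invariants G) \<and>
     (\<forall>u\<in>VV_invariants G. VV_op G P u = u) \<and>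
     (\<forall>x\<in>lie G. \<forall>u\<in>VV G. VV_op G P (VV_lie G x u) = VV_lie G x (VV_op G P u))"


section \<open>Harish-Chandra modules\<close>

record 'x gk_module =
  gk_space :: "'x cspace"
  gk_lie :: "complex mat \<Rightarrow> 'x \<Rightarrow> 'x"
  gk_grp :: "complex mat \<Rightarrow> 'x \<Rightarrow> 'x"

text \<open>The last clause says that the orbit map of every vector under \<open>K\<close> is a finite sum of
  continuous functions times fixed vectors (that is, the action is locally finite and continuous)
  and that the derivative of the action of \<open>K\<close> is the action of its Lie algebra.\<close>

definition is_gk_module :: "real_group \<Rightarrow> 'x gk_module \<Rightarrow> bool" where
  "is_gk_module G X \<longleftrightarrow> (let M = gk_space X; \<pi> = gk_lie X; \<kappa> = gk_grp X in
     complex_vectorspace M \<and>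
     (\<forall>x\<in>lie G. clinear M M (\<pi> x)) \<and>
     (\<forall>x\<in>lie G. \<forall>y\<in>lie G. \<forall>c. \<forall>v\<in>carrier M.
        \<pi> (x + y) v = \<pi> x v \<oplus>\<^bsub>M\<^esub> \<pi> y v \<and>
        \<pi> (c \<cdot>\<^sub>m x) v = c \<odot>\<^bsub>M\<^esub> \<pi> x v \<and>
        \<pi> (lie_bracket x y) v = \<pi> x (\<pi> y v) \<ominus>\<^bsub>M\<^esub> \<pi> y (\<pi> x v)) \<and>
     (\<forall>k\<in>K_of G. clinear M M (\<kappa> k)) \<and>
     (\<forall>v\<in>carrier M. \<kappa> (1\<^sub>m (vdim G)) v = v) \<and>
     (\<forall>k\<in>K_of G. \<forall>k'\<in>K_of G. \<forall>v\<in>carrier M. \<kappa> (k * k') v = \<kappa> k (\<kappa> k' v)) \<and>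
     (\<forall>k\<in>K_of G. \<forall>x\<in>lie G. \<forall>v\<in>carrier M. \<kappa> k (\<pi> x v) = \<pi> (k * x * mat_inv k) (\<kappa> k v)) \<and>
     (\<forall>v\<in>carrier M. \<exists>(m::nat) u c c'.
        (\<forall>j<m. u j \<in> carrier M \<and> mat_continuous_on (vdim G) (K_of G) (c j)) \<and>
        (\<forall>k\<in>K_of G. \<kappa> k v = (\<Oplus>\<^bsub>M\<^esub>j\<in>{..<m}. c j k \<odot>\<^bsub>M\<^esub> u j)) \<and>
        (\<forall>x\<in>k0 G. \<pi> x v = (\<Oplus>\<^bsub>M\<^esub>j\<in>{..<m}. c' j x \<odot>\<^bsub>M\<^esub> u j) \<and>
          (\<forall>j<m. ((\<lambda>t::real. c j (mat_exp (complex_of_real t \<cdot>\<^sub>m x)))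
                     has_vector_derivative c' j x) (at 0)))))"

definition K_irrep :: "real_group \<Rightarrow> nat \<Rightarrow> (complex mat \<Rightarrow> complex mat) \<Rightarrow> bool" where
  "K_irrep G m \<sigma> \<longleftrightarrow> 0 < m \<and>
     (\<forall>k\<in>K_of G. \<sigma> k \<in> carrier_mat m m) \<and> \<sigma> (1\<^sub>m (vdim G)) = 1\<^sub>m m \<and>
     (\<forall>k\<in>K_of G. \<forall>k'\<in>K_of G. \<sigma> (k * k') = \<sigma> k * \<sigma> k') \<and>
     (\<forall>i<m. \<forall>j<m. mat_continuous_on (vdim G) (K_of G) (\<lambda>k. \<sigma> k $$ (i, j))) \<and>
     (\<forall>W. subspace (class_ring :: complex ring) W (module_vec TYPE(complex) m) \<and>
        (\<forall>k\<in>K_of G. \<forall>v\<in>W. \<sigma> k *\<^sub>v v \<in> W) \<longrightarrow> W = {0\<^sub>v m} \<or> W = carrier_vec m)"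

text \<open>Every irreducible representation of \<open>K\<close> occurs with finite multiplicity: its isotypic
  component in \<open>X\<close> is finite-dimensional.\<close>

definition admissible :: "real_group \<Rightarrow> 'x gk_module \<Rightarrow> bool" where
  "admissible G X \<longleftrightarrow> (\<forall>m \<sigma>. K_irrep G m \<sigma> \<longrightarrow>
     (\<exists>S. finite S \<and> S \<subseteq> carrier (gk_space X) \<and>
        (\<forall>f. clinear (module_vec TYPE(complex) m) (gk_space X) f \<and>
             (\<forall>k\<in>K_of G. \<forall>v\<in>carrier_vec m. f (\<sigma> k *\<^sub>v v) = gk_grp X k (f v)) \<longrightarrow>
             f ` carrier_vec m \<subseteq> cspan (gk_space X) S)))"

definition finitely_generated :: "real_group \<Rightarrow> 'x gk_module \<Rightarrow> bool" where
  "finitely_generated G X \<longleftrightarrow> (\<exists>S. finite S \<and> S \<subseteq> carrier (gk_space X) \<and>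
     (\<forall>W. subspace (class_ring :: complex ring) W (gk_space X) \<and> S \<subseteq> W \<and>
        (\<forall>x\<in>lie G. \<forall>v\<in>W. gk_lie X x v \<in> W) \<longrightarrow> W = carrier (gk_space X)))"

definition harish_chandra_module :: "real_group \<Rightarrow> 'x gk_module \<Rightarrow> bool" where
  "harish_chandra_module G X \<longleftrightarrow>
     is_gk_module G X \<and> admissible G X \<and> finitely_generated G X"

text \<open>Invariance and unitarity refer to the action of the Lie algebra, with
  \<open>g\<^sup>* = - cnj g\<close>. For a unitary \<open>(\<gg>, K)\<close>-module, averaging the form over the finite
  component group of \<open>K\<close> makes it invariant under \<open>K\<close> as well.\<close>

definition gk_invariant_form :: "real_group \<Rightarrow> 'x gk_module \<Rightarrow> ('x \<Rightarrow> 'x \<Rightarrow> complex) \<Rightarrow> bool" where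
  "gk_invariant_form G X h \<longleftrightarrow> hermitian_form (gk_space X) h \<and>
     (\<forall>g\<in>lie G. \<forall>x\<in>carrier (gk_space X). \<forall>y\<in>carrier (gk_space X).
        h (gk_lie X g x) y = h x (gk_lie X (- map_mat cnj g) y))"

definition unitary_gk_module :: "real_group \<Rightarrow> 'x gk_module \<Rightarrow> bool" where
  "unitary_gk_module G X \<longleftrightarrow>
     (\<exists>h. gk_invariant_form G X h \<and> positive_definite (gk_space X) h)"

definition gk_langlands_quotient :: "'x gk_module \<Rightarrow> ('x \<Rightarrow> 'x \<Rightarrow> complex) \<Rightarrow> 'x set gk_module" where
  "gk_langlands_quotient X h = (let M = gk_space X; R = radical M h in
     \<lparr> gk_space = quot_space M R, gk_lie = (\<lambda>x. quot_op M R (gk_lie X x)),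
       gk_grp = (\<lambda>k. quot_op M R (gk_grp X k)) \<rparr>)"


section \<open>The functors\<close>

text \<open>\<open>X \<otimes> V\<^sup>\<otimes>\<^sup>l\<close> is identified with the space of families \<open>T\<close> of vectors of \<open>X\<close>
  indexed by the words \<open>I\<close> of length \<open>l\<close> in the basis of \<open>V\<close>: such a family stands for
  the sum of all \<open>T I \<otimes> e_{I_1} \<otimes> \<dots> \<otimes> e_{I_l}\<close>. Factor \<open>i \<ge> 1\<close> corresponds to the
  list position \<open>i - 1\<close>.\<close>

definition words :: "real_group \<Rightarrow> nat \<Rightarrow> nat list set" where
  "words G l = {I. length I = l \<and> set I \<subseteq> {..<vdim G}}"

definition tensor_space :: "real_group \<Rightarrow> 'x cspace \<Rightarrow> nat \<Rightarrow> (nat list \<Rightarrow> 'x) cspace" where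
  "tensor_space G M l =
     \<lparr> carrier = {T. (\<forall>I\<in>words G l. T I \<in> carrier M) \<and> (\<forall>I. I \<notin> words G l \<longrightarrow> T I = \<zero>\<^bsub>M\<^esub>)},
       mult = undefined, one = undefined, zero = (\<lambda>I. \<zero>\<^bsub>M\<^esub>),
       add = (\<lambda>T S I. T I \<oplus>\<^bsub>M\<^esub> S I), smult = (\<lambda>c T I. c \<odot>\<^bsub>M\<^esub> T I) \<rparr>"

definition factor_op ::
    "real_group \<Rightarrow> 'x cspace \<Rightarrow> nat \<Rightarrow> nat \<Rightarrow> complex mat \<Rightarrow> (nat list \<Rightarrow> 'x) \<Rightarrow> nat list \<Rightarrow> 'x" where
  "factor_op G M l i A T = (\<lambda>I. if I \<in> words G l
     then \<Oplus>\<^bsub>M\<^esub>j\<in>{..<vdim G}. A $$ (I ! (i - 1), j) \<odot>\<^bsub>M\<^esub> T (I[i - 1 := j]) else \<zero>\<^bsub>M\<^esub>)"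

definition lie_factor ::
    "real_group \<Rightarrow> 'x gk_module \<Rightarrow> nat \<Rightarrow> nat \<Rightarrow> complex mat \<Rightarrow> (nat list \<Rightarrow> 'x) \<Rightarrow> nat list \<Rightarrow> 'x" where
  "lie_factor G X l i x T =
     (if i = 0 then (\<lambda>I. if I \<in> words G l then gk_lie X x (T I) else \<zero>\<^bsub>gk_space X\<^esub>)
      else factor_op G (gk_space X) l i x T)"

definition tensor_grp ::
    "real_group \<Rightarrow> 'x gk_module \<Rightarrow> nat \<Rightarrow> complex mat \<Rightarrow> (nat list \<Rightarrow> 'x) \<Rightarrow> nat list \<Rightarrow> 'x" where
  "tensor_grp G X l k T = (\<lambda>I. if I \<in> words G l
     then \<Oplus>\<^bsub>gk_space X\<^esub>J\<in>words G l. (\<Prod>j<l. k $$ (I ! j, J ! j)) \<odot>\<^bsub>gk_space X\<^esub> gk_grp X k (T J)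
     else \<zero>\<^bsub>gk_space X\<^esub>)"

definition \<Omega>_op :: "real_group \<Rightarrow> complex mat set \<Rightarrow> (complex mat \<Rightarrow> complex mat) \<Rightarrow> 'x gk_module \<Rightarrow>
    nat \<Rightarrow> nat \<Rightarrow> nat \<Rightarrow> (nat list \<Rightarrow> 'x) \<Rightarrow> nat list \<Rightarrow> 'x" where
  "\<Omega>_op G B d X l i j T =
     (\<Oplus>\<^bsub>tensor_space G (gk_space X) l\<^esub>b\<in>B. lie_factor G X l i b (lie_factor G X l j (d b) T))"

fun vw_tensor_op :: "real_group \<Rightarrow> complex mat set \<Rightarrow> (complex mat \<Rightarrow> complex mat) \<Rightarrow>
    (nat \<times> nat \<Rightarrow> nat \<times> nat \<Rightarrow> complex) \<Rightarrow> 'x gk_module \<Rightarrow> nat \<Rightarrow> vw_gen \<Rightarrow>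
    (nat list \<Rightarrow> 'x) \<Rightarrow> nat list \<Rightarrow> 'x" where
  "vw_tensor_op G B d P X l (VT i) T = (\<lambda>I. T (I[i - 1 := I ! i, i := I ! (i - 1)]))"
| "vw_tensor_op G B d P X l (VE i) T = (let M = gk_space X in
     (\<lambda>I. if I \<in> words G l
       then vw_m0 G \<odot>\<^bsub>M\<^esub> (\<Oplus>\<^bsub>M\<^esub>ab\<in>{..<vdim G} \<times> {..<vdim G}.
              P (I ! (i - 1), I ! i) ab \<odot>\<^bsub>M\<^esub> T (I[i - 1 := fst ab, i := snd ab]))
       else \<zero>\<^bsub>M\<^esub>))"
| "vw_tensor_op G B d P X l (VZ i) T =
     (\<Oplus>\<^bsub>tensor_space G (gk_space X) l\<^esub>j\<in>{0..<i}. \<Omega>_op G B d X l j i T)"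
| "vw_tensor_op G B d P X l (VTheta i) T = factor_op G (gk_space X) l i (\<xi>_mat G) T"

definition K_character :: "real_group \<Rightarrow> (complex mat \<Rightarrow> complex) \<Rightarrow> bool" where
  "K_character G \<mu> \<longleftrightarrow> \<mu> (1\<^sub>m (vdim G)) = 1 \<and>
     (\<forall>k\<in>K_of G. \<forall>k'\<in>K_of G. \<mu> (k * k') = \<mu> k * \<mu> k') \<and>
     mat_continuous_on (vdim G) (K_of G) \<mu>"

text \<open>\<open>Hom_K(\<mu>, X \<otimes> V\<^sup>\<otimes>\<^sup>l)\<close>, the character \<open>\<mu>\<close> being realized on the complex line.\<close>

definition F_space ::
    "real_group \<Rightarrow> (complex mat \<Rightarrow> complex) \<Rightarrow> nat \<Rightarrow> 'x gk_module \<Rightarrow> (complex \<Rightarrow> nat list \<Rightarrow> 'x) cspace" where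
  "F_space G \<mu> l X = (let Y = tensor_space G (gk_space X) l in
     \<lparr> carrier = {\<phi>. (\<forall>a b. \<phi> a \<in> carrier Y \<and> \<phi> (a + b) = \<phi> a \<oplus>\<^bsub>Y\<^esub> \<phi> b \<and> \<phi> (a * b) = a \<odot>\<^bsub>Y\<^esub> \<phi> b) \<and>
                     (\<forall>k\<in>K_of G. \<forall>a. \<phi> (\<mu> k * a) = tensor_grp G X l k (\<phi> a))},
       mult = undefined, one = undefined, zero = (\<lambda>a. \<zero>\<^bsub>Y\<^esub>),
       add = (\<lambda>\<phi> \<psi> a. \<phi> a \<oplus>\<^bsub>Y\<^esub> \<psi> a), smult = (\<lambda>c \<phi> a. c \<odot>\<^bsub>Y\<^esub> \<phi> a) \<rparr>)"

definition F_vw_action :: "real_group \<Rightarrow> complex mat set \<Rightarrow> (complex mat \<Rightarrow> complex mat) \<Rightarrow>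
    (nat \<times> nat \<Rightarrow> nat \<times> nat \<Rightarrow> complex) \<Rightarrow> nat \<Rightarrow> 'x gk_module \<Rightarrow> vw_gen \<Rightarrow>
    (complex \<Rightarrow> nat list \<Rightarrow> 'x) \<Rightarrow> complex \<Rightarrow> nat list \<Rightarrow> 'x" where
  "F_vw_action G B d P l X g \<phi> = (\<lambda>a. vw_tensor_op G B d P X l g (\<phi> a))"

fun F_hecke_action :: "real_group \<Rightarrow> complex mat set \<Rightarrow> (complex mat \<Rightarrow> complex mat) \<Rightarrow>
    (nat \<times> nat \<Rightarrow> nat \<times> nat \<Rightarrow> complex) \<Rightarrow> (complex mat \<Rightarrow> complex) \<Rightarrow> complex \<Rightarrow> nat \<Rightarrow>
    'x gk_module \<Rightarrow> hecke_gen \<Rightarrow> (complex \<Rightarrow> nat list \<Rightarrow> 'x) \<Rightarrow> complex \<Rightarrow> nat list \<Rightarrow> 'x" where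
  "F_hecke_action G B d P \<mu> r l X (HS i) \<phi> = F_vw_action G B d P l X (VT i) \<phi>"
| "F_hecke_action G B d P \<mu> r l X (HSe i) \<phi> = F_vw_action G B d P l X (VTheta i) \<phi>"
| "F_hecke_action G B d P \<mu> r l X (HEps i) \<phi> = (let F = F_space G \<mu> l X in
     F_vw_action G B d P l X (VZ i) \<phi> \<oplus>\<^bsub>F\<^esub> (- r) \<odot>\<^bsub>F\<^esub> \<phi>)"

definition tensor_form :: "real_group \<Rightarrow> (complex vec \<Rightarrow> complex vec \<Rightarrow> complex) \<Rightarrow>
    ('x \<Rightarrow> 'x \<Rightarrow> complex) \<Rightarrow> nat \<Rightarrow> (nat list \<Rightarrow> 'x) \<Rightarrow> (nat list \<Rightarrow> 'x) \<Rightarrow> complex" where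
  "tensor_form G hV h l T S = (\<Sum>I\<in>words G l. \<Sum>J\<in>words G l.
     h (T I) (S J) * (\<Prod>j<l. hV (unit_vec (vdim G) (I ! j)) (unit_vec (vdim G) (J ! j))))"

definition F_form :: "real_group \<Rightarrow> (complex vec \<Rightarrow> complex vec \<Rightarrow> complex) \<Rightarrow>
    ('x \<Rightarrow> 'x \<Rightarrow> complex) \<Rightarrow> nat \<Rightarrow>
    (complex \<Rightarrow> nat list \<Rightarrow> 'x) \<Rightarrow> (complex \<Rightarrow> nat list \<Rightarrow> 'x) \<Rightarrow> complex" where
  "F_form G hV h l \<phi> \<psi> = tensor_form G hV h l (\<phi> 1) (\<psi> 1)"

definition unitary_langlands_quotient ::
    "'g presented_algebra \<Rightarrow> 'v cspace \<Rightarrow> ('g \<Rightarrow> 'v \<Rightarrow> 'v) \<Rightarrow> ('v \<Rightarrow> 'v \<Rightarrow> complex) \<Rightarrow> bool" where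
  "unitary_langlands_quotient A M \<rho> h \<longleftrightarrow>
     unitary_alg_module A (quot_space M (radical M h)) (\<lambda>g. quot_op M (radical M h) (\<rho> g))"


section \<open>Principal series of the split groups\<close>

datatype split_case = CaseS | CaseO1 | CaseO2

fun split_group :: "split_case \<Rightarrow> nat \<Rightarrow> real_group" where
  "split_group CaseS n = SpR n"
| "split_group CaseO1 n = OR (n + 1) n"
| "split_group CaseO2 n = OR (n + 1) n"

text \<open>The entry in row \<open>r\<close> and column \<open>s\<close> of the sum of all \<open>t_i a_i\<close>; here \<open>i\<close>
  runs from 0 to \<open>n - 1\<close>.\<close>

fun a_elem :: "real_group \<Rightarrow> nat \<Rightarrow> (nat \<Rightarrow> real) \<Rightarrow> complex mat" where
  "a_elem (SpR m) n t = mat (m + m) (m + m) (\<lambda>(r, s). \<Sum>i<n.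
     if (r, s) = (i, n + i) \<or> (r, s) = (n + i, i) then complex_of_real (t i) else 0)"
| "a_elem (OR p q) n t = mat (p + q) (p + q) (\<lambda>(r, s). \<Sum>i<n.
     if (r, s) = (p - 1 - i, p + i) \<or> (r, s) = (p + i, p - 1 - i) then complex_of_real (t i) else 0)"

definition M_group :: "real_group \<Rightarrow> nat \<Rightarrow> complex mat set" where
  "M_group G n = {m \<in> K_of G. \<forall>t. m * a_elem G n t = a_elem G n t * m}"

text \<open>A linear functional on \<open>\<aa>_0\<close> is given by its values on the basis.\<close>

definition positive_root :: "nat \<Rightarrow> (nat \<Rightarrow> real) \<Rightarrow> bool" where
  "positive_root n \<alpha> \<longleftrightarrow>
     (\<exists>i j. i < j \<and> j < n \<and>
        (\<alpha> = (\<lambda>r. of_bool (r = i) + of_bool (r = j)) \<or> \<alpha> = (\<lambda>r. of_bool (r = i) - of_bool (r = j)))) \<or>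
     (\<exists>i<n. \<exists>c>0. \<alpha> = (\<lambda>r. c * of_bool (r = i)))"

definition root_space :: "real_group \<Rightarrow> nat \<Rightarrow> (nat \<Rightarrow> real) \<Rightarrow> complex mat set" where
  "root_space G n \<alpha> = {x \<in> lie0 G. \<forall>t.
     lie_bracket (a_elem G n t) x = complex_of_real (\<Sum>i<n. t i * \<alpha> i) \<cdot>\<^sub>m x}"

inductive_set n0 :: "real_group \<Rightarrow> nat \<Rightarrow> complex mat set" for G :: real_group and n :: nat where
  "0\<^sub>m (vdim G) (vdim G) \<in> n0 G n"
| "x \<in> n0 G n \<Longrightarrow> positive_root n \<alpha> \<Longrightarrow> y \<in> root_space G n \<alpha> \<Longrightarrow> x + y \<in> n0 G n"

definition N_group :: "real_group \<Rightarrow> nat \<Rightarrow> complex mat set" where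
  "N_group G n = mat_exp ` n0 G n"

fun half_sum_roots :: "split_case \<Rightarrow> nat \<Rightarrow> nat \<Rightarrow> real" where
  "half_sum_roots CaseS n i = real n - real i"
| "half_sum_roots CaseO1 n i = real n - real i - 1 / 2"
| "half_sum_roots CaseO2 n i = real n - real i - 1 / 2"

text \<open>The elements of \<open>M\<close> are diagonal matrices with entries \<open>\<plusminus>1\<close>, and the entries below are
  the components of \<open>m\<close> in \<open>(\<int>/2)^n\<close>, respectively \<open>O(1) \<times> O(1)^n\<close>.\<close>

fun M_character :: "split_case \<Rightarrow> nat \<Rightarrow> nat \<Rightarrow> complex mat \<Rightarrow> complex" where
  "M_character CaseS n k m = (\<Prod>i<k. m $$ (i, i))"
| "M_character CaseO1 n k m = (\<Prod>i\<in>{k..<n}. m $$ (n + 1 + i, n + 1 + i))"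
| "M_character CaseO2 n k m = m $$ (0, 0) * (\<Prod>i\<in>{k..<n}. m $$ (n + 1 + i, n + 1 + i))"

text \<open>Normalized induction, realized on \<open>K\<close>-finite continuous functions on the group; by
  \<open>G = KAN\<close> such functions are automatically smooth.\<close>

definition principal_series_space ::
    "split_case \<Rightarrow> nat \<Rightarrow> nat \<Rightarrow> (nat \<Rightarrow> complex) \<Rightarrow> (complex mat \<Rightarrow> complex) cspace" where
  "principal_series_space cs n k \<nu> = (let G = split_group cs n in
     \<lparr> carrier = {f. (\<forall>g. g \<notin> group_of G \<longrightarrow> f g = 0) \<and>
          (\<forall>g\<in>group_of G. \<forall>m\<in>M_group G n. \<forall>t. \<forall>u\<in>N_group G n.
             f (g * m * mat_exp (a_elem G n t) * u) =
               inverse (M_character cs n k m) *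
               exp (- (\<Sum>i<n. (\<nu> i + of_real (half_sum_roots cs n i)) * of_real (t i))) * f g) \<and>
          mat_continuous_on (vdim G) (group_of G) f \<and>
          (\<exists>(r::nat) u c. \<forall>k'\<in>K_of G. \<forall>g\<in>group_of G. f (mat_inv k' * g) = (\<Sum>j<r. c j k' * u j g))},
       mult = undefined, one = undefined, zero = (\<lambda>g. 0),
       add = (\<lambda>f f' g. f g + f' g), smult = (\<lambda>c f g. c * f g) \<rparr>)"

definition left_derivative ::
    "real_group \<Rightarrow> complex mat \<Rightarrow> (complex mat \<Rightarrow> complex) \<Rightarrow> complex mat \<Rightarrow> complex" where
  "left_derivative G x f = (\<lambda>g. if g \<in> group_of G
     then vector_derivative (\<lambda>t::real. f (mat_exp (complex_of_real (- t) \<cdot>\<^sub>m x) * g)) (at 0) else 0)"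

definition principal_series ::
    "split_case \<Rightarrow> nat \<Rightarrow> nat \<Rightarrow> (nat \<Rightarrow> complex) \<Rightarrow> (complex mat \<Rightarrow> complex) gk_module" where
  "principal_series cs n k \<nu> = (let G = split_group cs n in
     \<lparr> gk_space = principal_series_space cs n k \<nu>,
       gk_lie = (\<lambda>x f g. left_derivative G (map_mat (\<lambda>z. of_real (Re z)) x) f g
                      + \<i> * left_derivative G (map_mat (\<lambda>z. of_real (Im z)) x) f g),
       gk_grp = (\<lambda>k' f g. if g \<in> group_of G then f (mat_inv k' * g) else 0) \<rparr>)"

text \<open>Subrepresentations up to isomorphism.\<close>

definition gk_subrepresentation :: "real_group \<Rightarrow> 'x gk_module \<Rightarrow> 'y gk_module \<Rightarrow> bool" where
  "gk_subrepresentation G X Y \<longleftrightarrow>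
     (\<exists>\<iota>. clinear (gk_space X) (gk_space Y) \<iota> \<and> inj_on \<iota> (carrier (gk_space X)) \<and>
        (\<forall>v\<in>carrier (gk_space X). (\<forall>x\<in>lie G. \<iota> (gk_lie X x v) = gk_lie Y x (\<iota> v)) \<and>
                                   (\<forall>k\<in>K_of G. \<iota> (gk_grp X k v) = gk_grp Y k (\<iota> v))))"

text \<open>\<open>K \<cong> U(n)\<close> is normalized so that the identity matrix of \<open>\<gg>\<ll>_n\<close>
  corresponds to \<open>\<xi>\<close>: the block matrix with rows \<open>(A, B)\<close>, \<open>(-B, A)\<close> goes to
  \<open>A - iB\<close>.\<close>

definition det_unitary :: "nat \<Rightarrow> complex mat \<Rightarrow> complex" where
  "det_unitary n k = det (mat n n (\<lambda>(i, j). k $$ (i, j) - \<i> * k $$ (i, n + j)))"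

definition det_first :: "nat \<Rightarrow> complex mat \<Rightarrow> complex" where
  "det_first p k = det (mat p p (\<lambda>(i, j). k $$ (i, j)))"

definition det_second :: "nat \<Rightarrow> nat \<Rightarrow> complex mat \<Rightarrow> complex" where
  "det_second p q k = det (mat q q (\<lambda>(i, j). k $$ (p + i, p + j)))"

fun \<mu>_char :: "split_case \<Rightarrow> nat \<Rightarrow> complex mat \<Rightarrow> complex" where
  "\<mu>_char CaseS n k = 1"
| "\<mu>_char CaseO1 n k = det_second (n + 1) n k"
| "\<mu>_char CaseO2 n k = det_first (n + 1) k"

fun \<mu>'_char :: "split_case \<Rightarrow> nat \<Rightarrow> complex mat \<Rightarrow> complex" where
  "\<mu>'_char CaseS n k = det_unitary n k"
| "\<mu>'_char CaseO1 n k = 1"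
| "\<mu>'_char CaseO2 n k = det_first (n + 1) k * det_second (n + 1) n k"

text \<open>With \<open>p = n + 1\<close> and \<open>q = n\<close> one has \<open>(p - q) / 2 = 1 / 2\<close> and
  \<open>(p + q) / 2 = n + 1 / 2\<close>.\<close>

fun c_\<mu> :: "split_case \<Rightarrow> complex" where
  "c_\<mu> CaseS = 0" | "c_\<mu> CaseO1 = 1 / 2" | "c_\<mu> CaseO2 = 1 / 2"

fun c_\<mu>' :: "split_case \<Rightarrow> complex" where
  "c_\<mu>' CaseS = 1" | "c_\<mu>' CaseO1 = 1 / 2" | "c_\<mu>' CaseO2 = 1 / 2"

fun r_const :: "split_case \<Rightarrow> nat \<Rightarrow> complex" where
  "r_const CaseS n = - of_nat n"
| "r_const CaseO1 n = of_nat n + 1 / 2"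
| "r_const CaseO2 n = of_nat n + 1 / 2"

end

theory Submission
  imports Defs
begin

text \<open>
  Pulling back a positive definite invariant form on the Langlands quotient of \<open>X\<close> gives a positive
  semidefinite invariant form on \<open>X\<close> with the radical of the given form, hence semidefinite forms on
  \<open>X \<otimes> V\<^sup>\<otimes>\<^sup>l\<close> and on the multiplicity space \<open>F\<close>. For every invariant form on \<open>X\<close> and
  the product form \<open>\<langle>u, v\<rangle>\<close> on \<open>X \<otimes> V\<^sup>\<otimes>\<^sup>l\<close>, each generator of the algebra is symmetric for
  \<open>\<langle>u, (\<xi> \<otimes> \<dots> \<otimes> \<xi>) v\<rangle>\<close>, and \<open>\<xi> \<otimes> \<dots> \<otimes> \<xi>\<close> is the action of \<open>w\<^sub>0\<close>: this is
  invariance on \<open>F\<close> under the involution \<open>*\<close>.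

  The radical \<open>R\<close> of the given form on \<open>F\<close> contains the null vectors of the semidefinite form but may
  be larger. By admissibility \<open>F\<close> has finite dimension modulo null vectors, and since \<open>R\<close> is a
  submodule the orthogonal projection to the complement of \<open>R\<close> commutes with the algebra and
  carries the semidefinite form to a positive definite invariant form on \<open>F / R\<close>.
\<close>

section \<open>Complex vector spaces\<close>

text \<open>The radical \<open>R\<close> can really be larger. Invariance of \<open>h\<close> refers
  to the Lie algebra only, while the multiplicity space is cut out by \<open>K\<close>, which is
  disconnected for \<open>O(p,q)\<close>: if \<open>h\<close> pairs a module with its twist by a
  character of the component group, it can vanish on that space without being degenerate on
  \<open>X\<close>. Moreover the positive form on the quotient of \<open>X\<close> is tied to
  \<open>h\<close> only through the radical. So the complement of \<open>R\<close> is taken for the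
  positive form, and the projection needs a finite orthonormal basis of \<open>R\<close> modulo null
  vectors. Admissibility bounds its size through complete reducibility of the representation of
  \<open>K\<close> on \<open>V\<^sup>\<otimes>\<^sup>l\<close> twisted by \<open>\<mu>\<close>.

  The symmetry of \<open>z\<^sub>i\<close> rests on one matrix identity. The Gram matrix of the form
  on \<open>V\<close> commutes with the Lie algebra, and \<open>\<xi>\<close> is a multiple of the
  matrix of the bilinear form; hence in the form twisted by \<open>\<xi>\<close> an element
  \<open>x\<close> has adjoint \<open>- cj x\<close>, the same rule as on \<open>X\<close>. In each
  \<open>\<Omega>\<close> the signs from \<open>b\<close> and \<open>d b\<close> cancel, and the
  Casimir tensor is invariant under complex conjugation.\<close>

locale cvs =
  fixes M :: "(complex, 'v) module" (structure)
  assumes vs: "complex_vectorspace M"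
begin

sublocale vectorspace "class_ring :: complex ring" M
  by (rule vs)

lemma sm_closed [simp]: "x \<in> carrier M \<Longrightarrow> c \<odot> x \<in> carrier M"
  by (rule smult_closed) auto

lemma sm_ladd: "x \<in> carrier M \<Longrightarrow> (a + b) \<odot> x = a \<odot> x \<oplus> b \<odot> x"
  using smult_l_distr[of a b x] by simp

lemma sm_radd: "x \<in> carrier M \<Longrightarrow> y \<in> carrier M \<Longrightarrow> a \<odot> (x \<oplus> y) = a \<odot> x \<oplus> a \<odot> y"
  using smult_r_distr[of a x y] by simp

lemma sm_assoc: "x \<in> carrier M \<Longrightarrow> (a * b) \<odot> x = a \<odot> (b \<odot> x)"
  using smult_assoc1[of a b x] by simp

lemma sm_one [simp]: "x \<in> carrier M \<Longrightarrow> 1 \<odot> x = x"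
  using smult_one[of x] by simp

lemma sm_zero [simp]: "x \<in> carrier M \<Longrightarrow> 0 \<odot> x = \<zero>"
  using lmult_0[of x] by simp

lemma sm_rzero [simp]: "c \<odot> \<zero> = \<zero>"
  using rmult_0[of c] by simp

lemma sm_neg: "x \<in> carrier M \<Longrightarrow> (- 1) \<odot> x = \<ominus> x"
  by (metis M.minus_equality add.left_inverse sm_closed sm_ladd sm_one sm_zero)

lemma sm_finsum: "f \<in> A \<rightarrow> carrier M \<Longrightarrow> c \<odot> finsum M f A = finsum M (\<lambda>i. c \<odot> f i) A"
proof (induction A rule: infinite_finite_induct)
  case (insert a A)
  then show ?case by (simp add: sm_radd Pi_def M.finsum_closed)
qed (auto)

lemma finsum_sm: "finite A \<Longrightarrow> x \<in> carrier M \<Longrightarrow> (\<Sum>i\<in>A. f i) \<odot> x = finsum M (\<lambda>i. f i \<odot> x) A"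
  by (induction A rule: finite_induct) (auto simp: sm_ladd Pi_def)

lemma finsum_swap:
  assumes "finite A" "finite B" "\<And>i j. i \<in> A \<Longrightarrow> j \<in> B \<Longrightarrow> f i j \<in> carrier M"
  shows "finsum M (\<lambda>i. finsum M (f i) B) A = finsum M (\<lambda>j. finsum M (\<lambda>i. f i j) A) B"
  using assms
proof (induction A rule: finite_induct)
  case (insert a A)
  then have "finsum M (\<lambda>j. finsum M (\<lambda>i. f i j) (insert a A)) B = finsum M (\<lambda>j. f a j \<oplus> finsum M (\<lambda>i. f i j) A) B"
    by (intro M.finsum_cong') (auto simp: Pi_def intro!: M.finsum_closed)
  also have "\<dots> = finsum M (f a) B \<oplus> finsum M (\<lambda>j. finsum M (\<lambda>i. f i j) A) B"
    using insert by (intro M.finsum_addf) (auto simp: Pi_def intro!: M.finsum_closed)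
  finally show ?case using insert by (simp add: Pi_def M.finsum_closed)
qed (auto)

lemma finsum_add:
  assumes "f \<in> A \<rightarrow> carrier M" "g \<in> A \<rightarrow> carrier M"
  shows "finsum M (\<lambda>i. f i \<oplus> g i) A = finsum M f A \<oplus> finsum M g A"
  using M.finsum_addf[OF assms] .

lemma finsum_delta:
  assumes "finite A" "a \<in> A" "x \<in> carrier M"
  shows "finsum M (\<lambda>i. (if i = a then c else 0) \<odot> x) A = c \<odot> x"
  using assms finsum_sm[OF assms(1,3), of "\<lambda>i. if i = a then c else 0"] by simp

lemma finsum_delta':
  assumes "finite A" "a \<in> A" "\<And>i. i \<in> A \<Longrightarrow> f i \<in> carrier M"
  shows "finsum M (\<lambda>i. (if i = a then 1 else 0) \<odot> f i) A = f a"
proof -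
  have "finsum M (\<lambda>i. (if i = a then 1 else 0) \<odot> f i) A = finsum M (\<lambda>i. (if i = a then 1 else 0) \<odot> f a) A"
    using assms by (intro M.finsum_cong') auto
  then show ?thesis using assms by (simp add: finsum_delta)
qed

end

text \<open>The additive inverse of \<open>x\<close> is provided as \<open>(- 1) \<odot> x\<close>,
  so the hypotheses mention the module operations only.\<close>

lemma cvsI:
  assumes add: "\<And>x y. x \<in> carrier M \<Longrightarrow> y \<in> carrier M \<Longrightarrow> x \<oplus>\<^bsub>M\<^esub> y \<in> carrier M"
    and zero: "\<zero>\<^bsub>M\<^esub> \<in> carrier M"
    and sm: "\<And>c x. x \<in> carrier M \<Longrightarrow> c \<odot>\<^bsub>M\<^esub> x \<in> carrier M"
    and a: "\<And>x y z. x \<in> carrier M \<Longrightarrow> y \<in> carrier M \<Longrightarrow> z \<in> carrier M \<Longrightarrow>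
          (x \<oplus>\<^bsub>M\<^esub> y) \<oplus>\<^bsub>M\<^esub> z = x \<oplus>\<^bsub>M\<^esub> (y \<oplus>\<^bsub>M\<^esub> z)"
    and c: "\<And>x y. x \<in> carrier M \<Longrightarrow> y \<in> carrier M \<Longrightarrow> x \<oplus>\<^bsub>M\<^esub> y = y \<oplus>\<^bsub>M\<^esub> x"
    and z: "\<And>x. x \<in> carrier M \<Longrightarrow> \<zero>\<^bsub>M\<^esub> \<oplus>\<^bsub>M\<^esub> x = x"
    and neg: "\<And>x. x \<in> carrier M \<Longrightarrow> (- 1) \<odot>\<^bsub>M\<^esub> x \<oplus>\<^bsub>M\<^esub> x = \<zero>\<^bsub>M\<^esub>"
    and l: "\<And>c d x. x \<in> carrier M \<Longrightarrow> (c + d) \<odot>\<^bsub>M\<^esub> x = c \<odot>\<^bsub>M\<^esub> x \<oplus>\<^bsub>M\<^esub> d \<odot>\<^bsub>M\<^esub> x"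
    and r: "\<And>c x y. x \<in> carrier M \<Longrightarrow> y \<in> carrier M \<Longrightarrow>
          c \<odot>\<^bsub>M\<^esub> (x \<oplus>\<^bsub>M\<^esub> y) = c \<odot>\<^bsub>M\<^esub> x \<oplus>\<^bsub>M\<^esub> c \<odot>\<^bsub>M\<^esub> y"
    and assoc: "\<And>c d x. x \<in> carrier M \<Longrightarrow> (c * d) \<odot>\<^bsub>M\<^esub> x = c \<odot>\<^bsub>M\<^esub> (d \<odot>\<^bsub>M\<^esub> x)"
    and one: "\<And>x. x \<in> carrier M \<Longrightarrow> 1 \<odot>\<^bsub>M\<^esub> x = x"
  shows "cvs (M :: (complex, 'v) module)"
proof (rule cvs.intro, rule vectorspace.intro, rule module.intro)
  show "abelian_group M"
    by (rule abelian_groupI) (use assms in blast)+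
qed (use assms class_field.field_axioms class_cring.is_cring in \<open>auto intro!: module_axioms.intro\<close>)

lemma clinear_finsum:
  assumes "cvs M" "cvs N" "clinear M N L" "f \<in> A \<rightarrow> carrier M"
  shows "L (finsum M f A) = finsum N (\<lambda>i. L (f i)) A"
proof -
  interpret M: cvs M by fact
  interpret N: cvs N by fact
  interpret mod_hom "class_ring :: complex ring" M N L
    by unfold_locales (rule assms)
  show ?thesis
    using assms(4)
  proof (induction A rule: infinite_finite_induct)
    case (insert a A)
    then show ?case by (simp add: Pi_def M.M.finsum_closed)
  qed auto
qed

lemma clinear_simps:
  assumes "clinear M N L" "x \<in> carrier M"
  shows "L x \<in> carrier N" "L (c \<odot>\<^bsub>M\<^esub> x) = c \<odot>\<^bsub>N\<^esub> L x"
    "y \<in> carrier M \<Longrightarrow> L (x \<oplus>\<^bsub>M\<^esub> y) = L x \<oplus>\<^bsub>N\<^esub> L y"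
  using assms by (auto simp: module_hom_def)

lemma clinearI:
  assumes "\<And>x. x \<in> carrier M \<Longrightarrow> L x \<in> carrier N"
    "\<And>x y. x \<in> carrier M \<Longrightarrow> y \<in> carrier M \<Longrightarrow> L (x \<oplus>\<^bsub>M\<^esub> y) = L x \<oplus>\<^bsub>N\<^esub> L y"
    "\<And>c x. x \<in> carrier M \<Longrightarrow> L (c \<odot>\<^bsub>M\<^esub> x) = c \<odot>\<^bsub>N\<^esub> L x"
  shows "clinear M N L"
  using assms by (auto simp: module_hom_def)

section \<open>Positive semidefinite forms\<close>

text \<open>Kept apart from \<open>psd\<close> because the given invariant form on a module is only
  sesquilinear: nothing proved here relies on conjugate symmetry, and the radical is the left
  one.\<close>

locale sesq = cvs M for M :: "(complex, 'v) module" (structure) +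
  fixes H :: "'v \<Rightarrow> 'v \<Rightarrow> complex"
  assumes herm: "hermitian_form M H"
begin

lemma H_add [simp]:
  "x \<in> carrier M \<Longrightarrow> y \<in> carrier M \<Longrightarrow> z \<in> carrier M \<Longrightarrow> H (x \<oplus> y) z = H x z + H y z"
  "x \<in> carrier M \<Longrightarrow> y \<in> carrier M \<Longrightarrow> z \<in> carrier M \<Longrightarrow> H z (x \<oplus> y) = H z x + H z y"
  using herm unfolding hermitian_form_def by blast+

lemma H_sm [simp]:
  "x \<in> carrier M \<Longrightarrow> z \<in> carrier M \<Longrightarrow> H (c \<odot> x) z = c * H x z"
  "x \<in> carrier M \<Longrightarrow> z \<in> carrier M \<Longrightarrow> H z (c \<odot> x) = cnj c * H z x"
  using herm unfolding hermitian_form_def by blast+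

lemma H_zero [simp]: "z \<in> carrier M \<Longrightarrow> H \<zero> z = 0" "z \<in> carrier M \<Longrightarrow> H z \<zero> = 0"
  using H_sm[of \<zero> z 0] by auto

lemma H_minus [simp]:
  assumes "x \<in> carrier M" "y \<in> carrier M" "z \<in> carrier M"
  shows "H (x \<ominus> y) z = H x z - H y z" "H z (x \<ominus> y) = H z x - H z y"
  using assms by (simp_all add: a_minus_def sm_neg[symmetric])

lemma H_finsum:
  assumes "z \<in> carrier M" "f \<in> A \<rightarrow> carrier M"
  shows "H (finsum M f A) z = (\<Sum>i\<in>A. H (f i) z)" "H z (finsum M f A) = (\<Sum>i\<in>A. H z (f i))"
  using assms(2)
  by (induction A rule: infinite_finite_induct) (auto simp: assms Pi_def)

end

locale psd = sesq M H for M :: "(complex, 'v) module" (structure) and H +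
  assumes psd: "x \<in> carrier M \<Longrightarrow> H x x \<in> \<real> \<and> 0 \<le> Re (H x x)"
begin

text \<open>Polarization: reality of the form at \<open>x + y\<close> gives the imaginary part of
  the identity, reality at \<open>x + \<i> y\<close> the real part.\<close>

lemma sym:
  assumes [simp]: "x \<in> carrier M" "y \<in> carrier M"
  shows "H y x = cnj (H x y)"
proof -
  have 1: "H (x \<oplus> y) (x \<oplus> y) = H x x + H x y + H y x + H y y" by simp
  have 2: "H (x \<oplus> \<i> \<odot> y) (x \<oplus> \<i> \<odot> y) = H x x - \<i> * H x y + \<i> * H y x + H y y"
    by (simp add: algebra_simps)
  have "Im (H x x) = 0" "Im (H y y) = 0" "Im (H (x \<oplus> y) (x \<oplus> y)) = 0"
    "Im (H (x \<oplus> \<i> \<odot> y) (x \<oplus> \<i> \<odot> y)) = 0"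
    using psd by (auto simp: complex_is_Real_iff simp del: H_add H_sm)
  then show ?thesis
    unfolding 1 2 by (simp add: complex_eq_iff)
qed

text \<open>The degenerate case of Cauchy-Schwarz: along the line \<open>y + t x\<close> the
  quadratic term vanishes, so nonnegativity forces the linear term to vanish too.\<close>

lemma null:
  assumes [simp]: "x \<in> carrier M" "y \<in> carrier M" and 0: "H x x = 0"
  shows "H x y = 0" "H y x = 0"
proof -
  define q where "q = (cmod (H x y))\<^sup>2"
  have q: "H x y * cnj (H x y) = of_real q"
    unfolding q_def by (simp add: complex_norm_square[symmetric])
  have le: "0 \<le> Re (H y y) - 2 * s * q" for s :: real
  proof -
    \<comment> \<open>With this direction both cross terms equal \<open>- s |H x y|^2\<close>, which
      leaves an affine function of the real parameter \<open>s\<close>.\<close>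
    define t where "t = - of_real s * H y x"
    have "H (y \<oplus> t \<odot> x) (y \<oplus> t \<odot> x) = H y y + t * H x y + cnj t * H y x"
      by (simp add: 0 algebra_simps)
    also have "\<dots> = H y y - of_real s * (H x y * cnj (H x y)) - of_real s * (H x y * cnj (H x y))"
      unfolding t_def sym[OF assms(1,2)] by (simp add: algebra_simps)
    also have "\<dots> = H y y - of_real (2 * s * q)" unfolding q by simp
    finally have "Re (H (y \<oplus> t \<odot> x) (y \<oplus> t \<odot> x)) = Re (H y y - of_real (2 * s * q))"
      by (rule arg_cong)
    also have "\<dots> = Re (H y y) - 2 * s * q"
      by (simp del: of_real_mult)
    finally show ?thesis using psd[of "y \<oplus> t \<odot> x"] by (simp del: H_add H_sm)
  qed
  have "q = 0"
  proof (rule ccontr)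
    assume "q \<noteq> 0"
    \<comment> \<open>This value of \<open>s\<close> turns the bound \<open>le\<close> into
      \<open>0 \<le> -1\<close>.\<close>
    then show False using le[of "(Re (H y y) + 1) / (2 * q)"] by simp
  qed
  then show "H x y = 0" by (simp add: q_def)
  then show "H y x = 0" using sym[of x y] by simp
qed

definition orthonormal :: "'v set \<Rightarrow> bool" where
  "orthonormal E \<longleftrightarrow> finite E \<and> E \<subseteq> carrier M \<and> (\<forall>f\<in>E. \<forall>g\<in>E. H f g = (if f = g then 1 else 0))"

text \<open>Up to vectors of length zero, such an \<open>x\<close> is the sum of its projections to the vectors of \<open>E\<close>.\<close>
definition covers :: "'v set \<Rightarrow> 'v \<Rightarrow> bool" where
  "covers E x \<longleftrightarrow> (\<forall>y\<in>carrier M. H x y = (\<Sum>f\<in>E. H x f * H f y))"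

definition proj :: "'v set \<Rightarrow> 'v \<Rightarrow> 'v" where
  "proj E x = finsum M (\<lambda>f. H x f \<odot> f) E"

lemma proj_closed [simp]: "orthonormal E \<Longrightarrow> x \<in> carrier M \<Longrightarrow> proj E x \<in> carrier M"
  unfolding proj_def orthonormal_def by (auto intro!: M.finsum_closed)

lemma H_proj:
  assumes "orthonormal E" "x \<in> carrier M" "y \<in> carrier M"
  shows "H (proj E x) y = (\<Sum>f\<in>E. H x f * H f y)" "H y (proj E x) = (\<Sum>f\<in>E. cnj (H x f) * H y f)"
proof -
  have "(\<lambda>f. H x f \<odot> f) \<in> E \<rightarrow> carrier M" using assms unfolding orthonormal_def by auto
  moreover have "f \<in> carrier M" if "f \<in> E" for f using that assms unfolding orthonormal_def by auto
  ultimately show "H (proj E x) y = (\<Sum>f\<in>E. H x f * H f y)"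
    "H y (proj E x) = (\<Sum>f\<in>E. cnj (H x f) * H y f)"
    unfolding proj_def using assms by (auto simp: H_finsum intro!: sum.cong)
qed

lemma H_proj_basis:
  assumes E: "orthonormal E" "x \<in> carrier M" "g \<in> E"
  shows "H (proj E x) g = H x g"
proof -
  have c: "g \<in> carrier M" "finite E" using E unfolding orthonormal_def by auto
  have "H (proj E x) g = (\<Sum>f\<in>E. if f = g then H x f else 0)"
    unfolding H_proj(1)[OF E(1,2) c(1)]
  proof (rule sum.cong)
    fix f assume "f \<in> E"
    then have "H f g = (if f = g then 1 else 0)" using E unfolding orthonormal_def by blast
    then show "H x f * H f g = (if f = g then H x f else 0)" by simp
  qed simp
  also have "\<dots> = H x g" using c(2) E(3) by (simp add: sum.delta)
  finally show ?thesis .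
qed

text \<open>Pythagoras: the projection has the same products with the members of \<open>E\<close> as
  \<open>x\<close> itself, so its square length and both cross terms are the same sum.\<close>

lemma residual_norm:
  assumes E: "orthonormal E" and x: "x \<in> carrier M"
  shows "H (x \<ominus> proj E x) (x \<ominus> proj E x) = H x x - (\<Sum>f\<in>E. H x f * H f x)"
proof -
  have "H (proj E x) (proj E x) = (\<Sum>f\<in>E. cnj (H x f) * H (proj E x) f)"
    by (rule H_proj) (use E x in auto)
  also have "\<dots> = (\<Sum>f\<in>E. cnj (H x f) * H x f)"
    using H_proj_basis[OF E x] by simp
  finally have 1: "H (proj E x) (proj E x) = (\<Sum>f\<in>E. cnj (H x f) * H x f)" .
  have 2: "(\<Sum>f\<in>E. H x f * H f x) = (\<Sum>f\<in>E. cnj (H x f) * H x f)"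
  proof (rule sum.cong)
    fix f assume "f \<in> E"
    then have "H f x = cnj (H x f)" using E x unfolding orthonormal_def by (intro sym) auto
    then show "H x f * H f x = cnj (H x f) * H x f" by simp
  qed simp
  show ?thesis
    using E x 1 2 H_proj[OF E x x] by simp
qed

lemma bessel:
  assumes E: "orthonormal E" and x: "x \<in> carrier M"
  shows "(\<Sum>f\<in>E. (cmod (H x f))\<^sup>2) \<le> Re (H x x)"
proof -
  have "(\<Sum>f\<in>E. H x f * H f x) = of_real (\<Sum>f\<in>E. (cmod (H x f))\<^sup>2)"
    unfolding of_real_sum
  proof (rule sum.cong)
    fix f assume "f \<in> E"
    then have "f \<in> carrier M" using E unfolding orthonormal_def by auto
    then show "H x f * H f x = of_real ((cmod (H x f))\<^sup>2)"
      using sym[of x f] x by (simp only: complex_norm_square)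
  qed simp
  then show ?thesis
    using psd[of "x \<ominus> proj E x"] residual_norm[OF E x] E x by simp
qed

text \<open>A covered vector is orthogonal to every member of \<open>E' - E\<close>, because such a
  member is orthogonal to all of \<open>E\<close>; the additional summands are zero.\<close>

lemma covers_mono:
  assumes "orthonormal E'" "E \<subseteq> E'" "x \<in> carrier M" "covers E x"
  shows "covers E' x"
  unfolding covers_def
proof
  fix y assume y: "y \<in> carrier M"
  have fin: "finite E'" and c: "E' \<subseteq> carrier M" using assms(1) unfolding orthonormal_def by auto
  have "H x g = 0" if g: "g \<in> E' - E" for g
  proof -
    have "H x g = (\<Sum>f\<in>E. H x f * H f g)"
      using assms(4) g c unfolding covers_def by auto
    also have "\<dots> = 0"
    proof (rule sum.neutral, rule ballI)
      fix f assume "f \<in> E"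
      then have "H f g = 0" using assms(1,2) g unfolding orthonormal_def by auto
      then show "H x f * H f g = 0" by simp
    qed
    finally show ?thesis .
  qed
  then have "(\<Sum>f\<in>E'. H x f * H f y) = (\<Sum>f\<in>E. H x f * H f y)"
    using fin assms(2) by (intro sum.mono_neutral_right) auto
  then show "H x y = (\<Sum>f\<in>E'. H x f * H f y)"
    using assms(4) y unfolding covers_def by auto
qed

text \<open>The Gram-Schmidt step. If the residual had length zero, it would be orthogonal to
  everything by \<open>null\<close> and \<open>x\<close> would be covered already; so it can be
  normalized. The new vector is displayed as a multiple of the residual so that callers can locate
  it in a given subspace.\<close>

lemma orthonormal_extend:
  assumes E: "orthonormal E" and x: "x \<in> carrier M" and n: "\<not> covers E x"
  obtains c where "orthonormal (insert (c \<odot> (x \<ominus> proj E x)) E)"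
    "c \<odot> (x \<ominus> proj E x) \<notin> E" "covers (insert (c \<odot> (x \<ominus> proj E x)) E) x"
proof -
  define r where "r = x \<ominus> proj E x"
  have r: "r \<in> carrier M" using E x by (simp add: r_def)
  have Oc: "E \<subseteq> carrier M" "finite E" using E unfolding orthonormal_def by auto
  have rO: "H r f = 0" if "f \<in> E" for f
    using that E x Oc H_proj_basis[OF E x that] by (auto simp: r_def)
  have Hx: "H x y = H r y + (\<Sum>f\<in>E. H x f * H f y)" if "y \<in> carrier M" for y
    using that E x by (simp add: r_def H_proj)
  have "H r r \<noteq> 0"
  proof
    assume "H r r = 0"
    then have "covers E x" unfolding covers_def using Hx null(1)[OF r] by auto
    then show False using n by simp
  qed
  then have pos: "Re (H r r) > 0" and real: "H r r = of_real (Re (H r r))"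
    using psd[OF r] by (auto simp: complex_eq_iff complex_is_Real_iff)
  define c :: complex where "c = of_real (1 / sqrt (Re (H r r)))"
  define g where "g = c \<odot> r"
  have g: "g \<in> carrier M" using r by (simp add: g_def)
  have cc: "c * c * H r r = 1"
  proof -
    have "c * c * H r r = of_real ((1 / sqrt (Re (H r r))) * (1 / sqrt (Re (H r r))) * Re (H r r))"
      unfolding c_def by (subst real) (simp only: of_real_mult)
    also have "\<dots> = 1" using pos by (simp add: field_simps flip: of_real_mult)
    finally show ?thesis .
  qed
  have cnjc: "cnj c = c" by (simp add: c_def)
  have gg: "H g g = 1" using cc r by (simp add: g_def cnjc mult.assoc)
  have gO: "H g f = 0" "H f g = 0" if "f \<in> E" for f
  proof -
    have f: "f \<in> carrier M" using that Oc by auto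
    show "H g f = 0" using rO[OF that] r f by (simp add: g_def)
    then show "H f g = 0" using sym[OF g f] by simp
  qed
  have gn: "g \<notin> E" using gO gg by auto
  have on: "orthonormal (insert g E)"
    using E g gg gO unfolding orthonormal_def by auto
  have Hxg: "H x g = c * H r r"
    using Hx[OF g] gO r g by (simp add: g_def cnjc)
  have "covers (insert g E) x"
    unfolding covers_def
  proof
    fix y assume y: "y \<in> carrier M"
    have "H g y = c * H r y" using r y by (simp add: g_def)
    then have "H x g * H g y = (c * c * H r r) * H r y"
      unfolding Hxg by (simp only: ac_simps)
    then have "H x g * H g y = H r y" unfolding cc by simp
    then show "H x y = (\<Sum>f\<in>insert g E. H x f * H f y)"
      using Hx[OF y] gn Oc by simp
  qed
  then show ?thesis using that[of c] on gn unfolding g_def r_def by blast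
qed

lemma orthonormal_cover_finite:
  assumes "finite Z" "Z \<subseteq> carrier M"
  shows "\<exists>E. orthonormal E \<and> (\<forall>z\<in>Z. covers E z)"
  using assms
proof (induction Z rule: finite_induct)
  case empty
  show ?case by (rule exI[of _ "{}"]) (simp add: orthonormal_def)
next
  case (insert z Z)
  then obtain E where E: "orthonormal E" "\<forall>z\<in>Z. covers E z" by auto
  show ?case
  proof (cases "covers E z")
    case False
    obtain g where g: "orthonormal (insert g E)" "covers (insert g E) z"
      using orthonormal_extend[OF E(1) _ False] insert.prems by auto
    have "covers (insert g E) w" if "w \<in> Z" for w
      by (rule covers_mono[OF g(1), of E]) (use that E insert.prems in auto)
    then show ?thesis using g by (intro exI[of _ "insert g E"]) auto
  qed (use E in auto)
qed

text \<open>Double counting of the squares \<open>|H f g|^2\<close>: for fixed \<open>g\<close> they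
  sum to 1 over \<open>E\<close> because \<open>g\<close> is covered, and for fixed \<open>f\<close>
  to at most 1 over \<open>E'\<close> by Bessel. This serves as the dimension bound in a space whose
  null vectors are not divided out.\<close>

lemma card_orthonormal_le:
  assumes E: "orthonormal E" and E': "orthonormal E'" and c: "\<And>g. g \<in> E' \<Longrightarrow> covers E g"
  shows "card E' \<le> card E"
proof -
  have Oc: "E \<subseteq> carrier M" "E' \<subseteq> carrier M" using E E' unfolding orthonormal_def by auto
  have "real (card E') = (\<Sum>g\<in>E'. Re (H g g))"
    using E' unfolding orthonormal_def by simp
  also have "\<dots> = (\<Sum>g\<in>E'. \<Sum>f\<in>E. (cmod (H f g))\<^sup>2)"
  proof (rule sum.cong)
    fix g assume g: "g \<in> E'"
    have "H g g = (\<Sum>f\<in>E. H g f * H f g)" using c[OF g] g Oc unfolding covers_def by auto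
    also have "\<dots> = (\<Sum>f\<in>E. of_real ((cmod (H f g))\<^sup>2))"
    proof (rule sum.cong)
      fix f assume "f \<in> E"
      then show "H g f * H f g = of_real ((cmod (H f g))\<^sup>2)"
        using sym[of f g] g Oc by (auto simp: complex_norm_square mult.commute simp del: of_real_power)
    qed simp
    finally show "Re (H g g) = (\<Sum>f\<in>E. (cmod (H f g))\<^sup>2)" by simp
  qed simp
  also have "\<dots> = (\<Sum>f\<in>E. \<Sum>g\<in>E'. (cmod (H f g))\<^sup>2)" by (rule sum.swap)
  also have "\<dots> \<le> (\<Sum>f\<in>E. Re (H f f))"
    using bessel[OF E'] Oc by (intro sum_mono) auto
  also have "\<dots> = real (card E)"
    using E unfolding orthonormal_def by simp
  finally show ?thesis by simp
qed

text \<open>The bound provides an orthonormal family in \<open>W\<close> of greatest size; a vector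
  of \<open>W\<close> that it does not cover would extend it inside \<open>W\<close>.\<close>

lemma orthonormal_basis_exists:
  assumes W: "W \<subseteq> carrier M" and add: "\<And>x y. x \<in> W \<Longrightarrow> y \<in> W \<Longrightarrow> x \<oplus> y \<in> W"
    and sm: "\<And>c x. x \<in> W \<Longrightarrow> c \<odot> x \<in> W" and zero: "\<zero> \<in> W"
    and bound: "\<And>E. orthonormal E \<Longrightarrow> E \<subseteq> W \<Longrightarrow> card E \<le> b"
  shows "\<exists>E\<subseteq>W. orthonormal E \<and> (\<forall>x\<in>W. covers E x)"
proof -
  let ?P = "\<lambda>E. orthonormal E \<and> E \<subseteq> W"
  have "?P {}" by (simp add: orthonormal_def)
  moreover have "\<forall>E. ?P E \<longrightarrow> card E < Suc b" using bound by (simp add: less_Suc_eq_le)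
  ultimately have "\<exists>E. ?P E \<and> (\<forall>E'. ?P E' \<longrightarrow> card E' \<le> card E)"
    by (rule ex_has_greatest_nat)
  then obtain E where E: "orthonormal E" "E \<subseteq> W"
    and max: "\<And>E'. orthonormal E' \<Longrightarrow> E' \<subseteq> W \<Longrightarrow> card E' \<le> card E" by blast
  have fin: "finite E" using E unfolding orthonormal_def by auto
  have "covers E x" if x: "x \<in> W" for x
  proof (rule ccontr)
    assume n: "\<not> covers E x"
    have xc: "x \<in> carrier M" using x W by auto
    have "proj E x \<in> W"
      unfolding proj_def using fin E(2)
    proof (induction E rule: finite_induct)
      case (insert f E)
      then show ?case using W add sm by (subst M.finsum_insert) (auto simp: Pi_def subset_iff)
    qed (simp add: zero)
    then have "x \<ominus> proj E x \<in> W"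
      using add[OF x sm, of "proj E x" "- 1"] W by (auto simp: a_minus_def sm_neg)
    then have "c \<odot> (x \<ominus> proj E x) \<in> W" for c by (rule sm)
    then obtain g where g: "orthonormal (insert g E)" "g \<notin> E" "g \<in> W"
      using orthonormal_extend[OF E(1) xc n] by metis
    then have "card (insert g E) \<le> card E" using max[of "insert g E"] E(2) by simp
    then show False using g(2) fin by simp
  qed
  then show ?thesis using E by blast
qed

end

section \<open>Matrices indexed by words\<close>

definition dlt :: "'i \<Rightarrow> 'i \<Rightarrow> complex" where
  "dlt a b = (if a = b then 1 else 0)"

lemma dlt_sum [simp]:
  "finite S \<Longrightarrow> (\<Sum>b\<in>S. dlt a b * f b) = (if a \<in> S then f a else 0)"
  "finite S \<Longrightarrow> (\<Sum>b\<in>S. dlt b a * f b) = (if a \<in> S then f a else 0)"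
  "finite S \<Longrightarrow> (\<Sum>b\<in>S. f b * dlt a b) = (if a \<in> S then f a else 0)"
  "finite S \<Longrightarrow> (\<Sum>b\<in>S. f b * dlt b a) = (if a \<in> S then f a else 0)"
  by (simp_all add: dlt_def if_distrib[of "\<lambda>x. x * _"] if_distrib[of "\<lambda>x. _ * x"] cong: if_cong)

definition wds :: "nat \<Rightarrow> nat \<Rightarrow> nat list set" where
  "wds N l = {I. length I = l \<and> set I \<subseteq> {..<N}}"

lemma finite_wds [simp]: "finite (wds N l)"
  unfolding wds_def using finite_lists_length_eq[of "{..<N}" l] by (simp add: conj_commute)

lemma wds_0 [simp]: "wds N 0 = {[]}"
  by (auto simp: wds_def)

lemma wds_Suc: "wds N (Suc l) = (\<lambda>(a, I). a # I) ` ({..<N} \<times> wds N l)"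
  by (auto simp: wds_def length_Suc_conv image_iff)

lemma wds_nth: "I \<in> wds N l \<Longrightarrow> i < l \<Longrightarrow> I ! i < N"
  unfolding wds_def using nth_mem by fastforce

lemma wds_length: "I \<in> wds N l \<Longrightarrow> length I = l"
  by (simp add: wds_def)

lemma wds_update: "I \<in> wds N l \<Longrightarrow> c < N \<Longrightarrow> I[i := c] \<in> wds N l"
  unfolding wds_def by (auto dest!: set_update_subset_insert[THEN subsetD])

lemma sum_wds_Suc: "(\<Sum>J\<in>wds N (Suc l). f J) = (\<Sum>a<N. \<Sum>J\<in>wds N l. f (a # J))"
proof -
  have "inj_on (\<lambda>(a, I). a # I) ({..<N} \<times> wds N l)" by (auto simp: inj_on_def)
  then show ?thesis
    unfolding wds_Suc by (simp add: sum.reindex sum.cartesian_product case_prod_unfold)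
qed

text \<open>Matrix entries of \<open>u 0 \<otimes> \<dots> \<otimes> u (l - 1)\<close> in the basis
  of words.\<close>

definition tens :: "nat \<Rightarrow> (nat \<Rightarrow> nat \<Rightarrow> nat \<Rightarrow> complex) \<Rightarrow> nat list \<Rightarrow> nat list \<Rightarrow> complex" where
  "tens l u I J = (\<Prod>m<l. u m (I ! m) (J ! m))"

lemma tens_Suc: "tens (Suc l) u (a # I) (b # J) = u 0 a b * tens l (\<lambda>m. u (Suc m)) I J"
  unfolding tens_def prod.lessThan_Suc_shift by simp

text \<open>A sum over words of a product over letters factors into sums over the single letters;
  the induction splits off the first letter.\<close>

lemma tens_mult:
  assumes "I \<in> wds N l" "K \<in> wds N l"
  shows "(\<Sum>J\<in>wds N l. tens l u I J * tens l v J K) = tens l (\<lambda>m a c. \<Sum>b<N. u m a b * v m b c) I K"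
  using assms
proof (induction l arbitrary: I K u v)
  case 0
  then show ?case by (simp add: tens_def)
next
  case (Suc l)
  from Suc.prems obtain a I' c K' where [simp]: "I = a # I'" "K = c # K'" "I' \<in> wds N l" "K' \<in> wds N l"
    by (auto simp: wds_Suc)
  have "(\<Sum>J\<in>wds N (Suc l). tens (Suc l) u I J * tens (Suc l) v J K) =
      (\<Sum>b<N. \<Sum>J\<in>wds N l. (u 0 a b * v 0 b c) * (tens l (\<lambda>m. u (Suc m)) I' J * tens l (\<lambda>m. v (Suc m)) J K'))"
    by (simp add: sum_wds_Suc tens_Suc mult.assoc mult.left_commute)
  also have "\<dots> = (\<Sum>b<N. u 0 a b * v 0 b c) * (\<Sum>J\<in>wds N l. tens l (\<lambda>m. u (Suc m)) I' J * tens l (\<lambda>m. v (Suc m)) J K')"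
    by (simp add: sum_product)
  also have "\<dots> = tens (Suc l) (\<lambda>m a c. \<Sum>b<N. u m a b * v m b c) I K"
    using Suc.IH[of I' K' "\<lambda>m. u (Suc m)" "\<lambda>m. v (Suc m)"] by (simp add: tens_Suc)
  finally show ?case .
qed

lemma tens_cong:
  assumes "I \<in> wds N l" "J \<in> wds N l" "\<And>m a b. m < l \<Longrightarrow> a < N \<Longrightarrow> b < N \<Longrightarrow> u m a b = v m a b"
  shows "tens l u I J = tens l v I J"
  unfolding tens_def using assms wds_nth by (intro prod.cong) auto

lemma tens_dlt:
  assumes "I \<in> wds N l" "J \<in> wds N l"
  shows "tens l (\<lambda>m. dlt) I J = dlt I J"
proof (cases "I = J")
  case False
  then obtain m where "m < l" "I ! m \<noteq> J ! m"
    using assms by (auto simp: list_eq_iff_nth_eq wds_length)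
  then have "tens l (\<lambda>m. dlt) I J = 0"
    unfolding tens_def by (auto simp: dlt_def intro!: prod_zero)
  then show ?thesis using False by (simp add: dlt_def)
qed (simp add: tens_def dlt_def)

text \<open>The operator \<open>x\<close> in one tensor factor, the identity in the others. List
  positions start at 0, so factor \<open>i\<close> is reached by
  \<open>loc1 l (i - 1)\<close>.\<close>

definition loc1 :: "nat \<Rightarrow> nat \<Rightarrow> (nat \<Rightarrow> nat \<Rightarrow> complex) \<Rightarrow> nat list \<Rightarrow> nat list \<Rightarrow> complex" where
  "loc1 l i x = tens l (\<lambda>m. if m = i then x else dlt)"

text \<open>Row \<open>I\<close> is supported on the words that differ from \<open>I\<close> at most
  at position \<open>i\<close>. This is the shape in which \<open>factor_op\<close> is
  written.\<close>

lemma loc1_eq: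
  assumes I: "I \<in> wds N l" and J: "J \<in> wds N l" and i: "i < l"
  shows "loc1 l i x I J = (\<Sum>c<N. x (I ! i) c * dlt J (I[i := c]))"
proof -
  have Ji: "J ! i < N" using wds_nth[OF J i] .
  have len: "length I = l" "length J = l" using I J by (auto simp: wds_length)
  have "J = I[i := c] \<longleftrightarrow> c = J ! i \<and> (\<forall>m<l. m \<noteq> i \<longrightarrow> I ! m = J ! m)" for c
    using len i by (auto simp: list_eq_iff_nth_eq nth_list_update)
  then have "(\<Sum>c<N. x (I ! i) c * dlt J (I[i := c])) =
      (\<Sum>c<N. if c = J ! i then (if \<forall>m<l. m \<noteq> i \<longrightarrow> I ! m = J ! m then x (I ! i) c else 0) else 0)"
    by (intro sum.cong) (auto simp: dlt_def)
  also have "\<dots> = (if \<forall>m<l. m \<noteq> i \<longrightarrow> I ! m = J ! m then x (I ! i) (J ! i) else 0)"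
    using Ji by simp
  also have "\<dots> = loc1 l i x I J"
  proof (cases "\<forall>m<l. m \<noteq> i \<longrightarrow> I ! m = J ! m")
    case True
    have "loc1 l i x I J = (\<Prod>m<l. if m = i then x (I ! i) (J ! i) else 1)"
      unfolding loc1_def tens_def using True by (intro prod.cong) (auto simp: dlt_def)
    then show ?thesis using True i by simp
  next
    case False
    then have "loc1 l i x I J = 0"
      unfolding loc1_def tens_def by (auto simp: dlt_def intro!: prod_zero)
    then show ?thesis unfolding if_not_P[OF False] by simp
  qed
  finally show ?thesis by simp
qed

text \<open>An arbitrary operator \<open>Q\<close> on two factors: the flip and the projection onto
  the trivial submodule are not pure tensors and so are not products of two
  \<open>loc1\<close>.\<close>

definition loc2 :: "nat \<Rightarrow> nat \<Rightarrow> nat \<Rightarrow> (nat \<times> nat \<Rightarrow> nat \<times> nat \<Rightarrow> complex) \<Rightarrow>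
    nat list \<Rightarrow> nat list \<Rightarrow> complex" where
  "loc2 l i j Q I J = (if \<forall>m<l. m \<noteq> i \<longrightarrow> m \<noteq> j \<longrightarrow> I ! m = J ! m then Q (I ! i, I ! j) (J ! i, J ! j) else 0)"

abbreviation prs :: "nat \<Rightarrow> (nat \<times> nat) set" where
  "prs N \<equiv> {..<N} \<times> {..<N}"

lemma loc2_eq:
  assumes I: "I \<in> wds N l" and J: "J \<in> wds N l" and i: "i < l" "j < l" "i \<noteq> j"
  shows "loc2 l i j Q I J = (\<Sum>p\<in>prs N. Q (I ! i, I ! j) p * dlt J (I[i := fst p, j := snd p]))"
    "loc2 l i j Q I J = (\<Sum>p\<in>prs N. Q p (J ! i, J ! j) * dlt I (J[i := fst p, j := snd p]))"
proof -
  have gen: "(\<Sum>p\<in>prs N. f p * dlt J (I[i := fst p, j := snd p])) =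
      (if \<forall>m<l. m \<noteq> i \<longrightarrow> m \<noteq> j \<longrightarrow> I ! m = J ! m then f (J ! i, J ! j) else 0)"
    if I: "I \<in> wds N l" and J: "J \<in> wds N l" for f I J
  proof -
    have Ji: "(J ! i, J ! j) \<in> prs N" using wds_nth[OF J] i by auto
    have len: "length I = l" "length J = l" using I J by (auto simp: wds_length)
    have "J = I[i := fst p, j := snd p] \<longleftrightarrow>
        p = (J ! i, J ! j) \<and> (\<forall>m<l. m \<noteq> i \<longrightarrow> m \<noteq> j \<longrightarrow> I ! m = J ! m)" for p
      using len i by (cases p) (auto simp: list_eq_iff_nth_eq nth_list_update)
    then have "(\<Sum>p\<in>prs N. f p * dlt J (I[i := fst p, j := snd p])) =
        (\<Sum>p\<in>prs N. if p = (J ! i, J ! j) then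
           (if \<forall>m<l. m \<noteq> i \<longrightarrow> m \<noteq> j \<longrightarrow> I ! m = J ! m then f p else 0) else 0)"
      by (intro sum.cong) (auto simp: dlt_def)
    then show ?thesis using Ji by (subst (asm) sum.delta) auto
  qed
  show "loc2 l i j Q I J = (\<Sum>p\<in>prs N. Q (I ! i, I ! j) p * dlt J (I[i := fst p, j := snd p]))"
    unfolding gen[OF I J] loc2_def by simp
  have "(\<forall>m<l. m \<noteq> i \<longrightarrow> m \<noteq> j \<longrightarrow> I ! m = J ! m) \<longleftrightarrow> (\<forall>m<l. m \<noteq> i \<longrightarrow> m \<noteq> j \<longrightarrow> J ! m = I ! m)"
    by metis
  then show "loc2 l i j Q I J = (\<Sum>p\<in>prs N. Q p (J ! i, J ! j) * dlt I (J[i := fst p, j := snd p]))"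
    unfolding gen[OF J I] loc2_def by simp
qed

text \<open>Separates the letters at \<open>i\<close> and \<open>j\<close>; the remaining product
  does not involve \<open>a\<close> and \<open>b\<close> and can be taken out of a sum over
  pairs.\<close>

lemma tens_update2:
  assumes I: "I \<in> wds N l" and i: "i < l" "j < l" "i \<noteq> j"
  shows "tens l (\<lambda>m. u) (I[i := a, j := b]) K =
      u a (K ! i) * u b (K ! j) * (\<Prod>m\<in>{..<l} - {i, j}. u (I ! m) (K ! m))"
    "tens l (\<lambda>m. u) K (I[i := a, j := b]) =
      u (K ! i) a * u (K ! j) b * (\<Prod>m\<in>{..<l} - {i, j}. u (K ! m) (I ! m))"
proof -
  have split: "(\<Prod>m<l. f m) = f i * f j * (\<Prod>m\<in>{..<l} - {i, j}. f m)" for f :: "nat \<Rightarrow> complex"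
  proof -
    have "{..<l} = insert i (insert j ({..<l} - {i, j}))" using i by auto
    then show ?thesis using i by (metis (no_types, lifting) Diff_iff finite_Diff finite_insert
          finite_lessThan insertCI insertE mult.assoc prod.insert)
  qed
  have len: "length I = l" using I by (simp add: wds_length)
  show "tens l (\<lambda>m. u) (I[i := a, j := b]) K =
      u a (K ! i) * u b (K ! j) * (\<Prod>m\<in>{..<l} - {i, j}. u (I ! m) (K ! m))"
    unfolding tens_def split using i len by (auto simp: nth_list_update intro!: prod.cong)
  show "tens l (\<lambda>m. u) K (I[i := a, j := b]) =
      u (K ! i) a * u (K ! j) b * (\<Prod>m\<in>{..<l} - {i, j}. u (K ! m) (I ! m))"
    unfolding tens_def split using i len by (auto simp: nth_list_update intro!: prod.cong)
qed

lemma sum_dlt_swap: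
  assumes "finite W" "\<And>p. p \<in> P \<Longrightarrow> \<phi> p \<in> W" "finite P"
  shows "(\<Sum>J\<in>W. (\<Sum>p\<in>P. a p * dlt J (\<phi> p)) * f J) = (\<Sum>p\<in>P. a p * f (\<phi> p))"
proof -
  have "(\<Sum>J\<in>W. (\<Sum>p\<in>P. a p * dlt J (\<phi> p)) * f J) = (\<Sum>p\<in>P. \<Sum>J\<in>W. a p * (dlt J (\<phi> p) * f J))"
    by (simp add: sum_distrib_right mult.assoc) (rule sum.swap)
  also have "\<dots> = (\<Sum>p\<in>P. a p * f (\<phi> p))"
    using assms by (intro sum.cong) (auto simp: sum_distrib_left[symmetric])
  finally show ?thesis .
qed

text \<open>An operator on two tensor factors is moved past \<open>u \<otimes> \<dots> \<otimes> u\<close> as it is moved past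
  \<open>u \<otimes> u\<close>.\<close>

lemma loc2_tens:
  assumes I: "I \<in> wds N l" and K: "K \<in> wds N l" and i: "i < l" "j < l" "i \<noteq> j"
    and Q: "\<And>a b c d. a < N \<Longrightarrow> b < N \<Longrightarrow> c < N \<Longrightarrow> d < N \<Longrightarrow>
      (\<Sum>p\<in>prs N. Q (a, b) p * (u (fst p) c * u (snd p) d)) =
      (\<Sum>p\<in>prs N. (u a (fst p) * u b (snd p)) * Q' p (c, d))"
  shows "(\<Sum>J\<in>wds N l. loc2 l i j Q I J * tens l (\<lambda>m. u) J K) =
         (\<Sum>J\<in>wds N l. tens l (\<lambda>m. u) I J * loc2 l i j Q' J K)"
proof -
  \<comment> \<open>The contribution of the factors other than \<open>i\<close> and
    \<open>j\<close>. It comes out the same whether the two letters are changed in \<open>I\<close>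
    or in \<open>K\<close>, so the claim reduces to the identity \<open>Q\<close> for two
    factors.\<close>
  define R where "R = (\<Prod>m\<in>{..<l} - {i, j}. u (I ! m) (K ! m))"
  have "(\<Sum>J\<in>wds N l. loc2 l i j Q I J * tens l (\<lambda>m. u) J K) =
      (\<Sum>J\<in>wds N l. (\<Sum>p\<in>prs N. Q (I ! i, I ! j) p * dlt J (I[i := fst p, j := snd p])) * tens l (\<lambda>m. u) J K)"
    using loc2_eq(1)[OF I _ i, of _ Q] by (intro sum.cong) auto
  also have "\<dots> = (\<Sum>p\<in>prs N. Q (I ! i, I ! j) p * tens l (\<lambda>m. u) (I[i := fst p, j := snd p]) K)"
    using wds_update I by (intro sum_dlt_swap) auto
  also have "\<dots> = (\<Sum>p\<in>prs N. Q (I ! i, I ! j) p * (u (fst p) (K ! i) * u (snd p) (K ! j))) * R"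
    unfolding tens_update2[OF I i] R_def sum_distrib_right by (intro sum.cong) auto
  also have "\<dots> = (\<Sum>p\<in>prs N. (u (I ! i) (fst p) * u (I ! j) (snd p)) * Q' p (K ! i, K ! j)) * R"
    using wds_nth[OF I] wds_nth[OF K] i by (subst Q) auto
  also have "\<dots> = (\<Sum>p\<in>prs N. Q' p (K ! i, K ! j) * tens l (\<lambda>m. u) I (K[i := fst p, j := snd p]))"
    unfolding tens_update2[OF K i] R_def sum_distrib_right by (intro sum.cong) auto
  also have "\<dots> = (\<Sum>J\<in>wds N l. (\<Sum>p\<in>prs N. Q' p (K ! i, K ! j) * dlt J (K[i := fst p, j := snd p])) * tens l (\<lambda>m. u) I J)"
    using wds_update K by (intro sum_dlt_swap[symmetric]) auto
  also have "\<dots> = (\<Sum>J\<in>wds N l. tens l (\<lambda>m. u) I J * loc2 l i j Q' J K)"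
    using loc2_eq(2)[OF _ K i, of _ Q'] by (intro sum.cong) (auto simp: mult.commute)
  finally show ?thesis .
qed

lemma loc1_tens:
  assumes I: "I \<in> wds N l" and K: "K \<in> wds N l"
    and x: "\<And>a c. a < N \<Longrightarrow> c < N \<Longrightarrow> (\<Sum>b<N. x a b * u b c) = (\<Sum>b<N. u a b * x' b c)"
  shows "(\<Sum>J\<in>wds N l. loc1 l i x I J * tens l (\<lambda>m. u) J K) =
         (\<Sum>J\<in>wds N l. tens l (\<lambda>m. u) I J * loc1 l i x' J K)"
  unfolding loc1_def tens_mult[OF I K]
  by (rule tens_cong[OF I K]) (use x in auto)

section \<open>The groups and their Lie algebras\<close>

abbreviation cj :: "complex mat \<Rightarrow> complex mat" where
  "cj \<equiv> map_mat cnj"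

lemma cj_mult: "A \<in> carrier_mat n m \<Longrightarrow> B \<in> carrier_mat m k \<Longrightarrow> cj (A * B) = cj A * cj B"
  by (rule eq_matI) (auto simp: scalar_prod_def)

lemma cj_simps [simp]:
  "A \<in> carrier_mat n m \<Longrightarrow> B \<in> carrier_mat n m \<Longrightarrow> cj (A + B) = cj A + cj B"
  "cj (c \<cdot>\<^sub>m A) = cnj c \<cdot>\<^sub>m cj A"
  "cj (A\<^sup>T) = (cj A)\<^sup>T"
  "cj (1\<^sub>m n) = 1\<^sub>m n"
  "cj (- A) = - cj A"
  "cj (cj A) = A"
  by (auto intro!: eq_matI)

lemma real_mats_iff: "A \<in> real_mats n \<longleftrightarrow> A \<in> carrier_mat n n \<and> cj A = A"
  unfolding real_mats_def
  by (auto simp: Reals_cnj_iff mat_eq_iff) 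

locale sqm =
  fixes N :: nat
begin

abbreviation C :: "complex mat set" where "C \<equiv> carrier_mat N N"

lemma sq_closed:
  "A \<in> C \<Longrightarrow> B \<in> C \<Longrightarrow> A * B \<in> C" "A \<in> C \<Longrightarrow> B \<in> C \<Longrightarrow> A + B \<in> C" "A \<in> C \<Longrightarrow> B \<in> C \<Longrightarrow> A - B \<in> C"
  "A \<in> C \<Longrightarrow> - A \<in> C" "A \<in> C \<Longrightarrow> c \<cdot>\<^sub>m A \<in> C" "A \<in> C \<Longrightarrow> A\<^sup>T \<in> C" "A \<in> C \<Longrightarrow> cj A \<in> C" "1\<^sub>m N \<in> C"
  by auto

lemma sq_assoc: "A \<in> C \<Longrightarrow> B \<in> C \<Longrightarrow> D \<in> C \<Longrightarrow> A * B * D = A * (B * D)"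
  by (rule assoc_mult_mat)

lemma sq_distrib:
  "A \<in> C \<Longrightarrow> B \<in> C \<Longrightarrow> D \<in> C \<Longrightarrow> (A + B) * D = A * D + B * D"
  "A \<in> C \<Longrightarrow> B \<in> C \<Longrightarrow> D \<in> C \<Longrightarrow> D * (A + B) = D * A + D * B"
  "A \<in> C \<Longrightarrow> B \<in> C \<Longrightarrow> D \<in> C \<Longrightarrow> (A - B) * D = A * D - B * D"
  "A \<in> C \<Longrightarrow> B \<in> C \<Longrightarrow> D \<in> C \<Longrightarrow> D * (A - B) = D * A - D * B"
  by (auto intro: add_mult_distrib_mat mult_add_distrib_mat minus_mult_distrib_mat mult_minus_distrib_mat)

lemma sq_smult:
  "A \<in> C \<Longrightarrow> B \<in> C \<Longrightarrow> (c \<cdot>\<^sub>m A) * B = c \<cdot>\<^sub>m (A * B)"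
  "A \<in> C \<Longrightarrow> B \<in> C \<Longrightarrow> A * (c \<cdot>\<^sub>m B) = c \<cdot>\<^sub>m (A * B)"
  "c \<cdot>\<^sub>m (d \<cdot>\<^sub>m A) = (c * d) \<cdot>\<^sub>m A"
  "1 \<cdot>\<^sub>m A = A"
  "(- 1) \<cdot>\<^sub>m A = - A"
  by (auto intro!: eq_matI simp: mult_smult_assoc_mat mult_smult_distrib)

lemma sq_one: "A \<in> C \<Longrightarrow> 1\<^sub>m N * A = A" "A \<in> C \<Longrightarrow> A * 1\<^sub>m N = A"
  by auto

lemma sq_transpose:
  "A \<in> C \<Longrightarrow> B \<in> C \<Longrightarrow> (A * B)\<^sup>T = B\<^sup>T * A\<^sup>T" "A \<in> C \<Longrightarrow> B \<in> C \<Longrightarrow> (A + B)\<^sup>T = A\<^sup>T + B\<^sup>T"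
  "A \<in> C \<Longrightarrow> B \<in> C \<Longrightarrow> (A - B)\<^sup>T = A\<^sup>T - B\<^sup>T"
  "(- A)\<^sup>T = - (A\<^sup>T)" "(c \<cdot>\<^sub>m A)\<^sup>T = c \<cdot>\<^sub>m A\<^sup>T"
  by (auto simp: transpose_mult transpose_add transpose_minus transpose_uminus intro!: eq_matI)

lemma sq_cj: "A \<in> C \<Longrightarrow> B \<in> C \<Longrightarrow> cj (A * B) = cj A * cj B" "A \<in> C \<Longrightarrow> B \<in> C \<Longrightarrow> cj (A + B) = cj A + cj B"
  "A \<in> C \<Longrightarrow> B \<in> C \<Longrightarrow> cj (A - B) = cj A - cj B"
  by (auto simp: cj_mult intro!: eq_matI)

lemma sq_neg: "- (- (A :: complex mat)) = A" "A \<in> C \<Longrightarrow> B \<in> C \<Longrightarrow> - A * B = - (A * B)"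
  "A \<in> C \<Longrightarrow> B \<in> C \<Longrightarrow> A * - B = - (A * B)"
  by auto

lemma sq_index: "A \<in> C \<Longrightarrow> B \<in> C \<Longrightarrow> a < N \<Longrightarrow> b < N \<Longrightarrow> (A * B) $$ (a, b) = (\<Sum>c<N. A $$ (a, c) * B $$ (c, b))"
  by (simp add: scalar_prod_def atLeast0LessThan)

text \<open>As rewrite rules these give a normal form: products bracketed to the right, scalars in
  front, transposes on the single factors. Many matrix identities below are proved by normalizing
  both sides.\<close>

lemmas sq = sq_closed sq_assoc sq_distrib sq_smult sq_one sq_transpose

lemma cancel1:
  assumes "X * Y = 1\<^sub>m N" "X \<in> C" "Y \<in> C" "Z \<in> C"
  shows "X * (Y * Z) = Z"
  using assms by (metis sq_assoc sq_one(1))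

end

text \<open>The scalar relating \<open>\<xi>_mat G\<close> to \<open>form_mat G\<close> (see
  \<open>xi_eq\<close>). Its square is the sign of the bilinear form under transposition, so that
  the symplectic and the orthogonal case share the later computations.\<close>

fun xi_scalar :: "real_group \<Rightarrow> complex" where
  "xi_scalar (SpR n) = \<i>"
| "xi_scalar (OR p q) = 1"

locale rgrp = sqm "vdim G" for G :: real_group
begin

abbreviation N where "N \<equiv> vdim G"
abbreviation F where "F \<equiv> form_mat G"
abbreviation \<xi> where "\<xi> \<equiv> \<xi>_mat G"
abbreviation c where "c \<equiv> xi_scalar G"

lemma c_norm: "c * cnj c = 1" "cnj c * c = 1" "c \<noteq> 0"
  by (cases G; simp)+

lemma F_closed [simp]: "F \<in> C"
  by (cases G) auto

lemma F_real [simp]: "cj F = F"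
  by (cases G) (auto intro!: eq_matI simp: four_block_mat_def Let_def)

lemma F_transpose: "F\<^sup>T = (c * c) \<cdot>\<^sub>m F"
  by (cases G) (auto intro!: eq_matI simp: four_block_mat_def Let_def)

lemma F_orth: "F\<^sup>T * F = 1\<^sub>m N"
proof (cases G)
  case (SpR n)
  have uz: "- 0\<^sub>m n n = (0\<^sub>m n n :: complex mat)" by (auto intro!: eq_matI)
  have "F\<^sup>T = four_block_mat (0\<^sub>m n n) (- 1\<^sub>m n) (1\<^sub>m n) (0\<^sub>m n n)"
    unfolding SpR by (auto intro!: eq_matI simp: four_block_mat_def Let_def)
  then show ?thesis
    unfolding SpR by (simp add: mult_four_block_mat[of _ n n _ n _ n _ _ n _ n] uz)
next
  case (OR p q)
  have uz: "- 0\<^sub>m p q = (0\<^sub>m p q :: complex mat)" by (auto intro!: eq_matI)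
  have "F\<^sup>T = F"
    unfolding OR by (auto intro!: eq_matI simp: four_block_mat_def Let_def)
  then show ?thesis
    unfolding OR by (simp add: mult_four_block_mat[of _ p p _ q _ q _ _ p _ q] uz)
qed

lemma F_orth': "F * F\<^sup>T = 1\<^sub>m N"
  using mat_mult_left_right_inverse[OF _ _ F_orth] by simp

lemma xi_eq: "\<xi> = c \<cdot>\<^sub>m F"
  by (cases G) (auto intro!: eq_matI simp: four_block_mat_def Let_def)

lemma xi_closed [simp]: "\<xi> \<in> C"
  unfolding xi_eq by auto

text \<open>With \<open>\<xi>\<close> equal to \<open>c\<close> times \<open>F\<close>, its square
  is \<open>c * c\<close> times \<open>F * F\<close>, which is \<open>F\<^sup>T * F\<close>.\<close>

lemma xi_square: "\<xi> * \<xi> = 1\<^sub>m N"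
  using F_orth unfolding F_transpose xi_eq by (simp add: sq)

lemma xi_commute: "x \<in> C \<Longrightarrow> \<xi> * x = x * \<xi> \<longleftrightarrow> F * x = x * F"
proof -
  assume x: "x \<in> C"
  have "(inverse c) \<cdot>\<^sub>m (c \<cdot>\<^sub>m A) = A" for A :: "complex mat" using c_norm(3) by (simp add: sq_smult)
  then have "c \<cdot>\<^sub>m A = c \<cdot>\<^sub>m B \<longleftrightarrow> A = B" for A B :: "complex mat" by metis
  then show ?thesis using x unfolding xi_eq by (simp add: sq)
qed

subsection \<open>The maximal compact subgroup\<close>

text \<open>For \<open>k\<close> commuting with \<open>F\<close> one has
  \<open>k\<^sup>T * F * k = (k\<^sup>T * k) * F\<close>, so preserving the form amounts to being
  orthogonal.\<close>

lemma K_iff: "k \<in> K_of G \<longleftrightarrow> k \<in> C \<and> cj k = k \<and> k\<^sup>T * k = 1\<^sub>m N \<and> F * k = k * F"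
proof -
  have "k\<^sup>T * F * k = F \<longleftrightarrow> k\<^sup>T * k = 1\<^sub>m N" if k: "k \<in> C" and "F * k = k * F"
  proof -
    have eq: "k\<^sup>T * F * k = (k\<^sup>T * k) * F" using that by (simp add: sq)
    show ?thesis
    proof
      assume "k\<^sup>T * F * k = F"
      then have "(k\<^sup>T * k) * F * F\<^sup>T = F * F\<^sup>T" unfolding eq by simp
      then show "k\<^sup>T * k = 1\<^sub>m N" using k by (simp add: sq F_orth')
    next
      assume "k\<^sup>T * k = 1\<^sub>m N"
      then show "k\<^sup>T * F * k = F" unfolding eq by (simp add: sq)
    qed
  qed
  then show ?thesis
    using xi_commute unfolding K_of_def group_of_def by (auto simp: real_mats_iff)
qed

lemma K_D:
  assumes "k \<in> K_of G"
  shows "k \<in> C" "cj k = k" "k\<^sup>T * k = 1\<^sub>m N" "k * k\<^sup>T = 1\<^sub>m N" "F * k = k * F" "\<xi> * k = k * \<xi>"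
  using assms mat_mult_left_right_inverse[of "k\<^sup>T" N k] xi_commute unfolding K_iff by auto

text \<open>Makes the Cartan involution, which is conjugation by \<open>F\<close>, an instance of
  conjugation by elements of \<open>K\<close>.\<close>

lemma K_F [simp]: "F \<in> K_of G"
  unfolding K_iff by (simp add: F_orth)

lemma K_transpose: "k \<in> K_of G \<Longrightarrow> k\<^sup>T \<in> K_of G"
proof -
  assume k: "k \<in> K_of G"
  note [simp] = K_D(1-2)[OF k]
  have "F * k\<^sup>T = k\<^sup>T * k * (F * k\<^sup>T)" using K_D[OF k] by (simp add: sq)
  also have "\<dots> = k\<^sup>T * (k * F) * k\<^sup>T" by (simp add: sq)
  also have "\<dots> = k\<^sup>T * (F * k) * k\<^sup>T" using K_D(5)[OF k] by simp
  also have "\<dots> = k\<^sup>T * F * (k * k\<^sup>T)" by (simp add: sq)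
  also have "\<dots> = k\<^sup>T * F" using K_D(4)[OF k] by (simp add: sq)
  finally show ?thesis unfolding K_iff using K_D(4)[OF k] by simp
qed

text \<open>\<open>mat_inv\<close> is computed by elimination, so the transpose has to be identified
  with the inverse that the algorithm returns.\<close>

lemma K_inv: "k \<in> K_of G \<Longrightarrow> mat_inv k = k\<^sup>T"
proof -
  assume k: "k \<in> K_of G"
  note [simp] = K_D(1)[OF k]
  show ?thesis
  proof (cases "mat_inverse k")
    case None
    then have "k \<notin> Units (ring_mat TYPE(complex) N ())" using mat_inverse(1)[of k N "()"] by auto
    moreover have "k \<in> Units (ring_mat TYPE(complex) N ())"
      unfolding Units_def ring_mat_def using K_D[OF k] by (auto intro!: bexI[of _ "k\<^sup>T"])
    ultimately show ?thesis by simp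
  next
    case (Some B)
    then have B: "B * k = 1\<^sub>m N" "B \<in> C" using mat_inverse(2)[of k N] by auto
    have "B = B * (k * k\<^sup>T)" using B K_D[OF k] by (simp add: sq)
    also have "\<dots> = k\<^sup>T" using B by (simp add: sq flip: sq_assoc)
    finally show ?thesis unfolding mat_inv_def Some by simp
  qed
qed

subsection \<open>The Lie algebra\<close>

lemma FT_closed [simp]: "F\<^sup>T \<in> C" by auto

text \<open>The defining equation is solved for the transpose, using that \<open>F\<close> is
  orthogonal: on the Lie algebra, \<open>- x\<^sup>T\<close> is the Cartan involution of
  \<open>x\<close>.\<close>

lemma lie0_iff: "x \<in> lie0 G \<longleftrightarrow> x \<in> C \<and> cj x = x \<and> x\<^sup>T = - (F * (x * F\<^sup>T))"
proof -
  have "x\<^sup>T * F + F * x = 0\<^sub>m N N \<longleftrightarrow> x\<^sup>T = - (F * (x * F\<^sup>T))" if x: "x \<in> C"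
  proof
    assume "x\<^sup>T * F + F * x = 0\<^sub>m N N"
    then have "(x\<^sup>T * F + F * x) * F\<^sup>T = 0\<^sub>m N N" using left_mult_zero_mat[OF FT_closed] by simp
    then have "x\<^sup>T * (F * F\<^sup>T) + F * (x * F\<^sup>T) = 0\<^sub>m N N" using x by (simp add: sq)
    then have *: "x\<^sup>T + F * (x * F\<^sup>T) = 0\<^sub>m N N" using x by (simp add: sq F_orth')
    show "x\<^sup>T = - (F * (x * F\<^sup>T))"
    proof (rule eq_matI)
      fix i j assume "i < dim_row (- (F * (x * F\<^sup>T)))" "j < dim_col (- (F * (x * F\<^sup>T)))"
      then have ij: "i < N" "j < N" by (auto simp: carrier_matD[OF F_closed])
      have "(x\<^sup>T + F * (x * F\<^sup>T)) $$ (i, j) = 0" unfolding * using ij by simp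
      then show "x\<^sup>T $$ (i, j) = (- (F * (x * F\<^sup>T))) $$ (i, j)"
        using ij x carrier_matD[OF F_closed] by (simp add: eq_neg_iff_add_eq_0)
    qed (use x carrier_matD[OF F_closed] in auto)
  next
    assume *: "x\<^sup>T = - (F * (x * F\<^sup>T))"
    have "x\<^sup>T * F = - (F * (x * (F\<^sup>T * F)))" unfolding * using x by (simp add: sq)
    also have "\<dots> = - (F * x)" using x by (simp add: F_orth sq)
    finally show "x\<^sup>T * F + F * x = 0\<^sub>m N N" using x by (auto intro!: eq_matI simp: carrier_matD[OF F_closed])
  qed
  then show ?thesis unfolding lie0_def by (auto simp: real_mats_iff)
qed


text \<open>Both sides are \<open>c * c\<close> times \<open>F * (x * F)\<close>.\<close>

lemma ad_F: "x \<in> C \<Longrightarrow> F * (x * F\<^sup>T) = \<xi> * (x * \<xi>)"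
  unfolding xi_eq F_transpose by (simp add: sq)

text \<open>The equation has real coefficients because \<open>F\<close> is real, so the real and the
  imaginary part of a complex solution both lie in \<open>lie0 G\<close>.\<close>

lemma lie_iff: "x \<in> lie G \<longleftrightarrow> x \<in> C \<and> x\<^sup>T = - (F * (x * F\<^sup>T))"
proof
  assume "x \<in> lie G"
  then obtain y z where x: "x = y + \<i> \<cdot>\<^sub>m z" and y: "y \<in> lie0 G" and z: "z \<in> lie0 G"
    unfolding lie_def by auto
  note [simp] = y[unfolded lie0_iff, THEN conjunct1] z[unfolded lie0_iff, THEN conjunct1]
  have "x\<^sup>T = y\<^sup>T + \<i> \<cdot>\<^sub>m z\<^sup>T" unfolding x by (simp add: sq)
  also have "\<dots> = - (F * (y * F\<^sup>T)) + \<i> \<cdot>\<^sub>m - (F * (z * F\<^sup>T))"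
    using y z unfolding lie0_iff by simp
  also have "\<dots> = - (F * (y * F\<^sup>T) + \<i> \<cdot>\<^sub>m (F * (z * F\<^sup>T)))"
    by (rule eq_matI) (auto simp: carrier_matD[OF F_closed])
  also have "\<dots> = - (F * (x * F\<^sup>T))"
    unfolding x by (simp add: sq)
  finally show "x \<in> C \<and> x\<^sup>T = - (F * (x * F\<^sup>T))" unfolding x by simp
next
  assume x: "x \<in> C \<and> x\<^sup>T = - (F * (x * F\<^sup>T))"
  then have [simp]: "x \<in> C" by simp
  have cx: "(cj x)\<^sup>T = - (F * (cj x * F\<^sup>T))"
  proof -
    have "(cj x)\<^sup>T = cj (x\<^sup>T)" by simp
    also have "\<dots> = cj (- (F * (x * F\<^sup>T)))" using x by simp
    also have "\<dots> = - (F * (cj x * F\<^sup>T))" by (simp add: sq_cj sq_closed)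
    finally show ?thesis .
  qed
  \<comment> \<open>Used with the coefficients \<open>1/2\<close>, \<open>1/2\<close> for the real
    part and \<open>- \<i>/2\<close>, \<open>\<i>/2\<close> for the imaginary part.\<close>
  have lin: "(a \<cdot>\<^sub>m x + b \<cdot>\<^sub>m cj x)\<^sup>T = - (F * ((a \<cdot>\<^sub>m x + b \<cdot>\<^sub>m cj x) * F\<^sup>T))" for a b
  proof -
    have "(a \<cdot>\<^sub>m x + b \<cdot>\<^sub>m cj x)\<^sup>T = a \<cdot>\<^sub>m - (F * (x * F\<^sup>T)) + b \<cdot>\<^sub>m - (F * (cj x * F\<^sup>T))"
      using x cx by (simp add: sq)
    also have "\<dots> = - (a \<cdot>\<^sub>m (F * (x * F\<^sup>T)) + b \<cdot>\<^sub>m (F * (cj x * F\<^sup>T)))"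
      by (rule eq_matI) (auto simp: carrier_matD[OF F_closed])
    also have "\<dots> = - (F * ((a \<cdot>\<^sub>m x + b \<cdot>\<^sub>m cj x) * F\<^sup>T))"
      by (simp add: sq)
    finally show ?thesis .
  qed
  have 1: "(1/2) \<cdot>\<^sub>m x + (1/2) \<cdot>\<^sub>m cj x \<in> lie0 G"
    unfolding lie0_iff using lin[of "1/2" "1/2"] by (auto intro!: eq_matI)
  have 2: "(- \<i>/2) \<cdot>\<^sub>m x + (\<i>/2) \<cdot>\<^sub>m cj x \<in> lie0 G"
    unfolding lie0_iff using lin[of "- \<i>/2" "\<i>/2"] by (auto intro!: eq_matI)
  have "x = ((1/2) \<cdot>\<^sub>m x + (1/2) \<cdot>\<^sub>m cj x) + \<i> \<cdot>\<^sub>m ((- \<i>/2) \<cdot>\<^sub>m x + (\<i>/2) \<cdot>\<^sub>m cj x)"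
    by (rule eq_matI) (auto simp: algebra_simps)
  then show "x \<in> lie G" unfolding lie_def using 1 2 by blast
qed

lemma lie_C: "x \<in> lie G \<Longrightarrow> x \<in> C"
  by (simp add: lie_iff)

lemma lie_transpose_eq: "x \<in> lie G \<Longrightarrow> x\<^sup>T = - (F * (x * F\<^sup>T))"
  by (simp add: lie_iff)

lemma lie_add: "x \<in> lie G \<Longrightarrow> y \<in> lie G \<Longrightarrow> x + y \<in> lie G"
  unfolding lie_iff by (auto simp: sq intro!: eq_matI simp: carrier_matD[OF F_closed])

lemma lie_smult: "x \<in> lie G \<Longrightarrow> a \<cdot>\<^sub>m x \<in> lie G"
  unfolding lie_iff by (auto simp: sq intro!: eq_matI simp: carrier_matD[OF F_closed])

lemma lie_uminus: "x \<in> lie G \<Longrightarrow> - x \<in> lie G"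
  using lie_smult[of x "- 1"] by (simp add: sq_smult)

lemma lie_cj: "x \<in> lie G \<Longrightarrow> cj x \<in> lie G"
proof -
  assume x: "x \<in> lie G"
  note [simp] = lie_C[OF x]
  have "(cj x)\<^sup>T = cj (x\<^sup>T)" by simp
  also have "\<dots> = cj (- (F * (x * F\<^sup>T)))" using lie_transpose_eq[OF x] by simp
  also have "\<dots> = - (F * (cj x * F\<^sup>T))" by (simp add: sq_cj sq_closed)
  finally show ?thesis unfolding lie_iff by simp
qed

lemma lie_bracket_C: "x \<in> C \<Longrightarrow> y \<in> C \<Longrightarrow> lie_bracket x y \<in> C"
  unfolding lie_bracket_def by (simp add: sq)

lemma lie_bracket_closed:
  assumes x: "x \<in> lie G" and y: "y \<in> lie G" shows "lie_bracket x y \<in> lie G"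
proof -
  note [simp] = lie_C[OF x] lie_C[OF y]
  have 1: "F * (x * F\<^sup>T) * (F * (y * F\<^sup>T)) = F * (x * (y * F\<^sup>T))"
    "F * (y * F\<^sup>T) * (F * (x * F\<^sup>T)) = F * (y * (x * F\<^sup>T))"
    by (simp_all add: sq cancel1[OF F_orth])
  have "(lie_bracket x y)\<^sup>T = y\<^sup>T * x\<^sup>T - x\<^sup>T * y\<^sup>T"
    unfolding lie_bracket_def by (simp add: sq)
  also have "\<dots> = F * (y * (x * F\<^sup>T)) - F * (x * (y * F\<^sup>T))"
    unfolding lie_transpose_eq[OF x] lie_transpose_eq[OF y]
    by (simp add: sq_neg sq_closed 1)
  also have "\<dots> = - (F * (lie_bracket x y * F\<^sup>T))"
    unfolding lie_bracket_def by (rule eq_matI) (auto simp: sq carrier_matD[OF F_closed])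
  finally show ?thesis unfolding lie_iff using lie_bracket_C by simp
qed

lemma lie_ad:
  assumes k: "k \<in> K_of G" and x: "x \<in> lie G" shows "k * x * k\<^sup>T \<in> lie G"
proof -
  note [simp] = lie_C[OF x] K_D(1)[OF k]
  note kT = K_D(5)[OF K_transpose[OF k]]
  have "(k * x * k\<^sup>T)\<^sup>T = k * (x\<^sup>T * k\<^sup>T)" by (simp add: sq)
  also have "\<dots> = - (k * (F * (x * (F\<^sup>T * k\<^sup>T))))"
    unfolding lie_transpose_eq[OF x] by (simp add: sq sq_neg)
  also have "\<dots> = - ((k * F) * (x * (k * F)\<^sup>T))" by (simp add: sq)
  also have "\<dots> = - ((F * k) * (x * (F * k)\<^sup>T))" using K_D(5)[OF k] by simp
  also have "\<dots> = - (F * (k * x * k\<^sup>T * F\<^sup>T))" by (simp add: sq)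
  finally show ?thesis unfolding lie_iff by (simp add: sq)
qed

text \<open>The adjoint of \<open>x\<close> is \<open>- (F * cj x * F\<^sup>T)\<close>, a composite
  of conjugation, Cartan involution and sign. Closure under adjoints is what makes the projection
  onto the invariants self-adjoint.\<close>

lemma lie_cj_transpose:
  assumes x: "x \<in> lie G" shows "(cj x)\<^sup>T \<in> lie G"
proof -
  have "(cj x)\<^sup>T = - (F * cj x * F\<^sup>T)"
    using lie_transpose_eq[OF lie_cj[OF x]] lie_C[OF x] by (simp add: sq)
  then show ?thesis using lie_uminus[OF lie_ad[OF K_F lie_cj[OF x]]] by simp
qed

end

section \<open>Gram matrices of invariant forms on the defining module\<close>

unbundle no vec_syntax

lemma cvs_vec: "cvs (module_vec TYPE(complex) n)"
  by (rule cvs.intro) (rule vec_vs)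

lemma vec_unit_expansion:
  assumes "v \<in> carrier_vec n"
  shows "finsum (module_vec TYPE(complex) n) (\<lambda>a. v $ a \<cdot>\<^sub>v unit_vec n a) {..<n} = v"
proof -
  interpret V: vec_space "TYPE(complex)" n .
  have "finsum (module_vec TYPE(complex) n) (\<lambda>a. v $ a \<cdot>\<^sub>v unit_vec n a) {..<n} =
      finsum_vec TYPE(complex) n (\<lambda>a. v $ a \<cdot>\<^sub>v unit_vec n a) {..<n}"
    by simp
  also have "\<dots> = v"
  proof (rule eq_vecI)
    fix i assume i: "i < dim_vec v"
    then have "finsum_vec TYPE(complex) n (\<lambda>a. v $ a \<cdot>\<^sub>v unit_vec n a) {..<n} $ i =
        (\<Sum>a<n. (v $ a \<cdot>\<^sub>v unit_vec n a) $ i)"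
      using assms by (intro index_finsum_vec) auto
    also have "\<dots> = (\<Sum>a<n. if a = i then v $ a else 0)"
      using i assms by (intro sum.cong) auto
    also have "\<dots> = v $ i" using i assms by simp
    finally show "finsum_vec TYPE(complex) n (\<lambda>a. v $ a \<cdot>\<^sub>v unit_vec n a) {..<n} $ i = v $ i" .
  next
    have "finsum_vec TYPE(complex) n (\<lambda>a. v $ a \<cdot>\<^sub>v unit_vec n a) {..<n} \<in> carrier_vec n"
      by (rule finsum_vec_closed) auto
    then show "dim_vec (finsum_vec TYPE(complex) n (\<lambda>a. v $ a \<cdot>\<^sub>v unit_vec n a) {..<n}) = dim_vec v"
      using assms by (auto simp del: V.finsum_vec)
  qed
  finally show ?thesis .
qed

lemma form_expand_vec:
  assumes h: "hermitian_form (module_vec TYPE(complex) n) h" and v: "v \<in> carrier_vec n" and w: "w \<in> carrier_vec n"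
  shows "h v w = (\<Sum>a<n. v $ a * h (unit_vec n a) w)" "h w v = (\<Sum>a<n. cnj (v $ a) * h w (unit_vec n a))"
proof -
  interpret V: sesq "module_vec TYPE(complex) n" h
    by (intro sesq.intro cvs_vec sesq_axioms.intro h)
  note [simp] = module_vec_simps
  have "h v w = h (finsum (module_vec TYPE(complex) n) (\<lambda>a. v $ a \<cdot>\<^sub>v unit_vec n a) {..<n}) w"
    using vec_unit_expansion[OF v] by simp
  also have "\<dots> = (\<Sum>a<n. h (v $ a \<cdot>\<^sub>v unit_vec n a) w)"
    by (rule V.H_finsum) (use w in auto)
  also have "\<dots> = (\<Sum>a<n. v $ a * h (unit_vec n a) w)"
    using V.H_sm(1)[of "unit_vec n _" w] w by simp
  finally show "h v w = (\<Sum>a<n. v $ a * h (unit_vec n a) w)" .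
  have "h w v = h w (finsum (module_vec TYPE(complex) n) (\<lambda>a. v $ a \<cdot>\<^sub>v unit_vec n a) {..<n})"
    using vec_unit_expansion[OF v] by simp
  also have "\<dots> = (\<Sum>a<n. h w (v $ a \<cdot>\<^sub>v unit_vec n a))"
    by (rule V.H_finsum) (use w in auto)
  also have "\<dots> = (\<Sum>a<n. cnj (v $ a) * h w (unit_vec n a))"
    using V.H_sm(2)[of "unit_vec n _" w] w by simp
  finally show "h w v = (\<Sum>a<n. cnj (v $ a) * h w (unit_vec n a))" .
qed

definition gram :: "nat \<Rightarrow> (complex vec \<Rightarrow> complex vec \<Rightarrow> complex) \<Rightarrow> complex mat" where
  "gram n h = mat n n (\<lambda>(a, b). h (unit_vec n a) (unit_vec n b))"

lemma gram_closed [simp]: "gram n h \<in> carrier_mat n n"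
  by (simp add: gram_def)

context rgrp
begin

text \<open>The linear variable produces a transpose, the conjugate linear one a complex
  conjugate.\<close>

lemma gram_mult:
  assumes h: "hermitian_form (V_space G) h" and X: "X \<in> C" and ab: "a < N" "b < N"
  shows "h (X *\<^sub>v unit_vec N a) (unit_vec N b) = (X\<^sup>T * gram N h) $$ (a, b)"
    "h (unit_vec N a) (X *\<^sub>v unit_vec N b) = (gram N h * cj X) $$ (a, b)"
proof -
  have Xc: "(X *\<^sub>v unit_vec N a) $ c' = X $$ (c', a)" if "a < N" "c' < N" for a c'
  proof -
    have "(X *\<^sub>v unit_vec N a) $ c' = (\<Sum>i<N. X $$ (c', i) * dlt i a)"
      using X that unfolding mult_mat_vec_def scalar_prod_def dlt_def
      by (simp add: atLeast0LessThan)
    then show ?thesis using that by simp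
  qed
  show "h (X *\<^sub>v unit_vec N a) (unit_vec N b) = (X\<^sup>T * gram N h) $$ (a, b)"
    using X ab by (subst form_expand_vec(1)[OF h], auto simp del: index_mult_mat)
      (subst sq_index, auto simp: Xc gram_def simp del: index_mult_mat index_mult_mat_vec)
  show "h (unit_vec N a) (X *\<^sub>v unit_vec N b) = (gram N h * cj X) $$ (a, b)"
    using X ab by (subst form_expand_vec(2)[OF h], auto simp del: index_mult_mat)
      (subst sq_index, auto simp: Xc gram_def mult.commute simp del: index_mult_mat index_mult_mat_vec)
qed

lemma gram_adjoint:
  assumes h: "hermitian_form (V_space G) h" and X: "X \<in> C" "Y \<in> C"
    and adj: "\<And>v w. v \<in> carrier_vec N \<Longrightarrow> w \<in> carrier_vec N \<Longrightarrow> h (X *\<^sub>v v) w = h v (Y *\<^sub>v w)"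
  shows "X\<^sup>T * gram N h = gram N h * cj Y"
proof (rule eq_matI)
  fix a b assume "a < dim_row (gram N h * cj Y)" "b < dim_col (gram N h * cj Y)"
  then have ab: "a < N" "b < N" using X by (auto simp: carrier_matD[OF gram_closed])
  show "(X\<^sup>T * gram N h) $$ (a, b) = (gram N h * cj Y) $$ (a, b)"
    using gram_mult(1)[OF h X(1) ab] gram_mult(2)[OF h X(2) ab] adj[of "unit_vec N a" "unit_vec N b"] by simp
qed (use X in \<open>auto simp: carrier_matD[OF gram_closed]\<close>)

lemma gram_commute_K:
  assumes V: "V_form G h" and k: "k \<in> K_of G"
  shows "k * gram N h = gram N h * k"
proof -
  have h: "hermitian_form (V_space G) h" using V unfolding V_form_def by simp
  note kT = K_transpose[OF k]
  \<comment> \<open>Adjointness is applied to the inverse \<open>k\<^sup>T\<close>, since the linear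
    variable transposes once more.\<close>
  have "(k\<^sup>T)\<^sup>T * gram N h = gram N h * cj k"
    by (rule gram_adjoint[OF h]) (use V kT K_D[OF k] K_inv[OF kT] in \<open>auto simp: V_form_def\<close>)
  then show ?thesis using K_D[OF k] by simp
qed

text \<open>A real skew matrix is anti-Hermitian, so its eigenvalues are imaginary. For an
  eigenvector \<open>v\<close> with eigenvalue 1 the squared length of \<open>v\<close> would equal
  its own negative.\<close>

lemma skew_no_eigenvalue_one:
  assumes x: "x \<in> C" "cj x = x" "x\<^sup>T = - x"
  shows "det (1\<^sub>m N - x) \<noteq> 0"
proof
  assume "det (1\<^sub>m N - x) = 0"
  then obtain v where v: "v \<in> carrier_vec N" "v \<noteq> 0\<^sub>v N" "(1\<^sub>m N - x) *\<^sub>v v = 0\<^sub>v N"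
    using det_0_iff_vec_prod_zero[of "1\<^sub>m N - x" N] x sq_closed(3)[OF sq_closed(8) x(1)] by auto
  have xe: "cnj (x $$ (a, b)) = x $$ (a, b)" "x $$ (b, a) = - x $$ (a, b)" if "a < N" "b < N" for a b
  proof -
    have "cj x $$ (a, b) = x $$ (a, b)" using x by simp
    moreover have "cj x $$ (a, b) = cnj (x $$ (a, b))" using x(1) that by simp
    ultimately show "cnj (x $$ (a, b)) = x $$ (a, b)" by simp
    have "x\<^sup>T $$ (a, b) = (- x) $$ (a, b)" using x by simp
    then show "x $$ (b, a) = - x $$ (a, b)" using x(1) that by simp
  qed
  have va: "v $ a = (\<Sum>b<N. x $$ (a, b) * v $ b)" if a: "a < N" for a
  proof -
    have "((1\<^sub>m N - x) *\<^sub>v v) $ a = v $ a - (x *\<^sub>v v) $ a"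
      using x v a by (subst minus_mult_distrib_mat_vec[of _ N N]) auto
    then show ?thesis using v x a by (simp add: scalar_prod_def atLeast0LessThan)
  qed
  define s where "s = (\<Sum>a<N. cnj (v $ a) * v $ a)"
  have s: "s = (\<Sum>a<N. \<Sum>b<N. cnj (v $ a) * x $$ (a, b) * v $ b)"
    unfolding s_def
  proof (rule sum.cong)
    fix a assume "a \<in> {..<N}"
    then have "cnj (v $ a) * v $ a = cnj (v $ a) * (\<Sum>b<N. x $$ (a, b) * v $ b)"
      using va by (intro arg_cong[where f="(*) _"]) blast
    then show "cnj (v $ a) * v $ a = (\<Sum>b<N. cnj (v $ a) * x $$ (a, b) * v $ b)"
      by (simp add: sum_distrib_left mult.assoc)
  qed simp
  have "cnj s = (\<Sum>a<N. \<Sum>b<N. v $ a * x $$ (a, b) * cnj (v $ b))"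
    unfolding s cnj_sum using xe(1) by (intro sum.cong) auto
  also have "\<dots> = (\<Sum>b<N. \<Sum>a<N. v $ a * x $$ (a, b) * cnj (v $ b))" by (rule sum.swap)
  also have "\<dots> = (\<Sum>b<N. \<Sum>a<N. - (cnj (v $ b) * x $$ (b, a) * v $ a))"
  proof (intro sum.cong refl)
    fix a b assume "b \<in> {..<N}" "a \<in> {..<N}"
    then have "x $$ (b, a) = - x $$ (a, b)" using xe(2) by blast
    then show "v $ a * x $$ (a, b) * cnj (v $ b) = - (cnj (v $ b) * x $$ (b, a) * v $ a)" by simp
  qed
  also have "\<dots> = - s" unfolding s by (simp add: sum_negf)
  finally have "cnj s = - s" .
  moreover have "cnj s = s" unfolding s_def by (simp add: mult.commute)
  ultimately have "s = 0" by (simp add: complex_eq_iff)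
  moreover have s2: "s = of_real (\<Sum>a<N. (cmod (v $ a))\<^sup>2)"
    unfolding s_def of_real_sum by (intro sum.cong) (auto simp: complex_norm_square mult.commute simp del: of_real_power)
  ultimately have "(\<Sum>a<N. (cmod (v $ a))\<^sup>2) = 0" by (metis of_real_eq_0_iff)
  then have "\<forall>a<N. v $ a = 0" by (simp add: sum_nonneg_eq_0_iff)
  then show False using v by auto
qed

text \<open>The Cayley transform of a skew matrix lies in \<open>K\<close>; this replaces differentiating along
  one-parameter subgroups.\<close>

lemma gram_commute_k0:
  assumes V: "V_form G h" and x: "x \<in> k0 G"
  shows "x * gram N h = gram N h * x"
proof -
  have xl: "x \<in> lie0 G" and xxi: "\<xi> * x = x * \<xi>" using x unfolding k0_def by auto
  have [simp]: "x \<in> C" and cx: "cj x = x" and xT: "x\<^sup>T = - (F * (x * F\<^sup>T))" using xl unfolding lie0_iff by auto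
  have Fx: "F * x = x * F" using xxi xi_commute by simp
  have xT: "x\<^sup>T = - x"
  proof -
    have "F * (x * F\<^sup>T) = (F * x) * F\<^sup>T" by (simp add: sq)
    also have "\<dots> = x" unfolding Fx by (simp add: sq F_orth')
    finally show ?thesis unfolding xT by simp
  qed
  define P where "P = 1\<^sub>m N + x"
  define Q where "Q = 1\<^sub>m N - x"
  have [simp]: "P \<in> C" "Q \<in> C" unfolding P_def Q_def by (auto simp: sq_closed)
  have "Q \<in> Units (ring_mat TYPE(complex) N ())"
    by (rule det_non_zero_imp_unit) (use skew_no_eigenvalue_one[OF _ cx xT] in \<open>auto simp flip: Q_def\<close>)
  then obtain Y where [simp]: "Y \<in> C" and Y: "Q * Y = 1\<^sub>m N" "Y * Q = 1\<^sub>m N"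
    unfolding Units_def ring_mat_def by auto
  have cjQ: "cj Q = Q" unfolding Q_def by (simp add: sq_cj cx sq_closed)
  have cjP: "cj P = P" unfolding P_def by (simp add: sq_cj cx sq_closed)
  have cjY: "cj Y = Y"
  proof -
    have "cj Y * Q = cj (Y * Q)" by (simp add: sq_cj cjQ)
    then have "cj Y * Q * Y = Y" unfolding Y by (simp add: sq)
    then show ?thesis using Y by (simp add: sq)
  qed
  have QT: "Q\<^sup>T = P" "P\<^sup>T = Q"
    unfolding P_def Q_def by (simp_all add: sq xT) (auto intro!: eq_matI)
  have comm: "Y * Z = Z * Y" if "Q * Z = Z * Q" "Z \<in> C" for Z
  proof -
    have "Y * Z = Y * (Z * (Q * Y))" using that Y by (simp add: sq)
    also have "\<dots> = Y * ((Q * Z) * Y)" using that by (simp add: sq)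
    also have "\<dots> = (Y * Q) * Z * Y" using that by (simp add: sq)
    also have "\<dots> = Z * Y" using that unfolding Y by (simp add: sq)
    finally show ?thesis .
  qed
  have QP: "Q * P = P * Q" unfolding P_def Q_def by (simp add: sq) (auto intro!: eq_matI)
  have YP: "Y * P = P * Y" by (rule comm[OF QP]) simp
  have QF: "Q * F = F * Q" unfolding Q_def by (simp add: sq Fx)
  have YF: "Y * F = F * Y" by (rule comm[OF QF]) simp
  have PF: "P * F = F * P" unfolding P_def by (simp add: sq Fx)
  define k where "k = P * Y"
  have [simp]: "k \<in> C" by (simp add: k_def sq)
  have YTP: "Y\<^sup>T * P = 1\<^sub>m N"
    using arg_cong[OF Y(1), of transpose_mat] by (simp add: sq QT)
  have kT: "k\<^sup>T * k = 1\<^sub>m N"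
  proof -
    have "k\<^sup>T * k = Y\<^sup>T * (Q * P) * Y" unfolding k_def by (simp add: sq QT)
    also have "\<dots> = (Y\<^sup>T * P) * (Q * Y)" unfolding QP by (simp add: sq)
    finally show ?thesis unfolding YTP Y by (simp add: sq)
  qed
  have kF: "F * k = k * F"
  proof -
    have "F * k = (F * P) * Y" by (simp add: k_def sq)
    also have "\<dots> = P * (F * Y)" unfolding PF[symmetric] by (simp add: sq)
    also have "\<dots> = k * F" unfolding YF[symmetric] by (simp add: k_def sq)
    finally show ?thesis .
  qed
  have "k \<in> K_of G" unfolding K_iff using kT kF by (simp add: k_def sq_cj cjP cjY sq_closed)
  from gram_commute_K[OF V this] have kA: "k * gram N h = gram N h * k" .
  let ?A = "gram N h"
  have [simp]: "?A \<in> C" by simp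
  \<comment> \<open>With \<open>k = (1 + x) (1 - x)^-1\<close>, adding 1 leaves twice the inverse
    \<open>Y\<close> of \<open>1 - x\<close>. So the Gram matrix, which commutes with
    \<open>k\<close>, commutes with \<open>Y\<close>, then with \<open>Q\<close> and with
    \<open>x\<close>.\<close>
  have "k + 1\<^sub>m N = 2 \<cdot>\<^sub>m Y"
  proof -
    have "k + 1\<^sub>m N = P * Y + Q * Y" unfolding Y k_def ..
    also have "\<dots> = (P + Q) * Y" by (simp add: sq)
    also have "P + Q = 2 \<cdot>\<^sub>m 1\<^sub>m N" unfolding P_def Q_def
      by (intro eq_matI) (auto simp: carrier_matD[OF \<open>x \<in> C\<close>])
    finally show ?thesis by (simp add: sq)
  qed
  then have Yk: "Y = (1/2) \<cdot>\<^sub>m (k + 1\<^sub>m N)" by (simp add: sq)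
  have YA: "Y * ?A = ?A * Y" unfolding Yk by (simp add: sq kA)
  have "Q * ?A = Q * ?A * (Y * Q)" using Y by (simp add: sq)
  also have "\<dots> = Q * (Y * ?A) * Q" unfolding YA by (simp add: sq)
  also have "\<dots> = (Q * Y) * (?A * Q)" by (simp add: sq)
  also have "\<dots> = ?A * Q" unfolding Y by (simp add: sq)
  finally have QA: "Q * ?A = ?A * Q" .
  have xQ: "x = 1\<^sub>m N - Q" unfolding Q_def by (auto intro!: eq_matI)
  show ?thesis unfolding xQ by (simp add: sq QA)
qed

text \<open>An element of \<open>p0 G\<close> is real and symmetric, so the relation saying that it
  is adjoint to itself is already the commutation relation.\<close>

lemma gram_commute_p0:
  assumes V: "V_form G h" and x: "x \<in> p0 G"
  shows "x * gram N h = gram N h * x"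
proof -
  have h: "hermitian_form (V_space G) h" using V unfolding V_form_def by simp
  have xl: "x \<in> lie0 G" and xxi: "\<xi> * x = - (x * \<xi>)" using x unfolding p0_def by auto
  have [simp]: "x \<in> C" and cx: "cj x = x" and xT: "x\<^sup>T = - (F * (x * F\<^sup>T))" using xl unfolding lie0_iff by auto
  have "F * (x * F\<^sup>T) = (\<xi> * x) * \<xi>" unfolding ad_F[OF \<open>x \<in> C\<close>] by (simp add: sq)
  also have "\<dots> = - x" unfolding xxi by (simp add: sq sq_neg xi_square)
  finally have xT: "x\<^sup>T = x" using xT by simp
  have "x\<^sup>T * gram N h = gram N h * cj x"
    by (rule gram_adjoint[OF h]) (use V x in \<open>auto simp: V_form_def\<close>)
  then show ?thesis by (simp add: xT cx)
qed

text \<open>Cartan decomposition: a real element is the sum of the halves of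
  \<open>y + F y F\<^sup>T\<close> and \<open>y - F y F\<^sup>T\<close>, which lie in
  \<open>k0 G\<close> and \<open>p0 G\<close>; complex elements follow by linearity.\<close>

lemma gram_commute_lie:
  assumes V: "V_form G h" and x: "x \<in> lie G"
  shows "x * gram N h = gram N h * x"
proof -
  let ?A = "gram N h"
  have [simp]: "?A \<in> C" by simp
  have l0: "y * ?A = ?A * y" if y: "y \<in> lie0 G" for y
  proof -
    have [simp]: "y \<in> C" and cy: "cj y = y" using y unfolding lie0_iff by auto
    have yl: "y \<in> lie G"
      using y unfolding lie_iff lie0_iff by simp
    define z where "z = F * (y * F\<^sup>T)"
    have [simp]: "z \<in> C" by (simp add: z_def sq)
    have zl: "z \<in> lie G" using lie_ad[OF K_F yl] by (simp add: z_def sq)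
    have cz: "cj z = z" by (simp add: z_def sq_cj sq_closed cy)
    have z: "z = \<xi> * (y * \<xi>)" unfolding z_def by (rule ad_F) simp
    have xz: "\<xi> * z = y * \<xi>" "z * \<xi> = \<xi> * y" unfolding z
      by (simp_all add: sq cancel1[OF xi_square] xi_square)
    \<comment> \<open>Taken with \<open>b\<close> equal to \<open>1/2\<close> for the part in
      \<open>k0 G\<close> and to \<open>-1/2\<close> for the part in \<open>p0 G\<close>; a real
      \<open>b\<close> keeps the matrix real.\<close>
    have re: "(1/2) \<cdot>\<^sub>m y + b \<cdot>\<^sub>m z \<in> lie0 G" if "cnj b = b" for b
      using that lie_add[OF lie_smult[OF yl, of "1/2"] lie_smult[OF zl, of b]]
      unfolding lie0_iff lie_iff by (simp add: sq_cj sq_closed cy cz)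
    define y1 where "y1 = (1/2) \<cdot>\<^sub>m y + (1/2) \<cdot>\<^sub>m z"
    define y2 where "y2 = (1/2) \<cdot>\<^sub>m y + (-1/2) \<cdot>\<^sub>m z"
    have [simp]: "y1 \<in> C" "y2 \<in> C" by (simp_all add: y1_def y2_def)
    have U: "\<xi> * y \<in> C" "y * \<xi> \<in> C" by (simp_all add: sq)
    have "\<xi> * y1 = y1 * \<xi>" unfolding y1_def
      using comm_add_mat[of "(1/2) \<cdot>\<^sub>m (\<xi> * y)" N N "(1/2) \<cdot>\<^sub>m (y * \<xi>)"] U by (simp add: sq xz)
    then have "y1 \<in> k0 G" unfolding k0_def using re[of "1/2"] by (simp add: y1_def)
    moreover have "(1/2) \<cdot>\<^sub>m U + (-1/2) \<cdot>\<^sub>m W = - ((1/2) \<cdot>\<^sub>m W + (-1/2) \<cdot>\<^sub>m U)"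
      if "U \<in> C" "W \<in> C" for U W :: "complex mat"
      using that by (intro eq_matI) auto
    from this[OF U] have "\<xi> * y2 = - (y2 * \<xi>)" unfolding y2_def by (simp add: sq xz)
    then have "y2 \<in> p0 G" unfolding p0_def using re[of "-1/2"] by (simp add: y2_def)
    moreover have "y = y1 + y2" unfolding y1_def y2_def
      by (intro eq_matI) (auto simp: carrier_matD[OF \<open>y \<in> C\<close>] carrier_matD[OF \<open>z \<in> C\<close>])
    ultimately show ?thesis
      using gram_commute_k0[OF V] gram_commute_p0[OF V] by (simp add: sq)
  qed
  from x obtain y z where xy: "x = y + \<i> \<cdot>\<^sub>m z" and y: "y \<in> lie0 G" and z: "z \<in> lie0 G"
    unfolding lie_def by auto
  have "y \<in> C" "z \<in> C" using y z unfolding lie0_iff by auto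
  then show ?thesis unfolding xy by (simp add: sq l0[OF y] l0[OF z])
qed

end

section \<open>The Killing form and the Casimir tensor\<close>

context rgrp
begin

lemma lie_space_simps [simp]:
  "carrier (lie_space G) = lie G" "add (lie_space G) = (+)" "zero (lie_space G) = 0\<^sub>m N N"
  "smult (lie_space G) = (\<cdot>\<^sub>m)"
  unfolding lie_space_def by (auto simp: module_mat_simps)

lemma lie_zero: "0\<^sub>m N N \<in> lie G"
  unfolding lie_iff by (auto intro!: eq_matI simp: scalar_prod_def carrier_matD[OF F_closed])

lemma cvs_lie: "cvs (lie_space G)"
proof (rule cvsI, unfold lie_space_simps)
  fix x y z :: "complex mat" and a b :: complex
  assume x: "x \<in> lie G"
  note [simp] = lie_C[OF x]
  show "0\<^sub>m N N + x = x" "1 \<cdot>\<^sub>m x = x" "(- 1) \<cdot>\<^sub>m x + x = 0\<^sub>m N N" "(a * b) \<cdot>\<^sub>m x = a \<cdot>\<^sub>m (b \<cdot>\<^sub>m x)"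
    "(a + b) \<cdot>\<^sub>m x = a \<cdot>\<^sub>m x + b \<cdot>\<^sub>m x"
    by (auto intro!: eq_matI simp: algebra_simps carrier_matD[OF \<open>x \<in> C\<close>])
  show "a \<cdot>\<^sub>m x \<in> lie G" by (rule lie_smult[OF x])
  assume y: "y \<in> lie G"
  note [simp] = lie_C[OF y]
  show "x + y \<in> lie G" by (rule lie_add[OF x y])
  show "x + y = y + x" by (rule comm_add_mat) (rule lie_C[OF x], rule lie_C[OF y])
  show "a \<cdot>\<^sub>m (x + y) = a \<cdot>\<^sub>m x + a \<cdot>\<^sub>m y"
    by (auto intro!: eq_matI simp: algebra_simps carrier_matD[OF \<open>x \<in> C\<close>] carrier_matD[OF \<open>y \<in> C\<close>])
  assume z: "z \<in> lie G"
  show "x + y + z = x + (y + z)" by (rule assoc_add_mat[OF lie_C[OF x] lie_C[OF y] lie_C[OF z]])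
qed (rule lie_zero)

definition lfun :: "(complex mat \<Rightarrow> complex) \<Rightarrow> bool" where
  "lfun \<psi> \<longleftrightarrow> (\<forall>x\<in>lie G. \<forall>y\<in>lie G. \<psi> (x + y) = \<psi> x + \<psi> y) \<and> (\<forall>x\<in>lie G. \<forall>a. \<psi> (a \<cdot>\<^sub>m x) = a * \<psi> x)"

lemma lfun_add: "lfun \<psi> \<Longrightarrow> x \<in> lie G \<Longrightarrow> y \<in> lie G \<Longrightarrow> \<psi> (x + y) = \<psi> x + \<psi> y"
  and lfun_smult: "lfun \<psi> \<Longrightarrow> x \<in> lie G \<Longrightarrow> \<psi> (a \<cdot>\<^sub>m x) = a * \<psi> x"
  unfolding lfun_def by auto

lemma lfun_entry: "a < N \<Longrightarrow> b < N \<Longrightarrow> lfun (\<lambda>x. x $$ (a, b))"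
  unfolding lfun_def by (auto dest!: lie_C)

text \<open>A basis with its coordinate functionals, stated by evaluating linear functionals so that
  no sums of matrices occur. The index set is separate from the members, so an automorphism can be
  applied to them without reindexing.\<close>

definition frame :: "'i set \<Rightarrow> ('i \<Rightarrow> complex mat) \<Rightarrow> ('i \<Rightarrow> complex mat \<Rightarrow> complex) \<Rightarrow> bool" where
  "frame I e \<phi> \<longleftrightarrow> finite I \<and> (\<forall>i\<in>I. e i \<in> lie G \<and> lfun (\<phi> i)) \<and>
     (\<forall>\<psi>. lfun \<psi> \<longrightarrow> (\<forall>x\<in>lie G. \<psi> x = (\<Sum>i\<in>I. \<phi> i x * \<psi> (e i))))"

lemma coord_exists_unique:
  assumes B: "lie_basis G B" and x: "x \<in> lie G"
  shows "\<exists>!a. a \<in> B \<rightarrow>\<^sub>E UNIV \<and> module.lincomb (lie_space G) a B = x"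
proof -
  interpret L: cvs "lie_space G" by (rule cvs_lie)
  have B': "finite B" "L.basis B" "B \<subseteq> lie G" using B unfolding lie_basis_def L.basis_def by auto
  show ?thesis
    using L.basis_criterion[of B] B' x by simp
qed

lemma basis_in_lie: "lie_basis G B \<Longrightarrow> b \<in> B \<Longrightarrow> b \<in> lie G"
proof -
  assume B: "lie_basis G B" "b \<in> B"
  interpret L: cvs "lie_space G" by (rule cvs_lie)
  show "b \<in> lie G" using B unfolding lie_basis_def L.basis_def by auto
qed

lemma coord_expansion:
  assumes B: "lie_basis G B" and x: "x \<in> lie G"
  shows "finsum (lie_space G) (\<lambda>b. lie_coord G B x b \<cdot>\<^sub>m b) B = x"
proof -
  interpret L: cvs "lie_space G" by (rule cvs_lie)
  have "module.lincomb (lie_space G) (lie_coord G B x) B = x"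
    using theI'[OF coord_exists_unique[OF B x]] unfolding lie_coord_def by blast
  then show ?thesis unfolding L.lincomb_def by simp
qed

lemma coord_unique:
  assumes B: "lie_basis G B" and x: "x \<in> lie G" and a: "finsum (lie_space G) (\<lambda>b. a b \<cdot>\<^sub>m b) B = x" and b: "b \<in> B"
  shows "lie_coord G B x b = a b"
proof -
  interpret L: cvs "lie_space G" by (rule cvs_lie)
  have fin: "finite B" using B unfolding lie_basis_def by simp
  have "finsum (lie_space G) (\<lambda>b. restrict a B b \<cdot>\<^sub>m b) B = finsum (lie_space G) (\<lambda>b. a b \<cdot>\<^sub>m b) B"
    by (rule L.M.finsum_cong') (use basis_in_lie[OF B] lie_smult in auto)
  then have "restrict a B \<in> B \<rightarrow>\<^sub>E UNIV \<and> module.lincomb (lie_space G) (restrict a B) B = x"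
    unfolding L.lincomb_def using a by simp
  then have "lie_coord G B x = restrict a B"
    unfolding lie_coord_def by (intro the1_equality coord_exists_unique[OF B x]) auto
  then show ?thesis using b by simp
qed

lemma frame_basis:
  assumes B: "lie_basis G B"
  shows "frame B (\<lambda>b. b) (\<lambda>b x. lie_coord G B x b)"
  unfolding frame_def
proof (intro conjI ballI allI impI)
  interpret L: cvs "lie_space G" by (rule cvs_lie)
  show fin: "finite B" using B unfolding lie_basis_def by simp
  note Bl = basis_in_lie[OF B]
  show "b \<in> lie G" if "b \<in> B" for b using Bl that .
  show "lfun (\<lambda>x. lie_coord G B x b)" if b: "b \<in> B" for b
    unfolding lfun_def
  proof (intro conjI ballI allI)
    fix x y assume x: "x \<in> lie G" and y: "y \<in> lie G"
    show "lie_coord G B (x + y) b = lie_coord G B x b + lie_coord G B y b"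
    proof (rule coord_unique[OF B lie_add[OF x y] _ b])
      have "finsum (lie_space G) (\<lambda>b. (lie_coord G B x b + lie_coord G B y b) \<cdot>\<^sub>m b) B =
          finsum (lie_space G) (\<lambda>b. lie_coord G B x b \<cdot>\<^sub>m b + lie_coord G B y b \<cdot>\<^sub>m b) B"
        by (rule L.M.finsum_cong') (use Bl lie_smult lie_add L.sm_ladd in auto)
      also have "\<dots> = x + y"
        using L.finsum_add[of "\<lambda>b. lie_coord G B x b \<cdot>\<^sub>m b" B "\<lambda>b. lie_coord G B y b \<cdot>\<^sub>m b"]
          coord_expansion[OF B] x y Bl lie_smult by auto
      finally show "finsum (lie_space G) (\<lambda>b. (lie_coord G B x b + lie_coord G B y b) \<cdot>\<^sub>m b) B = x + y" .
    qed
    fix a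
    show "lie_coord G B (a \<cdot>\<^sub>m x) b = a * lie_coord G B x b"
    proof (rule coord_unique[OF B lie_smult[OF x] _ b])
      have "finsum (lie_space G) (\<lambda>b. (a * lie_coord G B x b) \<cdot>\<^sub>m b) B =
          finsum (lie_space G) (\<lambda>b. a \<cdot>\<^sub>m (lie_coord G B x b \<cdot>\<^sub>m b)) B"
        by (rule L.M.finsum_cong') (use Bl lie_smult L.sm_assoc in auto)
      also have "\<dots> = a \<cdot>\<^sub>m x"
        using L.sm_finsum[of "\<lambda>b. lie_coord G B x b \<cdot>\<^sub>m b" B a] coord_expansion[OF B x] Bl lie_smult by auto
      finally show "finsum (lie_space G) (\<lambda>b. (a * lie_coord G B x b) \<cdot>\<^sub>m b) B = a \<cdot>\<^sub>m x" .
    qed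
  qed
  fix \<psi> x assume \<psi>: "lfun \<psi>" and x: "x \<in> lie G"
  have zero: "\<psi> (0\<^sub>m N N) = 0"
    using lfun_smult[OF \<psi> lie_zero, of 0] by simp
  have "\<psi> (finsum (lie_space G) f A) = (\<Sum>i\<in>A. \<psi> (f i))" if "f \<in> A \<rightarrow> lie G" "finite A" for f and A :: "complex mat set"
    using that(2,1)
  proof (induction A rule: finite_induct)
    case (insert a A)
    then have "finsum (lie_space G) f A \<in> lie G" using L.M.finsum_closed[of f A] by auto
    then show ?case using insert lfun_add[OF \<psi>] by (simp add: Pi_def)
  qed (simp add: zero)
  from this[of "\<lambda>b. lie_coord G B x b \<cdot>\<^sub>m b" B]
  show "\<psi> x = (\<Sum>b\<in>B. lie_coord G B x b * \<psi> b)"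
    unfolding coord_expansion[OF B x] using Bl lie_smult fin lfun_smult[OF \<psi>] by auto
qed

text \<open>Expanding in either frame leads to the double sum of
  \<open>\<phi>' j (T (e i)) * \<phi> i (e' j)\<close>. This removes the dependence of
  \<open>killing_form\<close> on the basis picked there by \<open>SOME\<close>.\<close>

lemma trace_independent:
  assumes 1: "frame I e \<phi>" and 2: "frame I' e' \<phi>'"
    and T: "\<And>x. x \<in> lie G \<Longrightarrow> T x \<in> lie G" "\<And>\<psi>. lfun \<psi> \<Longrightarrow> lfun (\<lambda>x. \<psi> (T x))"
  shows "(\<Sum>i\<in>I. \<phi> i (T (e i))) = (\<Sum>j\<in>I'. \<phi>' j (T (e' j)))"
proof -
  have f1: "lfun (\<phi> i)" "e i \<in> lie G" if "i \<in> I" for i using 1 that unfolding frame_def by auto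
  have f2: "lfun (\<phi>' i)" "e' i \<in> lie G" if "i \<in> I'" for i using 2 that unfolding frame_def by auto
  have x1: "\<psi> x = (\<Sum>i\<in>I. \<phi> i x * \<psi> (e i))" if "lfun \<psi>" "x \<in> lie G" for \<psi> x
    using 1 that unfolding frame_def by auto
  have x2: "\<psi> x = (\<Sum>i\<in>I'. \<phi>' i x * \<psi> (e' i))" if "lfun \<psi>" "x \<in> lie G" for \<psi> x
    using 2 that unfolding frame_def by auto
  have "(\<Sum>i\<in>I. \<phi> i (T (e i))) = (\<Sum>i\<in>I. \<Sum>j\<in>I'. \<phi>' j (T (e i)) * \<phi> i (e' j))"
    using f1 f2 T by (intro sum.cong refl x2) auto
  also have "\<dots> = (\<Sum>j\<in>I'. \<Sum>i\<in>I. \<phi> i (e' j) * \<phi>' j (T (e i)))"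
    by (subst sum.swap) (simp add: mult.commute)
  also have "\<dots> = (\<Sum>j\<in>I'. \<phi>' j (T (e' j)))"
    using f1 f2 T by (intro sum.cong refl x1[symmetric, where \<psi>="\<lambda>x. \<phi>' _ (T x)"]) auto
  finally show ?thesis .
qed

lemma lfun_bracket:
  assumes \<psi>: "lfun \<psi>" and x: "x \<in> lie G"
  shows "lfun (\<lambda>z. \<psi> (lie_bracket x z))" "lfun (\<lambda>z. \<psi> (lie_bracket z x))"
proof -
  have 1: "lie_bracket x (y + z) = lie_bracket x y + lie_bracket x z"
     "lie_bracket (y + z) x = lie_bracket y x + lie_bracket z x" if y: "y \<in> lie G" and z: "z \<in> lie G" for y z
  proof -
    note c = lie_C[OF x] lie_C[OF y] lie_C[OF z]
    have A: "(P + Q) - (R + S) = (P - R) + (Q - S)" if "P \<in> C" "Q \<in> C" "R \<in> C" "S \<in> C" for P Q R S :: "complex mat"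
      using that by (intro eq_matI) auto
    show "lie_bracket x (y + z) = lie_bracket x y + lie_bracket x z"
     "lie_bracket (y + z) x = lie_bracket y x + lie_bracket z x"
      unfolding lie_bracket_def using c by (simp_all add: sq A)
  qed
  have 2: "lie_bracket x (a \<cdot>\<^sub>m y) = a \<cdot>\<^sub>m lie_bracket x y" "lie_bracket (a \<cdot>\<^sub>m y) x = a \<cdot>\<^sub>m lie_bracket y x"
    if y: "y \<in> lie G" for y a
  proof -
    note c = lie_C[OF x] lie_C[OF y]
    have A: "a \<cdot>\<^sub>m P - a \<cdot>\<^sub>m Q = a \<cdot>\<^sub>m (P - Q)" if "P \<in> C" "Q \<in> C" for P Q :: "complex mat"
      using that by (intro eq_matI) (auto simp: algebra_simps)
    show "lie_bracket x (a \<cdot>\<^sub>m y) = a \<cdot>\<^sub>m lie_bracket x y" "lie_bracket (a \<cdot>\<^sub>m y) x = a \<cdot>\<^sub>m lie_bracket y x"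
      unfolding lie_bracket_def using c by (simp_all add: sq A)
  qed
  show "lfun (\<lambda>z. \<psi> (lie_bracket x z))" "lfun (\<lambda>z. \<psi> (lie_bracket z x))"
    unfolding lfun_def using x \<psi> by (auto simp: 1 2 lfun_add lfun_smult lie_bracket_closed)
qed

lemma frame_lfun: "frame I e \<phi> \<Longrightarrow> lfun \<psi> \<Longrightarrow> x \<in> lie G \<Longrightarrow> \<psi> x = (\<Sum>i\<in>I. \<phi> i x * \<psi> (e i))"
  unfolding frame_def by auto

text \<open>Linear and conjugate linear automorphisms at once, with \<open>\<sigma>\<close> the
  inverse of \<open>\<tau>\<close>: the Casimir tensor has to be invariant both under conjugation by
  \<open>K\<close> and under complex conjugation.\<close>

definition lie_auto :: "(complex \<Rightarrow> complex) \<Rightarrow> (complex mat \<Rightarrow> complex mat) \<Rightarrow> (complex mat \<Rightarrow> complex mat) \<Rightarrow> bool" where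
  "lie_auto s \<tau> \<sigma> \<longleftrightarrow> (s = (\<lambda>z. z) \<or> s = cnj) \<and>
     (\<forall>x\<in>lie G. \<tau> x \<in> lie G \<and> \<sigma> x \<in> lie G \<and> \<tau> (\<sigma> x) = x \<and> \<sigma> (\<tau> x) = x \<and>
        (\<forall>a. \<tau> (a \<cdot>\<^sub>m x) = s a \<cdot>\<^sub>m \<tau> x) \<and>
        (\<forall>y\<in>lie G. \<tau> (x + y) = \<tau> x + \<tau> y \<and> \<tau> (lie_bracket x y) = lie_bracket (\<tau> x) (\<tau> y)))"

lemma lie_auto_s:
  assumes "lie_auto s \<tau> \<sigma>"
  shows "s (s a) = a" "s (a + b) = s a + s b" "s (a * b) = s a * s b" "s (sum f A) = (\<Sum>i\<in>A. s (f i))"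
  using assms unfolding lie_auto_def by auto

lemma lie_auto_D:
  assumes "lie_auto s \<tau> \<sigma>" "x \<in> lie G"
  shows "\<tau> x \<in> lie G" "\<sigma> x \<in> lie G" "\<tau> (\<sigma> x) = x" "\<sigma> (\<tau> x) = x" "\<tau> (a \<cdot>\<^sub>m x) = s a \<cdot>\<^sub>m \<tau> x"
    "y \<in> lie G \<Longrightarrow> \<tau> (x + y) = \<tau> x + \<tau> y" "y \<in> lie G \<Longrightarrow> \<tau> (lie_bracket x y) = lie_bracket (\<tau> x) (\<tau> y)"
  using assms unfolding lie_auto_def by auto

lemma lie_auto_lfun:
  assumes a: "lie_auto s \<tau> \<sigma>" and \<psi>: "lfun \<psi>"
  shows "lfun (\<lambda>x. s (\<psi> (\<tau> x)))" "lfun (\<lambda>x. s (\<psi> (\<sigma> x)))"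
proof -
  have sadd: "\<sigma> (x + y) = \<sigma> x + \<sigma> y" if "x \<in> lie G" "y \<in> lie G" for x y
    using lie_auto_D[OF a] that lie_add by metis
  have ssm: "\<sigma> (b \<cdot>\<^sub>m x) = s b \<cdot>\<^sub>m \<sigma> x" if "x \<in> lie G" for x b
  proof -
    have "\<tau> (s b \<cdot>\<^sub>m \<sigma> x) = b \<cdot>\<^sub>m x" using lie_auto_D[OF a] that lie_auto_s[OF a] by simp
    then show ?thesis using lie_auto_D[OF a] that lie_smult by metis
  qed
  show "lfun (\<lambda>x. s (\<psi> (\<tau> x)))" "lfun (\<lambda>x. s (\<psi> (\<sigma> x)))"
    unfolding lfun_def
    using lie_auto_D[OF a] lie_auto_s[OF a] lfun_add[OF \<psi>] lfun_smult[OF \<psi>] by (simp_all add: sadd ssm)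
qed

lemma frame_auto:
  assumes a: "lie_auto s \<tau> \<sigma>" and f: "frame I e \<phi>"
  shows "frame I (\<lambda>i. \<tau> (e i)) (\<lambda>i x. s (\<phi> i (\<sigma> x)))"
  unfolding frame_def
proof (intro conjI ballI allI impI)
  show "finite I" using f unfolding frame_def by auto
  show "\<tau> (e i) \<in> lie G" "lfun (\<lambda>x. s (\<phi> i (\<sigma> x)))" if "i \<in> I" for i
    using that f lie_auto_D[OF a] lie_auto_lfun[OF a] unfolding frame_def by auto
  fix \<psi> x assume \<psi>: "lfun \<psi>" and x: "x \<in> lie G"
  have "\<psi> x = s (s (\<psi> (\<tau> (\<sigma> x))))" using lie_auto_D[OF a x] lie_auto_s[OF a] by simp
  also have "s (\<psi> (\<tau> (\<sigma> x))) = (\<Sum>i\<in>I. \<phi> i (\<sigma> x) * s (\<psi> (\<tau> (e i))))"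
    using frame_lfun[OF f lie_auto_lfun(1)[OF a \<psi>], of "\<sigma> x"] lie_auto_D[OF a x] by simp
  finally show "\<psi> x = (\<Sum>i\<in>I. s (\<phi> i (\<sigma> x)) * \<psi> (\<tau> (e i)))"
    by (simp add: lie_auto_s[OF a])
qed

abbreviation kil :: "complex mat \<Rightarrow> complex mat \<Rightarrow> complex" where "kil \<equiv> killing_form G"

lemma kil_frame:
  assumes "lie_basis G B" and f: "frame I e \<phi>" and x: "x \<in> lie G" and y: "y \<in> lie G"
  shows "kil x y = (\<Sum>i\<in>I. \<phi> i (lie_bracket x (lie_bracket y (e i))))"
proof -
  define B0 where "B0 = (SOME B. lie_basis G B)"
  have B0: "lie_basis G B0" unfolding B0_def by (rule someI[of "lie_basis G"]) (rule assms)
  have "kil x y = (\<Sum>b\<in>B0. lie_coord G B0 (lie_bracket x (lie_bracket y b)) b)"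
    unfolding killing_form_def B0_def by (simp add: Let_def)
  also have "\<dots> = (\<Sum>i\<in>I. \<phi> i (lie_bracket x (lie_bracket y (e i))))"
    by (rule trace_independent[OF frame_basis[OF B0] f])
      (use x y lie_bracket_closed lfun_bracket(1)[of "\<lambda>z. _ (lie_bracket x z)" y] lfun_bracket(1)[of _ x] in auto)
  finally show ?thesis .
qed

text \<open>The trace for \<open>\<tau> x\<close> and \<open>\<tau> y\<close> is evaluated in the
  transported frame, where every bracket is the image of the original one.\<close>

lemma kil_auto:
  assumes B: "lie_basis G B" and a: "lie_auto s \<tau> \<sigma>" and x: "x \<in> lie G" and y: "y \<in> lie G"
  shows "kil (\<tau> x) (\<tau> y) = s (kil x y)"
proof -
  note f = frame_basis[OF B]
  have Bl: "b \<in> lie G" if "b \<in> B" for b using basis_in_lie[OF B that] .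
  have "kil (\<tau> x) (\<tau> y) = (\<Sum>b\<in>B. s (lie_coord G B (\<sigma> (lie_bracket (\<tau> x) (lie_bracket (\<tau> y) (\<tau> b)))) b))"
    by (rule kil_frame[OF B frame_auto[OF a f]]) (use lie_auto_D[OF a] x y in auto)
  also have "\<dots> = (\<Sum>b\<in>B. s (lie_coord G B (lie_bracket x (lie_bracket y b)) b))"
  proof (intro sum.cong refl)
    fix b assume "b \<in> B"
    then have "lie_bracket (\<tau> x) (lie_bracket (\<tau> y) (\<tau> b)) = \<tau> (lie_bracket x (lie_bracket y b))"
      using lie_auto_D(7)[OF a] x y Bl lie_bracket_closed by simp
    then show "s (lie_coord G B (\<sigma> (lie_bracket (\<tau> x) (lie_bracket (\<tau> y) (\<tau> b)))) b) =
        s (lie_coord G B (lie_bracket x (lie_bracket y b)) b)"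
      using lie_auto_D(4)[OF a] x y Bl lie_bracket_closed \<open>b \<in> B\<close> by simp
  qed
  also have "\<dots> = s (kil x y)"
    unfolding kil_frame[OF B f x y] by (simp add: lie_auto_s[OF a])
  finally show ?thesis .
qed

text \<open>The symmetry of the trace of a product of two operators, written out in
  coordinates.\<close>

lemma kil_sym:
  assumes B: "lie_basis G B" and x: "x \<in> lie G" and y: "y \<in> lie G"
  shows "kil x y = kil y x"
proof -
  note f = frame_basis[OF B]
  have Bl: "b \<in> lie G" if "b \<in> B" for b using basis_in_lie[OF B that] .
  have lf: "lfun (\<lambda>x. lie_coord G B x b)" if "b \<in> B" for b using f that unfolding frame_def by auto
  have ex: "lie_coord G B (lie_bracket x (lie_bracket y b)) b =
      (\<Sum>c\<in>B. lie_coord G B (lie_bracket y b) c * lie_coord G B (lie_bracket x c) b)"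
    if "b \<in> B" "x \<in> lie G" "y \<in> lie G" for x y b
    using frame_lfun[OF f lfun_bracket(1)[OF lf[OF that(1)] that(2)] lie_bracket_closed[OF that(3) Bl[OF that(1)]]] .
  have "kil x y = (\<Sum>b\<in>B. \<Sum>c\<in>B. lie_coord G B (lie_bracket y b) c * lie_coord G B (lie_bracket x c) b)"
    unfolding kil_frame[OF B f x y] using ex x y by (intro sum.cong refl) auto
  also have "\<dots> = (\<Sum>c\<in>B. \<Sum>b\<in>B. lie_coord G B (lie_bracket x c) b * lie_coord G B (lie_bracket y b) c)"
    by (subst sum.swap) (simp add: mult.commute)
  also have "\<dots> = kil y x"
    unfolding kil_frame[OF B f y x] using ex x y by (intro sum.cong refl) auto
  finally show ?thesis .
qed

lemma kil_lfun:
  assumes B: "lie_basis G B" and y: "y \<in> lie G"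
  shows "lfun (\<lambda>x. kil x y)"
proof -
  note f = frame_basis[OF B]
  have Bl: "b \<in> lie G" if "b \<in> B" for b using basis_in_lie[OF B that] .
  have lf: "lfun (\<lambda>x. lie_coord G B x b)" if "b \<in> B" for b using f that unfolding frame_def by auto
  have lf': "lfun (\<lambda>x. lie_coord G B (lie_bracket x (lie_bracket y b)) b)" if "b \<in> B" for b
    using lfun_bracket(2)[OF lf[OF that]] lie_bracket_closed[OF y Bl[OF that]] by simp
  show ?thesis
    unfolding lfun_def
    using lf' by (auto simp: kil_frame[OF B f _ y] lie_add lie_smult lfun_add[OF lf'] lfun_smult[OF lf']
        sum.distrib sum_distrib_left)
qed

end

section \<open>Dual bases and the invariance of the Casimir tensor\<close>

locale casimir = rgrp G for G +
  fixes B d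
  assumes kd: "killing_dual_bases G B d"
begin

lemma basis: "lie_basis G B"
  using kd unfolding killing_dual_bases_def by auto

lemma finB: "finite B"
  using basis unfolding lie_basis_def by auto

lemma Bl: "b \<in> B \<Longrightarrow> b \<in> lie G" "b \<in> B \<Longrightarrow> d b \<in> lie G"
  using basis_in_lie[OF basis] kd unfolding killing_dual_bases_def by auto

lemma coord_kil:
  assumes x: "x \<in> lie G" and b: "b \<in> B"
  shows "lie_coord G B x b = kil x (d b)"
proof -
  have "kil x (d b) = (\<Sum>c\<in>B. lie_coord G B x c * kil c (d b))"
    by (rule frame_lfun[OF frame_basis[OF basis] kil_lfun[OF basis Bl(2)[OF b]] x])
  also have "\<dots> = (\<Sum>c\<in>B. if c = b then lie_coord G B x c else 0)"
    using kd b unfolding killing_dual_bases_def by (intro sum.cong) auto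
  also have "\<dots> = lie_coord G B x b" using b finB by simp
  finally show ?thesis ..
qed

lemma expand: "lfun \<psi> \<Longrightarrow> x \<in> lie G \<Longrightarrow> \<psi> x = (\<Sum>b\<in>B. kil x (d b) * \<psi> b)"
  using frame_lfun[OF frame_basis[OF basis]] coord_kil by simp

text \<open>Here the \<open>d b\<close> play the part of the basis. Instead of showing that they
  form one, each \<open>d b\<close> is expanded in \<open>B\<close>, and the symmetry of the Killing
  form lets the inner sum be contracted.\<close>

lemma expand':
  assumes \<psi>: "lfun \<psi>" and y: "y \<in> lie G"
  shows "(\<Sum>b\<in>B. kil b y * \<psi> (d b)) = \<psi> y"
proof -
  have "(\<Sum>b\<in>B. kil b y * \<psi> (d b)) = (\<Sum>b\<in>B. \<Sum>c\<in>B. kil b y * (kil (d b) (d c) * \<psi> c))"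
    using expand[OF \<psi> Bl(2)] by (simp add: sum_distrib_left)
  also have "\<dots> = (\<Sum>c\<in>B. (\<Sum>b\<in>B. kil (d c) (d b) * kil b y) * \<psi> c)"
    by (subst sum.swap) (use kil_sym[OF basis Bl(2) Bl(2)] in \<open>auto simp: sum_distrib_right mult.left_commute mult.assoc intro!: sum.cong\<close>)
  also have "\<dots> = (\<Sum>c\<in>B. kil y (d c) * \<psi> c)"
    using expand[OF kil_lfun[OF basis y] Bl(2)] kil_sym[OF basis Bl(2) y] by simp
  also have "\<dots> = \<psi> y" using expand[OF \<psi> y] by simp
  finally show ?thesis .
qed

text \<open>The families \<open>\<tau> b\<close> and \<open>\<tau> (d b)\<close> are again dual,
  since the Killing form is invariant; in the conjugate linear case the conjugations produced by the
  form and by \<open>\<psi>\<close> cancel.\<close>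

lemma casimir_auto:
  assumes a: "lie_auto s \<tau> \<sigma>" and \<psi>: "lfun \<psi>" and y: "y \<in> lie G"
  shows "(\<Sum>b\<in>B. kil (\<tau> b) y * \<psi> (\<tau> (d b))) = \<psi> y"
proof -
  note D = lie_auto_D[OF a] and S = lie_auto_s[OF a]
  have "(\<Sum>b\<in>B. kil (\<tau> b) y * \<psi> (\<tau> (d b))) = (\<Sum>b\<in>B. s (kil b (\<sigma> y) * s (\<psi> (\<tau> (d b)))))"
    using kil_auto[OF basis a Bl(1) D(2)[OF y]] D(3)[OF y] S by simp
  also have "\<dots> = s (\<Sum>b\<in>B. kil b (\<sigma> y) * s (\<psi> (\<tau> (d b))))" by (simp add: S)
  also have "\<dots> = \<psi> y"
    using expand'[OF lie_auto_lfun(1)[OF a \<psi>] D(2)[OF y]] S D(3)[OF y] by simp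
  finally show ?thesis .
qed

text \<open>The first argument is expanded in \<open>B\<close>, the second is then contracted by
  \<open>casimir_auto\<close>.\<close>

lemma casimir_bilinear:
  assumes a: "lie_auto s \<tau> \<sigma>"
    and l: "\<And>y. y \<in> lie G \<Longrightarrow> lfun (\<lambda>x. \<beta> x y)" and r: "\<And>x. x \<in> lie G \<Longrightarrow> lfun (\<beta> x)"
  shows "(\<Sum>b\<in>B. \<beta> (\<tau> b) (\<tau> (d b))) = (\<Sum>b\<in>B. \<beta> b (d b))"
proof -
  have "(\<Sum>b\<in>B. \<beta> (\<tau> b) (\<tau> (d b))) = (\<Sum>b\<in>B. \<Sum>c\<in>B. kil (\<tau> b) (d c) * \<beta> c (\<tau> (d b)))"
    using lie_auto_D(1)[OF a] Bl by (intro sum.cong refl expand[OF l]) auto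
  also have "\<dots> = (\<Sum>c\<in>B. \<Sum>b\<in>B. kil (\<tau> b) (d c) * \<beta> c (\<tau> (d b)))"
    by (rule sum.swap)
  also have "\<dots> = (\<Sum>c\<in>B. \<beta> c (d c))"
    using casimir_auto[OF a r] Bl by (intro sum.cong refl) auto
  finally show ?thesis .
qed

lemma auto_cj: "lie_auto cnj cj cj"
  unfolding lie_auto_def
proof (intro conjI ballI allI)
  fix x y assume x: "x \<in> lie G" and y: "y \<in> lie G"
  note [simp] = lie_C[OF x] lie_C[OF y]
  show "cj (x + y) = cj x + cj y" by (simp add: sq_cj)
  show "cj (lie_bracket x y) = lie_bracket (cj x) (cj y)" unfolding lie_bracket_def by (simp add: sq_cj sq_closed)
qed (auto simp: lie_cj)

lemma auto_ad:
  assumes k: "k \<in> K_of G"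
  shows "lie_auto (\<lambda>z. z) (\<lambda>x. k * x * k\<^sup>T) (\<lambda>x. k\<^sup>T * x * k)"
  unfolding lie_auto_def
proof (intro conjI ballI allI)
  note kc [simp] = K_D(1)[OF k]
  note kk = K_D(3,4)[OF k]
  have kT: "k\<^sup>T \<in> K_of G" using K_transpose[OF k] .
  fix x assume x: "x \<in> lie G"
  note [simp] = lie_C[OF x]
  show "k * x * k\<^sup>T \<in> lie G" by (rule lie_ad[OF k x])
  show "k\<^sup>T * x * k \<in> lie G" using lie_ad[OF kT x] by simp
  show "k * (k\<^sup>T * x * k) * k\<^sup>T = x" "k\<^sup>T * (k * x * k\<^sup>T) * k = x"
    by (simp_all add: sq kk cancel1[OF kk(1)] cancel1[OF kk(2)])
  show "k * (a \<cdot>\<^sub>m x) * k\<^sup>T = a \<cdot>\<^sub>m (k * x * k\<^sup>T)" for a by (simp add: sq)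
  fix y assume y: "y \<in> lie G"
  note [simp] = lie_C[OF y]
  show "k * (x + y) * k\<^sup>T = k * x * k\<^sup>T + k * y * k\<^sup>T" by (simp add: sq)
  show "k * lie_bracket x y * k\<^sup>T = lie_bracket (k * x * k\<^sup>T) (k * y * k\<^sup>T)"
    unfolding lie_bracket_def by (simp add: sq cancel1[OF kk(1)])
qed simp

end

section \<open>The projection onto the trivial submodule\<close>

definition mmul :: "'i set \<Rightarrow> ('i \<Rightarrow> 'i \<Rightarrow> complex) \<Rightarrow> ('i \<Rightarrow> 'i \<Rightarrow> complex) \<Rightarrow> 'i \<Rightarrow> 'i \<Rightarrow> complex" where
  "mmul S A B = (\<lambda>i j. \<Sum>k\<in>S. A i k * B k j)"

definition madj :: "('i \<Rightarrow> 'i \<Rightarrow> complex) \<Rightarrow> 'i \<Rightarrow> 'i \<Rightarrow> complex" where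
  "madj A = (\<lambda>i j. cnj (A j i))"

text \<open>A matrix given as a function is unconstrained outside its index set. After cutting,
  identities of matrices become identities of functions.\<close>

definition mcut :: "'i set \<Rightarrow> ('i \<Rightarrow> 'i \<Rightarrow> complex) \<Rightarrow> 'i \<Rightarrow> 'i \<Rightarrow> complex" where
  "mcut S A = (\<lambda>i j. if i \<in> S \<and> j \<in> S then A i j else 0)"

lemma mmul_assoc: "mmul S (mmul S A B) D = mmul S A (mmul S B D)"
proof (intro ext)
  fix i j
  have "mmul S (mmul S A B) D i j = (\<Sum>k\<in>S. \<Sum>m\<in>S. A i m * B m k * D k j)"
    unfolding mmul_def by (simp add: sum_distrib_right)
  also have "\<dots> = (\<Sum>m\<in>S. \<Sum>k\<in>S. A i m * B m k * D k j)" by (rule sum.swap)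
  also have "\<dots> = mmul S A (mmul S B D) i j"
    unfolding mmul_def by (simp add: sum_distrib_left mult.assoc)
  finally show "mmul S (mmul S A B) D i j = mmul S A (mmul S B D) i j" .
qed

lemma madj_mmul: "madj (mmul S A B) = mmul S (madj B) (madj A)"
  unfolding madj_def mmul_def by (simp add: mult.commute)

lemma madj_madj [simp]: "madj (madj A) = A"
  unfolding madj_def by simp

lemma madj_zero [simp]: "madj (\<lambda>_ _. 0) = (\<lambda>_ _. 0)"
  unfolding madj_def by simp

lemma mmul_zero [simp]: "mmul S A (\<lambda>_ _. 0) = (\<lambda>_ _. 0)" "mmul S (\<lambda>_ _. 0) A = (\<lambda>_ _. 0)"
  unfolding mmul_def by simp_all

lemma mcut_mmul: "mcut S (mmul S (mcut S A) (mcut S B)) = mmul S (mcut S A) (mcut S B)"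
  unfolding mcut_def mmul_def by (intro ext) auto

lemma madj_mcut: "madj (mcut S A) = mcut S (madj A)"
  unfolding madj_def mcut_def by (intro ext) auto

context rgrp
begin

text \<open>The matrix of \<open>x \<otimes> 1 + 1 \<otimes> x\<close>, the action of the Lie
  algebra on \<open>V \<otimes> V\<close>; \<open>kron u\<close> below is
  \<open>u \<otimes> u\<close>.\<close>

definition lie2 :: "complex mat \<Rightarrow> nat \<times> nat \<Rightarrow> nat \<times> nat \<Rightarrow> complex" where
  "lie2 x = mcut (prs N) (\<lambda>p q. x $$ (fst p, fst q) * dlt (snd p) (snd q) + dlt (fst p) (fst q) * x $$ (snd p, snd q))"

definition kron :: "complex mat \<Rightarrow> nat \<times> nat \<Rightarrow> nat \<times> nat \<Rightarrow> complex" where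
  "kron u = mcut (prs N) (\<lambda>p q. u $$ (fst p, fst q) * u $$ (snd p, snd q))"

lemma sum_prs: "(\<Sum>p\<in>prs N. f p) = (\<Sum>a<N. \<Sum>b<N. f (a, b))"
  by (simp add: sum.cartesian_product)

lemma lie2_apply:
  assumes "p \<in> prs N"
  shows "(\<Sum>r\<in>prs N. lie2 x p r * f r) =
    (\<Sum>j<N. x $$ (fst p, j) * f (j, snd p)) + (\<Sum>j<N. x $$ (snd p, j) * f (fst p, j))"
proof -
  have "(\<Sum>r\<in>prs N. lie2 x p r * f r) = (\<Sum>a<N. \<Sum>b<N. dlt (snd p) b * (x $$ (fst p, a) * f (a, b)))
     + (\<Sum>a<N. \<Sum>b<N. dlt (fst p) a * (x $$ (snd p, b) * f (a, b)))"
    unfolding sum_prs sum.distrib[symmetric] using assms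
    by (intro sum.cong refl) (auto simp: lie2_def mcut_def algebra_simps)
  also have "\<dots> = (\<Sum>j<N. x $$ (fst p, j) * f (j, snd p)) + (\<Sum>j<N. x $$ (snd p, j) * f (fst p, j))"
    using assms by (simp add: sum_distrib_left[symmetric] mem_Times_iff)
  finally show ?thesis .
qed

lemma lie2_apply_right:
  assumes "p \<in> prs N"
  shows "(\<Sum>r\<in>prs N. f r * lie2 x r p) =
    (\<Sum>j<N. f (j, snd p) * x $$ (j, fst p)) + (\<Sum>j<N. f (fst p, j) * x $$ (j, snd p))"
proof -
  have "(\<Sum>r\<in>prs N. f r * lie2 x r p) = (\<Sum>a<N. \<Sum>b<N. dlt b (snd p) * (f (a, b) * x $$ (a, fst p)))
     + (\<Sum>a<N. \<Sum>b<N. dlt a (fst p) * (f (a, b) * x $$ (b, snd p)))"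
    unfolding sum_prs sum.distrib[symmetric] using assms
    by (intro sum.cong refl) (auto simp: lie2_def mcut_def algebra_simps)
  also have "\<dots> = (\<Sum>j<N. f (j, snd p) * x $$ (j, fst p)) + (\<Sum>j<N. f (fst p, j) * x $$ (j, snd p))"
    using assms by (simp add: sum_distrib_left[symmetric] mem_Times_iff)
  finally show ?thesis .
qed

lemma VV_lie_eq: "VV_lie G x u = (\<lambda>p. if p \<in> prs N then \<Sum>r\<in>prs N. lie2 x p r * u r else 0)"
proof
  fix p :: "nat \<times> nat"
  show "VV_lie G x u p = (if p \<in> prs N then \<Sum>r\<in>prs N. lie2 x p r * u r else 0)"
  proof (cases "p \<in> prs N")
    case True
    then show ?thesis unfolding lie2_apply[OF True] by (cases p) (simp add: VV_lie_def)
  next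
    case False
    then show ?thesis by (cases p) (auto simp: VV_lie_def)
  qed
qed

lemma VV_op_eq: "VV_op G P u = (\<lambda>p. if p \<in> prs N then \<Sum>r\<in>prs N. P p r * u r else 0)"
  unfolding VV_op_def by (auto simp: fun_eq_iff)

lemma VV_iff: "u \<in> VV G \<longleftrightarrow> (\<forall>p. p \<notin> prs N \<longrightarrow> u p = 0)"
  unfolding VV_def by auto

text \<open>Obtained by applying the defining conditions to the unit vectors
  \<open>mcut (prs N) dlt q\<close>. For the third claim, each column of \<open>R\<close> is an
  invariant vector and hence fixed by \<open>P\<close>.\<close>

lemma trivial_projection_matrix:
  assumes P: "trivial_projection G P"
  shows "x \<in> lie G \<Longrightarrow> mmul (prs N) (lie2 x) (mcut (prs N) P) = (\<lambda>_ _. 0)"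
    and "x \<in> lie G \<Longrightarrow> mmul (prs N) (mcut (prs N) P) (lie2 x) = (\<lambda>_ _. 0)"
    and "(\<And>x. x \<in> lie G \<Longrightarrow> mmul (prs N) (lie2 x) (mcut (prs N) R) = (\<lambda>_ _. 0)) \<Longrightarrow>
      mmul (prs N) (mcut (prs N) P) (mcut (prs N) R) = mcut (prs N) R"
proof -
  have imV: "VV_op G P u \<in> VV_invariants G" if "u \<in> VV G" for u
    using P that unfolding trivial_projection_def by auto
  have fixV: "VV_op G P u = u" if "u \<in> VV_invariants G" for u
    using P that unfolding trivial_projection_def by auto
  have dV: "mcut (prs N) dlt q \<in> VV G" for q unfolding VV_iff mcut_def by auto
  have Pq: "VV_op G P (mcut (prs N) dlt q) p = mcut (prs N) P p q" for p q
    unfolding VV_op_eq mcut_def using dlt_sum(3)[of "prs N" "P p" q] by auto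
  have lq: "VV_lie G x (mcut (prs N) dlt q) p = lie2 x p q" for x p q
  proof -
    have "lie2 x p q = 0" if "q \<notin> prs N \<or> p \<notin> prs N" using that by (auto simp: lie2_def mcut_def)
    then show ?thesis
      unfolding VV_lie_eq mcut_def using dlt_sum(3)[of "prs N" "lie2 x p" q]
      by (cases "q \<in> prs N"; cases "p \<in> prs N") simp_all
  qed
  show "mmul (prs N) (lie2 x) (mcut (prs N) P) = (\<lambda>_ _. 0)" if x: "x \<in> lie G"
  proof (intro ext)
    fix p q
    have "VV_lie G x (VV_op G P (mcut (prs N) dlt q)) p = 0"
      using imV[OF dV] x unfolding VV_invariants_def by simp
    then have "p \<in> prs N \<longrightarrow> mmul (prs N) (lie2 x) (mcut (prs N) P) p q = 0"
      unfolding VV_lie_eq mmul_def Pq by (simp split: if_splits)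
    then show "mmul (prs N) (lie2 x) (mcut (prs N) P) p q = 0"
      by (cases "p \<in> prs N") (auto simp: mmul_def lie2_def mcut_def intro!: sum.neutral)
  qed
  show "mmul (prs N) (mcut (prs N) P) (lie2 x) = (\<lambda>_ _. 0)" if x: "x \<in> lie G"
  proof (intro ext)
    fix p q
    have "VV_op G P (VV_lie G x (mcut (prs N) dlt q)) p = VV_lie G x (VV_op G P (mcut (prs N) dlt q)) p"
      using P x dV unfolding trivial_projection_def by auto
    also have "\<dots> = 0"
      using imV[OF dV] x unfolding VV_invariants_def by simp
    finally have "p \<in> prs N \<longrightarrow> (\<Sum>r\<in>prs N. P p r * lie2 x r q) = 0"
      unfolding VV_op_eq lq by (simp split: if_splits)
    moreover have "mmul (prs N) (mcut (prs N) P) (lie2 x) p q = (if p \<in> prs N then \<Sum>r\<in>prs N. P p r * lie2 x r q else 0)"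
      unfolding mmul_def mcut_def by (auto intro!: sum.cong)
    ultimately show "mmul (prs N) (mcut (prs N) P) (lie2 x) p q = 0" by simp
  qed
  show "mmul (prs N) (mcut (prs N) P) (mcut (prs N) R) = mcut (prs N) R"
    if R: "\<And>x. x \<in> lie G \<Longrightarrow> mmul (prs N) (lie2 x) (mcut (prs N) R) = (\<lambda>_ _. 0)"
  proof (intro ext)
    fix p q
    define u where "u = (\<lambda>p. mcut (prs N) R p q)"
    have "VV_lie G x u = (\<lambda>_. 0)" if "x \<in> lie G" for x
      unfolding VV_lie_eq u_def using fun_cong[OF fun_cong[OF R[OF that]], of _ q] by (auto simp: mmul_def)
    then have "u \<in> VV_invariants G"
      unfolding VV_invariants_def VV_iff by (auto simp: u_def mcut_def)
    then have "VV_op G P u p = u p" using fixV by simp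
    then have "(if p \<in> prs N then \<Sum>r\<in>prs N. P p r * mcut (prs N) R r q else 0) = mcut (prs N) R p q"
      unfolding VV_op_eq u_def .
    moreover have "mmul (prs N) (mcut (prs N) P) (mcut (prs N) R) p q =
        (if p \<in> prs N then \<Sum>r\<in>prs N. P p r * mcut (prs N) R r q else 0)"
      unfolding mmul_def mcut_def by (auto intro!: sum.cong)
    ultimately show "mmul (prs N) (mcut (prs N) P) (mcut (prs N) R) p q = mcut (prs N) R p q" by simp
  qed
qed

lemma lie2_adj: "x \<in> lie G \<Longrightarrow> madj (lie2 x) = lie2 ((cj x)\<^sup>T)"
  unfolding lie2_def madj_mcut
  by (intro ext) (auto simp: mcut_def madj_def dlt_def dest!: lie_C)

text \<open>Both \<open>P\<close> and its adjoint have invariant values, since \<open>\<gg>\<close> is closed under adjoints; so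
  \<open>P\<^sup>* = P P\<^sup>*\<close> is self-adjoint.\<close>

lemma trivial_projection_adjoint:
  assumes P: "trivial_projection G P"
  shows "madj (mcut (prs N) P) = mcut (prs N) P"
proof -
  let ?P = "mcut (prs N) P"
  note T = trivial_projection_matrix[OF P]
  have "mmul (prs N) (lie2 x) (madj ?P) = (\<lambda>_ _. 0)" if x: "x \<in> lie G" for x
  proof -
    note y = lie_cj_transpose[OF x]
    have "lie2 x = madj (lie2 ((cj x)\<^sup>T))"
      using lie2_adj[OF y] lie_C[OF x] by simp
    then have "mmul (prs N) (lie2 x) (madj ?P) = madj (mmul (prs N) ?P (lie2 ((cj x)\<^sup>T)))"
      by (simp add: madj_mmul)
    then show ?thesis using T(2)[OF y] by simp
  qed
  then have PP: "mmul (prs N) ?P (madj ?P) = madj ?P"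
    using T(3)[of "madj P"] by (simp add: madj_mcut)
  have "madj ?P = madj (mmul (prs N) ?P (madj ?P))" unfolding madj_mmul madj_madj by (rule PP[symmetric])
  also have "\<dots> = madj (madj ?P)" using PP by (rule arg_cong)
  finally show ?thesis by simp
qed

text \<open>For invertible \<open>u\<close> this says that conjugation by the inverse of
  \<open>u\<close> maps the Lie algebra into itself. The multiplicative form also covers matrices
  for which no inverse is constructed, such as those in \<open>normalizes_tw\<close>.\<close>

definition normalizes :: "complex mat \<Rightarrow> bool" where
  "normalizes u \<longleftrightarrow> u \<in> C \<and> (\<forall>x\<in>lie G. \<exists>y\<in>lie G. x * u = u * y)"

lemma lie2_kron:
  assumes u: "u \<in> C" and x: "x \<in> C" and y: "y \<in> C" and eq: "x * u = u * y"
  shows "mmul (prs N) (lie2 x) (kron u) = mmul (prs N) (kron u) (lie2 y)"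
proof (intro ext)
  fix p q
  show "mmul (prs N) (lie2 x) (kron u) p q = mmul (prs N) (kron u) (lie2 y) p q"
  proof (cases "p \<in> prs N \<and> q \<in> prs N")
    case True
    then obtain a b r s where pq: "p = (a, b)" "q = (r, s)" and lt: "a < N" "b < N" "r < N" "s < N"
      by auto
    have k: "kron u (i, j) (r, s) = u $$ (i, r) * u $$ (j, s)" "kron u (a, b) (i, j) = u $$ (a, i) * u $$ (b, j)"
      if "i < N" "j < N" for i j
      using that lt by (simp_all add: kron_def mcut_def)
    have e: "(\<Sum>j<N. x $$ (i, j) * u $$ (j, m)) = (\<Sum>j<N. u $$ (i, j) * y $$ (j, m))" if "i < N" "m < N" for i m
      using sq_index[OF x u that] sq_index[OF u y that] eq by simp
    have "mmul (prs N) (lie2 x) (kron u) p q =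
        (\<Sum>j<N. x $$ (a, j) * u $$ (j, r)) * u $$ (b, s) + u $$ (a, r) * (\<Sum>j<N. x $$ (b, j) * u $$ (j, s))"
      unfolding mmul_def pq using lt
      by (subst lie2_apply) (auto simp: k sum_distrib_left sum_distrib_right mult.assoc mult.left_commute)
    also have "\<dots> = (\<Sum>j<N. u $$ (a, j) * y $$ (j, r)) * u $$ (b, s) + u $$ (a, r) * (\<Sum>j<N. u $$ (b, j) * y $$ (j, s))"
      using lt by (simp add: e)
    also have "\<dots> = mmul (prs N) (kron u) (lie2 y) p q"
      unfolding mmul_def pq using lt
      by (subst lie2_apply_right) (auto simp: k sum_distrib_left sum_distrib_right mult.assoc mult.left_commute mult.commute)
    finally show ?thesis .
  next
    case False
    then show ?thesis by (auto simp: mmul_def lie2_def kron_def mcut_def)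
  qed
qed

lemma kron_adj: "u \<in> C \<Longrightarrow> madj (kron u) = kron ((cj u)\<^sup>T)"
  unfolding kron_def madj_mcut by (intro ext) (auto simp: mcut_def madj_def)

text \<open>If \<open>u\<close> normalizes the Lie algebra, \<open>u \<otimes> u\<close> maps
  invariants to invariants, so \<open>P (u \<otimes> u) P = (u \<otimes> u) P\<close>. The same for
  the adjoint of \<open>u\<close>, followed by taking adjoints, gives
  \<open>P (u \<otimes> u) P = P (u \<otimes> u)\<close>.\<close>

lemma trivial_projection_commute:
  assumes P: "trivial_projection G P" and u: "normalizes u" "normalizes ((cj u)\<^sup>T)"
  shows "mmul (prs N) (mcut (prs N) P) (kron u) = mmul (prs N) (kron u) (mcut (prs N) P)"
proof -
  let ?P = "mcut (prs N) P"
  note T = trivial_projection_matrix[OF P]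
  have PuP: "mmul (prs N) ?P (mmul (prs N) (kron u) ?P) = mmul (prs N) (kron u) ?P" if u: "normalizes u" for u
  proof -
    have cut: "mmul (prs N) (kron u) ?P = mcut (prs N) (mmul (prs N) (kron u) ?P)"
      unfolding kron_def by (rule mcut_mmul[symmetric])
    have "mmul (prs N) (lie2 x) (mmul (prs N) (kron u) ?P) = (\<lambda>_ _. 0)" if x: "x \<in> lie G" for x
    proof -
      obtain y where y: "y \<in> lie G" "x * u = u * y" using u x unfolding normalizes_def by auto
      have "mmul (prs N) (lie2 x) (mmul (prs N) (kron u) ?P) = mmul (prs N) (kron u) (mmul (prs N) (lie2 y) ?P)"
        using lie2_kron[of u x y] u lie_C[OF x] lie_C[OF y(1)] y(2)
        unfolding normalizes_def by (simp add: mmul_assoc[symmetric])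
      then show ?thesis using T(1)[OF y(1)] by simp
    qed
    then show ?thesis using T(3) cut by metis
  qed
  have uC: "u \<in> C" using u(1) unfolding normalizes_def by simp
  have ad: "madj ?P = ?P" by (rule trivial_projection_adjoint[OF P])
  have "mmul (prs N) ?P (kron u) = madj (mmul (prs N) (kron ((cj u)\<^sup>T)) ?P)"
    using uC by (simp add: madj_mmul ad kron_adj)
  also have "\<dots> = madj (mmul (prs N) ?P (mmul (prs N) (kron ((cj u)\<^sup>T)) ?P))"
    using PuP[OF u(2)] by simp
  also have "\<dots> = mmul (prs N) (mmul (prs N) ?P (kron u)) ?P"
    using uC by (simp add: madj_mmul ad kron_adj mmul_assoc)
  also have "\<dots> = mmul (prs N) (kron u) ?P"
    using PuP[OF u(1)] by (simp add: mmul_assoc)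
  finally show ?thesis .
qed

lemma normalizes_mult: "normalizes u \<Longrightarrow> normalizes v \<Longrightarrow> normalizes (u * v)"
proof -
  assume u: "normalizes u" and v: "normalizes v"
  have c: "u \<in> C" "v \<in> C" using u v unfolding normalizes_def by auto
  show ?thesis unfolding normalizes_def
  proof (intro conjI ballI)
    show "u * v \<in> C" using c by simp
    fix x assume x: "x \<in> lie G"
    obtain y where y: "y \<in> lie G" "x * u = u * y" using u x unfolding normalizes_def by auto
    obtain z where z: "z \<in> lie G" "y * v = v * z" using v y unfolding normalizes_def by auto
    have "x * (u * v) = (x * u) * v" using c lie_C[OF x] by (simp add: sq)
    also have "\<dots> = u * (y * v)" unfolding y(2) using c lie_C[OF y(1)] by (simp add: sq)
    also have "\<dots> = u * v * z" unfolding z(2) using c lie_C[OF z(1)] by (simp add: sq)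
    finally show "\<exists>y\<in>lie G. x * (u * v) = u * v * y" using z by blast
  qed
qed

lemma normalizes_smult: "normalizes u \<Longrightarrow> normalizes (a \<cdot>\<^sub>m u)"
  unfolding normalizes_def by (auto simp: sq dest: lie_C) (metis lie_C sq_smult(1,2))

lemma normalizes_K: "k \<in> K_of G \<Longrightarrow> normalizes k"
proof -
  assume k: "k \<in> K_of G"
  note [simp] = K_D(1)[OF k]
  show ?thesis unfolding normalizes_def
  proof (intro conjI ballI)
    fix x assume x: "x \<in> lie G"
    have "x * k = k * (k\<^sup>T * x * k)" using lie_C[OF x] by (simp add: sq cancel1[OF K_D(4)[OF k]])
    then show "\<exists>y\<in>lie G. x * k = k * y" using lie_ad[OF K_transpose[OF k] x] by auto
  qed simp
qed

end

section \<open>Operators on tensor products\<close>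

lemma words_eq: "words G l = wds (vdim G) l"
  unfolding words_def wds_def ..

abbreviation ent :: "complex mat \<Rightarrow> nat \<Rightarrow> nat \<Rightarrow> complex" where
  "ent x \<equiv> \<lambda>a b. x $$ (a, b)"

locale tns = M: cvs M for G :: real_group and M :: "'x cspace" and l :: nat
begin

abbreviation W :: "nat list set" where "W \<equiv> wds (vdim G) l"

abbreviation TS :: "(nat list \<Rightarrow> 'x) cspace" where "TS \<equiv> tensor_space G M l"

lemma TS_simps [simp]:
  "T \<in> carrier TS \<longleftrightarrow> (\<forall>I\<in>W. T I \<in> carrier M) \<and> (\<forall>I. I \<notin> W \<longrightarrow> T I = \<zero>\<^bsub>M\<^esub>)"
  "\<zero>\<^bsub>TS\<^esub> = (\<lambda>I. \<zero>\<^bsub>M\<^esub>)" "T \<oplus>\<^bsub>TS\<^esub> S = (\<lambda>I. T I \<oplus>\<^bsub>M\<^esub> S I)" "a \<odot>\<^bsub>TS\<^esub> T = (\<lambda>I. a \<odot>\<^bsub>M\<^esub> T I)"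
  unfolding tensor_space_def words_eq by auto

lemma TS_closed: "T \<in> carrier TS \<Longrightarrow> T I \<in> carrier M"
  by (cases "I \<in> W") auto

lemma TS_eqI: "T \<in> carrier TS \<Longrightarrow> S \<in> carrier TS \<Longrightarrow> (\<And>I. I \<in> W \<Longrightarrow> T I = S I) \<Longrightarrow> T = S"
  by (rule ext) (metis TS_simps(1))

lemma cvs_TS: "cvs TS"
proof (rule cvsI)
  fix T S U :: "nat list \<Rightarrow> 'x" and a b
  assume T: "T \<in> carrier TS"
  note [simp] = TS_closed[OF T]
  show "a \<odot>\<^bsub>TS\<^esub> T \<in> carrier TS" "\<zero>\<^bsub>TS\<^esub> \<oplus>\<^bsub>TS\<^esub> T = T" "1 \<odot>\<^bsub>TS\<^esub> T = T" "(a * b) \<odot>\<^bsub>TS\<^esub> T = a \<odot>\<^bsub>TS\<^esub> (b \<odot>\<^bsub>TS\<^esub> T)"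
    "(a + b) \<odot>\<^bsub>TS\<^esub> T = a \<odot>\<^bsub>TS\<^esub> T \<oplus>\<^bsub>TS\<^esub> b \<odot>\<^bsub>TS\<^esub> T" "(- 1) \<odot>\<^bsub>TS\<^esub> T \<oplus>\<^bsub>TS\<^esub> T = \<zero>\<^bsub>TS\<^esub>"
    using T by (auto simp: M.sm_assoc M.sm_ladd M.sm_neg M.M.l_neg)
  assume S: "S \<in> carrier TS"
  note [simp] = TS_closed[OF S]
  show "T \<oplus>\<^bsub>TS\<^esub> S \<in> carrier TS" "T \<oplus>\<^bsub>TS\<^esub> S = S \<oplus>\<^bsub>TS\<^esub> T"
    "a \<odot>\<^bsub>TS\<^esub> (T \<oplus>\<^bsub>TS\<^esub> S) = a \<odot>\<^bsub>TS\<^esub> T \<oplus>\<^bsub>TS\<^esub> a \<odot>\<^bsub>TS\<^esub> S"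
    using T S by (auto simp: M.sm_radd M.M.a_comm)
  assume U: "U \<in> carrier TS"
  note [simp] = TS_closed[OF U]
  show "T \<oplus>\<^bsub>TS\<^esub> S \<oplus>\<^bsub>TS\<^esub> U = T \<oplus>\<^bsub>TS\<^esub> (S \<oplus>\<^bsub>TS\<^esub> U)"
    by (auto simp: M.M.a_assoc)
qed auto

sublocale TS: cvs TS by (rule cvs_TS)

lemma TS_finsum:
  assumes "f \<in> A \<rightarrow> carrier TS"
  shows "finsum TS f A I = finsum M (\<lambda>i. f i I) A"
  using assms
proof (induction A rule: infinite_finite_induct)
  case (insert a A)
  then have c: "f a \<in> carrier TS" "f \<in> A \<rightarrow> carrier TS" by auto
  have "(\<lambda>i. f i I) \<in> A \<rightarrow> carrier M"
    using c(2) TS_closed by blast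
  then show ?case
    using insert c TS_closed[OF c(1)] TS.M.finsum_insert[OF insert(1,2) c(2,1)] by simp
qed simp_all

text \<open>The operator \<open>1 \<otimes> A\<close> for a scalar matrix \<open>A\<close> over
  words, with \<open>lop L\<close> below as its counterpart \<open>L \<otimes> 1\<close>. The value
  zero off \<open>W\<close> keeps the result in the carrier of \<open>TS\<close>.\<close>

definition wop :: "(nat list \<Rightarrow> nat list \<Rightarrow> complex) \<Rightarrow> (nat list \<Rightarrow> 'x) \<Rightarrow> nat list \<Rightarrow> 'x" where
  "wop A T = (\<lambda>I. if I \<in> W then finsum M (\<lambda>J. A I J \<odot>\<^bsub>M\<^esub> T J) W else \<zero>\<^bsub>M\<^esub>)"

definition lop :: "('x \<Rightarrow> 'x) \<Rightarrow> (nat list \<Rightarrow> 'x) \<Rightarrow> nat list \<Rightarrow> 'x" where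
  "lop L T = (\<lambda>I. if I \<in> W then L (T I) else \<zero>\<^bsub>M\<^esub>)"

lemma wop_closed [simp]: "T \<in> carrier TS \<Longrightarrow> wop A T \<in> carrier TS"
  by (auto simp: wop_def intro!: M.M.finsum_closed)

lemma lop_closed [simp]: "clinear M M L \<Longrightarrow> T \<in> carrier TS \<Longrightarrow> lop L T \<in> carrier TS"
  by (auto simp: lop_def clinear_simps(1))

lemma clinear_wop: "clinear TS TS (wop A)"
proof (rule clinearI)
  fix T S assume T: "T \<in> carrier TS" and S: "S \<in> carrier TS"
  show "wop A T \<in> carrier TS" by (rule wop_closed[OF T])
  show "wop A (T \<oplus>\<^bsub>TS\<^esub> S) = wop A T \<oplus>\<^bsub>TS\<^esub> wop A S"
    using TS_closed[OF T] TS_closed[OF S]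
    by (auto simp: wop_def M.sm_radd M.finsum_add Pi_def)
next
  fix T a assume T: "T \<in> carrier TS"
  show "wop A (a \<odot>\<^bsub>TS\<^esub> T) = a \<odot>\<^bsub>TS\<^esub> wop A T"
    using TS_closed[OF T]
    by (auto simp: wop_def M.sm_finsum Pi_def M.sm_assoc[symmetric] mult.commute)
qed

lemma clinear_lop:
  assumes L: "clinear M M L" shows "clinear TS TS (lop L)"
proof (rule clinearI)
  fix T S assume T: "T \<in> carrier TS" and S: "S \<in> carrier TS"
  show "lop L T \<in> carrier TS" by (rule lop_closed[OF L T])
  show "lop L (T \<oplus>\<^bsub>TS\<^esub> S) = lop L T \<oplus>\<^bsub>TS\<^esub> lop L S"
    using TS_closed[OF T] TS_closed[OF S] clinear_simps(3)[OF L] by (auto simp: lop_def)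
next
  fix T a assume T: "T \<in> carrier TS"
  show "lop L (a \<odot>\<^bsub>TS\<^esub> T) = a \<odot>\<^bsub>TS\<^esub> lop L T"
    using TS_closed[OF T] clinear_simps(2)[OF L] by (auto simp: lop_def)
qed

lemma wop_comp:
  assumes T: "T \<in> carrier TS"
  shows "wop A (wop B T) = wop (mmul W A B) T"
proof
  fix I
  note [simp] = TS_closed[OF T]
  have "finsum M (\<lambda>J. A I J \<odot>\<^bsub>M\<^esub> finsum M (\<lambda>K. B J K \<odot>\<^bsub>M\<^esub> T K) W) W =
      finsum M (\<lambda>J. finsum M (\<lambda>K. (A I J * B J K) \<odot>\<^bsub>M\<^esub> T K) W) W"
    by (simp add: M.sm_finsum Pi_def M.sm_assoc)
  also have "\<dots> = finsum M (\<lambda>K. finsum M (\<lambda>J. (A I J * B J K) \<odot>\<^bsub>M\<^esub> T K) W) W"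
    by (rule M.finsum_swap) auto
  also have "\<dots> = finsum M (\<lambda>K. mmul W A B I K \<odot>\<^bsub>M\<^esub> T K) W"
    by (simp add: mmul_def M.finsum_sm)
  finally have "finsum M (\<lambda>J. A I J \<odot>\<^bsub>M\<^esub> finsum M (\<lambda>K. B J K \<odot>\<^bsub>M\<^esub> T K) W) W =
    finsum M (\<lambda>K. mmul W A B I K \<odot>\<^bsub>M\<^esub> T K) W" .
  moreover have "finsum M (\<lambda>J. A I J \<odot>\<^bsub>M\<^esub> wop B T J) W = finsum M (\<lambda>J. A I J \<odot>\<^bsub>M\<^esub> finsum M (\<lambda>K. B J K \<odot>\<^bsub>M\<^esub> T K) W) W"
    by (rule M.M.finsum_cong') (auto simp: wop_def intro!: M.sm_closed M.M.finsum_closed)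
  ultimately show "wop A (wop B T) I = wop (mmul W A B) T I"
    by (simp add: wop_def)
qed

lemma wop_cong:
  assumes T: "T \<in> carrier TS" and "\<And>I J. I \<in> W \<Longrightarrow> J \<in> W \<Longrightarrow> A I J = B I J"
  shows "wop A T = wop B T"
proof
  fix I
  show "wop A T I = wop B T I"
    unfolding wop_def using assms TS_closed[OF T] by (auto intro!: M.M.finsum_cong')
qed

lemma wop_dlt: "T \<in> carrier TS \<Longrightarrow> wop dlt T = T"
proof
  fix I assume T: "T \<in> carrier TS"
  note [simp] = TS_closed[OF T]
  have "finsum M (\<lambda>J. dlt I J \<odot>\<^bsub>M\<^esub> T J) W = T I" if "I \<in> W"
    using M.finsum_delta'[of W I T] that unfolding dlt_def by (simp add: eq_commute[of I])
  then show "wop dlt T I = T I" using T by (auto simp: wop_def)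
qed

text \<open>For operators on few factors: row \<open>I\<close> is then a short sum of unit rows,
  indexed by the new letters. Different indices may lead to the same word, since the coefficients
  are added.\<close>

lemma wop_local:
  assumes T: "T \<in> carrier TS" and I: "I \<in> W"
    and A: "\<And>J. J \<in> W \<Longrightarrow> A I J = (\<Sum>p\<in>Q. a p * dlt J (\<phi> p))"
    and \<phi>: "\<And>p. p \<in> Q \<Longrightarrow> \<phi> p \<in> W" and fin: "finite Q"
  shows "wop A T I = finsum M (\<lambda>p. a p \<odot>\<^bsub>M\<^esub> T (\<phi> p)) Q"
proof -
  note [simp] = TS_closed[OF T]
  have "wop A T I = finsum M (\<lambda>J. finsum M (\<lambda>p. (a p * dlt J (\<phi> p)) \<odot>\<^bsub>M\<^esub> T J) Q) W"
    unfolding wop_def using I A fin by (auto simp: M.finsum_sm intro!: M.M.finsum_cong' M.M.finsum_closed)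
  also have "\<dots> = finsum M (\<lambda>p. finsum M (\<lambda>J. (a p * dlt J (\<phi> p)) \<odot>\<^bsub>M\<^esub> T J) W) Q"
    by (rule M.finsum_swap) (use fin in auto)
  also have "\<dots> = finsum M (\<lambda>p. a p \<odot>\<^bsub>M\<^esub> T (\<phi> p)) Q"
  proof (rule M.M.finsum_cong')
    fix p assume p: "p \<in> Q"
    have "finsum M (\<lambda>J. (a p * dlt J (\<phi> p)) \<odot>\<^bsub>M\<^esub> T J) W = a p \<odot>\<^bsub>M\<^esub> finsum M (\<lambda>J. dlt J (\<phi> p) \<odot>\<^bsub>M\<^esub> T J) W"
      by (simp add: M.sm_finsum Pi_def M.sm_assoc)
    also have "finsum M (\<lambda>J. dlt J (\<phi> p) \<odot>\<^bsub>M\<^esub> T J) W = T (\<phi> p)"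
      using M.finsum_delta'[of W "\<phi> p" T] \<phi>[OF p] unfolding dlt_def by simp
    finally show "finsum M (\<lambda>J. (a p * dlt J (\<phi> p)) \<odot>\<^bsub>M\<^esub> T J) W = a p \<odot>\<^bsub>M\<^esub> T (\<phi> p)" .
  qed auto
  finally show ?thesis .
qed

lemma lop_wop:
  assumes L: "clinear M M L" and T: "T \<in> carrier TS"
  shows "lop L (wop A T) = wop A (lop L T)"
proof
  fix I
  note [simp] = TS_closed[OF T]
  have "L (finsum M (\<lambda>J. A I J \<odot>\<^bsub>M\<^esub> T J) W) = finsum M (\<lambda>J. L (A I J \<odot>\<^bsub>M\<^esub> T J)) W"
    by (rule clinear_finsum[OF M.cvs_axioms M.cvs_axioms L]) auto
  also have "\<dots> = finsum M (\<lambda>J. A I J \<odot>\<^bsub>M\<^esub> lop L T J) W"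
    by (rule M.M.finsum_cong') (auto simp: lop_def clinear_simps[OF L])
  finally show "lop L (wop A T) I = wop A (lop L T) I"
    by (auto simp: lop_def wop_def)
qed

lemma factor_op_eq:
  assumes T: "T \<in> carrier TS" and i: "1 \<le> i" "i \<le> l"
  shows "factor_op G M l i x T = wop (loc1 l (i - 1) (ent x)) T"
proof
  fix I
  show "factor_op G M l i x T I = wop (loc1 l (i - 1) (ent x)) T I"
  proof (cases "I \<in> W")
    case True
    have "wop (loc1 l (i - 1) (ent x)) T I = finsum M (\<lambda>j. ent x (I ! (i - 1)) j \<odot>\<^bsub>M\<^esub> T (I[i - 1 := j])) {..<vdim G}"
      by (rule wop_local[OF T True]) (use i wds_update[OF True] loc1_eq[OF True, of _ "i - 1" "ent x"] in auto)
    then show ?thesis using True unfolding factor_op_def words_eq by simp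
  qed (simp add: factor_op_def words_eq wop_def)
qed

lemma loc2_wop:
  assumes T: "T \<in> carrier TS" and I: "I \<in> W" and i: "i < l" "j < l" "i \<noteq> j"
  shows "wop (loc2 l i j Q) T I =
    finsum M (\<lambda>p. Q (I ! i, I ! j) p \<odot>\<^bsub>M\<^esub> T (I[i := fst p, j := snd p])) (prs (vdim G))"
  by (rule wop_local[OF T I]) (use wds_update[OF wds_update[OF I]] loc2_eq(1)[OF I _ i, of _ Q] in auto)

lemma flip_eq:
  assumes T: "T \<in> carrier TS" and i: "1 \<le> i" "i < l"
  shows "(\<lambda>I. T (I[i - 1 := I ! i, i := I ! (i - 1)])) =
    wop (loc2 l (i - 1) i (\<lambda>p q. dlt q (snd p, fst p))) T"
proof
  fix I
  show "T (I[i - 1 := I ! i, i := I ! (i - 1)]) =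
    wop (loc2 l (i - 1) i (\<lambda>p q. dlt q (snd p, fst p))) T I"
  proof (cases "I \<in> W")
    case True
    note [simp] = TS_closed[OF T]
    have "wop (loc2 l (i - 1) i (\<lambda>p q. dlt q (snd p, fst p))) T I =
      finsum M (\<lambda>p. dlt p (I ! i, I ! (i - 1)) \<odot>\<^bsub>M\<^esub> T (I[i - 1 := fst p, i := snd p])) (prs (vdim G))"
      by (subst loc2_wop[OF T True]) (use i in auto)
    also have "\<dots> = T (I[i - 1 := I ! i, i := I ! (i - 1)])"
      using M.finsum_delta'[of "prs (vdim G)" "(I ! i, I ! (i - 1))" "\<lambda>p. T (I[i - 1 := fst p, i := snd p])"]
        wds_nth[OF True] i unfolding dlt_def by simp
    finally show ?thesis by simp
  next
    case False
    \<comment> \<open>The flip is a bare reindexing with no test for membership in \<open>W\<close>.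
      Outside \<open>W\<close> it does not lead back into \<open>W\<close>, because it is an
      involution preserving \<open>W\<close>.\<close>
    have "I[i - 1 := I ! i, i := I ! (i - 1)] \<notin> W"
    proof
      assume J: "I[i - 1 := I ! i, i := I ! (i - 1)] \<in> W"
      then have len: "length I = l" by (auto dest: wds_length)
      define J' where "J' = I[i - 1 := I ! i, i := I ! (i - 1)]"
      have "I = J'[i - 1 := J' ! i, i := J' ! (i - 1)]"
        unfolding J'_def using i len by (auto simp: list_eq_iff_nth_eq nth_list_update)
      moreover have "J'[i - 1 := J' ! i, i := J' ! (i - 1)] \<in> W"
        using wds_update[OF wds_update[OF J wds_nth[OF J, of i]] wds_nth[OF J, of "i - 1"]] i
        unfolding J'_def[symmetric] by simp
      ultimately have "I \<in> W" by simp
      then show False using False by simp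
    qed
    then show ?thesis using T False by (simp add: wop_def)
  qed
qed

end

context rgrp
begin

text \<open>The Gram matrix of the form \<open>\<langle>v, \<xi> w\<rangle>\<close> on \<open>V\<close>.\<close>
definition tw :: "(complex vec \<Rightarrow> complex vec \<Rightarrow> complex) \<Rightarrow> complex mat" where
  "tw h = gram N h * cj \<xi>"

lemma tw_closed [simp]: "tw h \<in> C"
  by (simp add: tw_def sq_closed)

lemma cj_xi: "cj \<xi> = cnj c \<cdot>\<^sub>m F"
  unfolding xi_eq by simp

lemma tw_eq: "tw h = cnj c \<cdot>\<^sub>m (gram N h * F)"
  unfolding tw_def cj_xi by (simp add: sq)

text \<open>In the twisted form \<open>x\<close> has adjoint \<open>- cj x\<close>, the rule
  \<open>*\<close> that holds on \<open>X\<close>; the untwisted form on \<open>V\<close> obeys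
  \<open>\<bullet>\<close> instead. The sign comes from the transpose on the Lie algebra, the rest
  from the Gram matrix commuting with \<open>x\<close> and \<open>F\<close>.\<close>

lemma lie_tw:
  assumes V: "V_form G h" and x: "x \<in> lie G"
  shows "x\<^sup>T * tw h = - (tw h * x)"
proof -
  let ?A = "gram N h"
  have [simp]: "?A \<in> C" "x \<in> C" using lie_C[OF x] by auto
  have FA: "F * ?A = ?A * F" by (rule gram_commute_K[OF V K_F])
  have FFA: "F\<^sup>T * (?A * F) = ?A"
    unfolding FA[symmetric] by (simp add: cancel1[OF F_orth])
  have "F * (x * F\<^sup>T) * (?A * F) = F * (x * ?A)"
    by (simp add: sq FFA)
  also have "\<dots> = F * (?A * x)" using gram_commute_lie[OF V x] by simp
  also have "\<dots> = (F * ?A) * x" by (simp add: sq)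
  also have "\<dots> = ?A * (F * x)" unfolding FA by (simp add: sq)
  finally have 1: "F * (x * F\<^sup>T) * (?A * F) = ?A * (F * x)" .
  show ?thesis
    unfolding lie_transpose_eq[OF x] tw_eq using 1
    by (simp add: sq sq_neg) (auto intro!: eq_matI simp: carrier_matD[OF F_closed])
qed

text \<open>This is the symmetry of \<open>\<xi>\<close> for the twisted form, and hence that of the
  generators \<open>\<theta>_i\<close>.\<close>

lemma xi_tw:
  assumes V: "V_form G h"
  shows "\<xi>\<^sup>T * tw h = tw h * cj \<xi>"
proof -
  have FA: "F * gram N h = gram N h * F" by (rule gram_commute_K[OF V K_F])
  have "F * (gram N h * F) = gram N h * (F * F)"
    using arg_cong[OF FA, of "\<lambda>Z. Z * F"] by (simp add: sq)
  \<comment> \<open>Here \<open>c\<close> is \<open>\<i>\<close> or 1, so its cube is its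
    conjugate.\<close>
  moreover have "c * (c * c) = cnj c"
    by (cases G) auto
  ultimately show ?thesis
    unfolding tw_eq cj_xi xi_eq by (simp add: sq F_transpose mult.assoc)
qed

lemma normalizes_commuting:
  assumes "u \<in> C" "\<And>x. x \<in> lie G \<Longrightarrow> x * u = u * x" shows "normalizes u"
  using assms unfolding normalizes_def by blast

text \<open>Up to a scalar each matrix is the product of an element of \<open>K\<close> and a matrix
  commuting with the Lie algebra. The two are adjoint to each other, as
  \<open>trivial_projection_commute\<close> asks.\<close>

lemma normalizes_tw:
  assumes V: "V_form G h"
  shows "normalizes (cj (tw h))" "normalizes ((tw h)\<^sup>T)"
proof -
  let ?A = "gram N h"
  have [simp]: "?A \<in> C" by simp
  have 1: "normalizes (cj ?A)"
  proof (rule normalizes_commuting)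
    fix x assume x: "x \<in> lie G"
    then have "cj (cj x * ?A) = cj (?A * cj x)" using gram_commute_lie[OF V lie_cj] by simp
    then show "x * cj ?A = cj ?A * x" using lie_C[OF x] by (simp add: sq_cj sq_closed)
  qed simp
  have "cj (tw h) = c \<cdot>\<^sub>m (cj ?A * F)"
    unfolding tw_eq by (simp add: sq_cj sq_closed)
  then show "normalizes (cj (tw h))"
    using normalizes_smult[OF normalizes_mult[OF 1 normalizes_K[OF K_F]]] by simp
  have 2: "normalizes (?A\<^sup>T)"
  proof (rule normalizes_commuting)
    fix x assume x: "x \<in> lie G"
    have "x\<^sup>T \<in> lie G" using lie_cj_transpose[OF lie_cj[OF x]] by simp
    then have "(x\<^sup>T * ?A)\<^sup>T = (?A * x\<^sup>T)\<^sup>T" using gram_commute_lie[OF V] by simp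
    then show "x * ?A\<^sup>T = ?A\<^sup>T * x" using lie_C[OF x] by (simp add: sq)
  qed simp
  have "(tw h)\<^sup>T = cnj c \<cdot>\<^sub>m (F\<^sup>T * ?A\<^sup>T)"
    unfolding tw_eq by (simp add: sq)
  then show "normalizes ((tw h)\<^sup>T)"
    using normalizes_smult[OF normalizes_mult[OF normalizes_K[OF K_transpose[OF K_F]] 2]] by simp
qed

end

lemma sum_reverse3:
  "(\<Sum>i\<in>A. \<Sum>j\<in>B. \<Sum>k\<in>D. f i j k) = (\<Sum>k\<in>D. \<Sum>j\<in>B. \<Sum>i\<in>A. f i j k)"
proof -
  have "(\<Sum>i\<in>A. \<Sum>j\<in>B. \<Sum>k\<in>D. f i j k) = (\<Sum>i\<in>A. \<Sum>k\<in>D. \<Sum>j\<in>B. f i j k)"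
    by (intro sum.cong refl sum.swap)
  also have "\<dots> = (\<Sum>k\<in>D. \<Sum>i\<in>A. \<Sum>j\<in>B. f i j k)" by (rule sum.swap)
  also have "\<dots> = (\<Sum>k\<in>D. \<Sum>j\<in>B. \<Sum>i\<in>A. f i j k)"
    by (intro sum.cong refl sum.swap)
  finally show ?thesis .
qed

section \<open>Forms and group action on the tensor product\<close>

locale gk_tens = casimir G B d for G B d +
  fixes X :: "'x gk_module" and l :: nat and hV P
  assumes gk: "is_gk_module G X" and V: "V_form G hV" and P: "trivial_projection G P"
begin

abbreviation M where "M \<equiv> gk_space X"
abbreviation \<pi> where "\<pi> \<equiv> gk_lie X"
abbreviation \<kappa> where "\<kappa> \<equiv> gk_grp X"

lemma cvsM: "cvs M"
  using gk unfolding is_gk_module_def by (auto simp: Let_def intro: cvs.intro)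

sublocale tns G M l
  by (intro tns.intro cvsM)

lemma pi_linear: "x \<in> lie G \<Longrightarrow> clinear M M (\<pi> x)"
  using gk unfolding is_gk_module_def Let_def by blast

lemma pi_add: "x \<in> lie G \<Longrightarrow> y \<in> lie G \<Longrightarrow> v \<in> carrier M \<Longrightarrow> \<pi> (x + y) v = \<pi> x v \<oplus>\<^bsub>M\<^esub> \<pi> y v"
  and pi_smult: "x \<in> lie G \<Longrightarrow> v \<in> carrier M \<Longrightarrow> \<pi> (a \<cdot>\<^sub>m x) v = a \<odot>\<^bsub>M\<^esub> \<pi> x v"
  using gk unfolding is_gk_module_def Let_def by blast+

lemma kappa_linear: "k \<in> K_of G \<Longrightarrow> clinear M M (\<kappa> k)"
  using gk unfolding is_gk_module_def Let_def by blast

lemma kappa_pi: "k \<in> K_of G \<Longrightarrow> x \<in> lie G \<Longrightarrow> v \<in> carrier M \<Longrightarrow> \<kappa> k (\<pi> x v) = \<pi> (k * x * k\<^sup>T) (\<kappa> k v)"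
proof -
  assume k: "k \<in> K_of G" and x: "x \<in> lie G" "v \<in> carrier M"
  then have "\<kappa> k (\<pi> x v) = \<pi> (k * x * mat_inv k) (\<kappa> k v)"
    using gk unfolding is_gk_module_def Let_def by blast
  then show ?thesis unfolding K_inv[OF k] .
qed

lemma pi_closed: "x \<in> lie G \<Longrightarrow> v \<in> carrier M \<Longrightarrow> \<pi> x v \<in> carrier M"
  by (rule clinear_simps(1)[OF pi_linear])

text \<open>The Casimir tensor \<open>\<Sum> b \<otimes> b\<^sup>*\<close>, applied to \<open>v\<close> in the first factor and to a linear
  functional in the second.\<close>

lemma casimir_vector:
  assumes a: "lie_auto s \<tau> \<sigma>" and \<psi>: "lfun \<psi>" and v: "v \<in> carrier M"
  shows "finsum M (\<lambda>b. \<psi> (\<tau> (d b)) \<odot>\<^bsub>M\<^esub> \<pi> (\<tau> b) v) B = finsum M (\<lambda>b. \<psi> (d b) \<odot>\<^bsub>M\<^esub> \<pi> b v) B"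
proof -
  have pl: "clinear (lie_space G) M (\<lambda>x. \<pi> x v)"
    by (rule clinearI) (use v pi_add pi_smult pi_closed in auto)
  have ex: "\<pi> x v = finsum M (\<lambda>b. kil x (d b) \<odot>\<^bsub>M\<^esub> \<pi> b v) B" if x: "x \<in> lie G" for x
  proof -
    have "\<pi> x v = \<pi> (finsum (lie_space G) (\<lambda>b. lie_coord G B x b \<cdot>\<^sub>m b) B) v"
      using coord_expansion[OF basis x] by simp
    also have "\<dots> = finsum M (\<lambda>b. \<pi> (lie_coord G B x b \<cdot>\<^sub>m b) v) B"
      by (rule clinear_finsum[OF cvs_lie cvsM pl]) (use Bl lie_smult in auto)
    also have "\<dots> = finsum M (\<lambda>b. kil x (d b) \<odot>\<^bsub>M\<^esub> \<pi> b v) B"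
      by (rule M.M.finsum_cong') (use pi_smult v Bl coord_kil[OF x] pi_closed in auto)
    finally show ?thesis .
  qed
  have "finsum M (\<lambda>b. \<psi> (\<tau> (d b)) \<odot>\<^bsub>M\<^esub> \<pi> (\<tau> b) v) B =
      finsum M (\<lambda>b. finsum M (\<lambda>e. (\<psi> (\<tau> (d b)) * kil (\<tau> b) (d e)) \<odot>\<^bsub>M\<^esub> \<pi> e v) B) B"
  proof (rule M.M.finsum_cong')
    fix b assume b: "b \<in> B"
    have "\<psi> (\<tau> (d b)) \<odot>\<^bsub>M\<^esub> \<pi> (\<tau> b) v = \<psi> (\<tau> (d b)) \<odot>\<^bsub>M\<^esub> finsum M (\<lambda>e. kil (\<tau> b) (d e) \<odot>\<^bsub>M\<^esub> \<pi> e v) B"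
      using ex lie_auto_D(1)[OF a Bl(1)[OF b]] by simp
    also have "\<dots> = finsum M (\<lambda>e. (\<psi> (\<tau> (d b)) * kil (\<tau> b) (d e)) \<odot>\<^bsub>M\<^esub> \<pi> e v) B"
      using pi_closed[OF Bl(1) v] by (simp add: M.sm_finsum Pi_def M.sm_assoc cong: M.M.finsum_cong)
    finally show "\<psi> (\<tau> (d b)) \<odot>\<^bsub>M\<^esub> \<pi> (\<tau> b) v = finsum M (\<lambda>e. (\<psi> (\<tau> (d b)) * kil (\<tau> b) (d e)) \<odot>\<^bsub>M\<^esub> \<pi> e v) B" .
  qed (use pi_closed Bl v in \<open>auto intro!: M.M.finsum_closed\<close>)
  also have "\<dots> = finsum M (\<lambda>e. finsum M (\<lambda>b. (\<psi> (\<tau> (d b)) * kil (\<tau> b) (d e)) \<odot>\<^bsub>M\<^esub> \<pi> e v) B) B"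
    by (rule M.finsum_swap) (use finB pi_closed Bl v in auto)
  also have "\<dots> = finsum M (\<lambda>e. (\<Sum>b\<in>B. kil (\<tau> b) (d e) * \<psi> (\<tau> (d b))) \<odot>\<^bsub>M\<^esub> \<pi> e v) B"
    by (rule M.M.finsum_cong') (use finB pi_closed Bl v in \<open>auto simp: M.finsum_sm mult.commute\<close>)
  also have "\<dots> = finsum M (\<lambda>e. \<psi> (d e) \<odot>\<^bsub>M\<^esub> \<pi> e v) B"
    by (rule M.M.finsum_cong') (use casimir_auto[OF a \<psi> Bl(2)] pi_closed Bl v in auto)
  finally show ?thesis .
qed

abbreviation tk where "tk k \<equiv> tens l (\<lambda>m. ent k)"

lemma tensor_grp_eq:
  assumes T: "T \<in> carrier TS" and k: "k \<in> K_of G"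
  shows "tensor_grp G X l k T = wop (tk k) (lop (\<kappa> k) T)"
proof
  fix I
  show "tensor_grp G X l k T I = wop (tk k) (lop (\<kappa> k) T) I"
    unfolding tensor_grp_def wop_def words_eq tens_def lop_def
    using clinear_simps(1)[OF kappa_linear[OF k]] TS_closed[OF T] by (auto intro!: M.M.finsum_cong')
qed

definition tf :: "('x \<Rightarrow> 'x \<Rightarrow> complex) \<Rightarrow> (nat list \<Rightarrow> 'x) \<Rightarrow> (nat list \<Rightarrow> 'x) \<Rightarrow> complex" where
  "tf h T S = tensor_form G hV h l T (wop (tk \<xi>) S)"

lemma tensor_form_eq:
  "tensor_form G hV h l T S = (\<Sum>I\<in>W. \<Sum>J\<in>W. h (T I) (S J) * tens l (\<lambda>m. ent (gram N hV)) I J)"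
  unfolding tensor_form_def words_eq tens_def gram_def using wds_nth by (auto intro!: sum.cong prod.cong)

lemma tensor_form_hermitian:
  assumes h: "hermitian_form M h" shows "hermitian_form TS (tensor_form G hV h l)"
proof -
  interpret h: sesq M h by (intro sesq.intro sesq_axioms.intro cvsM h)
  show ?thesis
    unfolding hermitian_form_def tensor_form_eq
  proof (intro ballI allI)
    fix T S U a assume c: "T \<in> carrier TS" "S \<in> carrier TS" "U \<in> carrier TS"
    note [simp] = TS_closed[OF c(1)] TS_closed[OF c(2)] TS_closed[OF c(3)]
    show "(\<Sum>I\<in>W. \<Sum>J\<in>W. h ((T \<oplus>\<^bsub>TS\<^esub> S) I) (U J) * tens l (\<lambda>m. ent (gram N hV)) I J) =
        (\<Sum>I\<in>W. \<Sum>J\<in>W. h (T I) (U J) * tens l (\<lambda>m. ent (gram N hV)) I J) +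
        (\<Sum>I\<in>W. \<Sum>J\<in>W. h (S I) (U J) * tens l (\<lambda>m. ent (gram N hV)) I J) \<and>
       (\<Sum>I\<in>W. \<Sum>J\<in>W. h ((a \<odot>\<^bsub>TS\<^esub> T) I) (U J) * tens l (\<lambda>m. ent (gram N hV)) I J) =
        a * (\<Sum>I\<in>W. \<Sum>J\<in>W. h (T I) (U J) * tens l (\<lambda>m. ent (gram N hV)) I J) \<and>
       (\<Sum>I\<in>W. \<Sum>J\<in>W. h (U I) ((T \<oplus>\<^bsub>TS\<^esub> S) J) * tens l (\<lambda>m. ent (gram N hV)) I J) =
        (\<Sum>I\<in>W. \<Sum>J\<in>W. h (U I) (T J) * tens l (\<lambda>m. ent (gram N hV)) I J) +
        (\<Sum>I\<in>W. \<Sum>J\<in>W. h (U I) (S J) * tens l (\<lambda>m. ent (gram N hV)) I J) \<and>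
       (\<Sum>I\<in>W. \<Sum>J\<in>W. h (U I) ((a \<odot>\<^bsub>TS\<^esub> T) J) * tens l (\<lambda>m. ent (gram N hV)) I J) =
        cnj a * (\<Sum>I\<in>W. \<Sum>J\<in>W. h (U I) (T J) * tens l (\<lambda>m. ent (gram N hV)) I J)"
      by (simp add: distrib_right sum.distrib sum_distrib_left mult.assoc)
  qed
qed

lemma tf_hermitian:
  assumes h: "hermitian_form M h" shows "hermitian_form TS (tf h)"
proof -
  interpret t: sesq TS "tensor_form G hV h l"
    by (intro sesq.intro sesq_axioms.intro cvs_TS tensor_form_hermitian h)
  note w = clinear_simps[OF clinear_wop]
  show ?thesis
    unfolding hermitian_form_def tf_def
    using t.H_add t.H_sm w by (simp del: TS_simps)
qed

text \<open>Moving \<open>\<xi> \<otimes> \<dots> \<otimes> \<xi>\<close> from the conjugate linear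
  variable into the Gram matrix replaces \<open>gram N hV\<close> by \<open>tw hV\<close> in every
  factor.\<close>

lemma tf_eq:
  assumes h: "hermitian_form M h" and T: "T \<in> carrier TS" and S: "S \<in> carrier TS"
  shows "tf h T S = (\<Sum>I\<in>W. \<Sum>J\<in>W. h (T I) (S J) * tens l (\<lambda>m. ent (tw hV)) I J)"
proof -
  interpret h: sesq M h by (intro sesq.intro sesq_axioms.intro cvsM h)
  note [simp] = TS_closed[OF T] TS_closed[OF S]
  have hw: "h (T I) (wop (tk \<xi>) S J) = (\<Sum>K\<in>W. cnj (tk \<xi> J K) * h (T I) (S K))" if "J \<in> W" for I J
    using that unfolding wop_def by (simp add: h.H_finsum Pi_def)
  have cx: "cnj (tk \<xi> J K) = tk (cj \<xi>) J K" if "J \<in> W" "K \<in> W" for J K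
    unfolding tens_def cnj_prod
    using wds_nth[OF that(1)] wds_nth[OF that(2)] by (intro prod.cong) (auto simp: carrier_matD[OF xi_closed])
  have tg: "(\<Sum>J\<in>W. tk (gram N hV) I J * tk (cj \<xi>) J K) = tk (tw hV) I K" if "I \<in> W" "K \<in> W" for I K
    unfolding tens_mult[OF that] tw_def
    by (rule tens_cong[OF that]) (simp add: sq_index sq_closed del: index_mult_mat)
  have "tf h T S = (\<Sum>I\<in>W. \<Sum>J\<in>W. \<Sum>K\<in>W. h (T I) (S K) * (tk (gram N hV) I J * tk (cj \<xi>) J K))"
    unfolding tf_def tensor_form_eq by (simp add: hw cx sum_distrib_right sum_distrib_left mult_ac)
  also have "\<dots> = (\<Sum>I\<in>W. \<Sum>K\<in>W. \<Sum>J\<in>W. h (T I) (S K) * (tk (gram N hV) I J * tk (cj \<xi>) J K))"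
    by (intro sum.cong refl sum.swap)
  also have "\<dots> = (\<Sum>I\<in>W. \<Sum>K\<in>W. h (T I) (S K) * tk (tw hV) I K)"
    by (simp add: sum_distrib_left[symmetric] tg)
  finally show ?thesis .
qed

text \<open>The form \<open>h\<close> on \<open>X\<close> is untouched by operators on the
  \<open>V\<close> factors, so adjointness reduces to an identity between \<open>A\<close>,
  \<open>A'\<close> and the twisted Gram matrix.\<close>

lemma tf_wop_adjoint:
  assumes h: "hermitian_form M h" and T: "T \<in> carrier TS" and S: "S \<in> carrier TS"
    and adj: "\<And>I J. I \<in> W \<Longrightarrow> J \<in> W \<Longrightarrow>
      (\<Sum>K\<in>W. A K I * tk (tw hV) K J) = (\<Sum>K\<in>W. tk (tw hV) I K * cnj (A' K J))"
  shows "tf h (wop A T) S = tf h T (wop A' S)"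
proof -
  interpret h: sesq M h by (intro sesq.intro sesq_axioms.intro cvsM h)
  note [simp] = TS_closed[OF T] TS_closed[OF S]
  have 1: "h (wop A T I) y = (\<Sum>K\<in>W. A I K * h (T K) y)" if "I \<in> W" "y \<in> carrier M" for I y
    using that unfolding wop_def by (simp add: h.H_finsum Pi_def)
  have 2: "h x (wop A' S J) = (\<Sum>K\<in>W. cnj (A' J K) * h x (S K))" if "J \<in> W" "x \<in> carrier M" for J x
    using that unfolding wop_def by (simp add: h.H_finsum Pi_def)
  have "tf h (wop A T) S = (\<Sum>I\<in>W. \<Sum>J\<in>W. \<Sum>K\<in>W. h (T K) (S J) * (A I K * tk (tw hV) I J))"
    unfolding tf_eq[OF h wop_closed[OF T] S] by (simp add: 1 sum_distrib_right sum_distrib_left mult_ac)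
  also have "\<dots> = (\<Sum>K\<in>W. \<Sum>J\<in>W. \<Sum>I\<in>W. h (T K) (S J) * (A I K * tk (tw hV) I J))"
    by (rule sum_reverse3)
  also have "\<dots> = (\<Sum>K\<in>W. \<Sum>J\<in>W. h (T K) (S J) * (\<Sum>I\<in>W. tk (tw hV) K I * cnj (A' I J)))"
    by (simp add: sum_distrib_left[symmetric] adj)
  also have "\<dots> = (\<Sum>K\<in>W. \<Sum>J\<in>W. \<Sum>I\<in>W. (cnj (A' I J) * h (T K) (S J)) * tk (tw hV) K I)"
    by (simp add: sum_distrib_left mult_ac)
  also have "\<dots> = (\<Sum>K\<in>W. \<Sum>I\<in>W. \<Sum>J\<in>W. (cnj (A' I J) * h (T K) (S J)) * tk (tw hV) K I)"
    by (intro sum.cong refl sum.swap)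
  also have "\<dots> = tf h T (wop A' S)"
    unfolding tf_eq[OF h T wop_closed[OF S]] by (simp add: 2 sum_distrib_right)
  finally show ?thesis .
qed

end

section \<open>Products, transposes and conjugates of local operators\<close>

lemma loc1_loc1:
  assumes I: "I \<in> wds N l" and J: "J \<in> wds N l" and i: "i < l" "j < l" "i \<noteq> j"
  shows "mmul (wds N l) (loc1 l i x) (loc1 l j y) I J =
    loc2 l i j (\<lambda>p q. x (fst p) (fst q) * y (snd p) (snd q)) I J"
proof -
  let ?u = "\<lambda>m. if m = i then x else if m = j then y else dlt"
  have "mmul (wds N l) (loc1 l i x) (loc1 l j y) I J = tens l ?u I J"
    unfolding mmul_def loc1_def tens_mult[OF I J]
    by (rule tens_cong[OF I J]) (use i in auto)
  also have "\<dots> = loc2 l i j (\<lambda>p q. x (fst p) (fst q) * y (snd p) (snd q)) I J"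
  proof (cases "\<forall>m<l. m \<noteq> i \<longrightarrow> m \<noteq> j \<longrightarrow> I ! m = J ! m")
    case True
    define R where "R = {..<l} - {i, j}"
    define f where "f = (\<lambda>m. ?u m (I ! m) (J ! m))"
    have R: "finite R" "i \<notin> insert j R" "j \<notin> R" using i by (auto simp: R_def)
    have eq: "{..<l} = insert i (insert j R)" using i by (auto simp: R_def)
    have "tens l ?u I J = prod f (insert i (insert j R))"
      unfolding tens_def f_def eq[symmetric] ..
    also have "\<dots> = f i * (f j * prod f R)"
      using prod.insert[OF _ R(2), of f] prod.insert[OF R(1) R(3), of f] R(1) by simp
    also have "prod f R = 1"
      using True by (intro prod.neutral) (auto simp: dlt_def f_def R_def)
    also have "f i * (f j * 1) = x (I ! i) (J ! i) * y (I ! j) (J ! j)"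
      using i by (simp add: f_def)
    finally show ?thesis using True by (simp add: loc2_def)
  next
    case False
    then have "tens l ?u I J = 0"
      unfolding tens_def by (auto simp: dlt_def intro!: prod_zero)
    then show ?thesis unfolding loc2_def if_not_P[OF False] .
  qed
  finally show ?thesis .
qed

lemma loc2_transpose: "loc2 l i j Q K I = loc2 l i j (\<lambda>p q. Q q p) I K"
  unfolding loc2_def by (auto simp: eq_commute)

lemma loc2_cnj: "cnj (loc2 l i j Q K J) = loc2 l i j (\<lambda>p q. cnj (Q p q)) K J"
  unfolding loc2_def by auto

lemma loc2_sum: "loc2 l i j (\<lambda>p q. \<Sum>b\<in>B. Q b p q) I J = (\<Sum>b\<in>B. loc2 l i j (Q b) I J)"
proof (cases "\<forall>m<l. m \<noteq> i \<longrightarrow> m \<noteq> j \<longrightarrow> I ! m = J ! m")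
  case True
  show ?thesis unfolding loc2_def if_P[OF True] ..
next
  case False
  show ?thesis unfolding loc2_def if_not_P[OF False] by simp
qed

lemma tens_transpose: "tens l u K I = tens l (\<lambda>m a b. u m b a) I K"
  unfolding tens_def ..

lemma loc1_transpose: "loc1 l i x K I = loc1 l i (\<lambda>a b. x b a) I K"
  unfolding loc1_def tens_def by (auto intro!: prod.cong simp: dlt_def)

lemma loc1_cnj: "cnj (loc1 l i x K J) = loc1 l i (\<lambda>a b. cnj (x a b)) K J"
  unfolding loc1_def tens_def by (auto intro!: prod.cong simp: dlt_def)

context gk_tens
begin

text \<open>The operators that are compatible with \<open>K\<close> and symmetric for the forms twisted by \<open>\<xi> \<otimes> \<dots> \<otimes> \<xi>\<close>,
  which is how the involution \<open>*\<close> of the algebras enters.\<close>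
definition good :: "((nat list \<Rightarrow> 'x) \<Rightarrow> nat list \<Rightarrow> 'x) \<Rightarrow> bool" where
  "good f \<longleftrightarrow> clinear TS TS f \<and>
     (\<forall>k\<in>K_of G. \<forall>T\<in>carrier TS. tensor_grp G X l k (f T) = f (tensor_grp G X l k T)) \<and>
     (\<forall>h. gk_invariant_form G X h \<longrightarrow> (\<forall>T\<in>carrier TS. \<forall>S\<in>carrier TS. tf h (f T) S = tf h T (f S)))"

lemma tensor_grp_closed:
  assumes T: "T \<in> carrier TS" and k: "k \<in> K_of G"
  shows "tensor_grp G X l k T \<in> carrier TS"
  unfolding tensor_grp_eq[OF T k] by (rule wop_closed[OF lop_closed[OF kappa_linear[OF k] T]])

lemma good_cong:
  assumes g: "good f" and eq: "\<And>T. T \<in> carrier TS \<Longrightarrow> f' T = f T"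
  shows "good f'"
  unfolding good_def
proof (intro conjI ballI allI impI)
  have c: "clinear TS TS f" using g unfolding good_def by simp
  show "clinear TS TS f'"
    by (rule clinearI)
      (simp_all only: eq TS.M.add.m_closed TS.sm_closed clinear_simps[OF c])
  fix k T assume k: "k \<in> K_of G" and T: "T \<in> carrier TS"
  show "tensor_grp G X l k (f' T) = f' (tensor_grp G X l k T)"
    unfolding eq[OF T] eq[OF tensor_grp_closed[OF T k]] using g k T unfolding good_def by blast
next
  fix h T S assume "gk_invariant_form G X h" "T \<in> carrier TS" "S \<in> carrier TS"
  then show "tf h (f' T) S = tf h T (f' S)"
    using g eq unfolding good_def by simp
qed

lemma clinear_tensor_grp:
  assumes k: "k \<in> K_of G" shows "clinear TS TS (tensor_grp G X l k)"
proof -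
  have "clinear TS TS (\<lambda>T. wop (tk k) (lop (\<kappa> k) T))"
    by (rule clinearI)
      (simp_all only: clinear_simps[OF clinear_lop[OF kappa_linear[OF k]]] clinear_simps[OF clinear_wop])
  then show ?thesis
    unfolding module_hom_def using tensor_grp_eq[OF _ k] tensor_grp_closed[OF _ k]
    by (simp del: TS_simps add: TS.M.add.m_closed TS.sm_closed)
qed

lemma clinear_sum:
  assumes c: "\<And>i. i \<in> A \<Longrightarrow> clinear TS TS (f i)"
  shows "clinear TS TS (\<lambda>T. finsum TS (\<lambda>i. f i T) A)"
proof -
  have cl: "(\<lambda>i. f i T) \<in> A \<rightarrow> carrier TS" if "T \<in> carrier TS" for T
    using clinear_simps(1)[OF c that] by auto
  show ?thesis
proof (rule clinearI)
  fix T S assume T: "T \<in> carrier TS" and S: "S \<in> carrier TS"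
  show "finsum TS (\<lambda>i. f i T) A \<in> carrier TS" by (rule TS.M.finsum_closed[OF cl[OF T]])
  have "finsum TS (\<lambda>i. f i (T \<oplus>\<^bsub>TS\<^esub> S)) A = finsum TS (\<lambda>i. f i T \<oplus>\<^bsub>TS\<^esub> f i S) A"
    by (rule TS.M.finsum_cong', rule refl)
      (use clinear_simps[OF c] T S TS.M.add.m_closed in \<open>auto simp del: TS_simps\<close>)
  also have "\<dots> = finsum TS (\<lambda>i. f i T) A \<oplus>\<^bsub>TS\<^esub> finsum TS (\<lambda>i. f i S) A"
    by (rule TS.finsum_add[OF cl[OF T] cl[OF S]])
  finally show "finsum TS (\<lambda>i. f i (T \<oplus>\<^bsub>TS\<^esub> S)) A = finsum TS (\<lambda>i. f i T) A \<oplus>\<^bsub>TS\<^esub> finsum TS (\<lambda>i. f i S) A" .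
next
  fix T a assume T: "T \<in> carrier TS"
  have "finsum TS (\<lambda>i. f i (a \<odot>\<^bsub>TS\<^esub> T)) A = finsum TS (\<lambda>i. a \<odot>\<^bsub>TS\<^esub> f i T) A"
    by (rule TS.M.finsum_cong', rule refl)
      (use clinear_simps[OF c] T TS.sm_closed in \<open>auto simp del: TS_simps\<close>)
  also have "\<dots> = a \<odot>\<^bsub>TS\<^esub> finsum TS (\<lambda>i. f i T) A"
    by (rule TS.sm_finsum[symmetric, OF cl[OF T]])
  finally show "finsum TS (\<lambda>i. f i (a \<odot>\<^bsub>TS\<^esub> T)) A = a \<odot>\<^bsub>TS\<^esub> finsum TS (\<lambda>i. f i T) A" .
qed
qed

lemma good_sum:
  assumes g: "\<And>i. i \<in> A \<Longrightarrow> good (f i)"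
  shows "good (\<lambda>T. finsum TS (\<lambda>i. f i T) A)"
proof -
  have c: "clinear TS TS (f i)" if "i \<in> A" for i using g[OF that] unfolding good_def by simp
  have cl: "(\<lambda>i. f i T) \<in> A \<rightarrow> carrier TS" if "T \<in> carrier TS" for T
    using clinear_simps(1)[OF c that] by auto
  show ?thesis
    unfolding good_def
  proof (intro conjI ballI allI impI)
    show "clinear TS TS (\<lambda>T. finsum TS (\<lambda>i. f i T) A)" by (rule clinear_sum[OF c])
    fix k T assume k: "k \<in> K_of G" and T: "T \<in> carrier TS"
    have "tensor_grp G X l k (finsum TS (\<lambda>i. f i T) A) = finsum TS (\<lambda>i. tensor_grp G X l k (f i T)) A"
      by (rule clinear_finsum[OF cvs_TS cvs_TS clinear_tensor_grp[OF k] cl[OF T]])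
    also have "\<dots> = finsum TS (\<lambda>i. f i (tensor_grp G X l k T)) A"
    proof (rule TS.M.finsum_cong', rule refl)
      show "(\<lambda>i. f i (tensor_grp G X l k T)) \<in> A \<rightarrow> carrier TS"
        by (rule cl[OF tensor_grp_closed[OF T k]])
      show "tensor_grp G X l k (f i T) = f i (tensor_grp G X l k T)" if "i \<in> A" for i
        using g[OF that] k T unfolding good_def by blast
    qed
    finally show "tensor_grp G X l k (finsum TS (\<lambda>i. f i T) A) = finsum TS (\<lambda>i. f i (tensor_grp G X l k T)) A" .
  next
    fix h T S assume h: "gk_invariant_form G X h" and T: "T \<in> carrier TS" and S: "S \<in> carrier TS"
    interpret t: sesq TS "tf h"
      by (intro sesq.intro sesq_axioms.intro cvs_TS tf_hermitian) (use h in \<open>simp add: gk_invariant_form_def\<close>)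
    show "tf h (finsum TS (\<lambda>i. f i T) A) S = tf h T (finsum TS (\<lambda>i. f i S) A)"
      unfolding t.H_finsum(1)[OF S cl[OF T]] t.H_finsum(2)[OF T cl[OF S]]
      using g h T S unfolding good_def by (intro sum.cong) blast+
  qed
qed

text \<open>\<open>wop A\<close> commutes with the action of \<open>K\<close> on \<open>X\<close>,
  so only its action on the \<open>V\<close> factors has to be compared; symmetry is the case
  \<open>A' = A\<close> of \<open>tf_wop_adjoint\<close>.\<close>

lemma good_wop:
  assumes com: "\<And>k I J. k \<in> K_of G \<Longrightarrow> I \<in> W \<Longrightarrow> J \<in> W \<Longrightarrow> mmul W (tk k) A I J = mmul W A (tk k) I J"
    and adj: "\<And>I J. I \<in> W \<Longrightarrow> J \<in> W \<Longrightarrow>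
      (\<Sum>K\<in>W. A K I * tk (tw hV) K J) = (\<Sum>K\<in>W. tk (tw hV) I K * cnj (A K J))"
  shows "good (wop A)"
  unfolding good_def
proof (intro conjI ballI allI impI)
  show "clinear TS TS (wop A)" by (rule clinear_wop)
  fix k T assume k: "k \<in> K_of G" and T: "T \<in> carrier TS"
  note kl = kappa_linear[OF k]
  note lT = lop_closed[OF kl T]
  have "tensor_grp G X l k (wop A T) = wop (tk k) (wop A (lop (\<kappa> k) T))"
    unfolding tensor_grp_eq[OF wop_closed[OF T] k] lop_wop[OF kl T] ..
  also have "\<dots> = wop A (wop (tk k) (lop (\<kappa> k) T))"
    unfolding wop_comp[OF lT] by (rule wop_cong[OF lT com[OF k]])
  finally show "tensor_grp G X l k (wop A T) = wop A (tensor_grp G X l k T)"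
    unfolding tensor_grp_eq[OF T k] .
next
  fix h T S assume h: "gk_invariant_form G X h" and T: "T \<in> carrier TS" and S: "S \<in> carrier TS"
  have "hermitian_form M h" using h unfolding gk_invariant_form_def by simp
  then show "tf h (wop A T) S = tf h T (wop A S)"
    by (rule tf_wop_adjoint[OF _ T S adj])
qed

text \<open>Both conditions reduce to identities on \<open>V \<otimes> V\<close> by
  \<open>loc2_tens\<close>, where \<open>u\<close> is an element of \<open>K\<close> in the first
  and the twisted Gram matrix in the second.\<close>

lemma good_loc2:
  assumes i: "i < l" "j < l" "i \<noteq> j"
    and com: "\<And>k a b e f. k \<in> K_of G \<Longrightarrow> a < N \<Longrightarrow> b < N \<Longrightarrow> e < N \<Longrightarrow> f < N \<Longrightarrow>
      (\<Sum>p\<in>prs N. Q (a, b) p * (ent k (fst p) e * ent k (snd p) f)) =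
      (\<Sum>p\<in>prs N. (ent k a (fst p) * ent k b (snd p)) * Q p (e, f))"
    and adj: "\<And>a b e f. a < N \<Longrightarrow> b < N \<Longrightarrow> e < N \<Longrightarrow> f < N \<Longrightarrow>
      (\<Sum>p\<in>prs N. Q p (a, b) * (ent (tw hV) (fst p) e * ent (tw hV) (snd p) f)) =
      (\<Sum>p\<in>prs N. (ent (tw hV) a (fst p) * ent (tw hV) b (snd p)) * cnj (Q p (e, f)))"
  shows "good (wop (loc2 l i j Q))"
proof (rule good_wop)
  fix k I J assume k: "k \<in> K_of G" and I: "I \<in> W" and J: "J \<in> W"
  show "mmul W (tk k) (loc2 l i j Q) I J = mmul W (loc2 l i j Q) (tk k) I J"
    unfolding mmul_def by (rule loc2_tens[OF I J i com[OF k], symmetric])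
next
  fix I J assume I: "I \<in> W" and J: "J \<in> W"
  show "(\<Sum>K\<in>W. loc2 l i j Q K I * tk (tw hV) K J) = (\<Sum>K\<in>W. tk (tw hV) I K * cnj (loc2 l i j Q K J))"
    unfolding loc2_transpose[of l i j Q _ I] loc2_cnj
    by (rule loc2_tens[OF I J i adj])
qed

text \<open>The flip commutes with \<open>u \<otimes> u\<close> for every matrix \<open>u\<close>,
  and it is real and equal to its transpose.\<close>

lemma good_flip:
  assumes i: "1 \<le> i" "i < l"
  shows "good (wop (loc2 l (i - 1) i (\<lambda>p q. dlt q (snd p, fst p))))"
proof -
  have s1: "(\<Sum>p\<in>prs N. dlt p (b, a) * f p) = f (b, a)" if "a < N" "b < N" for f a b
    using that dlt_sum(2)[of "prs N" "(b, a)" f] by simp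
  have s2: "(\<Sum>p\<in>prs N. f p * dlt (a, b) (snd p, fst p)) = f (b, a)" if "a < N" "b < N" for f a b
  proof -
    have "dlt (a, b) (snd p, fst p) = dlt (b, a) p" for p :: "nat \<times> nat" by (cases p) (auto simp: dlt_def)
    then show ?thesis using that dlt_sum(3)[of "prs N" f "(b, a)"] by simp
  qed
  have cd: "cnj (dlt a b) = dlt a b" for a b :: "nat \<times> nat" by (simp add: dlt_def)
  show ?thesis
  proof (rule good_loc2)
    fix k a b e f assume "a < N" "b < N" "e < N" "f < N"
    then show "(\<Sum>p\<in>prs N. dlt p (snd (a, b), fst (a, b)) * (ent k (fst p) e * ent k (snd p) f)) =
      (\<Sum>p\<in>prs N. (ent k a (fst p) * ent k b (snd p)) * dlt (e, f) (snd p, fst p))"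
      unfolding fst_conv snd_conv by (subst s1, simp, simp, subst s2) (simp_all add: mult.commute)
  next
    fix a b e f assume "a < N" "b < N" "e < N" "f < N"
    then show "(\<Sum>p\<in>prs N. dlt (a, b) (snd p, fst p) * (ent (tw hV) (fst p) e * ent (tw hV) (snd p) f)) =
      (\<Sum>p\<in>prs N. (ent (tw hV) a (fst p) * ent (tw hV) b (snd p)) * cnj (dlt (e, f) (snd p, fst p)))"
      unfolding cd mult.commute[of "dlt _ _"] by (subst s2, simp, simp, subst s2) (simp_all add: mult.commute)
  qed (use i in auto)
qed

lemma m0_real: "cnj (vw_m0 G) = vw_m0 G"
  by (cases G) auto

text \<open>Both conditions are instances of \<open>trivial_projection_commute\<close>, once for
  \<open>k\<close> and once for the conjugate of the twisted Gram matrix; the scalar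
  \<open>vw_m0 G\<close> is real.\<close>

lemma good_projection:
  assumes i: "1 \<le> i" "i < l"
  shows "good (wop (loc2 l (i - 1) i (\<lambda>p q. vw_m0 G * P p q)))"
proof -
  let ?P = "mcut (prs N) P"
  have com: "(\<Sum>p\<in>prs N. P (a, b) p * (ent u (fst p) e * ent u (snd p) f)) =
      (\<Sum>p\<in>prs N. (ent u a (fst p) * ent u b (snd p)) * P p (e, f))"
    if u: "normalizes u" "normalizes ((cj u)\<^sup>T)" and lt: "a < N" "b < N" "e < N" "f < N" for u a b e f
  proof -
    have "mmul (prs N) ?P (kron u) (a, b) (e, f) = mmul (prs N) (kron u) ?P (a, b) (e, f)"
      using trivial_projection_commute[OF P u] by simp
    moreover have "mmul (prs N) ?P (kron u) (a, b) (e, f) =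
        (\<Sum>p\<in>prs N. P (a, b) p * (ent u (fst p) e * ent u (snd p) f))"
      unfolding mmul_def by (rule sum.cong) (use lt in \<open>auto simp: mcut_def kron_def\<close>)
    moreover have "mmul (prs N) (kron u) ?P (a, b) (e, f) =
        (\<Sum>p\<in>prs N. (ent u a (fst p) * ent u b (snd p)) * P p (e, f))"
      unfolding mmul_def by (rule sum.cong) (use lt in \<open>auto simp: mcut_def kron_def\<close>)
    ultimately show ?thesis by simp
  qed
  have herm: "cnj (P q p) = P p q" if "p \<in> prs N" "q \<in> prs N" for p q
    using fun_cong[OF fun_cong[OF trivial_projection_adjoint[OF P]], of p q] that
    unfolding madj_def mcut_def by simp
  show ?thesis
  proof (rule good_loc2)
    fix k a b e f assume k: "k \<in> K_of G" and lt: "a < N" "b < N" "e < N" "f < N"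
    have u: "normalizes k" "normalizes ((cj k)\<^sup>T)"
      using normalizes_K[OF k] normalizes_K[OF K_transpose[OF k]] K_D(2)[OF k] by simp_all
    show "(\<Sum>p\<in>prs N. vw_m0 G * P (a, b) p * (ent k (fst p) e * ent k (snd p) f)) =
      (\<Sum>p\<in>prs N. (ent k a (fst p) * ent k b (snd p)) * (vw_m0 G * P p (e, f)))"
      using com[OF u lt] by (simp add: mult.assoc mult.left_commute flip: sum_distrib_left)
  next
    fix a b e f assume lt: "a < N" "b < N" "e < N" "f < N"
    let ?A = "tw hV"
    have u: "normalizes (cj ?A)" "normalizes ((cj (cj ?A))\<^sup>T)"
      using normalizes_tw[OF V] by simp_all
    have A: "ent (cj ?A) x y = cnj (ent ?A x y)" if "x < N" "y < N" for x y
      using that by (simp add: carrier_matD[OF tw_closed])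
    \<comment> \<open>The symmetry condition contains the transpose of \<open>P\<close> on one side
      and its conjugate on the other. Conjugating the identity and using that \<open>P\<close> is
      self-adjoint makes it a commutation relation.\<close>
    have "(\<Sum>p\<in>prs N. cnj (P (a, b) p) * (ent ?A (fst p) e * ent ?A (snd p) f)) =
        cnj (\<Sum>p\<in>prs N. P (a, b) p * (ent (cj ?A) (fst p) e * ent (cj ?A) (snd p) f))"
      unfolding cnj_sum by (rule sum.cong) (use lt A in auto)
    also have "\<dots> = cnj (\<Sum>p\<in>prs N. (ent (cj ?A) a (fst p) * ent (cj ?A) b (snd p)) * P p (e, f))"
      unfolding com[OF u lt] ..
    also have "\<dots> = (\<Sum>p\<in>prs N. (ent ?A a (fst p) * ent ?A b (snd p)) * cnj (P p (e, f)))"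
      unfolding cnj_sum by (rule sum.cong) (use lt A in auto)
    finally have "(\<Sum>p\<in>prs N. P p (a, b) * (ent ?A (fst p) e * ent ?A (snd p) f)) =
        (\<Sum>p\<in>prs N. (ent ?A a (fst p) * ent ?A b (snd p)) * cnj (P p (e, f)))"
      using herm[of "(a, b)"] herm[of _ "(a, b)"] lt by simp
    then show "(\<Sum>p\<in>prs N. vw_m0 G * P p (a, b) * (ent ?A (fst p) e * ent ?A (snd p) f)) =
      (\<Sum>p\<in>prs N. (ent ?A a (fst p) * ent ?A b (snd p)) * cnj (vw_m0 G * P p (e, f)))"
      by (simp add: m0_real mult.assoc mult.left_commute flip: sum_distrib_left)
  qed (use i in auto)
qed

lemma good_xi:
  assumes i: "i < l"
  shows "good (wop (loc1 l i (ent \<xi>)))"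
proof (rule good_wop)
  have e: "(\<Sum>b<N. ent x a b * ent y b e) = (\<Sum>b<N. ent y' a b * ent x' b e)"
    if "x * y = y' * x'" "x \<in> C" "y \<in> C" "x' \<in> C" "y' \<in> C" "a < N" "e < N" for x y x' y' a e
    using sq_index[of x y a e] sq_index[of y' x' a e] that by simp
  fix I J assume I: "I \<in> W" and J: "J \<in> W"
  show "mmul W (tk k) (loc1 l i (ent \<xi>)) I J = mmul W (loc1 l i (ent \<xi>)) (tk k) I J" if k: "k \<in> K_of G" for k
    unfolding mmul_def
    by (rule loc1_tens[OF I J, symmetric], rule e) (use K_D[OF k] in auto)
  have tr: "(\<lambda>a b. ent \<xi> b a) = (\<lambda>a b. \<xi> $$ (b, a))" ..
  show "(\<Sum>K\<in>W. loc1 l i (ent \<xi>) K I * tk (tw hV) K J) = (\<Sum>K\<in>W. tk (tw hV) I K * cnj (loc1 l i (ent \<xi>) K J))"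
    unfolding loc1_transpose[of l i "ent \<xi>" _ I] loc1_cnj
  proof (rule loc1_tens[OF I J])
    fix a e assume lt: "a < N" "e < N"
    have "(\<Sum>b<N. ent (\<xi>\<^sup>T) a b * ent (tw hV) b e) = (\<Sum>b<N. ent (tw hV) a b * ent (cj \<xi>) b e)"
      by (rule e[OF xi_tw[OF V]]) (use lt in \<open>auto simp: sq_closed\<close>)
    then show "(\<Sum>b<N. ent \<xi> b a * ent (tw hV) b e) = (\<Sum>b<N. ent (tw hV) a b * cnj (ent \<xi> b e))"
      using lt by (simp add: carrier_matD[OF xi_closed])
  qed
qed

end

section \<open>Symmetry of the Casimir operators\<close>

context rgrp
begin

lemma sum_kron:
  assumes c: "x \<in> C" "y \<in> C" "u \<in> C" "v \<in> C" and lt: "a < N" "b < N" "e < N" "f < N"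
  shows "(\<Sum>p\<in>prs N. ent x a (fst p) * ent y b (snd p) * (ent u (fst p) e * ent v (snd p) f)) =
    (x * u) $$ (a, e) * (y * v) $$ (b, f)"
  unfolding sum_prs sq_index[OF c(1,3) lt(1,3)] sq_index[OF c(2,4) lt(2,4)] sum_product
  by (intro sum.cong refl) (simp add: mult_ac)

lemma lfun_mult_entry:
  assumes u: "u \<in> C" and lt: "a < N" "e < N"
  shows "lfun (\<lambda>x. (x * u) $$ (a, e))" "lfun (\<lambda>x. (u * x) $$ (a, e))"
proof -
  have add: "(P + Q) $$ (a, e) = P $$ (a, e) + Q $$ (a, e)" "(z \<cdot>\<^sub>m P) $$ (a, e) = z * P $$ (a, e)"
    if "P \<in> C" "Q \<in> C" for P Q :: "complex mat" and z
    using that lt by auto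
  show "lfun (\<lambda>x. (x * u) $$ (a, e))" "lfun (\<lambda>x. (u * x) $$ (a, e))"
    unfolding lfun_def using u by (auto simp: sq add simp del: index_mult_mat dest!: lie_C)
qed

end

context gk_tens
begin

text \<open>Compatibility with \<open>K\<close> is invariance of the Casimir tensor under
  conjugation by \<open>k\<close>. Moving the operator across the form replaces \<open>b\<close> and
  \<open>d b\<close> by \<open>- cj b\<close> and \<open>- cj (d b)\<close>; the signs cancel, and
  invariance of the tensor under complex conjugation absorbs the rest.\<close>

lemma good_casimir2:
  assumes i: "i < l" "j < l" "i \<noteq> j"
  shows "good (wop (loc2 l i j (\<lambda>p q. \<Sum>b\<in>B. ent b (fst p) (fst q) * ent (d b) (snd p) (snd q))))"
proof (rule good_loc2[OF i])
  fix k a b e f assume k: "k \<in> K_of G" and lt: "a < N" "b < N" "e < N" "f < N"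
  note kC = K_D(1)[OF k]
  let ?\<beta> = "\<lambda>x y. (x * k) $$ (a, e) * (y * k) $$ (b, f)"
  have "(\<Sum>p\<in>prs N. (\<Sum>x\<in>B. ent x (fst (a, b)) (fst p) * ent (d x) (snd (a, b)) (snd p)) * (ent k (fst p) e * ent k (snd p) f)) =
      (\<Sum>x\<in>B. \<Sum>p\<in>prs N. ent x a (fst p) * ent (d x) b (snd p) * (ent k (fst p) e * ent k (snd p) f))"
    unfolding fst_conv snd_conv sum_distrib_right by (rule sum.swap)
  also have "\<dots> = (\<Sum>x\<in>B. ?\<beta> x (d x))"
    using sum_kron[OF _ _ kC kC lt] Bl[THEN lie_C] by (intro sum.cong refl) blast
  also have "\<dots> = (\<Sum>x\<in>B. ?\<beta> (k * x * k\<^sup>T) (k * d x * k\<^sup>T))"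
  proof (rule casimir_bilinear[OF auto_ad[OF k], symmetric])
    show "lfun (\<lambda>x. ?\<beta> x y)" for y
      using lfun_mult_entry(1)[OF kC lt(1,3)] unfolding lfun_def by (auto simp: algebra_simps)
    show "lfun (?\<beta> x)" for x
      using lfun_mult_entry(1)[OF kC lt(2,4)] unfolding lfun_def by (auto simp: algebra_simps)
  qed
  also have "\<dots> = (\<Sum>x\<in>B. (k * x) $$ (a, e) * (k * d x) $$ (b, f))"
  proof (intro sum.cong refl)
    fix x assume "x \<in> B"
    then have "k * x * k\<^sup>T * k = k * x" "k * d x * k\<^sup>T * k = k * d x"
      using K_D[OF k] Bl[THEN lie_C] by (simp_all add: sq)
    then show "?\<beta> (k * x * k\<^sup>T) (k * d x * k\<^sup>T) = (k * x) $$ (a, e) * (k * d x) $$ (b, f)" by simp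
  qed
  also have "\<dots> = (\<Sum>x\<in>B. \<Sum>p\<in>prs N. ent k a (fst p) * ent k b (snd p) * (ent x (fst p) e * ent (d x) (snd p) f))"
    using sum_kron[OF kC kC _ _ lt, symmetric] Bl[THEN lie_C] by (intro sum.cong refl) blast
  also have "\<dots> = (\<Sum>p\<in>prs N. (ent k a (fst p) * ent k b (snd p)) * (\<Sum>x\<in>B. ent x (fst p) (fst (e, f)) * ent (d x) (snd p) (snd (e, f))))"
    unfolding fst_conv snd_conv sum_distrib_left by (rule sum.swap)
  finally show "(\<Sum>p\<in>prs N. (\<Sum>x\<in>B. ent x (fst (a, b)) (fst p) * ent (d x) (snd (a, b)) (snd p)) * (ent k (fst p) e * ent k (snd p) f)) =
      (\<Sum>p\<in>prs N. (ent k a (fst p) * ent k b (snd p)) * (\<Sum>x\<in>B. ent x (fst p) (fst (e, f)) * ent (d x) (snd p) (snd (e, f))))" .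
next
  fix a b e f assume lt: "a < N" "b < N" "e < N" "f < N"
  let ?A = "tw hV"
  have [simp]: "?A \<in> C" by simp
  let ?\<beta> = "\<lambda>x y. (?A * x) $$ (a, e) * (?A * y) $$ (b, f)"
  have "(\<Sum>p\<in>prs N. (\<Sum>x\<in>B. ent x (fst p) (fst (a, b)) * ent (d x) (snd p) (snd (a, b))) * (ent ?A (fst p) e * ent ?A (snd p) f)) =
      (\<Sum>x\<in>B. \<Sum>p\<in>prs N. ent x (fst p) a * ent (d x) (snd p) b * (ent ?A (fst p) e * ent ?A (snd p) f))"
    unfolding fst_conv snd_conv sum_distrib_right by (rule sum.swap)
  also have "\<dots> = (\<Sum>x\<in>B. ?\<beta> x (d x))"
  proof (intro sum.cong refl)
    fix x assume x: "x \<in> B"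
    note xC = lie_C[OF Bl(1)[OF x]] and dC = lie_C[OF Bl(2)[OF x]]
    have "(\<Sum>p\<in>prs N. ent x (fst p) a * ent (d x) (snd p) b * (ent ?A (fst p) e * ent ?A (snd p) f)) =
        (\<Sum>p\<in>prs N. ent (x\<^sup>T) a (fst p) * ent ((d x)\<^sup>T) b (snd p) * (ent ?A (fst p) e * ent ?A (snd p) f))"
      using xC dC lt by (intro sum.cong refl) auto
    also have "\<dots> = (x\<^sup>T * ?A) $$ (a, e) * ((d x)\<^sup>T * ?A) $$ (b, f)"
      using xC dC by (intro sum_kron lt) (auto simp: sq_closed)
    \<comment> \<open>Two applications of \<open>lie_tw\<close>, whose signs cancel.\<close>
    also have "\<dots> = ?\<beta> x (d x)"
      unfolding lie_tw[OF V Bl(1)[OF x]] lie_tw[OF V Bl(2)[OF x]]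
      using lt xC dC by (simp add: carrier_matD[OF tw_closed] del: index_mult_mat(1))
    finally show "(\<Sum>p\<in>prs N. ent x (fst p) a * ent (d x) (snd p) b * (ent ?A (fst p) e * ent ?A (snd p) f)) = ?\<beta> x (d x)" .
  qed
  also have "\<dots> = (\<Sum>x\<in>B. ?\<beta> (cj x) (cj (d x)))"
  proof (rule casimir_bilinear[OF auto_cj, symmetric])
    show "lfun (\<lambda>x. ?\<beta> x y)" for y
      using lfun_mult_entry(2)[OF tw_closed lt(1,3)] unfolding lfun_def by (auto simp: algebra_simps)
    show "lfun (?\<beta> x)" for x
      using lfun_mult_entry(2)[OF tw_closed lt(2,4)] unfolding lfun_def by (auto simp: algebra_simps)
  qed
  also have "\<dots> = (\<Sum>x\<in>B. \<Sum>p\<in>prs N. ent ?A a (fst p) * ent ?A b (snd p) * (cnj (ent x (fst p) e) * cnj (ent (d x) (snd p) f)))"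
  proof (intro sum.cong refl)
    fix x assume x: "x \<in> B"
    note xC = lie_C[OF Bl(1)[OF x]] and dC = lie_C[OF Bl(2)[OF x]]
    have "?\<beta> (cj x) (cj (d x)) = (\<Sum>p\<in>prs N. ent ?A a (fst p) * ent ?A b (snd p) * (ent (cj x) (fst p) e * ent (cj (d x)) (snd p) f))"
      using xC dC by (intro sum_kron[symmetric] lt) (auto simp: sq_closed)
    also have "\<dots> = (\<Sum>p\<in>prs N. ent ?A a (fst p) * ent ?A b (snd p) * (cnj (ent x (fst p) e) * cnj (ent (d x) (snd p) f)))"
      using xC dC lt by (intro sum.cong refl) auto
    finally show "?\<beta> (cj x) (cj (d x)) = \<dots>" .
  qed
  also have "\<dots> = (\<Sum>p\<in>prs N. (ent ?A a (fst p) * ent ?A b (snd p)) *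
      cnj (\<Sum>x\<in>B. ent x (fst p) (fst (e, f)) * ent (d x) (snd p) (snd (e, f))))"
    unfolding fst_conv snd_conv cnj_sum complex_cnj_mult sum_distrib_left by (rule sum.swap)
  finally show "(\<Sum>p\<in>prs N. (\<Sum>x\<in>B. ent x (fst p) (fst (a, b)) * ent (d x) (snd p) (snd (a, b))) * (ent ?A (fst p) e * ent ?A (snd p) f)) =
      (\<Sum>p\<in>prs N. (ent ?A a (fst p) * ent ?A b (snd p)) *
        cnj (\<Sum>x\<in>B. ent x (fst p) (fst (e, f)) * ent (d x) (snd p) (snd (e, f))))" .
qed

abbreviation lw :: "nat \<Rightarrow> complex mat \<Rightarrow> complex mat \<Rightarrow> (nat list \<Rightarrow> 'x) \<Rightarrow> nat list \<Rightarrow> 'x" where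
  "lw i x y T \<equiv> lop (\<pi> x) (wop (loc1 l i (ent y)) T)"

lemma lw_closed: "x \<in> lie G \<Longrightarrow> T \<in> carrier TS \<Longrightarrow> lw i x y T \<in> carrier TS"
  by (rule lop_closed[OF pi_linear wop_closed])

lemma lw_expand:
  assumes i: "i < l" and x: "x \<in> lie G" and T: "T \<in> carrier TS" and I: "I \<in> W"
  shows "lw i x y T I = finsum M (\<lambda>e. ent y (I ! i) e \<odot>\<^bsub>M\<^esub> \<pi> x (T (I[i := e]))) {..<N}"
proof -
  note Tc = TS_closed[OF T]
  have "wop (loc1 l i (ent y)) T I = finsum M (\<lambda>e. ent y (I ! i) e \<odot>\<^bsub>M\<^esub> T (I[i := e])) {..<N}"
    by (rule wop_local[OF T I]) (use i wds_update[OF I] loc1_eq[OF I, of _ i "ent y"] in auto)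
  then have "lw i x y T I = \<pi> x (finsum M (\<lambda>e. ent y (I ! i) e \<odot>\<^bsub>M\<^esub> T (I[i := e])) {..<N})"
    using I by (simp add: lop_def)
  also have "\<dots> = finsum M (\<lambda>e. \<pi> x (ent y (I ! i) e \<odot>\<^bsub>M\<^esub> T (I[i := e]))) {..<N}"
    by (rule clinear_finsum[OF cvsM cvsM pi_linear[OF x]]) (use Tc in auto)
  also have "\<dots> = finsum M (\<lambda>e. ent y (I ! i) e \<odot>\<^bsub>M\<^esub> \<pi> x (T (I[i := e]))) {..<N}"
    unfolding clinear_simps(2)[OF pi_linear[OF x] Tc] ..
  finally show ?thesis .
qed

text \<open>Componentwise this is \<open>casimir_vector\<close> with a matrix entry as the linear
  functional; the sums over \<open>b\<close> and \<open>e\<close> are exchanged before and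
  after.\<close>

lemma casimir1_auto:
  assumes a: "lie_auto s \<tau> \<sigma>" and i: "i < l" and T: "T \<in> carrier TS"
  shows "finsum TS (\<lambda>b. lw i (\<tau> b) (\<tau> (d b)) T) B = finsum TS (\<lambda>b. lw i b (d b) T) B"
proof (rule TS_eqI)
  note tl = lie_auto_D(1)[OF a Bl(1)]
  have c1: "(\<lambda>b. lw i (\<tau> b) (\<tau> (d b)) T) \<in> B \<rightarrow> carrier TS" by (intro Pi_I lw_closed tl T)
  have c2: "(\<lambda>b. lw i b (d b) T) \<in> B \<rightarrow> carrier TS" by (intro Pi_I lw_closed Bl T)
  show "finsum TS (\<lambda>b. lw i (\<tau> b) (\<tau> (d b)) T) B \<in> carrier TS" by (rule TS.M.finsum_closed[OF c1])
  show "finsum TS (\<lambda>b. lw i b (d b) T) B \<in> carrier TS" by (rule TS.M.finsum_closed[OF c2])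
  fix I assume I: "I \<in> W"
  note Tc = TS_closed[OF T]
  have Ii: "I ! i < N" using wds_nth[OF I i] .
  let ?f = "\<lambda>\<tau> b e. ent (\<tau> (d b)) (I ! i) e \<odot>\<^bsub>M\<^esub> \<pi> (\<tau> b) (T (I[i := e]))"
  have "finsum TS (\<lambda>b. lw i (\<tau> b) (\<tau> (d b)) T) B I = finsum M (\<lambda>b. finsum M (?f \<tau> b) {..<N}) B"
    unfolding TS_finsum[OF c1]
    by (rule M.M.finsum_cong', rule refl) (use lw_expand[OF i tl T I] pi_closed[OF tl Tc] in \<open>auto intro!: M.M.finsum_closed\<close>)
  also have "\<dots> = finsum M (\<lambda>e. finsum M (\<lambda>b. ?f \<tau> b e) B) {..<N}"
    by (rule M.finsum_swap) (use finB pi_closed[OF tl Tc] in auto)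
  also have "\<dots> = finsum M (\<lambda>e. finsum M (\<lambda>b. ?f (\<lambda>x. x) b e) B) {..<N}"
  proof (rule M.M.finsum_cong', rule refl)
    fix e assume "e \<in> {..<N}"
    then show "finsum M (\<lambda>b. ?f \<tau> b e) B = finsum M (\<lambda>b. ?f (\<lambda>x. x) b e) B"
      using casimir_vector[OF a lfun_entry[OF Ii, of e] Tc] by simp
  qed (use pi_closed[OF Bl(1) Tc] in \<open>auto intro!: M.M.finsum_closed\<close>)
  also have "\<dots> = finsum M (\<lambda>b. finsum M (?f (\<lambda>x. x) b) {..<N}) B"
    by (rule M.finsum_swap[symmetric]) (use finB pi_closed[OF Bl(1) Tc] in auto)
  also have "\<dots> = finsum TS (\<lambda>b. lw i b (d b) T) B I"
    unfolding TS_finsum[OF c2]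
    by (rule M.M.finsum_cong', rule refl) (use lw_expand[OF i Bl(1) T I] pi_closed[OF Bl(1) Tc] in \<open>auto intro!: M.M.finsum_closed simp del: TS_simps\<close>)
  finally show "finsum TS (\<lambda>b. lw i (\<tau> b) (\<tau> (d b)) T) B I = finsum TS (\<lambda>b. lw i b (d b) T) B I" .
qed

text \<open>Cancels the two signs that arise when \<open>b\<close> is moved across the form on
  \<open>X\<close> and \<open>d b\<close> across the form on \<open>V\<close>.\<close>

lemma lw_uminus:
  assumes i: "i < l" and x: "x \<in> lie G" and y: "y \<in> C" and T: "T \<in> carrier TS"
  shows "lw i (- x) (- y) T = lw i x y T"
proof (rule TS_eqI)
  have mx: "- x = (- 1) \<cdot>\<^sub>m x" by (simp add: sq_smult)
  note xl = lie_uminus[OF x]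
  show "lw i (- x) (- y) T \<in> carrier TS" "lw i x y T \<in> carrier TS" by (rule lw_closed[OF xl T], rule lw_closed[OF x T])
  fix I assume I: "I \<in> W"
  note Tc = TS_closed[OF T]
  show "lw i (- x) (- y) T I = lw i x y T I"
    unfolding lw_expand[OF i xl T I] lw_expand[OF i x T I]
  proof (rule M.M.finsum_cong', rule refl)
    fix e assume e: "e \<in> {..<N}"
    have "ent (- y) (I ! i) e = (- 1) * ent y (I ! i) e" using y e wds_nth[OF I i] by simp
    then show "ent (- y) (I ! i) e \<odot>\<^bsub>M\<^esub> \<pi> (- x) (T (I[i := e])) = ent y (I ! i) e \<odot>\<^bsub>M\<^esub> \<pi> x (T (I[i := e]))"
      unfolding mx pi_smult[OF x Tc] using M.sm_assoc[symmetric] pi_closed[OF x Tc] by simp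
  qed (use pi_closed[OF x Tc] in auto)
qed

text \<open>The argument of \<open>good_casimir2\<close> with the first factor on \<open>X\<close>,
  where invariance of \<open>h\<close> takes the place of \<open>lie_tw\<close>.\<close>

lemma good_casimir1:
  assumes i: "i < l"
  shows "good (\<lambda>T. finsum TS (\<lambda>b. lw i b (d b) T) B)"
  unfolding good_def
proof (intro conjI ballI allI impI)
  have cl: "clinear TS TS (lw i x y)" if "x \<in> lie G" for x y
    by (rule clinearI)
      (simp_all only: clinear_simps[OF clinear_lop[OF pi_linear[OF that]]] clinear_simps[OF clinear_wop])
  show "clinear TS TS (\<lambda>T. finsum TS (\<lambda>b. lw i b (d b) T) B)"
    by (rule clinear_sum) (rule cl[OF Bl(1)])
  have cB: "(\<lambda>b. lw i b (d b) T) \<in> B \<rightarrow> carrier TS" if "T \<in> carrier TS" for T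
    by (intro Pi_I lw_closed Bl that)
  {
    fix k T assume k: "k \<in> K_of G" and T: "T \<in> carrier TS"
    note kl = kappa_linear[OF k]
    let ?\<tau> = "\<lambda>x. k * x * k\<^sup>T"
    note kT = lop_closed[OF kl T]
    \<comment> \<open>\<open>k\<close> passes both operators at the price of conjugating
      \<open>b\<close> and \<open>d b\<close>; invariance of the Casimir tensor then removes the
      conjugation.\<close>
    have one: "tensor_grp G X l k (lw i b (d b) T) = lw i (?\<tau> b) (?\<tau> (d b)) (tensor_grp G X l k T)" if b: "b \<in> B" for b
    proof -
      note bl = Bl(1)[OF b] and dl = Bl(2)[OF b]
      note tb = lie_ad[OF k bl] and td = lie_ad[OF k dl]
      note wT = wop_closed[OF T, of "loc1 l i (ent (d b))"]
      have "lop (\<kappa> k) (lw i b (d b) T) = lop (\<pi> (?\<tau> b)) (lop (\<kappa> k) (wop (loc1 l i (ent (d b))) T))"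
        using kappa_pi[OF k bl TS_closed[OF wT]] by (auto simp: lop_def)
      also have "\<dots> = lop (\<pi> (?\<tau> b)) (wop (loc1 l i (ent (d b))) (lop (\<kappa> k) T))"
        unfolding lop_wop[OF kl T] ..
      finally have "tensor_grp G X l k (lw i b (d b) T) =
          wop (tk k) (lop (\<pi> (?\<tau> b)) (wop (loc1 l i (ent (d b))) (lop (\<kappa> k) T)))"
        unfolding tensor_grp_eq[OF lw_closed[OF bl T] k] by simp
      also have "\<dots> = lop (\<pi> (?\<tau> b)) (wop (mmul W (tk k) (loc1 l i (ent (d b)))) (lop (\<kappa> k) T))"
        unfolding lop_wop[OF pi_linear[OF tb] wop_closed[OF kT], symmetric] wop_comp[OF kT] ..
      also have "wop (mmul W (tk k) (loc1 l i (ent (d b)))) (lop (\<kappa> k) T) =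
          wop (mmul W (loc1 l i (ent (?\<tau> (d b)))) (tk k)) (lop (\<kappa> k) T)"
      proof (rule wop_cong[OF kT])
        fix I J assume I: "I \<in> W" and J: "J \<in> W"
        show "mmul W (tk k) (loc1 l i (ent (d b))) I J = mmul W (loc1 l i (ent (?\<tau> (d b)))) (tk k) I J"
          unfolding mmul_def
        proof (rule loc1_tens[OF I J, symmetric])
          fix a e assume lt: "a < N" "e < N"
          have "?\<tau> (d b) * k = k * d b" using K_D[OF k] lie_C[OF dl] by (simp add: sq)
          then show "(\<Sum>c<N. ent (?\<tau> (d b)) a c * ent k c e) = (\<Sum>c<N. ent k a c * ent (d b) c e)"
            using sq_index[OF lie_C[OF td] K_D(1)[OF k] lt] sq_index[OF K_D(1)[OF k] lie_C[OF dl] lt] by simp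
        qed
      qed
      also have "\<dots> = wop (loc1 l i (ent (?\<tau> (d b)))) (tensor_grp G X l k T)"
        unfolding tensor_grp_eq[OF T k] wop_comp[OF kT] ..
      finally show ?thesis .
    qed
    have "tensor_grp G X l k (finsum TS (\<lambda>b. lw i b (d b) T) B) = finsum TS (\<lambda>b. tensor_grp G X l k (lw i b (d b) T)) B"
      by (rule clinear_finsum[OF cvs_TS cvs_TS clinear_tensor_grp[OF k] cB[OF T]])
    also have "\<dots> = finsum TS (\<lambda>b. lw i (?\<tau> b) (?\<tau> (d b)) (tensor_grp G X l k T)) B"
      by (rule TS.M.finsum_cong', rule refl)
        (use one lw_closed[OF lie_ad[OF k Bl(1)] tensor_grp_closed[OF T k]] in \<open>auto simp del: TS_simps\<close>)
    also have "\<dots> = finsum TS (\<lambda>b. lw i b (d b) (tensor_grp G X l k T)) B"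
      by (rule casimir1_auto[OF auto_ad[OF k] i tensor_grp_closed[OF T k]])
    finally show "tensor_grp G X l k (finsum TS (\<lambda>b. lw i b (d b) T) B) = finsum TS (\<lambda>b. lw i b (d b) (tensor_grp G X l k T)) B" .
  }
  fix h T S assume h: "gk_invariant_form G X h" and T: "T \<in> carrier TS" and S: "S \<in> carrier TS"
  have hh: "hermitian_form M h" using h unfolding gk_invariant_form_def by simp
  interpret t: sesq TS "tf h"
    by (intro sesq.intro sesq_axioms.intro cvs_TS tf_hermitian hh)
  have one: "tf h (lw i b (d b) T) S = tf h T (lw i (cj b) (cj (d b)) S)" if b: "b \<in> B" for b
  proof -
    note bl = Bl(1)[OF b] and dl = Bl(2)[OF b]
    note cb = lie_cj[OF bl] and cd = lie_cj[OF dl]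
    note mcb = lie_uminus[OF cb]
    note pT = lop_closed[OF pi_linear[OF bl] T]
    let ?S = "wop (loc1 l i (ent (- cj (d b)))) S"
    note SS = wop_closed[OF S, of "loc1 l i (ent (- cj (d b)))"]
    have "tf h (lw i b (d b) T) S = tf h (wop (loc1 l i (ent (d b))) (lop (\<pi> b) T)) S"
      unfolding lop_wop[OF pi_linear[OF bl] T] ..
    also have "\<dots> = tf h (lop (\<pi> b) T) ?S"
    proof (rule tf_wop_adjoint[OF hh pT S])
      fix I J assume I: "I \<in> W" and J: "J \<in> W"
      show "(\<Sum>K\<in>W. loc1 l i (ent (d b)) K I * tk (tw hV) K J) =
          (\<Sum>K\<in>W. tk (tw hV) I K * cnj (loc1 l i (ent (- cj (d b))) K J))"
        unfolding loc1_transpose[of l i "ent (d b)" _ I] loc1_cnj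
      proof (rule loc1_tens[OF I J])
        fix a e assume lt: "a < N" "e < N"
        note dC = lie_C[OF dl]
        have "(\<Sum>x<N. ent (d b) x a * ent (tw hV) x e) = ((d b)\<^sup>T * tw hV) $$ (a, e)"
          using lt dC by (subst sq_index) (auto simp: sq_closed)
        also have "\<dots> = - ((tw hV * d b) $$ (a, e))"
          unfolding lie_tw[OF V dl] using lt dC by (simp add: carrier_matD[OF tw_closed] del: index_mult_mat(1))
        also have "\<dots> = (\<Sum>x<N. ent (tw hV) a x * cnj (ent (- cj (d b)) x e))"
          unfolding sq_index[OF tw_closed dC lt] sum_negf[symmetric]
          using lt dC by (intro sum.cong refl) auto
        finally show "(\<Sum>x<N. ent (d b) x a * ent (tw hV) x e) = (\<Sum>x<N. ent (tw hV) a x * cnj (ent (- cj (d b)) x e))" .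
      qed
    qed
    also have "\<dots> = tf h T (lop (\<pi> (- cj b)) ?S)"
    proof -
      have "h (\<pi> b x) y = h x (\<pi> (- cj b) y)" if "x \<in> carrier M" "y \<in> carrier M" for x y
        using h bl that unfolding gk_invariant_form_def by blast
      then show ?thesis
        unfolding tf_eq[OF hh pT SS] tf_eq[OF hh T lop_closed[OF pi_linear[OF mcb] SS]]
        using TS_closed[OF T] TS_closed[OF SS] by (simp add: lop_def)
    qed
    also have "\<dots> = tf h T (lw i (cj b) (cj (d b)) S)"
      unfolding lw_uminus[OF i cb lie_C[OF cd] S] ..
    finally show ?thesis .
  qed
  have cC: "(\<lambda>b. lw i (cj b) (cj (d b)) S) \<in> B \<rightarrow> carrier TS"
    by (intro Pi_I lw_closed[OF lie_cj[OF Bl(1)] S])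
  have "tf h (finsum TS (\<lambda>b. lw i b (d b) T) B) S = (\<Sum>b\<in>B. tf h (lw i b (d b) T) S)"
    by (rule t.H_finsum(1)[OF S cB[OF T]])
  also have "\<dots> = (\<Sum>b\<in>B. tf h T (lw i (cj b) (cj (d b)) S))"
    using one by (rule sum.cong[OF refl])
  also have "\<dots> = tf h T (finsum TS (\<lambda>b. lw i (cj b) (cj (d b)) S) B)"
    by (rule t.H_finsum(2)[OF T cC, symmetric])
  also have "\<dots> = tf h T (finsum TS (\<lambda>b. lw i b (d b) S) B)"
    unfolding casimir1_auto[OF auto_cj i S] ..
  finally show "tf h (finsum TS (\<lambda>b. lw i b (d b) T) B) S = tf h T (finsum TS (\<lambda>b. lw i b (d b) S) B)" .
qed

end

section \<open>The generators as operators on the tensor product\<close>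

context gk_tens
begin

lemma lie_factor_0: "lie_factor G X l 0 x T = lop (\<pi> x) T"
  unfolding lie_factor_def lop_def words_eq by simp

lemma lie_factor_pos:
  "T \<in> carrier TS \<Longrightarrow> 1 \<le> i \<Longrightarrow> i \<le> l \<Longrightarrow> lie_factor G X l i x T = wop (loc1 l (i - 1) (ent x)) T"
  unfolding lie_factor_def using factor_op_eq[of T i x] by simp

lemma good_Omega0:
  assumes i: "1 \<le> i" "i \<le> l"
  shows "good (\<Omega>_op G B d X l 0 i)"
proof (rule good_cong[OF good_casimir1[of "i - 1"]])
  show "i - 1 < l" using i by simp
  fix T assume "T \<in> carrier TS"
  show "\<Omega>_op G B d X l 0 i T = finsum TS (\<lambda>b. lw (i - 1) b (d b) T) B"
    unfolding \<Omega>_op_def lie_factor_0 lie_factor_pos[OF \<open>T \<in> carrier TS\<close> i] ..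
qed

text \<open>For each \<open>b\<close> the two one-factor operators combine to a single
  \<open>loc2\<close>, and the sum over \<open>B\<close> then moves into its matrix.\<close>

lemma good_Omega:
  assumes i: "1 \<le> j" "j < i" "i \<le> l"
  shows "good (\<Omega>_op G B d X l j i)"
proof (rule good_cong[OF good_casimir2[of "j - 1" "i - 1"]])
  let ?Q = "\<lambda>b p q. ent b (fst p) (fst q) * ent (d b) (snd p) (snd q)"
  show lt: "j - 1 < l" "i - 1 < l" "j - 1 \<noteq> i - 1" using i by auto
  fix T assume T: "T \<in> carrier TS"
  have ij: "1 \<le> i" "i \<le> l" "1 \<le> j" "j \<le> l" using i by auto
  have f: "lie_factor G X l j b (lie_factor G X l i (d b) T) = wop (loc2 l (j - 1) (i - 1) (?Q b)) T" for b
    unfolding lie_factor_pos[OF T ij(1,2)] lie_factor_pos[OF wop_closed[OF T] ij(3,4)] wop_comp[OF T]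
    by (rule wop_cong[OF T]) (rule loc1_loc1[OF _ _ lt])
  have cl: "(\<lambda>b. wop (loc2 l (j - 1) (i - 1) (?Q b)) T) \<in> B \<rightarrow> carrier TS" using wop_closed[OF T] by blast
  note Tc = TS_closed[OF T]
  show "\<Omega>_op G B d X l j i T = wop (loc2 l (j - 1) (i - 1) (\<lambda>p q. \<Sum>b\<in>B. ?Q b p q)) T"
    unfolding \<Omega>_op_def f
  proof (rule TS_eqI[OF TS.M.finsum_closed[OF cl] wop_closed[OF T]])
    fix I assume I: "I \<in> W"
    have "finsum TS (\<lambda>b. wop (loc2 l (j - 1) (i - 1) (?Q b)) T) B I =
        finsum M (\<lambda>b. finsum M (\<lambda>J. loc2 l (j - 1) (i - 1) (?Q b) I J \<odot>\<^bsub>M\<^esub> T J) W) B"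
      unfolding TS_finsum[OF cl] using I by (simp add: wop_def)
    also have "\<dots> = finsum M (\<lambda>J. finsum M (\<lambda>b. loc2 l (j - 1) (i - 1) (?Q b) I J \<odot>\<^bsub>M\<^esub> T J) B) W"
      by (rule M.finsum_swap) (use finB Tc in auto)
    also have "\<dots> = finsum M (\<lambda>J. loc2 l (j - 1) (i - 1) (\<lambda>p q. \<Sum>b\<in>B. ?Q b p q) I J \<odot>\<^bsub>M\<^esub> T J) W"
      unfolding loc2_sum using M.finsum_sm[OF finB Tc] by simp
    also have "\<dots> = wop (loc2 l (j - 1) (i - 1) (\<lambda>p q. \<Sum>b\<in>B. ?Q b p q)) T I"
      using I by (simp add: wop_def)
    finally show "finsum TS (\<lambda>b. wop (loc2 l (j - 1) (i - 1) (?Q b)) T) B I =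
        wop (loc2 l (j - 1) (i - 1) (\<lambda>p q. \<Sum>b\<in>B. ?Q b p q)) T I" .
  qed
qed

lemma good_VZ:
  assumes i: "1 \<le> i" "i \<le> l"
  shows "good (vw_tensor_op G B d P X l (VZ i))"
proof (rule good_cong[OF good_sum[of "{0..<i}" "\<lambda>j. \<Omega>_op G B d X l j i"]])
  fix j assume j: "j \<in> {0..<i}"
  show "good (\<Omega>_op G B d X l j i)"
  proof (cases "j = 0")
    case True
    then show ?thesis using good_Omega0[OF i] by simp
  next
    case False
    then show ?thesis using good_Omega[of j i] i j by simp
  qed
qed simp

lemma good_VE:
  assumes i: "1 \<le> i" "i < l"
  shows "good (vw_tensor_op G B d P X l (VE i))"
proof (rule good_cong[OF good_projection[OF i]])
  fix T assume T: "T \<in> carrier TS"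
  have lt: "i - 1 < l" "i < l" "i - 1 \<noteq> i" using i by auto
  note Tc = TS_closed[OF T]
  show "vw_tensor_op G B d P X l (VE i) T = wop (loc2 l (i - 1) i (\<lambda>p q. vw_m0 G * P p q)) T"
  proof
    fix I
    show "vw_tensor_op G B d P X l (VE i) T I = wop (loc2 l (i - 1) i (\<lambda>p q. vw_m0 G * P p q)) T I"
    proof (cases "I \<in> W")
      case True
      show ?thesis
        unfolding loc2_wop[OF T True lt] M.sm_assoc[OF Tc]
        using True Tc by (simp add: words_eq Let_def M.sm_finsum Pi_def)
    qed (simp add: words_eq Let_def wop_def)
  qed
qed

lemma good_VT:
  assumes i: "1 \<le> i" "i < l"
  shows "good (vw_tensor_op G B d P X l (VT i))"
  by (rule good_cong[OF good_flip[OF i]]) (use flip_eq[OF _ i] in simp)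

lemma VTheta_eq:
  assumes i: "1 \<le> i" "i \<le> l" and T: "T \<in> carrier TS"
  shows "vw_tensor_op G B d P X l (VTheta i) T = wop (loc1 l (i - 1) (ent \<xi>)) T"
  using factor_op_eq[OF T i] by simp

lemma good_VTheta:
  assumes i: "1 \<le> i" "i \<le> l"
  shows "good (vw_tensor_op G B d P X l (VTheta i))"
  by (rule good_cong[OF good_xi[of "i - 1"]]) (use VTheta_eq[OF i] i in auto)

lemma good_id: "good (\<lambda>T. T)"
  unfolding good_def by (auto intro!: clinearI simp del: TS_simps intro: TS.M.add.m_closed TS.sm_closed)

text \<open>The scalar is real because symmetric operators form only a real vector space.\<close>

lemma good_smult:
  assumes g: "good f" and a: "cnj a = a"
  shows "good (\<lambda>T. a \<odot>\<^bsub>TS\<^esub> f T)"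
  unfolding good_def
proof (intro conjI ballI allI impI)
  have c: "clinear TS TS f" using g unfolding good_def by simp
  show "clinear TS TS (\<lambda>T. a \<odot>\<^bsub>TS\<^esub> f T)"
  proof (rule clinearI)
    fix T S assume T: "T \<in> carrier TS" and S: "S \<in> carrier TS"
    show "a \<odot>\<^bsub>TS\<^esub> f T \<in> carrier TS" by (rule TS.sm_closed[OF clinear_simps(1)[OF c T]])
    show "a \<odot>\<^bsub>TS\<^esub> f (T \<oplus>\<^bsub>TS\<^esub> S) = a \<odot>\<^bsub>TS\<^esub> f T \<oplus>\<^bsub>TS\<^esub> a \<odot>\<^bsub>TS\<^esub> f S"
      unfolding clinear_simps(3)[OF c T S] by (rule TS.sm_radd[OF clinear_simps(1)[OF c T] clinear_simps(1)[OF c S]])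
  next
    fix T b assume T: "T \<in> carrier TS"
    note fT = clinear_simps(1)[OF c T]
    show "a \<odot>\<^bsub>TS\<^esub> f (b \<odot>\<^bsub>TS\<^esub> T) = b \<odot>\<^bsub>TS\<^esub> (a \<odot>\<^bsub>TS\<^esub> f T)"
      unfolding clinear_simps(2)[OF c T] TS.sm_assoc[OF fT, symmetric] mult.commute[of a] ..
  qed
  fix k T assume k: "k \<in> K_of G" and T: "T \<in> carrier TS"
  show "tensor_grp G X l k (a \<odot>\<^bsub>TS\<^esub> f T) = a \<odot>\<^bsub>TS\<^esub> f (tensor_grp G X l k T)"
    unfolding clinear_simps(2)[OF clinear_tensor_grp[OF k] clinear_simps(1)[OF c T]]
    using g k T unfolding good_def by metis
next
  fix h T S assume h: "gk_invariant_form G X h" and T: "T \<in> carrier TS" and S: "S \<in> carrier TS"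
  have c: "clinear TS TS f" using g unfolding good_def by simp
  interpret t: sesq TS "tf h"
    by (intro sesq.intro sesq_axioms.intro cvs_TS tf_hermitian) (use h in \<open>simp add: gk_invariant_form_def\<close>)
  have "tf h (f T) S = tf h T (f S)" using g h T S unfolding good_def by blast
  then show "tf h (a \<odot>\<^bsub>TS\<^esub> f T) S = tf h T (a \<odot>\<^bsub>TS\<^esub> f S)"
    unfolding t.H_sm(1)[OF clinear_simps(1)[OF c T] S] t.H_sm(2)[OF clinear_simps(1)[OF c S] T] a by simp
qed

lemma good_add:
  assumes f: "good f" and g: "good g"
  shows "good (\<lambda>T. f T \<oplus>\<^bsub>TS\<^esub> g T)"
\<comment> \<open>A sum of two terms is treated as a sum over the truth values.\<close>
proof (rule good_cong[OF good_sum[of UNIV "\<lambda>b. if b then f else g"]])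
  show "good (if b then f else g)" for b using f g by simp
  fix T assume T: "T \<in> carrier TS"
  have "clinear TS TS f" "clinear TS TS g" using f g unfolding good_def by simp_all
  note this[THEN clinear_simps(1), OF T]
  then show "f T \<oplus>\<^bsub>TS\<^esub> g T = finsum TS (\<lambda>b. (if b then f else g) T) UNIV"
    unfolding UNIV_bool by (simp del: TS_simps add: TS.M.finsum_insert TS.M.add.m_comm Pi_def)
qed

lemma vw_good:
  assumes "g \<in> alg_gens (vw_algebra l m0 m1 w)"
  shows "good (vw_tensor_op G B d P X l g)"
  using assms good_VT good_VE good_VZ good_VTheta unfolding vw_algebra_def Let_def by auto

text \<open>Adds one factor to a partial product of \<open>w\<^sub>0\<close>. Here \<open>r\<close>
  is the number of factors already treated, so the next one, factor \<open>r + 1\<close>, sits at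
  position \<open>r\<close>.\<close>

lemma wop_xi_power:
  assumes T: "T \<in> carrier TS" and r: "r < l"
  shows "wop (tens l (\<lambda>m. if m < r then ent \<xi> else dlt)) (wop (loc1 l r (ent \<xi>)) T) =
    wop (tens l (\<lambda>m. if m < Suc r then ent \<xi> else dlt)) T"
  unfolding wop_comp[OF T]
proof (rule wop_cong[OF T])
  fix I J assume I: "I \<in> W" and J: "J \<in> W"
  show "mmul W (tens l (\<lambda>m. if m < r then ent \<xi> else dlt)) (loc1 l r (ent \<xi>)) I J =
      tens l (\<lambda>m. if m < Suc r then ent \<xi> else dlt) I J"
    unfolding mmul_def loc1_def tens_mult[OF I J]
    by (rule tens_cong[OF I J]) (auto simp: less_Suc_eq)
qed

lemma wop_xi_involution:
  assumes T: "T \<in> carrier TS"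
  shows "wop (tk \<xi>) (wop (tk \<xi>) T) = T"
proof -
  have "wop (tk \<xi>) (wop (tk \<xi>) T) = wop dlt T"
    unfolding wop_comp[OF T]
  proof (rule wop_cong[OF T])
    fix I J assume I: "I \<in> W" and J: "J \<in> W"
    have "mmul W (tk \<xi>) (tk \<xi>) I J = tens l (\<lambda>m. dlt) I J"
      unfolding mmul_def tens_mult[OF I J]
    proof (rule tens_cong[OF I J])
      fix a b assume lt: "a < N" "b < N"
      show "(\<Sum>x<N. ent \<xi> a x * ent \<xi> x b) = dlt a b"
        unfolding sq_index[OF xi_closed xi_closed lt, symmetric] xi_square using lt by (simp add: dlt_def)
    qed
    then show "mmul W (tk \<xi>) (tk \<xi>) I J = dlt I J" using tens_dlt[OF I J] by simp
  qed
  then show ?thesis using wop_dlt[OF T] by simp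
qed

end

section \<open>The multiplicity spaces\<close>

locale mult_space = gk_tens G B d X l hV P for G B d and X :: "'x gk_module" and l hV P +
  fixes \<mu> :: "complex mat \<Rightarrow> complex"
begin

abbreviation FS where "FS \<equiv> F_space G \<mu> l X"

lemma FS_iff: "\<phi> \<in> carrier FS \<longleftrightarrow>
    (\<forall>a. \<phi> a \<in> carrier TS) \<and> (\<forall>a b. \<phi> (a + b) = \<phi> a \<oplus>\<^bsub>TS\<^esub> \<phi> b) \<and> (\<forall>a b. \<phi> (a * b) = a \<odot>\<^bsub>TS\<^esub> \<phi> b) \<and>
    (\<forall>k\<in>K_of G. \<forall>a. \<phi> (\<mu> k * a) = tensor_grp G X l k (\<phi> a))"
  unfolding F_space_def Let_def by (auto simp del: TS_simps)

lemma FS_simps: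
  "\<zero>\<^bsub>FS\<^esub> = (\<lambda>a. \<zero>\<^bsub>TS\<^esub>)" "\<phi> \<oplus>\<^bsub>FS\<^esub> \<psi> = (\<lambda>a. \<phi> a \<oplus>\<^bsub>TS\<^esub> \<psi> a)" "a \<odot>\<^bsub>FS\<^esub> \<phi> = (\<lambda>x. a \<odot>\<^bsub>TS\<^esub> \<phi> x)"
  unfolding F_space_def Let_def by (simp_all del: TS_simps)

text \<open>By linearity an element is determined by its value at 1 (the last fact), which is why
  \<open>F_form\<close> looks at that value only.\<close>

lemma FS_D:
  assumes "\<phi> \<in> carrier FS"
  shows "\<phi> a \<in> carrier TS" "\<phi> (a + b) = \<phi> a \<oplus>\<^bsub>TS\<^esub> \<phi> b" "\<phi> (a * b) = a \<odot>\<^bsub>TS\<^esub> \<phi> b"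
    "k \<in> K_of G \<Longrightarrow> \<phi> (\<mu> k * a) = tensor_grp G X l k (\<phi> a)" "\<phi> a = a \<odot>\<^bsub>TS\<^esub> \<phi> 1"
proof -
  show "\<phi> a \<in> carrier TS" "\<phi> (a + b) = \<phi> a \<oplus>\<^bsub>TS\<^esub> \<phi> b" "\<phi> (a * b) = a \<odot>\<^bsub>TS\<^esub> \<phi> b"
    "k \<in> K_of G \<Longrightarrow> \<phi> (\<mu> k * a) = tensor_grp G X l k (\<phi> a)"
    using assms unfolding FS_iff by blast+
  have "\<phi> (a * 1) = a \<odot>\<^bsub>TS\<^esub> \<phi> 1" using assms unfolding FS_iff by blast
  then show "\<phi> a = a \<odot>\<^bsub>TS\<^esub> \<phi> 1" by (simp del: TS_simps)
qed

lemma FS_op: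
  assumes c: "clinear TS TS f"
    and k: "\<And>k T. k \<in> K_of G \<Longrightarrow> T \<in> carrier TS \<Longrightarrow> tensor_grp G X l k (f T) = f (tensor_grp G X l k T)"
    and \<phi>: "\<phi> \<in> carrier FS"
  shows "(\<lambda>a. f (\<phi> a)) \<in> carrier FS"
  unfolding FS_iff
proof (intro conjI allI ballI)
  note D = FS_D[OF \<phi>] and cc = clinear_simps[OF c D(1)]
  fix a b
  show "f (\<phi> a) \<in> carrier TS" by (rule cc(1))
  show "f (\<phi> (a + b)) = f (\<phi> a) \<oplus>\<^bsub>TS\<^esub> f (\<phi> b)" unfolding D(2) by (rule cc(3)[OF D(1)])
  show "f (\<phi> (a * b)) = a \<odot>\<^bsub>TS\<^esub> f (\<phi> b)" unfolding D(3) by (rule cc(2))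
  show "f (\<phi> (\<mu> x * a)) = tensor_grp G X l x (f (\<phi> a))" if x: "x \<in> K_of G" for x
    unfolding D(4)[OF x] k[OF x D(1)] ..
qed

lemma FS_add:
  assumes \<phi>: "\<phi> \<in> carrier FS" and \<psi>: "\<psi> \<in> carrier FS"
  shows "(\<lambda>a. \<phi> a \<oplus>\<^bsub>TS\<^esub> \<psi> a) \<in> carrier FS"
  unfolding FS_iff
proof (intro conjI allI ballI)
  note D = FS_D[OF \<phi>] and E = FS_D[OF \<psi>]
  fix a b
  show "\<phi> a \<oplus>\<^bsub>TS\<^esub> \<psi> a \<in> carrier TS" by (rule TS.M.add.m_closed[OF D(1) E(1)])
  show "\<phi> (a + b) \<oplus>\<^bsub>TS\<^esub> \<psi> (a + b) = \<phi> a \<oplus>\<^bsub>TS\<^esub> \<psi> a \<oplus>\<^bsub>TS\<^esub> (\<phi> b \<oplus>\<^bsub>TS\<^esub> \<psi> b)"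
    unfolding D(2) E(2) using D(1) E(1)
    by (simp only: TS.M.add.m_assoc TS.M.add.m_lcomm TS.M.add.m_closed)
  show "\<phi> (a * b) \<oplus>\<^bsub>TS\<^esub> \<psi> (a * b) = a \<odot>\<^bsub>TS\<^esub> (\<phi> b \<oplus>\<^bsub>TS\<^esub> \<psi> b)"
    unfolding D(3) E(3) by (rule TS.sm_radd[OF D(1) E(1), symmetric])
  show "\<phi> (\<mu> x * a) \<oplus>\<^bsub>TS\<^esub> \<psi> (\<mu> x * a) = tensor_grp G X l x (\<phi> a \<oplus>\<^bsub>TS\<^esub> \<psi> a)" if x: "x \<in> K_of G" for x
    unfolding D(4)[OF x] E(4)[OF x] by (rule clinear_simps(3)[OF clinear_tensor_grp[OF x] D(1) E(1), symmetric])
qed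

lemma FS_smult:
  assumes \<phi>: "\<phi> \<in> carrier FS"
  shows "(\<lambda>x. a \<odot>\<^bsub>TS\<^esub> \<phi> x) \<in> carrier FS"
proof (rule FS_op[OF _ _ \<phi>])
  show "clinear TS TS (\<lambda>T. a \<odot>\<^bsub>TS\<^esub> T)"
  proof (rule clinearI)
    show "a \<odot>\<^bsub>TS\<^esub> (b \<odot>\<^bsub>TS\<^esub> T) = b \<odot>\<^bsub>TS\<^esub> (a \<odot>\<^bsub>TS\<^esub> T)" if "T \<in> carrier TS" for b T
      unfolding TS.sm_assoc[OF that, symmetric] mult.commute[of a] ..
  qed (rule TS.sm_closed, assumption, rule TS.sm_radd)
  show "tensor_grp G X l k (a \<odot>\<^bsub>TS\<^esub> T) = a \<odot>\<^bsub>TS\<^esub> tensor_grp G X l k T" if "k \<in> K_of G" "T \<in> carrier TS" for k T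
    by (rule clinear_simps(2)[OF clinear_tensor_grp[OF that(1)] that(2)])
qed

lemma FS_zero: "(\<lambda>a. \<zero>\<^bsub>TS\<^esub>) \<in> carrier FS"
  unfolding FS_iff
proof (intro conjI allI ballI)
  show "\<zero>\<^bsub>TS\<^esub> = tensor_grp G X l k \<zero>\<^bsub>TS\<^esub>" if k: "k \<in> K_of G" for k
    using clinear_simps(2)[OF clinear_tensor_grp[OF k] TS.M.zero_closed, of 0]
      TS.sm_zero[OF tensor_grp_closed[OF TS.M.zero_closed k]] TS.sm_rzero[of 0] by (simp del: TS_simps)
qed (simp_all only: TS.M.zero_closed TS.M.l_zero TS.sm_rzero)

lemma cvs_FS: "cvs FS"
proof (rule cvsI, unfold FS_simps)
  fix x y z and a b
  assume x: "x \<in> carrier FS"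
  note X = FS_D(1)[OF x]
  show "(\<lambda>i. a \<odot>\<^bsub>TS\<^esub> x i) \<in> carrier FS" by (rule FS_smult[OF x])
  show "(\<lambda>i. \<zero>\<^bsub>TS\<^esub> \<oplus>\<^bsub>TS\<^esub> x i) = x" "(\<lambda>i. 1 \<odot>\<^bsub>TS\<^esub> x i) = x"
    "(\<lambda>i. (a * b) \<odot>\<^bsub>TS\<^esub> x i) = (\<lambda>i. a \<odot>\<^bsub>TS\<^esub> (b \<odot>\<^bsub>TS\<^esub> x i))"
    "(\<lambda>i. (a + b) \<odot>\<^bsub>TS\<^esub> x i) = (\<lambda>i. a \<odot>\<^bsub>TS\<^esub> x i \<oplus>\<^bsub>TS\<^esub> b \<odot>\<^bsub>TS\<^esub> x i)"
    using X by (simp_all only: TS.M.l_zero TS.sm_one TS.sm_assoc TS.sm_ladd)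
  show "(\<lambda>i. (- 1) \<odot>\<^bsub>TS\<^esub> x i \<oplus>\<^bsub>TS\<^esub> x i) = (\<lambda>i. \<zero>\<^bsub>TS\<^esub>)"
    using X by (simp only: TS.sm_neg TS.M.l_neg)
  assume y: "y \<in> carrier FS"
  note Y = FS_D(1)[OF y]
  show "(\<lambda>i. x i \<oplus>\<^bsub>TS\<^esub> y i) \<in> carrier FS" by (rule FS_add[OF x y])
  show "(\<lambda>i. x i \<oplus>\<^bsub>TS\<^esub> y i) = (\<lambda>i. y i \<oplus>\<^bsub>TS\<^esub> x i)" "(\<lambda>i. a \<odot>\<^bsub>TS\<^esub> (x i \<oplus>\<^bsub>TS\<^esub> y i)) = (\<lambda>i. a \<odot>\<^bsub>TS\<^esub> x i \<oplus>\<^bsub>TS\<^esub> a \<odot>\<^bsub>TS\<^esub> y i)"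
    using TS.M.a_comm[OF X Y] TS.sm_radd[OF X Y] by simp_all
  assume z: "z \<in> carrier FS"
  show "(\<lambda>i. x i \<oplus>\<^bsub>TS\<^esub> y i \<oplus>\<^bsub>TS\<^esub> z i) = (\<lambda>i. x i \<oplus>\<^bsub>TS\<^esub> (y i \<oplus>\<^bsub>TS\<^esub> z i))"
    using TS.M.a_assoc[OF X Y FS_D(1)[OF z]] by simp
qed (rule FS_zero)

sublocale FS: cvs FS by (rule cvs_FS)

end

section \<open>Quotients\<close>

locale lin_quot = cvs F for F :: "(complex, 'v) module" (structure) +
  fixes R
  assumes R_sub: "R \<subseteq> carrier F" and R_zero: "\<zero> \<in> R"
    and R_add: "x \<in> R \<Longrightarrow> y \<in> R \<Longrightarrow> x \<oplus> y \<in> R" and R_sm: "x \<in> R \<Longrightarrow> a \<odot> x \<in> R"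
begin

abbreviation cl :: "'v \<Rightarrow> 'v set" where "cl x \<equiv> R +>\<^bsub>F\<^esub> x"

lemma R_carrier: "x \<in> R \<Longrightarrow> x \<in> carrier F"
  using R_sub by blast

lemma R_minus: "x \<in> R \<Longrightarrow> \<ominus> x \<in> R"
  using R_sm[of x "- 1"] sm_neg R_carrier by simp

sublocale Q: abelian_subgroup R F
proof (rule abelian_subgroupI3)
  show "additive_subgroup R F"
    by (rule additive_subgroup.intro, rule subgroup.intro)
      (use R_sub R_add R_zero R_minus in \<open>auto simp: a_inv_def\<close>)
  show "abelian_group F" by (rule M.abelian_group_axioms)
qed

lemma cl_mem: "x \<in> carrier F \<Longrightarrow> x \<in> cl x"
  by (rule Q.a_rcos_self)

lemma cl_repr: "z \<in> cl x \<Longrightarrow> x \<in> carrier F \<Longrightarrow> z \<in> carrier F \<and> cl z = cl x"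
  using Q.a_repr_independence'[of z x] Q.a_elemrcos_carrier[of x z] by simp

lemma cl_diff: "z \<in> cl x \<Longrightarrow> x \<in> carrier F \<Longrightarrow> z \<ominus> x \<in> R"
  unfolding a_minus_def by (rule Q.a_rcos_module_imp)

lemma cl_eqI: "x \<in> carrier F \<Longrightarrow> z \<in> carrier F \<Longrightarrow> z \<ominus> x \<in> R \<Longrightarrow> cl z = cl x"
  using Q.a_rcos_module_rev[of x z] cl_repr[of z x] by (simp add: a_minus_def)

lemma cl_zero_iff:
  assumes x: "x \<in> carrier F" shows "cl x = R \<longleftrightarrow> x \<in> R"
proof
  assume "cl x = R"
  then show "x \<in> R" using cl_mem[OF x] by simp
next
  assume xR: "x \<in> R"
  have "cl x = cl \<zero>"
    by (rule cl_eqI) (use x xR in \<open>simp_all add: a_minus_def\<close>)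
  also have "\<dots> = R" by (rule M.a_coset_add_zero[OF R_sub])
  finally show "cl x = R" .
qed

lemma quot_space_simps:
  "carrier (quot_space F R) = cl ` carrier F" "\<zero>\<^bsub>quot_space F R\<^esub> = R"
  by (auto simp: quot_space_def A_RCOSETS_def')

lemma quot_add:
  "x \<in> carrier F \<Longrightarrow> y \<in> carrier F \<Longrightarrow> cl x \<oplus>\<^bsub>quot_space F R\<^esub> cl y = cl (x \<oplus> y)"
  by (simp add: quot_space_def Q.a_rcos_sum)

text \<open>The operations of the quotient are written as unions over all representatives. The
  unions collapse because \<open>f\<close> maps representatives that differ by \<open>R\<close> to
  vectors that differ by \<open>R\<close>.\<close>

lemma quot_union:
  assumes x: "x \<in> carrier F" and f: "clinear F F f" "\<And>r. r \<in> R \<Longrightarrow> f r \<in> R"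
  shows "(\<Union>z\<in>cl x. cl (f z)) = cl (f x)"
proof -
  have "cl (f z) = cl (f x)" if z: "z \<in> cl x" for z
  proof (rule cl_eqI)
    have zc: "z \<in> carrier F" using cl_repr[OF z x] by simp
    show "f x \<in> carrier F" "f z \<in> carrier F" using clinear_simps(1)[OF f(1)] x zc by simp_all
    have "f (z \<oplus> (- 1) \<odot> x) = f z \<oplus> (- 1) \<odot> f x"
      using clinear_simps[OF f(1)] x zc by simp
    then have "f z \<ominus> f x = f (z \<ominus> x)"
      using x zc clinear_simps(1)[OF f(1)] by (simp add: a_minus_def sm_neg)
    then show "f z \<ominus> f x \<in> R" using f(2)[OF cl_diff[OF z x]] by simp
  qed
  then show ?thesis using cl_mem[OF x] by blast
qed

lemma quot_op_cl:
  "x \<in> carrier F \<Longrightarrow> clinear F F f \<Longrightarrow> (\<And>r. r \<in> R \<Longrightarrow> f r \<in> R) \<Longrightarrow> quot_op F R f (cl x) = cl (f x)"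
  unfolding quot_op_def by (rule quot_union)

lemma clinear_sm: "clinear F F (\<lambda>x. a \<odot> x)"
  by (rule clinearI) (auto simp: sm_radd sm_assoc[symmetric] mult.commute)

lemma quot_smult:
  "x \<in> carrier F \<Longrightarrow> a \<odot>\<^bsub>quot_space F R\<^esub> cl x = cl (a \<odot> x)"
  using quot_union[OF _ clinear_sm R_sm, of x] by (simp add: quot_space_def)

lemma nc_eval_closed:
  assumes g: "\<And>g. g \<in> A \<Longrightarrow> clinear F F (\<rho> g)" and a: "set_ncpoly a \<subseteq> A" and x: "x \<in> carrier F"
  shows "nc_eval F \<rho> a x \<in> carrier F"
  using a x by (induction a arbitrary: x) (auto simp: clinear_simps(1)[OF g])

lemma nc_eval_add:
  assumes g: "\<And>g. g \<in> A \<Longrightarrow> clinear F F (\<rho> g)" and a: "set_ncpoly a \<subseteq> A" and x: "x \<in> carrier F" and y: "y \<in> carrier F"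
  shows "nc_eval F \<rho> a (x \<oplus> y) = nc_eval F \<rho> a x \<oplus> nc_eval F \<rho> a y"
  using a x y
proof (induction a arbitrary: x y)
  case (Gen h)
  then show ?case using clinear_simps(3)[OF g] by simp
next
  case (Plus a b)
  then have c: "nc_eval F \<rho> a x \<in> carrier F" "nc_eval F \<rho> a y \<in> carrier F"
    "nc_eval F \<rho> b x \<in> carrier F" "nc_eval F \<rho> b y \<in> carrier F"
    using nc_eval_closed[where A=A and \<rho>=\<rho>, OF g] by auto
  show ?case using Plus by (simp add: M.add.m_ac c)
next
  case (Times a b)
  then have c: "nc_eval F \<rho> b x \<in> carrier F" "nc_eval F \<rho> b y \<in> carrier F"
    using nc_eval_closed[where A=A and \<rho>=\<rho>, OF g] by auto
  show ?case using Times c by simp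
qed (simp add: sm_radd)

lemma nc_eval_quot:
  assumes g: "\<And>g. g \<in> A \<Longrightarrow> clinear F F (\<rho> g)" "\<And>g x. g \<in> A \<Longrightarrow> x \<in> R \<Longrightarrow> \<rho> g x \<in> R"
    and a: "set_ncpoly a \<subseteq> A" and x: "x \<in> carrier F"
  shows "nc_eval (quot_space F R) (\<lambda>g. quot_op F R (\<rho> g)) a (cl x) = cl (nc_eval F \<rho> a x)"
  using a x
proof (induction a arbitrary: x)
  case (Gen h)
  then show ?case using quot_op_cl[OF _ g(1) g(2)] by simp
next
  case (Plus a b)
  then show ?case using nc_eval_closed[where A=A and \<rho>=\<rho>, OF g(1)] by (simp add: quot_add)
next
  case (Times a b)
  then show ?case using nc_eval_closed[where A=A and \<rho>=\<rho>, OF g(1)] by simp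
qed (simp add: quot_smult)

text \<open>Representatives are chosen arbitrarily; the choice does not matter once \<open>H\<close>
  vanishes on \<open>R\<close> in both variables, as in \<open>qform_cl\<close>.\<close>

definition qform :: "('v \<Rightarrow> 'v \<Rightarrow> complex) \<Rightarrow> 'v set \<Rightarrow> 'v set \<Rightarrow> complex" where
  "qform H S T = H (SOME x. x \<in> S) (SOME y. y \<in> T)"

lemma qform_cl:
  assumes H: "hermitian_form F H" and R: "\<And>r y. r \<in> R \<Longrightarrow> y \<in> carrier F \<Longrightarrow> H r y = 0 \<and> H y r = 0"
    and x: "x \<in> carrier F" and y: "y \<in> carrier F"
  shows "qform H (cl x) (cl y) = H x y"
proof -
  interpret H: sesq F H by (intro sesq.intro sesq_axioms.intro H cvs_axioms)
  define x' where "x' = (SOME x'. x' \<in> cl x)"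
  define y' where "y' = (SOME y'. y' \<in> cl y)"
  have x': "x' \<in> cl x" unfolding x'_def using cl_mem[OF x] by (rule someI)
  have y': "y' \<in> cl y" unfolding y'_def using cl_mem[OF y] by (rule someI)
  note xc = cl_repr[OF x' x, THEN conjunct1] and yc = cl_repr[OF y' y, THEN conjunct1]
  have "H (x' \<ominus> x) y' = 0" "H x (y' \<ominus> y) = 0"
    using R cl_diff[OF x' x] cl_diff[OF y' y] x yc by blast+
  then show ?thesis
    unfolding qform_def x'_def[symmetric] y'_def[symmetric] using x y xc yc by simp
qed

text \<open>It is applied with \<open>R\<close> the radical of one form and \<open>H\<close> built
  from another; what ties them together is that \<open>H\<close> vanishes on \<open>R\<close> in
  both variables and is positive off \<open>R\<close>.\<close>

lemma unitary_quotientI: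
  assumes g: "\<And>g. g \<in> alg_gens A \<Longrightarrow> clinear F F (\<rho> g)" "\<And>g x. g \<in> alg_gens A \<Longrightarrow> x \<in> R \<Longrightarrow> \<rho> g x \<in> R"
    and w0: "set_ncpoly (alg_w0 A) \<subseteq> alg_gens A"
    and H: "hermitian_form F H" and R: "\<And>r y. r \<in> R \<Longrightarrow> y \<in> carrier F \<Longrightarrow> H r y = 0 \<and> H y r = 0"
    and pos: "\<And>x. x \<in> carrier F \<Longrightarrow> x \<notin> R \<Longrightarrow> H x x \<in> \<real> \<and> 0 < Re (H x x)"
    and inv: "\<And>a x y. set_ncpoly a \<subseteq> alg_gens A \<Longrightarrow> x \<in> carrier F \<Longrightarrow> y \<in> carrier F \<Longrightarrow>
      H (nc_eval F \<rho> a x) y = H x (nc_eval F \<rho> (alg_star A a) y)"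
  shows "unitary_alg_module A (quot_space F R) (\<lambda>g. quot_op F R (\<rho> g))"
  unfolding unitary_alg_module_def
proof (intro exI[of _ "qform H"] conjI allI impI ballI)
  interpret H: sesq F H by (intro sesq.intro sesq_axioms.intro H cvs_axioms)
  have q: "qform H (cl x) (cl y) = H x y" if "x \<in> carrier F" "y \<in> carrier F" for x y
    by (rule qform_cl[OF H _ that]) (rule R)
  show "hermitian_form (quot_space F R) (qform H)"
    unfolding hermitian_form_def quot_space_simps ball_simps
    by (intro ballI allI) (simp add: quot_add quot_smult q)
  show "positive_definite (quot_space F R) (qform H)"
    unfolding positive_definite_def quot_space_simps ball_simps
    using pos by (auto simp: q cl_zero_iff)
  fix a u v
  assume a: "set_ncpoly a \<subseteq> alg_gens A" and u: "u \<in> carrier (quot_space F R)" and v: "v \<in> carrier (quot_space F R)"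
  obtain x y where x: "x \<in> carrier F" "u = cl x" and y: "y \<in> carrier F" "v = cl y"
    using u v unfolding quot_space_simps by blast
  have "set_ncpoly (nc_bullet a) = set_ncpoly a" by (induction a) auto
  then have s: "set_ncpoly (alg_star A a) \<subseteq> alg_gens A"
    using w0 a unfolding alg_star_def by simp
  have e1: "nc_eval (quot_space F R) (\<lambda>g. quot_op F R (\<rho> g)) a u = cl (nc_eval F \<rho> a x)"
    unfolding x(2) by (rule nc_eval_quot[where A="alg_gens A", OF g a x(1)])
  have e2: "nc_eval (quot_space F R) (\<lambda>g. quot_op F R (\<rho> g)) (alg_star A a) v = cl (nc_eval F \<rho> (alg_star A a) y)"
    unfolding y(2) by (rule nc_eval_quot[where A="alg_gens A", OF g s y(1)])
  have c: "nc_eval F \<rho> a x \<in> carrier F" "nc_eval F \<rho> (alg_star A a) y \<in> carrier F"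
    using nc_eval_closed[where A="alg_gens A" and \<rho>=\<rho>, OF g(1) a x(1)]
      nc_eval_closed[where A="alg_gens A" and \<rho>=\<rho>, OF g(1) s y(1)] by simp_all
  show "qform H (nc_eval (quot_space F R) (\<lambda>g. quot_op F R (\<rho> g)) a u) v =
      qform H u (nc_eval (quot_space F R) (\<lambda>g. quot_op F R (\<rho> g)) (alg_star A a) v)"
    unfolding e1 e2 unfolding x(2) y(2) q[OF c(1) y(1)] q[OF x(1) c(2)] by (rule inv[OF a x(1) y(1)])
qed

end

lemma (in sesq) lin_quot_radical: "lin_quot M (radical M H)"
proof (intro lin_quot.intro lin_quot_axioms.intro cvs_axioms)
  show "radical M H \<subseteq> carrier M" unfolding radical_def by blast
  show "\<zero> \<in> radical M H" unfolding radical_def by simp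
  show "x \<oplus> y \<in> radical M H" if "x \<in> radical M H" "y \<in> radical M H" for x y
    using that unfolding radical_def by simp
  show "a \<odot> x \<in> radical M H" if "x \<in> radical M H" for a x
    using that unfolding radical_def by simp
qed

text \<open>A version for rectangular matrices: the factorization of the Gram matrix passes through
  \<open>r\<close> columns, with no relation between \<open>r\<close> and the dimension of
  \<open>V\<close> recorded.\<close>

lemma tens_mult_general:
  assumes "I \<in> wds N1 l" "K \<in> wds N2 l"
  shows "(\<Sum>J\<in>wds N l. tens l u I J * tens l v J K) = tens l (\<lambda>m a c. \<Sum>b<N. u m a b * v m b c) I K"
  using assms
proof (induction l arbitrary: I K u v)
  case 0
  then show ?case by (simp add: tens_def)
next
  case (Suc l)
  from Suc.prems obtain a I' c K' where [simp]: "I = a # I'" "K = c # K'" "I' \<in> wds N1 l" "K' \<in> wds N2 l"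
    by (auto simp: wds_Suc)
  have "(\<Sum>J\<in>wds N (Suc l). tens (Suc l) u I J * tens (Suc l) v J K) =
      (\<Sum>b<N. \<Sum>J\<in>wds N l. (u 0 a b * v 0 b c) * (tens l (\<lambda>m. u (Suc m)) I' J * tens l (\<lambda>m. v (Suc m)) J K'))"
    by (simp add: sum_wds_Suc tens_Suc mult.assoc mult.left_commute)
  also have "\<dots> = (\<Sum>b<N. u 0 a b * v 0 b c) * (\<Sum>J\<in>wds N l. tens l (\<lambda>m. u (Suc m)) I' J * tens l (\<lambda>m. v (Suc m)) J K')"
    by (simp add: sum_product)
  also have "\<dots> = tens (Suc l) (\<lambda>m a c. \<Sum>b<N. u m a b * v m b c) I K"
    using Suc.IH[of I' K' "\<lambda>m. u (Suc m)" "\<lambda>m. v (Suc m)"] by (simp add: tens_Suc)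
  finally show ?case .
qed

lemma (in cvs) eq_of_minus:
  assumes "x \<in> carrier M" "y \<in> carrier M" "x \<ominus> y = \<zero>" shows "x = y"
proof -
  have "x = (x \<ominus> y) \<oplus> y" using assms(1,2) by (simp add: a_minus_def M.a_assoc M.l_neg)
  then show ?thesis using assms by simp
qed

section \<open>Positivity of the product form\<close>

context rgrp
begin

text \<open>For an orthonormal family \<open>f\<close> covering the basis vectors,
  \<open>\<alpha> a k\<close> is the product of \<open>e_a\<close> with \<open>f k\<close>. Positive
  definiteness makes \<open>e_a\<close> equal to the sum of its projections, so the coordinates of
  the \<open>f k\<close> form the right inverse \<open>\<beta>\<close>.\<close>

lemma gram_factorization:
  assumes V: "V_form G h"
  shows "\<exists>(r::nat) \<alpha> \<beta>.
    (\<forall>a<N. \<forall>b<N. gram N h $$ (a, b) = (\<Sum>k<r. \<alpha> a k * cnj (\<alpha> b k))) \<and>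
    (\<forall>a<N. \<forall>b<N. (\<Sum>k<r. \<alpha> a k * \<beta> k b) = dlt a b)"
proof -
  have hh: "hermitian_form (V_space G) h" and pd: "positive_definite (V_space G) h"
    using V unfolding V_form_def by simp_all
  interpret V: psd "V_space G" h
  proof (intro psd.intro sesq.intro sesq_axioms.intro psd_axioms.intro cvs_vec hh)
    interpret V: sesq "V_space G" h by (intro sesq.intro sesq_axioms.intro cvs_vec hh)
    fix x assume "x \<in> carrier (V_space G)"
    then show "h x x \<in> \<real> \<and> 0 \<le> Re (h x x)"
      using pd V.H_zero(1)[of x] unfolding positive_definite_def
      by (cases "x = \<zero>\<^bsub>V_space G\<^esub>") auto
  qed
  note [simp] = module_vec_simps
  let ?e = "unit_vec N :: nat \<Rightarrow> complex vec"
  obtain E where E: "V.orthonormal E" and cov: "\<And>a. a < N \<Longrightarrow> V.covers E (?e a)"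
  proof -
    have "finite (?e ` {..<N})" "?e ` {..<N} \<subseteq> carrier (V_space G)" by auto
    from V.orthonormal_cover_finite[OF this] show ?thesis using that by blast
  qed
  have Ec: "E \<subseteq> carrier_vec N" and fin: "finite E" using E unfolding V.orthonormal_def by simp_all
  define r where "r = card E"
  obtain f where f: "bij_betw f {..<r} E"
    using ex_bij_betw_nat_finite[OF fin] unfolding r_def atLeast0LessThan by blast
  have re: "(\<Sum>g\<in>E. F g) = (\<Sum>k<r. F (f k))" for F :: "complex vec \<Rightarrow> complex"
    using sum.reindex_bij_betw[OF f, of F] by simp
  have fE: "f k \<in> carrier_vec N" if "k < r" for k
    using f that Ec by (auto simp: bij_betw_def)
  show ?thesis
  proof (rule exI[of _ r], rule exI[of _ "\<lambda>a k. h (?e a) (f k)"], rule exI[of _ "\<lambda>k b. f k $ b"],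
      intro conjI allI impI)
    fix a b assume ab: "a < N" "b < N"
    have "gram N h $$ (a, b) = h (?e a) (?e b)" using ab by (simp add: gram_def)
    also have "\<dots> = (\<Sum>k<r. h (?e a) (f k) * h (f k) (?e b))"
      using cov[OF ab(1)] unfolding V.covers_def re by simp
    also have "\<dots> = (\<Sum>k<r. h (?e a) (f k) * cnj (h (?e b) (f k)))"
      using V.sym[of "?e b" "f _"] fE by (intro sum.cong refl) simp
    finally show "gram N h $$ (a, b) = (\<Sum>k<r. h (?e a) (f k) * cnj (h (?e b) (f k)))" .
  next
    fix a b assume ab: "a < N" "b < N"
    define q where "q = ?e a \<ominus>\<^bsub>V_space G\<^esub> V.proj E (?e a)"
    have ec: "?e a \<in> carrier (V_space G)" by simp
    note pe = V.proj_closed[OF E ec]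
    have qc: "q \<in> carrier (V_space G)" unfolding q_def by (rule V.M.minus_closed[OF ec pe])
    have "h q q = 0"
      using V.residual_norm[OF E, of "?e a"] cov[OF ab(1)] unfolding V.covers_def q_def by simp
    then have "q = \<zero>\<^bsub>V_space G\<^esub>" using pd qc unfolding positive_definite_def by fastforce
    then have "V.proj E (?e a) = ?e a"
      using V.eq_of_minus[OF ec pe] unfolding q_def by simp
    then have "?e a $ b = finsum (V_space G) (\<lambda>g. h (?e a) g \<cdot>\<^sub>v g) E $ b"
      unfolding V.proj_def by simp
    also have "\<dots> = (\<Sum>g\<in>E. (h (?e a) g \<cdot>\<^sub>v g) $ b)"
    proof -
      interpret VS: vec_space "TYPE(complex)" N .
      have "finsum_vec TYPE(complex) N (\<lambda>g. h (?e a) g \<cdot>\<^sub>v g) E $ b = (\<Sum>g\<in>E. (h (?e a) g \<cdot>\<^sub>v g) $ b)"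
        by (rule index_finsum_vec[OF fin ab(2)]) (use Ec in auto)
      then show ?thesis by simp
    qed
    also have "\<dots> = (\<Sum>k<r. h (?e a) (f k) * f k $ b)"
      unfolding re using carrier_vecD[OF fE] ab by (intro sum.cong refl) auto
    finally have "(\<Sum>k<r. h (?e a) (f k) * f k $ b) = ?e a $ b" ..
    also have "\<dots> = dlt a b" using ab by (auto simp: dlt_def)
    finally show "(\<Sum>k<r. h (?e a) (f k) * f k $ b) = dlt a b" .
  qed
qed

end

context gk_tens
begin

text \<open>Factoring the Gram matrix writes the product form at \<open>T\<close> as the sum of the
  values of \<open>h\<close> at the vectors \<open>S T K\<close>, each nonnegative. If the sum is
  zero, all \<open>S T K\<close> are null vectors of \<open>h\<close>, and the right inverse of the
  factor recovers the components of \<open>T\<close> from them.\<close>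

lemma tensor_form_psd:
  assumes "psd M h"
  shows "psd TS (tensor_form G hV h l)"
    and "\<And>T J y. T \<in> carrier TS \<Longrightarrow> tensor_form G hV h l T T = 0 \<Longrightarrow> J \<in> W \<Longrightarrow> y \<in> carrier M \<Longrightarrow> h (T J) y = 0"
proof -
  interpret h: psd M h by fact
  have hh: "hermitian_form M h" by (rule h.herm)
  from gram_factorization[OF V] obtain r :: nat and \<alpha> \<beta> where
    gf: "\<And>a b. a < N \<Longrightarrow> b < N \<Longrightarrow> gram N hV $$ (a, b) = (\<Sum>k<r. \<alpha> a k * cnj (\<alpha> b k))"
    and CD: "\<And>a b. a < N \<Longrightarrow> b < N \<Longrightarrow> (\<Sum>k<r. \<alpha> a k * \<beta> k b) = dlt a b"
    by (elim exE conjE) blast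
  let ?R = "wds r l"
  let ?C = "tens l (\<lambda>m. \<alpha>)"
  let ?D = "tens l (\<lambda>m. \<beta>)"
  define S where "S = (\<lambda>T K. finsum M (\<lambda>I. ?C I K \<odot>\<^bsub>M\<^esub> T I) W)"
  have Sc: "S T K \<in> carrier M" if T: "T \<in> carrier TS" for T K
    unfolding S_def using TS_closed[OF T] by (intro M.M.finsum_closed) auto
  have tg: "tk (gram N hV) I J = (\<Sum>K\<in>?R. ?C I K * cnj (?C J K))" if I: "I \<in> W" and J: "J \<in> W" for I J
  proof -
    have "(\<Sum>K\<in>?R. ?C I K * cnj (?C J K)) = (\<Sum>K\<in>?R. ?C I K * tens l (\<lambda>m k b. cnj (\<alpha> b k)) K J)"
      unfolding tens_def by simp
    also have "\<dots> = tk (gram N hV) I J"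
      unfolding tens_mult_general[OF I J] by (rule tens_cong[OF I J]) (simp add: gf)
    finally show ?thesis ..
  qed
  have hS: "h (S T K) (S T K) = (\<Sum>I\<in>W. \<Sum>J\<in>W. h (T I) (T J) * (?C I K * cnj (?C J K)))"
    if T: "T \<in> carrier TS" for T K
  proof -
    note [simp] = TS_closed[OF T]
    have "h (S T K) (S T K) = (\<Sum>I\<in>W. ?C I K * h (T I) (S T K))"
      using Sc[OF T] by (subst S_def) (simp add: h.H_finsum Pi_def)
    also have "\<dots> = (\<Sum>I\<in>W. ?C I K * (\<Sum>J\<in>W. cnj (?C J K) * h (T I) (T J)))"
      unfolding S_def by (simp add: h.H_finsum Pi_def)
    finally show ?thesis by (simp add: sum_distrib_left mult_ac)
  qed
  have tS: "tensor_form G hV h l T T = (\<Sum>K\<in>?R. h (S T K) (S T K))" if T: "T \<in> carrier TS" for T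
  proof -
    have "tensor_form G hV h l T T = (\<Sum>I\<in>W. \<Sum>J\<in>W. \<Sum>K\<in>?R. h (T I) (T J) * (?C I K * cnj (?C J K)))"
      unfolding tensor_form_eq by (simp add: tg sum_distrib_left)
    also have "\<dots> = (\<Sum>K\<in>?R. \<Sum>J\<in>W. \<Sum>I\<in>W. h (T I) (T J) * (?C I K * cnj (?C J K)))"
      by (rule sum_reverse3)
    also have "\<dots> = (\<Sum>K\<in>?R. h (S T K) (S T K))"
      unfolding hS[OF T] by (intro sum.cong refl sum.swap)
    finally show ?thesis .
  qed
  have real: "h (S T K) (S T K) = of_real (Re (h (S T K) (S T K)))" "0 \<le> Re (h (S T K) (S T K))"
    if "T \<in> carrier TS" for T K
    using h.psd[OF Sc[OF that]] by (auto simp: complex_is_Real_iff complex_eq_iff)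
  have tr: "tensor_form G hV h l T T = of_real (\<Sum>K\<in>?R. Re (h (S T K) (S T K)))" if T: "T \<in> carrier TS" for T
    unfolding tS[OF T] of_real_sum using real(1)[OF T] by (intro sum.cong refl)
  show "psd TS (tensor_form G hV h l)"
  proof (intro psd.intro sesq.intro sesq_axioms.intro psd_axioms.intro cvs_TS tensor_form_hermitian hh)
    fix T assume "T \<in> carrier TS"
    then show "tensor_form G hV h l T T \<in> \<real> \<and> 0 \<le> Re (tensor_form G hV h l T T)"
      using tr real(2) by (simp add: sum_nonneg del: TS_simps)
  qed
  fix T J y assume T: "T \<in> carrier TS" and 0: "tensor_form G hV h l T T = 0" and J: "J \<in> W" and y: "y \<in> carrier M"
  note Tc = TS_closed[OF T]
  have "(\<Sum>K\<in>?R. Re (h (S T K) (S T K))) = 0" using 0 unfolding tr[OF T] of_real_eq_0_iff .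
  then have "\<forall>K\<in>?R. Re (h (S T K) (S T K)) = 0"
    using real(2)[OF T] by (subst (asm) sum_nonneg_eq_0_iff) auto
  then have "h (S T K) (S T K) = 0" if "K \<in> ?R" for K
    using real(1)[OF T, of K] that by simp
  then have null: "h (S T K) y = 0" if "K \<in> ?R" for K
    using h.null(1)[OF Sc[OF T] y] that by blast
  \<comment> \<open>Applying \<open>?D\<close>, the right inverse of \<open>?C\<close>, isolates the
    component \<open>J\<close> of \<open>T\<close>.\<close>
  have "0 = (\<Sum>K\<in>?R. ?D K J * h (S T K) y)" using null by simp
  also have "\<dots> = (\<Sum>K\<in>?R. \<Sum>I\<in>W. (?C I K * ?D K J) * h (T I) y)"
    unfolding S_def using y Tc by (simp add: h.H_finsum Pi_def sum_distrib_left mult_ac)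
  also have "\<dots> = (\<Sum>I\<in>W. (\<Sum>K\<in>?R. ?C I K * ?D K J) * h (T I) y)"
    unfolding sum_distrib_right by (rule sum.swap)
  also have "\<dots> = (\<Sum>I\<in>W. dlt I J * h (T I) y)"
  proof (intro sum.cong refl)
    fix I assume I: "I \<in> W"
    have "(\<Sum>K\<in>?R. ?C I K * ?D K J) = tens l (\<lambda>m. dlt) I J"
      unfolding tens_mult_general[OF I J] by (rule tens_cong[OF I J]) (simp add: CD)
    then show "(\<Sum>K\<in>?R. ?C I K * ?D K J) * h (T I) y = dlt I J * h (T I) y"
      using tens_dlt[OF I J] by simp
  qed
  also have "\<dots> = h (T J) y" using J by simp
  finally show "h (T J) y = 0" by simp
qed

end

section \<open>Finite-dimensionality of the multiplicity spaces\<close>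

lemma mat_continuous_const: "mat_continuous_on n S (\<lambda>_. a)"
  unfolding mat_continuous_on_def by simp

lemma mat_continuous_mult:
  "mat_continuous_on n S f \<Longrightarrow> mat_continuous_on n S g \<Longrightarrow> mat_continuous_on n S (\<lambda>k. f k * g k)"
  unfolding mat_continuous_on_def by (intro ballI allI impI tendsto_mult) simp_all

lemma mat_continuous_add:
  "mat_continuous_on n S f \<Longrightarrow> mat_continuous_on n S g \<Longrightarrow> mat_continuous_on n S (\<lambda>k. f k + g k)"
  unfolding mat_continuous_on_def by (intro ballI allI impI tendsto_add) simp_all

lemma mat_continuous_sum:
  "(\<And>i. i \<in> A \<Longrightarrow> mat_continuous_on n S (f i)) \<Longrightarrow> mat_continuous_on n S (\<lambda>k. \<Sum>i\<in>A. f i k)"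
proof (induction A rule: infinite_finite_induct)
  case (insert a A)
  then show ?case by (simp add: mat_continuous_add)
qed (simp_all add: mat_continuous_const)

lemma mat_continuous_prod:
  "(\<And>i. i \<in> A \<Longrightarrow> mat_continuous_on n S (f i)) \<Longrightarrow> mat_continuous_on n S (\<lambda>k. \<Prod>i\<in>A. f i k)"
proof (induction A rule: infinite_finite_induct)
  case (insert a A)
  then show ?case by (simp add: mat_continuous_mult)
qed (simp_all add: mat_continuous_const)

lemma mat_continuous_entry: "i < n \<Longrightarrow> j < n \<Longrightarrow> mat_continuous_on n S (\<lambda>k. k $$ (i, j))"
  unfolding mat_continuous_on_def by simp

lemma mat_continuous_cong:
  "mat_continuous_on n S f \<Longrightarrow> (\<And>k. k \<in> S \<Longrightarrow> f k = g k) \<Longrightarrow> mat_continuous_on n S g"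
  unfolding mat_continuous_on_def by simp

section \<open>Subspaces and orthogonal projections in coordinate space\<close>

definition sprod :: "nat \<Rightarrow> complex vec \<Rightarrow> complex vec \<Rightarrow> complex" where
  "sprod n v w = (\<Sum>i<n. v $ i * cnj (w $ i))"

lemma sprod_psd: "psd (module_vec TYPE(complex) n) (sprod n)"
proof (intro psd.intro sesq.intro sesq_axioms.intro psd_axioms.intro cvs_vec)
  show "hermitian_form (module_vec TYPE(complex) n) (sprod n)"
    unfolding hermitian_form_def sprod_def module_vec_simps
    by (auto simp: distrib_left distrib_right sum.distrib sum_distrib_left mult_ac)
  fix x
  have "sprod n x x = of_real (\<Sum>i<n. (cmod (x $ i))\<^sup>2)"
    unfolding sprod_def of_real_sum by (simp add: complex_norm_square[symmetric] del: of_real_power)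
  then show "sprod n x x \<in> \<real> \<and> 0 \<le> Re (sprod n x x)"
    by (simp add: sum_nonneg)
qed

lemma sprod_definite:
  assumes "x \<in> carrier_vec n" "sprod n x x = 0" shows "x = 0\<^sub>v n"
proof -
  have "sprod n x x = of_real (\<Sum>i<n. (cmod (x $ i))\<^sup>2)"
    unfolding sprod_def of_real_sum by (simp add: complex_norm_square[symmetric] del: of_real_power)
  then have "(\<Sum>i<n. (cmod (x $ i))\<^sup>2) = 0" using assms(2) by (metis of_real_eq_0_iff)
  then have "\<forall>i<n. x $ i = 0" by (simp add: sum_nonneg_eq_0_iff)
  then show ?thesis using assms(1) by auto
qed

lemma sprod_adjoint:
  assumes A: "A \<in> carrier_mat n m" and v: "v \<in> carrier_vec m" and w: "w \<in> carrier_vec n"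
  shows "sprod n (A *\<^sub>v v) w = sprod m v ((cj A)\<^sup>T *\<^sub>v w)"
proof -
  have "sprod n (A *\<^sub>v v) w = (\<Sum>i<n. \<Sum>j<m. A $$ (i, j) * v $ j * cnj (w $ i))"
    unfolding sprod_def using A v
    by (intro sum.cong refl) (simp add: scalar_prod_def atLeast0LessThan sum_distrib_right)
  also have "\<dots> = (\<Sum>j<m. \<Sum>i<n. A $$ (i, j) * v $ j * cnj (w $ i))" by (rule sum.swap)
  also have "\<dots> = sprod m v ((cj A)\<^sup>T *\<^sub>v w)"
    unfolding sprod_def using A w
    by (intro sum.cong refl) (simp add: scalar_prod_def atLeast0LessThan sum_distrib_left mult_ac)
  finally show ?thesis .
qed

text \<open>A proper subspace is presented as the range of an isometry \<open>Q\<close>, with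
  \<open>Q\<close> times its adjoint as the orthogonal projection. The strict inequality
  \<open>r < n\<close> is what the induction in \<open>equivariant_images_finite\<close> descends
  along.\<close>

lemma orthonormal_basis_matrix:
  assumes U: "U \<subseteq> carrier_vec n" "U \<noteq> carrier_vec n" "0\<^sub>v n \<in> U"
    and add: "\<And>x y. x \<in> U \<Longrightarrow> y \<in> U \<Longrightarrow> x + y \<in> U" and sm: "\<And>a x. x \<in> U \<Longrightarrow> a \<cdot>\<^sub>v x \<in> U"
  shows "\<exists>r Q. r < n \<and> Q \<in> carrier_mat n r \<and> (cj Q)\<^sup>T * Q = 1\<^sub>m r \<and>
    (\<forall>u\<in>U. Q *\<^sub>v ((cj Q)\<^sup>T *\<^sub>v u) = u) \<and> (\<forall>j<r. col Q j \<in> U)"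
proof -
  interpret V: psd "module_vec TYPE(complex) n" "sprod n" by (rule sprod_psd)
  note [simp] = module_vec_simps
  have std: "V.orthonormal (unit_vec n ` {..<n})" "card (unit_vec n ` {..<n} :: complex vec set) = n"
  proof -
    have inj: "inj_on (unit_vec n :: nat \<Rightarrow> complex vec) {..<n}"
      by (auto simp: inj_on_def)
    then show "card (unit_vec n ` {..<n} :: complex vec set) = n" by (simp add: card_image)
    have "sprod n (unit_vec n i) (unit_vec n j) = (if i = j then 1 else 0)" if "i < n" "j < n" for i j
    proof -
      have "sprod n (unit_vec n i) (unit_vec n j) = (\<Sum>x<n. dlt x i * dlt x j)"
        unfolding sprod_def dlt_def using that by (intro sum.cong refl) auto
      also have "\<dots> = dlt i j" using that by simp
      finally show ?thesis by (simp add: dlt_def)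
    qed
    then show "V.orthonormal (unit_vec n ` {..<n})"
      unfolding V.orthonormal_def using inj by (auto simp: inj_on_def)
  qed
  have covstd: "V.covers (unit_vec n ` {..<n}) x" if x: "x \<in> carrier_vec n" for x
    unfolding V.covers_def
  proof
    fix y :: "complex vec" assume "y \<in> carrier (module_vec TYPE(complex) n)"
    then have y: "y \<in> carrier_vec n" by simp
    have inj: "inj_on (unit_vec n :: nat \<Rightarrow> complex vec) {..<n}"
      by (auto simp: inj_on_def)
    have 1: "sprod n x (unit_vec n i) = x $ i" "sprod n (unit_vec n i) y = cnj (y $ i)" if "i < n" for i
    proof -
      have "sprod n x (unit_vec n i) = (\<Sum>j<n. x $ j * dlt j i)"
        unfolding sprod_def dlt_def using that by (intro sum.cong refl) auto
      then show "sprod n x (unit_vec n i) = x $ i" using that by simp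
      have "sprod n (unit_vec n i) y = (\<Sum>j<n. dlt j i * cnj (y $ j))"
        unfolding sprod_def dlt_def using that by (intro sum.cong refl) auto
      then show "sprod n (unit_vec n i) y = cnj (y $ i)" using that by simp
    qed
    show "sprod n x y = (\<Sum>f\<in>unit_vec n ` {..<n}. sprod n x f * sprod n f y)"
      unfolding sum.reindex[OF inj] comp_def using 1 by (simp add: sprod_def)
  qed
  have bound: "card E \<le> n" if "V.orthonormal E" for E
  proof -
    have "E \<subseteq> carrier_vec n" using that unfolding V.orthonormal_def by simp
    then have "card E \<le> card (unit_vec n ` {..<n} :: complex vec set)"
      by (intro V.card_orthonormal_le[OF std(1) that] covstd) auto
    then show ?thesis using std(2) by simp
  qed
  have "\<exists>E\<subseteq>U. V.orthonormal E \<and> (\<forall>x\<in>U. V.covers E x)"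
    by (rule V.orthonormal_basis_exists[of U n]) (use U add sm bound in auto)
  then obtain E where EU: "E \<subseteq> U" and E: "V.orthonormal E" and cov: "\<And>x. x \<in> U \<Longrightarrow> V.covers E x"
    by blast
  have fin: "finite E" and Ec: "E \<subseteq> carrier_vec n"
    and on: "\<And>f g. f \<in> E \<Longrightarrow> g \<in> E \<Longrightarrow> sprod n f g = (if f = g then 1 else 0)"
    using E unfolding V.orthonormal_def by auto
  have eqI: "x = y" if "x \<in> carrier_vec n" "y \<in> carrier_vec n" "\<And>z. z \<in> carrier_vec n \<Longrightarrow> sprod n x z = sprod n y z" for x y
  proof -
    have "sprod n (x \<ominus>\<^bsub>module_vec TYPE(complex) n\<^esub> y) (x \<ominus>\<^bsub>module_vec TYPE(complex) n\<^esub> y) = 0"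
      using that V.M.minus_closed[of x y] V.H_minus(1)[of x y "x \<ominus>\<^bsub>module_vec TYPE(complex) n\<^esub> y"] by simp
    then have "x \<ominus>\<^bsub>module_vec TYPE(complex) n\<^esub> y = \<zero>\<^bsub>module_vec TYPE(complex) n\<^esub>"
      using sprod_definite V.M.minus_closed[of x y] that by simp
    then show "x = y" using V.eq_of_minus[of x y] that by simp
  qed
  define r where "r = card E"
  have "r < n"
  proof -
    obtain v where v: "v \<in> carrier_vec n" "v \<notin> U" using U by blast
    \<comment> \<open>A covered \<open>v\<close> would equal its projection, which lies in
      \<open>U\<close>. So \<open>E\<close> can be extended to \<open>r + 1\<close> orthonormal
      vectors, whence \<open>r < n\<close>.\<close>
    have "\<not> V.covers E v"
    proof
      assume c: "V.covers E v"
      have "finsum (module_vec TYPE(complex) n) (\<lambda>f. sprod n v f \<cdot>\<^sub>v f) A \<in> U" if "A \<subseteq> E" "finite A" for A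
        using that(2,1)
      proof (induction A rule: finite_induct)
        case (insert a A)
        have "finsum (module_vec TYPE(complex) n) (\<lambda>f. sprod n v f \<cdot>\<^sub>v f) (insert a A) =
            sprod n v a \<cdot>\<^sub>v a + finsum (module_vec TYPE(complex) n) (\<lambda>f. sprod n v f \<cdot>\<^sub>v f) A"
          by (subst V.M.finsum_insert) (use insert Ec in auto)
        then show ?case using insert EU add sm by auto
      qed (use U in simp)
      then have pU: "V.proj E v \<in> U" unfolding V.proj_def using fin by simp
      have "v = V.proj E v"
      proof (rule eqI[OF v(1)])
        show "V.proj E v \<in> carrier_vec n" using pU U by blast
        show "sprod n v z = sprod n (V.proj E v) z" if "z \<in> carrier_vec n" for z
          using c that V.H_proj(1)[OF E, of v z] v unfolding V.covers_def by simp
      qed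
      then show False using pU v by simp
    qed
    then obtain c where c: "V.orthonormal (insert (c \<cdot>\<^sub>v (v \<ominus>\<^bsub>module_vec TYPE(complex) n\<^esub> V.proj E v)) E)"
      "c \<cdot>\<^sub>v (v \<ominus>\<^bsub>module_vec TYPE(complex) n\<^esub> V.proj E v) \<notin> E"
      using V.orthonormal_extend[OF E, of v] v by auto
    show ?thesis using bound[OF c(1)] c(2) fin unfolding r_def by simp
  qed
  obtain f where f: "bij_betw f {..<r} E"
    using ex_bij_betw_nat_finite[OF fin] unfolding r_def atLeast0LessThan by blast
  have fE: "f j \<in> E" "f j \<in> carrier_vec n" if "j < r" for j using f that Ec by (auto simp: bij_betw_def)
  define Q where "Q = mat n r (\<lambda>(i, j). f j $ i)"
  have Qc: "Q \<in> carrier_mat n r" by (simp add: Q_def)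
  have colQ: "col Q j = f j" if "j < r" for j
    using that fE(2)[OF that] by (auto simp: Q_def)
  have QHu: "((cj Q)\<^sup>T *\<^sub>v u) $ j = sprod n u (f j)" if "u \<in> carrier_vec n" "j < r" for u j
    using that Qc by (simp add: scalar_prod_def atLeast0LessThan sprod_def Q_def mult.commute)
  have QHQ: "(cj Q)\<^sup>T * Q = 1\<^sub>m r"
  proof (rule eq_matI)
    fix i j assume "i < dim_row (1\<^sub>m r :: complex mat)" "j < dim_col (1\<^sub>m r :: complex mat)"
    then have ij: "i < r" "j < r" by auto
    have "((cj Q)\<^sup>T * Q) $$ (i, j) = ((cj Q)\<^sup>T *\<^sub>v col Q j) $ i"
      using ij Qc by simp
    also have "\<dots> = sprod n (f j) (f i)" unfolding colQ[OF ij(2)] by (rule QHu[OF fE(2)[OF ij(2)] ij(1)])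
    also have "\<dots> = (if j = i then 1 else 0)"
      using on[OF fE(1) fE(1)] ij f by (auto simp: bij_betw_def inj_on_def)
    finally show "((cj Q)\<^sup>T * Q) $$ (i, j) = 1\<^sub>m r $$ (i, j)" using ij by auto
  qed (use Qc in auto)
  have "Q *\<^sub>v ((cj Q)\<^sup>T *\<^sub>v u) = u" if u: "u \<in> U" for u
  proof (rule eqI)
    have uc: "u \<in> carrier_vec n" using u U by blast
    have QHuc: "(cj Q)\<^sup>T *\<^sub>v u \<in> carrier_vec r" using Qc uc by (auto intro!: mult_mat_vec_carrier[of _ r n])
    show "Q *\<^sub>v ((cj Q)\<^sup>T *\<^sub>v u) \<in> carrier_vec n" by (rule mult_mat_vec_carrier[OF Qc QHuc])
    show "u \<in> carrier_vec n" by (rule uc)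
    fix z :: "complex vec" assume z: "z \<in> carrier_vec n"
    have "sprod n (Q *\<^sub>v ((cj Q)\<^sup>T *\<^sub>v u)) z = sprod r ((cj Q)\<^sup>T *\<^sub>v u) ((cj Q)\<^sup>T *\<^sub>v z)"
      by (rule sprod_adjoint[OF Qc QHuc z])
    also have "\<dots> = (\<Sum>j<r. sprod n u (f j) * cnj (sprod n z (f j)))"
      unfolding sprod_def[of r] using QHu[OF uc] QHu[OF z] by simp
    also have "\<dots> = (\<Sum>j<r. sprod n u (f j) * sprod n (f j) z)"
    proof (intro sum.cong refl)
      fix j assume "j \<in> {..<r}"
      then have "sprod n (f j) z = cnj (sprod n z (f j))" using V.sym[of z "f j"] z fE(2) by simp
      then show "sprod n u (f j) * cnj (sprod n z (f j)) = sprod n u (f j) * sprod n (f j) z" by simp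
    qed
    also have "\<dots> = (\<Sum>g\<in>E. sprod n u g * sprod n g z)"
      using sum.reindex_bij_betw[OF f, of "\<lambda>g. sprod n u g * sprod n g z"] by simp
    also have "\<dots> = sprod n u z" using cov[OF u] z unfolding V.covers_def by simp
    finally show "sprod n (Q *\<^sub>v ((cj Q)\<^sup>T *\<^sub>v u)) z = sprod n u z" .
  qed
  then show ?thesis using \<open>r < n\<close> Qc QHQ colQ fE EU by (intro exI[of _ r] exI[of _ Q]) auto
qed

lemma (in cvs) span_closed:
  assumes S: "S \<subseteq> carrier M"
  shows "\<zero> \<in> span S" "x \<in> span S \<Longrightarrow> y \<in> span S \<Longrightarrow> x \<oplus> y \<in> span S" "x \<in> span S \<Longrightarrow> a \<odot> x \<in> span S"
    "span S \<subseteq> carrier M"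
proof -
  interpret S: submodule "class_ring :: complex ring" "span S" M by (rule span_is_submodule[OF S])
  show "\<zero> \<in> span S" "x \<in> span S \<Longrightarrow> y \<in> span S \<Longrightarrow> x \<oplus> y \<in> span S" by auto
  show "x \<in> span S \<Longrightarrow> a \<odot> x \<in> span S" using S.smult_closed[of a x] by simp
  show "span S \<subseteq> carrier M" by (rule S.subset)
qed

lemma index_mult_mat_sum:
  "A \<in> carrier_mat a b \<Longrightarrow> B \<in> carrier_mat b c \<Longrightarrow> i < a \<Longrightarrow> j < c \<Longrightarrow>
    (A * B) $$ (i, j) = (\<Sum>k<b. A $$ (i, k) * B $$ (k, j))"
  by (simp add: scalar_prod_def atLeast0LessThan)

section \<open>Finite-dimensional representations of K and admissibility\<close>

context gk_tens
begin

text \<open>The last clause stands in for unitarity: it makes the orthogonal complement of an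
  invariant subspace invariant. The scalar \<open>a\<close> is allowed because the values of a
  \<open>K_character\<close> are not shown to have absolute value 1.\<close>

definition rep :: "nat \<Rightarrow> (complex mat \<Rightarrow> complex mat) \<Rightarrow> bool" where
  "rep n \<sigma> \<longleftrightarrow> (\<forall>k\<in>K_of G. \<sigma> k \<in> carrier_mat n n) \<and> \<sigma> (1\<^sub>m N) = 1\<^sub>m n \<and>
     (\<forall>k\<in>K_of G. \<forall>k'\<in>K_of G. \<sigma> (k * k') = \<sigma> k * \<sigma> k') \<and>
     (\<forall>i<n. \<forall>j<n. mat_continuous_on N (K_of G) (\<lambda>k. \<sigma> k $$ (i, j))) \<and>
     (\<forall>k\<in>K_of G. \<exists>k'\<in>K_of G. \<exists>a. (cj (\<sigma> k))\<^sup>T = a \<cdot>\<^sub>m \<sigma> k')"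

definition equivariant :: "nat \<Rightarrow> (complex mat \<Rightarrow> complex mat) \<Rightarrow> (complex vec \<Rightarrow> 'x) \<Rightarrow> bool" where
  "equivariant n \<sigma> f \<longleftrightarrow> clinear (module_vec TYPE(complex) n) M f \<and>
     (\<forall>k\<in>K_of G. \<forall>v\<in>carrier_vec n. f (\<sigma> k *\<^sub>v v) = \<kappa> k (f v))"

text \<open>Compression to an invariant subspace presented by the isometry \<open>Q\<close>.
  Invariance means that the projection fixes the columns of \<open>\<sigma> k * Q\<close>; this
  makes the compression multiplicative and the restricted map equivariant.\<close>

lemma subrep:
  assumes \<sigma>: "rep n \<sigma>" and Q: "Q \<in> carrier_mat n r" "(cj Q)\<^sup>T * Q = 1\<^sub>m r"
    and fixU: "\<And>u. u \<in> U \<Longrightarrow> Q *\<^sub>v ((cj Q)\<^sup>T *\<^sub>v u) = u" and col: "\<And>j. j < r \<Longrightarrow> col Q j \<in> U"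
    and inv: "\<And>k u. k \<in> K_of G \<Longrightarrow> u \<in> U \<Longrightarrow> \<sigma> k *\<^sub>v u \<in> U"
  shows "rep r (\<lambda>k. (cj Q)\<^sup>T * \<sigma> k * Q)"
    and "equivariant n \<sigma> f \<Longrightarrow> equivariant r (\<lambda>k. (cj Q)\<^sup>T * \<sigma> k * Q) (\<lambda>v. f (Q *\<^sub>v v))"
proof -
  let ?H = "(cj Q)\<^sup>T"
  let ?\<tau> = "\<lambda>k. ?H * \<sigma> k * Q"
  have Hc: "?H \<in> carrier_mat r n" using Q by simp
  have \<sigma>c: "\<sigma> k \<in> carrier_mat n n" if "k \<in> K_of G" for k using \<sigma> that unfolding rep_def by blast
  \<comment> \<open>Checked column by column: the columns lie in \<open>U\<close>, which
    \<open>Q * ?H\<close> fixes pointwise.\<close>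
  have QHs: "Q * (?H * (\<sigma> k * Q)) = \<sigma> k * Q" if k: "k \<in> K_of G" for k
  proof (rule eq_matI)
    fix i j assume ij: "i < dim_row (\<sigma> k * Q)" "j < dim_col (\<sigma> k * Q)"
    then have ij': "i < n" "j < r" using \<sigma>c[OF k] Q by auto
    have c: "col (\<sigma> k * Q) j = \<sigma> k *\<^sub>v col Q j"
      by (rule col_mult2[OF \<sigma>c[OF k] Q(1) ij'(2)])
    have cu: "col (\<sigma> k * Q) j \<in> U" unfolding c by (rule inv[OF k col[OF ij'(2)]])
    have sQ: "\<sigma> k * Q \<in> carrier_mat n r" using \<sigma>c[OF k] Q by simp
    have "col (Q * (?H * (\<sigma> k * Q))) j = Q *\<^sub>v (?H *\<^sub>v col (\<sigma> k * Q) j)"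
      unfolding col_mult2[OF Q(1) mult_carrier_mat[OF Hc sQ] ij'(2)] col_mult2[OF Hc sQ ij'(2)] ..
    also have "\<dots> = col (\<sigma> k * Q) j" by (rule fixU[OF cu])
    finally have "col (Q * (?H * (\<sigma> k * Q))) j $ i = col (\<sigma> k * Q) j $ i" by simp
    then show "(Q * (?H * (\<sigma> k * Q))) $$ (i, j) = (\<sigma> k * Q) $$ (i, j)"
      using Q(1) Hc sQ \<sigma>c[OF k] ij'
      by (simp del: index_mult_mat(1) add: index_mult_mat(1)[of i "\<sigma> k" j Q])
  qed (use Q Hc \<sigma>c[OF k] in auto)
  show "rep r ?\<tau>"
    unfolding rep_def
  proof (intro conjI ballI allI impI)
    show "?H * \<sigma> k * Q \<in> carrier_mat r r" if "k \<in> K_of G" for k using Hc \<sigma>c[OF that] Q by simp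
    have "\<sigma> (1\<^sub>m N) = 1\<^sub>m n" using \<sigma> unfolding rep_def by blast
    then show "?H * \<sigma> (1\<^sub>m N) * Q = 1\<^sub>m r" using Hc Q by simp
  next
    fix k k' assume k: "k \<in> K_of G" and k': "k' \<in> K_of G"
    have "\<sigma> (k * k') = \<sigma> k * \<sigma> k'" using \<sigma> k k' unfolding rep_def by blast
    then have "?\<tau> (k * k') = ?H * (\<sigma> k * (\<sigma> k' * Q))"
      using Hc \<sigma>c[OF k] \<sigma>c[OF k'] Q by (simp add: assoc_mult_mat[of _ r n _ n _ r] assoc_mult_mat[of _ n n _ n _ r])
    also have "\<dots> = ?H * (\<sigma> k * (Q * (?H * (\<sigma> k' * Q))))" unfolding QHs[OF k'] ..
    also have "\<dots> = ?\<tau> k * ?\<tau> k'"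
      using Hc \<sigma>c[OF k] \<sigma>c[OF k'] Q
      by (simp add: assoc_mult_mat[of _ r n _ n _ r] assoc_mult_mat[of _ n n _ r _ r] assoc_mult_mat[of _ r n _ r _ r])
    finally show "?\<tau> (k * k') = ?\<tau> k * ?\<tau> k'" .
  next
    fix i j assume ij: "i < r" "j < r"
    have "mat_continuous_on N (K_of G) (\<lambda>k. \<Sum>b<n. (\<Sum>a<n. ?H $$ (i, a) * \<sigma> k $$ (a, b)) * Q $$ (b, j))"
      using \<sigma> unfolding rep_def
      by (intro mat_continuous_sum mat_continuous_mult mat_continuous_const) blast
    then show "mat_continuous_on N (K_of G) (\<lambda>k. ?\<tau> k $$ (i, j))"
    proof (rule mat_continuous_cong)
      fix k assume k: "k \<in> K_of G"
      have "?\<tau> k $$ (i, j) = (\<Sum>b<n. (?H * \<sigma> k) $$ (i, b) * Q $$ (b, j))"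
        by (rule index_mult_mat_sum[OF mult_carrier_mat[OF Hc \<sigma>c[OF k]] Q(1) ij])
      also have "\<dots> = (\<Sum>b<n. (\<Sum>a<n. ?H $$ (i, a) * \<sigma> k $$ (a, b)) * Q $$ (b, j))"
        using index_mult_mat_sum[OF Hc \<sigma>c[OF k] ij(1)] by (intro sum.cong refl) simp
      finally show "(\<Sum>b<n. (\<Sum>a<n. ?H $$ (i, a) * \<sigma> k $$ (a, b)) * Q $$ (b, j)) = ?\<tau> k $$ (i, j)" ..
    qed
  next
    fix k assume k: "k \<in> K_of G"
    obtain k' a where k': "k' \<in> K_of G" and a: "(cj (\<sigma> k))\<^sup>T = a \<cdot>\<^sub>m \<sigma> k'" using \<sigma> k unfolding rep_def by blast
    have "(cj (?\<tau> k))\<^sup>T = ?H * ((cj (\<sigma> k))\<^sup>T * Q)"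
    proof -
      have "cj (?\<tau> k) = cj ?H * cj (\<sigma> k) * cj Q"
        using Hc \<sigma>c[OF k] Q(1) by (subst cj_mult[of _ r n _ r], simp, simp, subst cj_mult[of _ r n _ n]) auto
      moreover have "(cj ?H * cj (\<sigma> k) * cj Q)\<^sup>T = ?H * ((cj (\<sigma> k))\<^sup>T * (cj ?H)\<^sup>T)"
        using Hc \<sigma>c[OF k] Q(1)
        by (subst transpose_mult[of _ r n _ r], simp, simp, subst transpose_mult[of _ r n _ n]) auto
      ultimately show ?thesis by simp
    qed
    also have "\<dots> = a \<cdot>\<^sub>m ?\<tau> k'"
      unfolding a using Hc \<sigma>c[OF k'] Q(1)
      by (simp add: mult_smult_assoc_mat[of _ n n _ r] mult_smult_distrib[of _ r n _ r] assoc_mult_mat[of _ r n _ n _ r])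
    finally show "\<exists>k'\<in>K_of G. \<exists>a. (cj (?\<tau> k))\<^sup>T = a \<cdot>\<^sub>m ?\<tau> k'" using k' by blast
  qed
  assume f: "equivariant n \<sigma> f"
  then have fl: "clinear (module_vec TYPE(complex) n) M f" unfolding equivariant_def by blast
  note fc = clinear_simps[OF fl, unfolded module_vec_simps]
  show "equivariant r ?\<tau> (\<lambda>v. f (Q *\<^sub>v v))"
    unfolding equivariant_def
  proof (intro conjI ballI)
    show "clinear (module_vec TYPE(complex) r) M (\<lambda>v. f (Q *\<^sub>v v))"
    proof (rule clinearI, unfold module_vec_simps)
      fix x y :: "complex vec" and a
      assume x: "x \<in> carrier_vec r"
      have Qx: "Q *\<^sub>v x \<in> carrier_vec n" by (rule mult_mat_vec_carrier[OF Q(1) x])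
      show "f (Q *\<^sub>v x) \<in> carrier M" by (rule fc(1)[OF Qx])
      show "f (Q *\<^sub>v (a \<cdot>\<^sub>v x)) = a \<odot>\<^bsub>M\<^esub> f (Q *\<^sub>v x)"
        unfolding mult_mat_vec[OF Q(1) x] by (rule fc(2)[OF Qx])
      assume y: "y \<in> carrier_vec r"
      have Qy: "Q *\<^sub>v y \<in> carrier_vec n" by (rule mult_mat_vec_carrier[OF Q(1) y])
      show "f (Q *\<^sub>v (x + y)) = f (Q *\<^sub>v x) \<oplus>\<^bsub>M\<^esub> f (Q *\<^sub>v y)"
        unfolding mult_add_distrib_mat_vec[OF Q(1) x y] by (rule fc(3)[OF Qx Qy])
    qed
    fix k and v :: "complex vec" assume k: "k \<in> K_of G" and v: "v \<in> carrier_vec r"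
    have Qv: "Q *\<^sub>v v \<in> carrier_vec n" by (rule mult_mat_vec_carrier[OF Q(1) v])
    have sQ: "\<sigma> k * Q \<in> carrier_mat n r" using \<sigma>c[OF k] Q by simp
    have HsQ: "?H * (\<sigma> k * Q) \<in> carrier_mat r r" using Hc sQ by simp
    have "Q *\<^sub>v (?\<tau> k *\<^sub>v v) = (Q * (?H * (\<sigma> k * Q))) *\<^sub>v v"
      unfolding assoc_mult_mat[OF Hc \<sigma>c[OF k] Q(1)] assoc_mult_mat_vec[OF Q(1) HsQ v] ..
    also have "\<dots> = \<sigma> k *\<^sub>v (Q *\<^sub>v v)"
      unfolding QHs[OF k] by (rule assoc_mult_mat_vec[OF \<sigma>c[OF k] Q(1) v])
    finally show "f (Q *\<^sub>v (?\<tau> k *\<^sub>v v)) = \<kappa> k (f (Q *\<^sub>v v))"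
      using f k Qv unfolding equivariant_def by simp
  qed
qed

text \<open>\<open>admissible\<close> speaks of irreducible representations only. A reducible one is
  split into an invariant subspace and its orthogonal complement, both of smaller dimension, and the
  two finite spanning sets are united.\<close>

lemma equivariant_images_finite:
  assumes adm: "admissible G X" and \<sigma>: "rep n \<sigma>"
  shows "\<exists>S. finite S \<and> S \<subseteq> carrier M \<and> (\<forall>f. equivariant n \<sigma> f \<longrightarrow> f ` carrier_vec n \<subseteq> cspan M S)"
  using \<sigma>
proof (induction n arbitrary: \<sigma> rule: less_induct)
  case (less n)
  interpret M: cvs M by (rule cvsM)
  note \<sigma> = less.prems
  have \<sigma>c: "\<sigma> k \<in> carrier_mat n n" if "k \<in> K_of G" for k using \<sigma> that unfolding rep_def by blast
  consider (zero) "n = 0" | (irr) "K_irrep G n \<sigma>" | (red) "0 < n" "\<not> K_irrep G n \<sigma>" by blast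
  then show ?case
  proof cases
    case zero
    have "f ` carrier_vec n \<subseteq> cspan M {}" if f: "equivariant n \<sigma> f" for f
    proof -
      have fl: "clinear (module_vec TYPE(complex) n) M f" using f unfolding equivariant_def by blast
      have "f v = \<zero>\<^bsub>M\<^esub>" if v: "v \<in> carrier_vec n" for v
      proof -
        have "0 \<cdot>\<^sub>v v = v" using v zero by auto
        then show ?thesis
          using clinear_simps(1)[OF fl, of v] clinear_simps(2)[OF fl, of v 0] v by (simp add: module_vec_simps)
      qed
      then show ?thesis using M.span_closed(1)[of "{}"] by auto
    qed
    then show ?thesis by (intro exI[of _ "{}"]) auto
  next
    case irr
    then show ?thesis using adm unfolding admissible_def equivariant_def by blast
  next
    case red
    \<comment> \<open>For positive \<open>n\<close> the other clauses of \<open>K_irrep\<close> are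
      contained in \<open>rep\<close>, so irreducibility can fail only through an invariant
      subspace.\<close>
    have "\<not> (\<forall>W. subspace (class_ring :: complex ring) W (module_vec TYPE(complex) n) \<and>
        (\<forall>k\<in>K_of G. \<forall>v\<in>W. \<sigma> k *\<^sub>v v \<in> W) \<longrightarrow> W = {0\<^sub>v n} \<or> W = carrier_vec n)"
      using red \<sigma> unfolding K_irrep_def rep_def by blast
    then obtain U where U: "subspace (class_ring :: complex ring) U (module_vec TYPE(complex) n)"
      and inv: "\<And>k v. k \<in> K_of G \<Longrightarrow> v \<in> U \<Longrightarrow> \<sigma> k *\<^sub>v v \<in> U" and ne: "U \<noteq> {0\<^sub>v n}" "U \<noteq> carrier_vec n"
      by blast
    interpret U: submodule "class_ring :: complex ring" U "module_vec TYPE(complex) n"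
      using U unfolding subspace_def by blast
    have Uc: "U \<subseteq> carrier_vec n" "0\<^sub>v n \<in> U" using U.subset U.zero_closed by (simp_all add: module_vec_simps)
    have Ua: "x + y \<in> U" if "x \<in> U" "y \<in> U" for x y using U.m_closed[OF that] by (simp add: module_vec_simps)
    have Us: "a \<cdot>\<^sub>v x \<in> U" if "x \<in> U" for a x using U.smult_closed[of a x] that by (simp add: module_vec_simps)
    interpret V: psd "module_vec TYPE(complex) n" "sprod n" by (rule sprod_psd)
    define U' where "U' = {v \<in> carrier_vec n. \<forall>u\<in>U. sprod n v u = 0}"
    \<comment> \<open>Stated for a general proper invariant subspace \<open>Y\<close>, to be used
      for \<open>U\<close> and for its complement.\<close>
    have part: "\<exists>S. finite S \<and> S \<subseteq> carrier M \<and> (\<forall>f. equivariant n \<sigma> f \<longrightarrow> f ` Y \<subseteq> cspan M S)"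
      if Y: "Y \<subseteq> carrier_vec n" "Y \<noteq> carrier_vec n" "0\<^sub>v n \<in> Y"
        and add: "\<And>x y. x \<in> Y \<Longrightarrow> y \<in> Y \<Longrightarrow> x + y \<in> Y" and sm: "\<And>a x. x \<in> Y \<Longrightarrow> a \<cdot>\<^sub>v x \<in> Y"
        and invY: "\<And>k v. k \<in> K_of G \<Longrightarrow> v \<in> Y \<Longrightarrow> \<sigma> k *\<^sub>v v \<in> Y" for Y
    proof -
      obtain r Q where r: "r < n" and Q: "Q \<in> carrier_mat n r" "(cj Q)\<^sup>T * Q = 1\<^sub>m r"
        and fixU: "\<And>u. u \<in> Y \<Longrightarrow> Q *\<^sub>v ((cj Q)\<^sup>T *\<^sub>v u) = u" and col: "\<And>j. j < r \<Longrightarrow> col Q j \<in> Y"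
        using orthonormal_basis_matrix[OF Y add sm] by auto
      have sub1: "rep r (\<lambda>k. (cj Q)\<^sup>T * \<sigma> k * Q)"
        by (rule subrep(1)[OF \<sigma> Q fixU col invY])
      have sub2: "equivariant r (\<lambda>k. (cj Q)\<^sup>T * \<sigma> k * Q) (\<lambda>v. f (Q *\<^sub>v v))" if "equivariant n \<sigma> f" for f
        by (rule subrep(2)[OF \<sigma> Q fixU col invY that])
      obtain S where S: "finite S" "S \<subseteq> carrier M"
        and im: "\<And>f. equivariant r (\<lambda>k. (cj Q)\<^sup>T * \<sigma> k * Q) f \<Longrightarrow> f ` carrier_vec r \<subseteq> cspan M S"
        using less.IH[OF r sub1] by blast
      have "f ` Y \<subseteq> cspan M S" if f: "equivariant n \<sigma> f" for f
      proof
        fix x assume "x \<in> f ` Y"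
        then obtain u where u: "u \<in> Y" "x = f u" by blast
        have "(cj Q)\<^sup>T *\<^sub>v u \<in> carrier_vec r"
          using Q(1) u Y by (intro mult_mat_vec_carrier[of _ r n]) auto
        then have "f (Q *\<^sub>v ((cj Q)\<^sup>T *\<^sub>v u)) \<in> cspan M S" using im[OF sub2[OF f]] by blast
        then show "x \<in> cspan M S" using fixU[OF u(1)] u(2) by simp
      qed
      then show ?thesis using S by blast
    qed
    have "U' \<noteq> carrier_vec n"
    proof
      assume "U' = carrier_vec n"
      then have "sprod n u u = 0" if "u \<in> U" for u using that Uc unfolding U'_def by blast
      then have "U \<subseteq> {0\<^sub>v n}" using sprod_definite Uc by blast
      then show False using ne Uc by blast
    qed
    moreover have "\<sigma> k *\<^sub>v v \<in> U'" if k: "k \<in> K_of G" and v: "v \<in> U'" for k v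
    proof -
      obtain k' a where k': "k' \<in> K_of G" and a: "(cj (\<sigma> k))\<^sup>T = a \<cdot>\<^sub>m \<sigma> k'" using \<sigma> k unfolding rep_def by blast
      have vc: "v \<in> carrier_vec n" and v0: "\<And>u. u \<in> U \<Longrightarrow> sprod n v u = 0" using v unfolding U'_def by auto
      have "sprod n (\<sigma> k *\<^sub>v v) u = 0" if u: "u \<in> U" for u
      proof -
        have uc: "u \<in> carrier_vec n" using u Uc by blast
        have "sprod n (\<sigma> k *\<^sub>v v) u = sprod n v ((a \<cdot>\<^sub>m \<sigma> k') *\<^sub>v u)"
          unfolding sprod_adjoint[OF \<sigma>c[OF k] vc uc] a ..
        also have "(a \<cdot>\<^sub>m \<sigma> k') *\<^sub>v u = a \<cdot>\<^sub>v (\<sigma> k' *\<^sub>v u)"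
          using \<sigma>c[OF k'] uc by (auto intro!: eq_vecI simp: scalar_prod_def sum_distrib_left mult.assoc)
        also have "sprod n v (a \<cdot>\<^sub>v (\<sigma> k' *\<^sub>v u)) = 0"
          by (rule v0[OF Us[OF inv[OF k' u]]])
        finally show ?thesis .
      qed
      then show ?thesis using mult_mat_vec_carrier[OF \<sigma>c[OF k] vc] unfolding U'_def by blast
    qed
    moreover have "0\<^sub>v n \<in> U'" using V.H_zero(1) Uc unfolding U'_def by (auto simp: module_vec_simps)
    moreover have "x + y \<in> U'" if "x \<in> U'" "y \<in> U'" for x y
      using that V.H_add(1)[of x y] Uc unfolding U'_def by (auto simp: module_vec_simps)
    moreover have "a \<cdot>\<^sub>v x \<in> U'" if "x \<in> U'" for a x
      using that V.H_sm(1)[of x _ a] Uc unfolding U'_def by (auto simp: module_vec_simps)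
    ultimately obtain S2 where S2: "finite S2" "S2 \<subseteq> carrier M"
      and im2: "\<And>f. equivariant n \<sigma> f \<Longrightarrow> f ` U' \<subseteq> cspan M S2"
      using part[of U'] unfolding U'_def by auto
    obtain S1 where S1: "finite S1" "S1 \<subseteq> carrier M"
      and im1: "\<And>f. equivariant n \<sigma> f \<Longrightarrow> f ` U \<subseteq> cspan M S1"
      using part[OF Uc(1) ne(2) Uc(2) Ua Us inv] by auto
    obtain r Q where Q: "Q \<in> carrier_mat n r"
        and fixU: "\<And>u. u \<in> U \<Longrightarrow> Q *\<^sub>v ((cj Q)\<^sup>T *\<^sub>v u) = u" and col: "\<And>j. j < r \<Longrightarrow> col Q j \<in> U"
        using orthonormal_basis_matrix[OF Uc(1) ne(2) Uc(2) Ua Us] by auto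
    have S12: "S1 \<union> S2 \<subseteq> carrier M" using S1 S2 by blast
    have "f ` carrier_vec n \<subseteq> cspan M (S1 \<union> S2)" if f: "equivariant n \<sigma> f" for f
    proof
      fix x assume "x \<in> f ` carrier_vec n"
      then obtain v where v: "v \<in> carrier_vec n" "x = f v" by blast
      have fl: "clinear (module_vec TYPE(complex) n) M f" using f unfolding equivariant_def by blast
      \<comment> \<open>The orthogonal projection of \<open>v\<close> to \<open>U\<close>; the rest
        \<open>w\<close> is orthogonal to \<open>U\<close> by adjointness.\<close>
      define u where "u = Q *\<^sub>v ((cj Q)\<^sup>T *\<^sub>v v)"
      have Hv: "(cj Q)\<^sup>T *\<^sub>v v \<in> carrier_vec r" using Q v by (intro mult_mat_vec_carrier[of _ r n]) auto
      have uU: "u \<in> U"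
      proof -
        have "Q *\<^sub>v w \<in> U" if w: "w \<in> carrier_vec r" for w
        proof -
          interpret VS: vec_space "TYPE(complex)" n .
          have fc: "(\<lambda>j. w $ j \<cdot>\<^sub>v col Q j) \<in> {..<r} \<rightarrow> carrier_vec n" using Q by auto
          have "finsum_vec TYPE(complex) n (\<lambda>j. w $ j \<cdot>\<^sub>v col Q j) {..<r} = Q *\<^sub>v w"
          proof (rule eq_vecI)
            fix i assume "i < dim_vec (Q *\<^sub>v w)"
            then have i: "i < n" using Q by simp
            show "finsum_vec TYPE(complex) n (\<lambda>j. w $ j \<cdot>\<^sub>v col Q j) {..<r} $ i = (Q *\<^sub>v w) $ i"
              using i Q w by (subst index_finsum_vec[OF _ i fc])
                (auto simp: scalar_prod_def atLeast0LessThan mult.commute intro!: sum.cong)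
          next
            show "dim_vec (finsum_vec TYPE(complex) n (\<lambda>j. w $ j \<cdot>\<^sub>v col Q j) {..<r}) = dim_vec (Q *\<^sub>v w)"
              using finsum_vec_closed[OF fc] Q by (auto simp del: VS.finsum_vec)
          qed
          moreover have "finsum (module_vec TYPE(complex) n) (\<lambda>j. w $ j \<cdot>\<^sub>v col Q j) A \<in> U" if "A \<subseteq> {..<r}" "finite A" for A
            using that(2,1)
          proof (induction A rule: finite_induct)
            case (insert a A)
            have "finsum (module_vec TYPE(complex) n) (\<lambda>j. w $ j \<cdot>\<^sub>v col Q j) (insert a A) =
                w $ a \<cdot>\<^sub>v col Q a + finsum (module_vec TYPE(complex) n) (\<lambda>j. w $ j \<cdot>\<^sub>v col Q j) A"
              by (subst V.M.finsum_insert) (use insert Q in \<open>auto simp: module_vec_simps\<close>)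
            then show ?case using insert Ua Us col by auto
          qed (use Uc in \<open>simp add: module_vec_simps\<close>)
          ultimately show ?thesis by (metis VS.finsum_vec finite_lessThan order_refl)
        qed
        then show ?thesis unfolding u_def using Hv by blast
      qed
      have uc: "u \<in> carrier_vec n" using uU Uc by blast
      define w where "w = v + (- 1) \<cdot>\<^sub>v u"
      have wc: "w \<in> carrier_vec n" using v uc by (simp add: w_def)
      have "sprod n w y = 0" if y: "y \<in> U" for y
      proof -
        have yc: "y \<in> carrier_vec n" using y Uc by blast
        have "sprod n u y = sprod r ((cj Q)\<^sup>T *\<^sub>v v) ((cj Q)\<^sup>T *\<^sub>v y)"
          unfolding u_def by (rule sprod_adjoint[OF Q Hv yc])
        also have "\<dots> = sprod n v (Q *\<^sub>v ((cj Q)\<^sup>T *\<^sub>v y))"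
        proof -
          have c: "(cj Q)\<^sup>T \<in> carrier_mat r n" using Q by simp
          have Hy: "(cj Q)\<^sup>T *\<^sub>v y \<in> carrier_vec r" by (rule mult_mat_vec_carrier[OF c yc])
          show ?thesis using sprod_adjoint[OF c v(1) Hy] by simp
        qed
        also have "\<dots> = sprod n v y" using fixU[OF y] by simp
        finally have uv: "sprod n u y = sprod n v y" .
        have "sprod n w y = sprod n v y + sprod n ((- 1) \<cdot>\<^sub>v u) y"
          unfolding w_def using V.H_add(1)[of v "(- 1) \<cdot>\<^sub>v u" y] v uc yc by (simp add: module_vec_simps)
        also have "sprod n ((- 1) \<cdot>\<^sub>v u) y = - 1 * sprod n u y"
          using V.H_sm(1)[of u y "- 1"] uc yc by (simp add: module_vec_simps)
        finally show ?thesis unfolding uv by simp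
      qed
      then have wU: "w \<in> U'" using wc unfolding U'_def by blast
      have "v = u + w" unfolding w_def using v uc by auto
      then have "x = f u \<oplus>\<^bsub>M\<^esub> f w"
        using clinear_simps(3)[OF fl, of u w] v(2) uc wc by (simp add: module_vec_simps)
      moreover have "f u \<in> cspan M (S1 \<union> S2)" "f w \<in> cspan M (S1 \<union> S2)"
        using im1[OF f] im2[OF f] uU wU M.span_is_monotone[of S1 "S1 \<union> S2"] M.span_is_monotone[of S2 "S1 \<union> S2"] by blast+
      ultimately show "x \<in> cspan M (S1 \<union> S2)" using M.span_closed(2)[OF S12] by simp
    qed
    then show ?thesis using S1 S2 S12 by (intro exI[of _ "S1 \<union> S2"]) blast
  qed
qed

end

section \<open>The representation of K on words, twisted by a character\<close>

context gk_tens
begin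

lemma tk_mult:
  assumes x: "x \<in> C" and y: "y \<in> C" and I: "I \<in> W" and J: "J \<in> W"
  shows "(\<Sum>K\<in>W. tk x I K * tk y K J) = tk (x * y) I J"
  unfolding tens_mult[OF I J] by (rule tens_cong[OF I J]) (use sq_index[OF x y] in simp)

lemma tk_one:
  assumes I: "I \<in> W" and J: "J \<in> W"
  shows "tk (1\<^sub>m N) I J = dlt I J"
  unfolding tens_dlt[OF I J, symmetric] by (rule tens_cong[OF I J]) (simp add: dlt_def)

lemma tk_transpose:
  assumes x: "x \<in> C" and I: "I \<in> W" and J: "J \<in> W"
  shows "tk x\<^sup>T I J = tk x J I"
  unfolding tens_transpose[of l "\<lambda>m. ent x" J I] by (rule tens_cong[OF I J]) (use x in auto)

lemma tk_real:
  assumes x: "x \<in> C" "cj x = x" and I: "I \<in> W" and J: "J \<in> W"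
  shows "cnj (tk x I J) = tk x I J"
proof -
  have "cnj (x $$ (a, b)) = x $$ (a, b)" if "a < N" "b < N" for a b
    using arg_cong[OF x(2), of "\<lambda>Z. Z $$ (a, b)"] x(1) that by simp
  then show ?thesis
    unfolding tens_def cnj_prod using wds_nth[OF I] wds_nth[OF J] by (intro prod.cong) auto
qed

lemma tk_continuous:
  assumes I: "I \<in> W" and J: "J \<in> W"
  shows "mat_continuous_on N S (\<lambda>k. tk k I J)"
  unfolding tens_def by (intro mat_continuous_prod mat_continuous_entry) (use wds_nth[OF I] wds_nth[OF J] in auto)

text \<open>Since \<open>k\<close> is real, the adjoint of its tensor power is the tensor power of
  \<open>k\<^sup>T\<close>, which lies in \<open>K\<close> again; the scalar in \<open>rep\<close>
  absorbs the values of \<open>\<chi>\<close>.\<close>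

lemma rep_tensor:
  assumes \<chi>: "K_character G \<chi>" and e: "bij_betw e {..<n} W"
  shows "rep n (\<lambda>k. mat n n (\<lambda>(i, j). \<chi> k * tk k (e i) (e j)))"
proof -
  have eW: "e i \<in> W" if "i < n" for i using bij_betwE[OF e] that by blast
  have e1: "e i = e j \<longleftrightarrow> i = j" if "i < n" "j < n" for i j
    using e that unfolding bij_betw_def inj_on_def by blast
  have \<chi>1: "\<chi> (1\<^sub>m N) = 1" and \<chi>m: "\<And>k k'. k \<in> K_of G \<Longrightarrow> k' \<in> K_of G \<Longrightarrow> \<chi> (k * k') = \<chi> k * \<chi> k'"
    and \<chi>c: "mat_continuous_on N (K_of G) \<chi>"
    using \<chi> unfolding K_character_def by simp_all
  show ?thesis
    unfolding rep_def
  proof (intro conjI ballI allI impI)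
    show "mat n n (\<lambda>(i, j). \<chi> (1\<^sub>m N) * tk (1\<^sub>m N) (e i) (e j)) = 1\<^sub>m n"
      by (rule eq_matI) (auto simp: \<chi>1 tk_one[OF eW eW] dlt_def e1)
  next
    fix k k' assume k: "k \<in> K_of G" and k': "k' \<in> K_of G"
    show "mat n n (\<lambda>(i, j). \<chi> (k * k') * tk (k * k') (e i) (e j)) =
      mat n n (\<lambda>(i, j). \<chi> k * tk k (e i) (e j)) * mat n n (\<lambda>(i, j). \<chi> k' * tk k' (e i) (e j))"
    proof (rule eq_matI)
      fix i j
      assume "i < dim_row (mat n n (\<lambda>(i, j). \<chi> k * tk k (e i) (e j)) * mat n n (\<lambda>(i, j). \<chi> k' * tk k' (e i) (e j)))"
        "j < dim_col (mat n n (\<lambda>(i, j). \<chi> k * tk k (e i) (e j)) * mat n n (\<lambda>(i, j). \<chi> k' * tk k' (e i) (e j)))"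
      then have i: "i < n" and j: "j < n" by simp_all
      have "tk (k * k') (e i) (e j) = (\<Sum>b<n. tk k (e i) (e b) * tk k' (e b) (e j))"
        unfolding tk_mult[OF K_D(1)[OF k] K_D(1)[OF k'] eW[OF i] eW[OF j], symmetric]
        by (rule sum.reindex_bij_betw[OF e, symmetric])
      then show "mat n n (\<lambda>(i, j). \<chi> (k * k') * tk (k * k') (e i) (e j)) $$ (i, j) =
          (mat n n (\<lambda>(i, j). \<chi> k * tk k (e i) (e j)) * mat n n (\<lambda>(i, j). \<chi> k' * tk k' (e i) (e j))) $$ (i, j)"
        using i j by (simp add: scalar_prod_def atLeast0LessThan \<chi>m[OF k k'] sum_distrib_left mult_ac)
    qed simp_all
  next
    fix i j assume "i < n" "j < n"
    then show "mat_continuous_on N (K_of G) (\<lambda>k. mat n n (\<lambda>(i, j). \<chi> k * tk k (e i) (e j)) $$ (i, j))"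
      by (simp add: mat_continuous_mult \<chi>c tk_continuous eW)
  next
    fix k assume k: "k \<in> K_of G"
    note kT = K_transpose[OF k]
    have "\<chi> k\<^sup>T * \<chi> k = 1" using \<chi>m[OF kT k] \<chi>1 K_D(3)[OF k] by simp
    then have ne: "\<chi> k\<^sup>T \<noteq> 0" by auto
    have "(cj (mat n n (\<lambda>(i, j). \<chi> k * tk k (e i) (e j))))\<^sup>T =
        (cnj (\<chi> k) / \<chi> k\<^sup>T) \<cdot>\<^sub>m mat n n (\<lambda>(i, j). \<chi> k\<^sup>T * tk k\<^sup>T (e i) (e j))"
      by (rule eq_matI) (use ne in \<open>auto simp: tk_real[OF K_D(1,2)[OF k] eW eW] tk_transpose[OF K_D(1)[OF k] eW eW]\<close>)
    then show "\<exists>k'\<in>K_of G. \<exists>a. (cj (mat n n (\<lambda>(i, j). \<chi> k * tk k (e i) (e j))))\<^sup>T =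
        a \<cdot>\<^sub>m mat n n (\<lambda>(i, j). \<chi> k' * tk k' (e i) (e j))"
      using kT by blast
  qed simp
qed

end

context mult_space
begin

text \<open>The condition on \<open>\<phi>\<close> says that \<open>k\<close> on \<open>X\<close>
  together with \<open>k\<close> on the words multiplies by \<open>\<mu> k\<close>. Moving the
  action on words to the other side by \<open>k\<^sup>T\<close> shows that \<open>K\<close> acts on
  the components of \<open>\<phi> 1\<close> through a finite-dimensional representation.\<close>

lemma FS_kappa:
  assumes \<phi>: "\<phi> \<in> carrier FS" and k: "k \<in> K_of G" and J: "J \<in> W"
  shows "\<kappa> k (\<phi> 1 J) = finsum M (\<lambda>I. (\<mu> k * tk k I J) \<odot>\<^bsub>M\<^esub> \<phi> 1 I) W"
proof -
  let ?L = "lop (\<kappa> k) (\<phi> 1)"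
  note D = FS_D[OF \<phi>] and Tc = TS_closed[OF D(1)[of 1]]
  have L: "?L \<in> carrier TS" by (rule lop_closed[OF kappa_linear[OF k] D(1)])
  have "wop (tk k) ?L = \<mu> k \<odot>\<^bsub>TS\<^esub> \<phi> 1"
    using D(4)[OF k, of 1] D(3)[of "\<mu> k" 1] tensor_grp_eq[OF D(1) k, of 1] by simp
  moreover have "wop (tk k\<^sup>T) (wop (tk k) ?L) = wop dlt ?L"
    unfolding wop_comp[OF L]
  proof (rule wop_cong[OF L])
    fix I J assume I: "I \<in> W" and J: "J \<in> W"
    show "mmul W (tk k\<^sup>T) (tk k) I J = dlt I J"
      unfolding mmul_def tk_mult[OF K_D(1)[OF K_transpose[OF k]] K_D(1)[OF k] I J] K_D(3)[OF k] by (rule tk_one[OF I J])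
  qed
  ultimately have "?L = wop (tk k\<^sup>T) (\<mu> k \<odot>\<^bsub>TS\<^esub> \<phi> 1)" using wop_dlt[OF L] by simp
  then have "?L J = finsum M (\<lambda>I. tk k\<^sup>T J I \<odot>\<^bsub>M\<^esub> (\<mu> k \<odot>\<^bsub>M\<^esub> \<phi> 1 I)) W"
    using J by (simp add: wop_def)
  also have "\<dots> = finsum M (\<lambda>I. (\<mu> k * tk k I J) \<odot>\<^bsub>M\<^esub> \<phi> 1 I) W"
    by (rule M.M.finsum_cong')
      (use Tc J in \<open>auto simp: tk_transpose[OF K_D(1)[OF k] J] M.sm_assoc[symmetric] mult.commute\<close>)
  finally show ?thesis using J by (simp add: lop_def)
qed

text \<open>The components of \<open>\<phi> 1\<close> are the images of the unit vectors under a
  \<open>K\<close>-equivariant map into \<open>X\<close>. Its source, the representation of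
  \<open>rep_tensor\<close>, does not depend on \<open>\<phi>\<close>, so one finite spanning set
  serves all \<open>\<phi>\<close>.\<close>

lemma FS_values_finite:
  assumes adm: "admissible G X" and \<chi>: "K_character G \<mu>"
  shows "\<exists>S. finite S \<and> S \<subseteq> carrier M \<and> (\<forall>\<phi>\<in>carrier FS. \<forall>J\<in>W. \<phi> 1 J \<in> cspan M S)"
proof -
  define n where "n = card W"
  obtain e where e: "bij_betw e {..<n} W"
    using ex_bij_betw_nat_finite[of W] unfolding n_def atLeast0LessThan by auto
  have eW: "e i \<in> W" if "i < n" for i using bij_betwE[OF e] that by blast
  let ?\<sigma> = "\<lambda>k. mat n n (\<lambda>(i, j). \<mu> k * tk k (e i) (e j))"
  obtain S where S: "finite S" "S \<subseteq> carrier M"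
    and im: "\<And>f. equivariant n ?\<sigma> f \<Longrightarrow> f ` carrier_vec n \<subseteq> cspan M S"
    using equivariant_images_finite[OF adm rep_tensor[OF \<chi> e]] by blast
  have "\<phi> 1 J \<in> cspan M S" if \<phi>: "\<phi> \<in> carrier FS" and J: "J \<in> W" for \<phi> J
  proof -
    let ?T = "\<lambda>j. \<phi> 1 (e j)"
    have Tc: "\<phi> 1 I \<in> carrier M" for I by (rule TS_closed[OF FS_D(1)[OF \<phi>]])
    define f where "f = (\<lambda>v. finsum M (\<lambda>j. v $ j \<odot>\<^bsub>M\<^esub> ?T j) {..<n})"
    have fl: "clinear (module_vec TYPE(complex) n) M f"
    proof (rule clinearI, unfold module_vec_simps f_def)
      fix x y :: "complex vec" and a assume x: "x \<in> carrier_vec n"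
      show "finsum M (\<lambda>j. x $ j \<odot>\<^bsub>M\<^esub> ?T j) {..<n} \<in> carrier M"
        by (rule M.M.finsum_closed) (use Tc in auto)
      show "finsum M (\<lambda>j. (a \<cdot>\<^sub>v x) $ j \<odot>\<^bsub>M\<^esub> ?T j) {..<n} = a \<odot>\<^bsub>M\<^esub> finsum M (\<lambda>j. x $ j \<odot>\<^bsub>M\<^esub> ?T j) {..<n}"
        by (subst M.sm_finsum) (use Tc x in \<open>auto simp: M.sm_assoc intro!: M.M.finsum_cong'\<close>)
      assume y: "y \<in> carrier_vec n"
      show "finsum M (\<lambda>j. (x + y) $ j \<odot>\<^bsub>M\<^esub> ?T j) {..<n} =
          finsum M (\<lambda>j. x $ j \<odot>\<^bsub>M\<^esub> ?T j) {..<n} \<oplus>\<^bsub>M\<^esub> finsum M (\<lambda>j. y $ j \<odot>\<^bsub>M\<^esub> ?T j) {..<n}"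
      proof -
        have "finsum M (\<lambda>j. (x + y) $ j \<odot>\<^bsub>M\<^esub> ?T j) {..<n} = finsum M (\<lambda>j. x $ j \<odot>\<^bsub>M\<^esub> ?T j \<oplus>\<^bsub>M\<^esub> y $ j \<odot>\<^bsub>M\<^esub> ?T j) {..<n}"
          by (rule M.M.finsum_cong') (use Tc x y in \<open>auto simp: M.sm_ladd\<close>)
        then show ?thesis by (subst (asm) M.finsum_add) (use Tc in auto)
      qed
    qed
    have "f (?\<sigma> k *\<^sub>v v) = \<kappa> k (f v)" if k: "k \<in> K_of G" and v: "v \<in> carrier_vec n" for k v
    proof -
      have "\<kappa> k (f v) = finsum M (\<lambda>j. \<kappa> k (v $ j \<odot>\<^bsub>M\<^esub> ?T j)) {..<n}"
        unfolding f_def by (rule clinear_finsum[OF cvsM cvsM kappa_linear[OF k]]) (use Tc in auto)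
      also have "\<dots> = finsum M (\<lambda>j. finsum M (\<lambda>i. (v $ j * (\<mu> k * tk k (e i) (e j))) \<odot>\<^bsub>M\<^esub> ?T i) {..<n}) {..<n}"
      proof (rule M.M.finsum_cong')
        fix j assume j: "j \<in> {..<n}"
        have "finsum M (\<lambda>I. (\<mu> k * tk k I (e j)) \<odot>\<^bsub>M\<^esub> \<phi> 1 I) W =
            finsum M (\<lambda>i. (\<mu> k * tk k (e i) (e j)) \<odot>\<^bsub>M\<^esub> ?T i) {..<n}"
          using M.M.finsum_reindex[of "\<lambda>I. (\<mu> k * tk k I (e j)) \<odot>\<^bsub>M\<^esub> \<phi> 1 I" e "{..<n}"] Tc
          using e unfolding bij_betw_def by simp
        then show "\<kappa> k (v $ j \<odot>\<^bsub>M\<^esub> ?T j) = finsum M (\<lambda>i. (v $ j * (\<mu> k * tk k (e i) (e j))) \<odot>\<^bsub>M\<^esub> ?T i) {..<n}"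
          using clinear_simps(2)[OF kappa_linear[OF k] Tc, of "v $ j" "e j"] FS_kappa[OF \<phi> k eW[of j]] j Tc
          by (simp add: M.sm_finsum Pi_def M.sm_assoc)
      qed (use Tc in \<open>auto intro!: M.M.finsum_closed\<close>)
      also have "\<dots> = finsum M (\<lambda>i. finsum M (\<lambda>j. (v $ j * (\<mu> k * tk k (e i) (e j))) \<odot>\<^bsub>M\<^esub> ?T i) {..<n}) {..<n}"
        by (rule M.finsum_swap) (use Tc in auto)
      also have "\<dots> = f (?\<sigma> k *\<^sub>v v)"
        unfolding f_def
      proof (rule M.M.finsum_cong')
        fix i assume i: "i \<in> {..<n}"
        have "(?\<sigma> k *\<^sub>v v) $ i = (\<Sum>j<n. v $ j * (\<mu> k * tk k (e i) (e j)))"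
          using i v by (simp add: scalar_prod_def atLeast0LessThan mult.commute)
        then show "finsum M (\<lambda>j. (v $ j * (\<mu> k * tk k (e i) (e j))) \<odot>\<^bsub>M\<^esub> ?T i) {..<n} = (?\<sigma> k *\<^sub>v v) $ i \<odot>\<^bsub>M\<^esub> ?T i"
          using M.finsum_sm[of "{..<n}" "?T i"] Tc by simp
      qed (use Tc in auto)
      finally show ?thesis ..
    qed
    then have im': "f ` carrier_vec n \<subseteq> cspan M S" using im fl unfolding equivariant_def by blast
    obtain i where i: "i < n" "J = e i" using e J unfolding bij_betw_def by auto
    have "f (unit_vec n i) = finsum M (\<lambda>j. (if j = i then 1 else 0) \<odot>\<^bsub>M\<^esub> ?T j) {..<n}"
      unfolding f_def by (rule M.M.finsum_cong') (use i Tc in \<open>auto simp: unit_vec_def\<close>)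
    also have "\<dots> = \<phi> 1 J" using M.finsum_delta'[of "{..<n}" i ?T] i Tc by simp
    finally show ?thesis using im' by (metis image_subset_iff unit_vec_carrier)
  qed
  then show ?thesis using S by blast
qed

end

lemma (in cvs) finsum_mem:
  assumes U: "U \<subseteq> carrier M" and zero: "\<zero> \<in> U" and add: "\<And>x y. x \<in> U \<Longrightarrow> y \<in> U \<Longrightarrow> x \<oplus> y \<in> U"
    and f: "\<And>i. i \<in> A \<Longrightarrow> f i \<in> U"
  shows "finsum M f A \<in> U"
  using f
proof (induction A rule: infinite_finite_induct)
  case (insert a A)
  then have "f a \<in> U" "\<And>i. i \<in> A \<Longrightarrow> f i \<in> U" by auto
  then show ?case
    using insert add U by (subst M.finsum_insert) (auto simp: Pi_def subset_iff)
qed (simp_all add: zero)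

lemma (in psd) covers_closed:
  assumes E: "orthonormal E"
  shows "covers E \<zero>"
    and "x \<in> carrier M \<and> covers E x \<Longrightarrow> y \<in> carrier M \<and> covers E y \<Longrightarrow> x \<oplus> y \<in> carrier M \<and> covers E (x \<oplus> y)"
    and "x \<in> carrier M \<and> covers E x \<Longrightarrow> a \<odot> x \<in> carrier M \<and> covers E (a \<odot> x)"
proof -
  have c: "f \<in> carrier M" if "f \<in> E" for f using E that unfolding orthonormal_def by blast
  show "covers E \<zero>" unfolding covers_def using c by simp
  show "x \<oplus> y \<in> carrier M \<and> covers E (x \<oplus> y)" if x: "x \<in> carrier M \<and> covers E x" and y: "y \<in> carrier M \<and> covers E y"
    unfolding covers_def
  proof (intro conjI ballI)
    fix z assume z: "z \<in> carrier M"
    have e: "H x z = (\<Sum>f\<in>E. H x f * H f z)" "H y z = (\<Sum>f\<in>E. H y f * H f z)"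
      using x y z unfolding covers_def by blast+
    show "H (x \<oplus> y) z = (\<Sum>f\<in>E. H (x \<oplus> y) f * H f z)"
      unfolding H_add(1)[OF conjunct1[OF x] conjunct1[OF y] z] e sum.distrib[symmetric]
      by (intro sum.cong refl) (simp add: c x y distrib_right)
  qed (simp add: x y)
  show "a \<odot> x \<in> carrier M \<and> covers E (a \<odot> x)" if x: "x \<in> carrier M \<and> covers E x"
    unfolding covers_def
  proof (intro conjI ballI)
    fix z assume z: "z \<in> carrier M"
    have e: "H x z = (\<Sum>f\<in>E. H x f * H f z)" using x z unfolding covers_def by blast
    show "H (a \<odot> x) z = (\<Sum>f\<in>E. H (a \<odot> x) f * H f z)"
      unfolding H_sm(1)[OF conjunct1[OF x] z] e sum_distrib_left
      by (intro sum.cong refl) (simp add: c x mult.assoc)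
  qed (simp add: x)
qed

context tns
begin

text \<open>Tensors with components in the span of \<open>S\<close> are combinations of the finitely
  many tensors \<open>one J s\<close>. An orthonormal family covering these bounds every orthonormal
  family of such tensors, by \<open>card_orthonormal_le\<close>.\<close>

lemma orthonormal_bounded:
  assumes \<Theta>: "psd TS \<Theta>" and S: "finite S" "S \<subseteq> carrier M"
  shows "\<exists>b. \<forall>E. psd.orthonormal TS \<Theta> E \<and> (\<forall>T\<in>E. \<forall>J\<in>W. T J \<in> cspan M S) \<longrightarrow> card E \<le> b"
proof -
  interpret \<Theta>: psd TS \<Theta> by fact
  define one where "one (J :: nat list) s = (\<lambda>I. if I = J then s else \<zero>\<^bsub>M\<^esub>)" for J s
  have one: "one J s \<in> carrier TS" if "J \<in> W" "s \<in> carrier M" for J s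
    using that by (auto simp: one_def)
  have oneS: "one J s \<in> carrier TS" if "J \<in> W" "s \<in> S" for J s
    using one[OF that(1)] S(2) that(2) by blast
  obtain E where E: "\<Theta>.orthonormal E" and cov: "\<And>J s. J \<in> W \<Longrightarrow> s \<in> S \<Longrightarrow> \<Theta>.covers E (one J s)"
    using \<Theta>.orthonormal_cover_finite[of "(\<lambda>(J, s). one J s) ` (W \<times> S)"] S(1) oneS by fastforce
  define U where "U = {T \<in> carrier TS. \<Theta>.covers E T}"
  have U0: "\<zero>\<^bsub>TS\<^esub> \<in> U" and Ua: "\<And>T T'. T \<in> U \<Longrightarrow> T' \<in> U \<Longrightarrow> T \<oplus>\<^bsub>TS\<^esub> T' \<in> U"
    and Us: "\<And>a T. T \<in> U \<Longrightarrow> a \<odot>\<^bsub>TS\<^esub> T \<in> U" and UC: "U \<subseteq> carrier TS"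
    using \<Theta>.covers_closed[OF E] unfolding U_def TS.M.zero_closed by blast+
  have Uf: "finsum TS f Z \<in> U" if "\<And>i. i \<in> Z \<Longrightarrow> f i \<in> U" for f :: "'b \<Rightarrow> _" and Z
    by (rule TS.finsum_mem[OF UC U0 Ua that])
  have TU: "T \<in> U" if T: "T \<in> carrier TS" and sp: "\<And>J. J \<in> W \<Longrightarrow> T J \<in> cspan M S" for T
  proof -
    have "\<exists>a. T J = finsum M (\<lambda>s. a s \<odot>\<^bsub>M\<^esub> s) S" if "J \<in> W" for J
      using sp[OF that] unfolding M.finite_span[OF S] M.lincomb_def by blast
    then obtain a where a: "\<And>J. J \<in> W \<Longrightarrow> T J = finsum M (\<lambda>s. a J s \<odot>\<^bsub>M\<^esub> s) S" by metis
    let ?f = "\<lambda>J. finsum TS (\<lambda>s. a J s \<odot>\<^bsub>TS\<^esub> one J s) S"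
    have oU: "one J s \<in> U" if "J \<in> W" "s \<in> S" for J s unfolding U_def using oneS cov that by blast
    have fU: "?f J \<in> U" if "J \<in> W" for J by (rule Uf, rule Us, rule oU) (use that in auto)
    then have fc: "?f \<in> W \<rightarrow> carrier TS" unfolding U_def by blast
    have "T = finsum TS ?f W"
    proof (rule TS_eqI[OF T TS.M.finsum_closed[OF fc]])
      fix I assume I: "I \<in> W"
      have "finsum TS ?f W I = finsum M (\<lambda>J. ?f J I) W" by (rule TS_finsum[OF fc])
      also have "\<dots> = finsum M (\<lambda>J. (if J = I then 1 else 0) \<odot>\<^bsub>M\<^esub> T J) W"
      proof (rule M.M.finsum_cong')
        fix J assume J: "J \<in> W"
        have c: "(\<lambda>s. a J s \<odot>\<^bsub>TS\<^esub> one J s) \<in> S \<rightarrow> carrier TS"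
          using TS.sm_closed oneS[OF J] by blast
        have "?f J I = finsum M (\<lambda>s. (a J s \<odot>\<^bsub>TS\<^esub> one J s) I) S" by (rule TS_finsum[OF c])
        also have "\<dots> = (if J = I then 1 else 0) \<odot>\<^bsub>M\<^esub> T J"
          using a[OF J] TS_closed[OF T, of J] by (auto simp: one_def)
        finally show "?f J I = (if J = I then 1 else 0) \<odot>\<^bsub>M\<^esub> T J" .
      qed (use TS_closed[OF T] in auto)
      also have "\<dots> = T I" by (rule M.finsum_delta') (use I TS_closed[OF T] in auto)
      finally show "T I = finsum TS ?f W I" ..
    qed
    then show ?thesis using Uf[OF fU, of W "\<lambda>J. J"] by simp
  qed
  have "card E' \<le> card E" if E': "\<Theta>.orthonormal E'" "\<forall>T\<in>E'. \<forall>J\<in>W. T J \<in> cspan M S" for E'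
  proof (rule \<Theta>.card_orthonormal_le[OF E E'(1)])
    fix T assume T: "T \<in> E'"
    then have "T \<in> carrier TS" using E'(1) unfolding \<Theta>.orthonormal_def by blast
    then show "\<Theta>.covers E T" using TU[of T] E'(2) T unfolding U_def by blast
  qed
  then show ?thesis by blast
qed

end

section \<open>Pulling back a form from the Langlands quotient\<close>

context gk_tens
begin

text \<open>The positive form \<open>h1\<close> on the quotient is arbitrary and is related to
  \<open>h\<close> only by living on \<open>X\<close> modulo the radical of \<open>h\<close>. What
  survives of this relation is the last property: null vectors of \<open>k\<close> lie in the left
  radical of \<open>h\<close>.\<close>

lemma langlands_quotient_psd:
  assumes h: "gk_invariant_form G X h" and u: "unitary_gk_module G (gk_langlands_quotient X h)"
  obtains k where "gk_invariant_form G X k" "psd M k"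
    "\<And>x y. x \<in> carrier M \<Longrightarrow> y \<in> carrier M \<Longrightarrow> k x x = 0 \<Longrightarrow> h x y = 0"
proof -
  define R where "R = radical M h"
  have hh: "hermitian_form M h" and hi: "\<And>g x y. g \<in> lie G \<Longrightarrow> x \<in> carrier M \<Longrightarrow> y \<in> carrier M \<Longrightarrow>
      h (\<pi> g x) y = h x (\<pi> (- cj g) y)"
    using h unfolding gk_invariant_form_def by blast+
  interpret h: sesq M h by (intro sesq.intro sesq_axioms.intro cvsM hh)
  interpret Q: lin_quot M R unfolding R_def by (rule h.lin_quot_radical)
  obtain h1 where h1: "gk_invariant_form G (gk_langlands_quotient X h) h1" "positive_definite (quot_space M R) h1"
    using u unfolding unitary_gk_module_def gk_langlands_quotient_def Let_def R_def by auto
  have herm: "hermitian_form (quot_space M R) h1"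
    and inv: "\<And>g S T. g \<in> lie G \<Longrightarrow> S \<in> carrier (quot_space M R) \<Longrightarrow> T \<in> carrier (quot_space M R) \<Longrightarrow>
      h1 (quot_op M R (\<pi> g) S) T = h1 S (quot_op M R (\<pi> (- cj g)) T)"
    using h1(1) unfolding gk_invariant_form_def gk_langlands_quotient_def Let_def R_def by simp_all
  define k where "k x y = h1 (Q.cl x) (Q.cl y)" for x y
  have qc: "Q.cl x \<in> carrier (quot_space M R)" if "x \<in> carrier M" for x
    using that unfolding Q.quot_space_simps by blast
  have kh: "hermitian_form M k"
    unfolding hermitian_form_def
  proof (intro ballI allI conjI)
    fix x y z a assume c: "x \<in> carrier M" "y \<in> carrier M" "z \<in> carrier M"
    note hq = herm[unfolded hermitian_form_def, rule_format, OF qc[OF c(1)] qc[OF c(2)] qc[OF c(3)]]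
    show "k (x \<oplus>\<^bsub>M\<^esub> y) z = k x z + k y z" "k z (x \<oplus>\<^bsub>M\<^esub> y) = k z x + k z y"
      "k (a \<odot>\<^bsub>M\<^esub> x) z = a * k x z" "k z (a \<odot>\<^bsub>M\<^esub> x) = cnj a * k z x"
      unfolding k_def Q.quot_add[OF c(1,2), symmetric] Q.quot_smult[OF c(1), symmetric] using hq by blast+
  qed
  interpret k: sesq M k by (intro sesq.intro sesq_axioms.intro cvsM kh)
  have pos: "(x \<in> R \<longrightarrow> k x x = 0) \<and> (x \<notin> R \<longrightarrow> k x x \<in> \<real> \<and> 0 < Re (k x x))" if x: "x \<in> carrier M" for x
  proof (cases "x \<in> R")
    case True
    have "Q.cl x = Q.cl \<zero>\<^bsub>M\<^esub>"
      using Q.cl_zero_iff[OF x] Q.cl_zero_iff[OF M.M.zero_closed] True Q.R_zero by simp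
    then have "k x x = k \<zero>\<^bsub>M\<^esub> \<zero>\<^bsub>M\<^esub>" unfolding k_def by simp
    then show ?thesis using True by simp
  next
    case False
    then have "Q.cl x \<noteq> \<zero>\<^bsub>quot_space M R\<^esub>" using Q.cl_zero_iff[OF x] unfolding Q.quot_space_simps by blast
    then show ?thesis using h1(2) qc[OF x] False unfolding positive_definite_def k_def by blast
  qed
  show thesis
  proof (rule that[of k])
    have lneg: "- cj g \<in> lie G" if "g \<in> lie G" for g
      using lie_uminus[OF lie_cj[OF that]] .
    \<comment> \<open>Stability of \<open>R\<close> lets the operators on the quotient be computed
      on representatives.\<close>
    have st: "\<pi> g r \<in> R" if g: "g \<in> lie G" and r: "r \<in> R" for g r
    proof -
      have rc: "r \<in> carrier M" and r0: "\<And>y. y \<in> carrier M \<Longrightarrow> h r y = 0" using r unfolding R_def radical_def by blast+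
      have "h (\<pi> g r) y = 0" if y: "y \<in> carrier M" for y
        unfolding hi[OF g rc y] by (rule r0[OF pi_closed[OF lneg[OF g] y]])
      then show ?thesis unfolding R_def radical_def using pi_closed[OF g rc] by blast
    qed
    show "gk_invariant_form G X k"
      unfolding gk_invariant_form_def
    proof (intro conjI ballI kh)
      fix g x y assume g: "g \<in> lie G" and x: "x \<in> carrier M" and y: "y \<in> carrier M"
      note g' = lneg[OF g]
      have "quot_op M R (\<pi> g) (Q.cl x) = Q.cl (\<pi> g x)"
        by (rule Q.quot_op_cl[OF x pi_linear[OF g]]) (rule st[OF g])
      moreover have "quot_op M R (\<pi> (- cj g)) (Q.cl y) = Q.cl (\<pi> (- cj g) y)"
        by (rule Q.quot_op_cl[OF y pi_linear[OF g']]) (rule st[OF g'])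
      ultimately show "k (\<pi> g x) y = k x (\<pi> (- cj g) y)"
        using inv[OF g qc[OF x] qc[OF y]] unfolding k_def by simp
    qed
    show "psd M k"
    proof (intro psd.intro psd_axioms.intro k.sesq_axioms)
      fix x assume "x \<in> carrier M"
      then show "k x x \<in> \<real> \<and> 0 \<le> Re (k x x)" using pos[of x] by (cases "x \<in> R") auto
    qed
    fix x y assume x: "x \<in> carrier M" and y: "y \<in> carrier M" and 0: "k x x = 0"
    have "x \<in> R" using pos[OF x] 0 by auto
    then show "h x y = 0" using y unfolding R_def radical_def by blast
  qed
qed

end

text \<open>Isolates what the VW-algebra and the Hecke algebra share, so that the unitarity argument
  is given once for both.\<close>

locale tensor_action = mult_space G B d X l hV P \<mu>
  for G B d and X :: "'x gk_module" and l hV P \<mu> +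
  fixes A :: "'g presented_algebra" and \<rho> :: "'g \<Rightarrow> (complex \<Rightarrow> nat list \<Rightarrow> 'x) \<Rightarrow> complex \<Rightarrow> nat list \<Rightarrow> 'x"
  assumes act: "g \<in> alg_gens A \<Longrightarrow> \<exists>f. good f \<and> (\<forall>\<phi>\<in>carrier FS. \<rho> g \<phi> = (\<lambda>a. f (\<phi> a)))"
    and w0_gens: "set_ncpoly (alg_w0 A) \<subseteq> alg_gens A"
    and w0_eval: "\<phi> \<in> carrier FS \<Longrightarrow> nc_eval FS \<rho> (alg_w0 A) \<phi> = (\<lambda>a. wop (tk \<xi>) (\<phi> a))"
begin

abbreviation ev where "ev \<equiv> nc_eval FS \<rho>"

lemma good_FS:
  assumes "good f" "\<phi> \<in> carrier FS" shows "(\<lambda>a. f (\<phi> a)) \<in> carrier FS"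
proof (rule FS_op[OF _ _ assms(2)])
  show "clinear TS TS f" using assms(1) unfolding good_def by blast
  show "tensor_grp G X l k (f T) = f (tensor_grp G X l k T)" if "k \<in> K_of G" "T \<in> carrier TS" for k T
    using assms(1) that unfolding good_def by blast
qed

lemma clinear_act:
  assumes g: "g \<in> alg_gens A" shows "clinear FS FS (\<rho> g)"
proof -
  obtain f where f: "good f" and eq: "\<And>\<phi>. \<phi> \<in> carrier FS \<Longrightarrow> \<rho> g \<phi> = (\<lambda>a. f (\<phi> a))"
    using act[OF g] by blast
  have c: "clinear TS TS f" using f unfolding good_def by blast
  show ?thesis
  proof (rule clinearI)
    fix \<phi> \<psi> a assume \<phi>: "\<phi> \<in> carrier FS"
    show "\<rho> g \<phi> \<in> carrier FS" unfolding eq[OF \<phi>] by (rule good_FS[OF f \<phi>])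
    show "\<rho> g (a \<odot>\<^bsub>FS\<^esub> \<phi>) = a \<odot>\<^bsub>FS\<^esub> \<rho> g \<phi>"
      unfolding eq[OF \<phi>] eq[OF FS.sm_closed[OF \<phi>]] unfolding FS_simps
      by (rule ext) (rule clinear_simps(2)[OF c FS_D(1)[OF \<phi>]])
    assume \<psi>: "\<psi> \<in> carrier FS"
    show "\<rho> g (\<phi> \<oplus>\<^bsub>FS\<^esub> \<psi>) = \<rho> g \<phi> \<oplus>\<^bsub>FS\<^esub> \<rho> g \<psi>"
      unfolding eq[OF \<phi>] eq[OF \<psi>] eq[OF FS.M.add.m_closed[OF \<phi> \<psi>]] unfolding FS_simps
      by (rule ext) (rule clinear_simps(3)[OF c FS_D(1)[OF \<phi>] FS_D(1)[OF \<psi>]])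
  qed
qed

lemma ev_closed:
  assumes "set_ncpoly a \<subseteq> alg_gens A" "\<phi> \<in> carrier FS" shows "ev a \<phi> \<in> carrier FS"
  using assms by (induction a arbitrary: \<phi>) (auto simp: clinear_simps(1)[OF clinear_act])

lemma bullet_gens: "set_ncpoly a \<subseteq> Y \<Longrightarrow> set_ncpoly (nc_bullet a) \<subseteq> Y"
  by (induction a) auto

text \<open>Induction over polynomials: generators are symmetric by \<open>good\<close>, products
  reverse their order and constants are conjugated, just as in \<open>nc_bullet\<close>.\<close>

lemma tf_adjoint:
  assumes k: "gk_invariant_form G X k"
    and a: "set_ncpoly a \<subseteq> alg_gens A" and \<phi>: "\<phi> \<in> carrier FS" and \<psi>: "\<psi> \<in> carrier FS"
  shows "tf k (ev a \<phi> 1) (\<psi> 1) = tf k (\<phi> 1) (ev (nc_bullet a) \<psi> 1)"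
  using a \<phi> \<psi>
proof (induction a arbitrary: \<phi> \<psi>)
  case (Gen g)
  then obtain f where f: "good f" and eq: "\<And>\<phi>. \<phi> \<in> carrier FS \<Longrightarrow> \<rho> g \<phi> = (\<lambda>a. f (\<phi> a))"
    using act[of g] by auto
  have "tf k (f (\<phi> 1)) (\<psi> 1) = tf k (\<phi> 1) (f (\<psi> 1))"
    using f k FS_D(1)[OF Gen(2)] FS_D(1)[OF Gen(3)] unfolding good_def by blast
  then show ?case using eq Gen by simp
next
  interpret t: sesq TS "tf k"
    by (intro sesq.intro sesq_axioms.intro cvs_TS tf_hermitian) (use k in \<open>simp add: gk_invariant_form_def\<close>)
  {
    case (Const c)
    show ?case
      unfolding nc_eval.simps nc_bullet.simps FS_simps
        t.H_sm(1)[OF FS_D(1)[OF Const(2)] FS_D(1)[OF Const(3)]] t.H_sm(2)[OF FS_D(1)[OF Const(3)] FS_D(1)[OF Const(2)]]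
      by simp
  next
    case (Plus a b)
    then have s: "set_ncpoly a \<subseteq> alg_gens A" "set_ncpoly b \<subseteq> alg_gens A" by auto
    note s' = s[THEN bullet_gens]
    note x = FS_D(1)[OF Plus(4)] and y = FS_D(1)[OF Plus(5)]
    note e = ev_closed[OF s(1) Plus(4), THEN FS_D(1)] ev_closed[OF s(2) Plus(4), THEN FS_D(1)]
      ev_closed[OF s'(1) Plus(5), THEN FS_D(1)] ev_closed[OF s'(2) Plus(5), THEN FS_D(1)]
    show ?case
      unfolding nc_eval.simps nc_bullet.simps FS_simps t.H_add(1)[OF e(1,2) y] t.H_add(2)[OF e(3,4) x]
        Plus.IH(1)[OF s(1) Plus(4,5)] Plus.IH(2)[OF s(2) Plus(4,5)] ..
  next
    case (Times a b)
    then have s: "set_ncpoly a \<subseteq> alg_gens A" "set_ncpoly b \<subseteq> alg_gens A" by auto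
    note s' = s[THEN bullet_gens]
    show ?case
      unfolding nc_eval.simps nc_bullet.simps
        Times.IH(1)[OF s(1) ev_closed[OF s(2) Times(4)] Times(5)]
      by (rule Times.IH(2)[OF s(2) Times(4) ev_closed[OF s'(1) Times(5)]])
  }
qed

lemma star_gens: "set_ncpoly a \<subseteq> alg_gens A \<Longrightarrow> set_ncpoly (alg_star A a) \<subseteq> alg_gens A"
  using w0_gens bullet_gens[of a] unfolding alg_star_def by simp

text \<open>Because \<open>\<xi> \<otimes> \<dots> \<otimes> \<xi>\<close> is an involution,
  \<open>F_form\<close> is the twisted form with \<open>w\<^sub>0\<close> put into its second
  variable. Moving \<open>a\<close> across gives \<open>nc_bullet a\<close> after
  \<open>w\<^sub>0\<close>, and undoing the twist puts another \<open>w\<^sub>0\<close> in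
  front.\<close>

lemma F_form_adjoint:
  assumes k: "gk_invariant_form G X k"
    and a: "set_ncpoly a \<subseteq> alg_gens A" and \<phi>: "\<phi> \<in> carrier FS" and \<psi>: "\<psi> \<in> carrier FS"
  shows "F_form G hV k l (ev a \<phi>) \<psi> = F_form G hV k l \<phi> (ev (alg_star A a) \<psi>)"
proof -
  have F: "F_form G hV k l \<eta> \<psi> = tf k (\<eta> 1) (ev (alg_w0 A) \<psi> 1)" if "\<psi> \<in> carrier FS" for \<eta> \<psi>
    unfolding F_form_def tf_def w0_eval[OF that] wop_xi_involution[OF FS_D(1)[OF that]] ..
  note w\<psi> = ev_closed[OF w0_gens \<psi>]
  note s = ev_closed[OF star_gens[OF a] \<psi>]
  have aw: "ev (nc_bullet a) (ev (alg_w0 A) \<psi>) \<in> carrier FS"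
    by (rule ev_closed[OF bullet_gens[OF a] w\<psi>])
  have "F_form G hV k l (ev a \<phi>) \<psi> = tf k (\<phi> 1) (ev (nc_bullet a) (ev (alg_w0 A) \<psi>) 1)"
    unfolding F[OF \<psi>] by (rule tf_adjoint[OF k a \<phi> w\<psi>])
  also have "\<dots> = F_form G hV k l \<phi> (ev (alg_star A a) \<psi>)"
    unfolding F_form_def tf_def alg_star_def nc_eval.simps w0_eval[OF aw] ..
  finally show ?thesis .
qed

lemma F_form_hermitian:
  assumes "hermitian_form M k" shows "hermitian_form FS (F_form G hV k l)"
proof -
  interpret t: sesq TS "tensor_form G hV k l"
    by (intro sesq.intro sesq_axioms.intro cvs_TS tensor_form_hermitian assms)
  show ?thesis
    unfolding hermitian_form_def
  proof (intro ballI allI conjI)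
    fix \<phi> \<psi> \<eta> a assume c: "\<phi> \<in> carrier FS" "\<psi> \<in> carrier FS" "\<eta> \<in> carrier FS"
    note D = c[THEN FS_D(1)]
    show "F_form G hV k l (\<phi> \<oplus>\<^bsub>FS\<^esub> \<psi>) \<eta> = F_form G hV k l \<phi> \<eta> + F_form G hV k l \<psi> \<eta>"
      unfolding F_form_def FS_simps by (rule t.H_add(1)[OF D])
    show "F_form G hV k l \<eta> (\<phi> \<oplus>\<^bsub>FS\<^esub> \<psi>) = F_form G hV k l \<eta> \<phi> + F_form G hV k l \<eta> \<psi>"
      unfolding F_form_def FS_simps by (rule t.H_add(2)[OF D])
    show "F_form G hV k l (a \<odot>\<^bsub>FS\<^esub> \<phi>) \<eta> = a * F_form G hV k l \<phi> \<eta>"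
      unfolding F_form_def FS_simps by (rule t.H_sm(1)[OF D(1,3)])
    show "F_form G hV k l \<eta> (a \<odot>\<^bsub>FS\<^esub> \<phi>) = cnj a * F_form G hV k l \<eta> \<phi>"
      unfolding F_form_def FS_simps by (rule t.H_sm(2)[OF D(1,3)])
  qed
qed

theorem unitary_quotient:
  assumes adm: "admissible G X" and \<chi>: "K_character G \<mu>"
    and h: "gk_invariant_form G X h" and u: "unitary_gk_module G (gk_langlands_quotient X h)"
  shows "unitary_langlands_quotient A FS \<rho> (F_form G hV h l)"
proof -
  obtain k where k: "gk_invariant_form G X k" "psd M k"
    and null: "\<And>x y. x \<in> carrier M \<Longrightarrow> y \<in> carrier M \<Longrightarrow> k x x = 0 \<Longrightarrow> h x y = 0"
    using langlands_quotient_psd[OF h u] by blast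
  have hh: "hermitian_form M h" using h unfolding gk_invariant_form_def by blast
  interpret t: sesq TS "tensor_form G hV h l"
    by (intro sesq.intro sesq_axioms.intro cvs_TS tensor_form_hermitian hh)
  interpret f: sesq FS "F_form G hV h l"
    by (intro sesq.intro sesq_axioms.intro cvs_FS F_form_hermitian hh)
  \<comment> \<open>\<open>R\<close> belongs to the given form \<open>h\<close>, while
    \<open>\<Theta>\<close> below comes from the positive form \<open>k\<close>. The link between
    them is \<open>hnull\<close>: null vectors of \<open>\<Theta>\<close> are annihilated by the
    product form of \<open>h\<close>.\<close>
  define R where "R = radical FS (F_form G hV h l)"
  interpret Q: lin_quot FS R unfolding R_def by (rule f.lin_quot_radical)
  define \<Theta> where "\<Theta> = tensor_form G hV k l"
  interpret \<Theta>: psd TS \<Theta> unfolding \<Theta>_def by (rule tensor_form_psd(1)[OF k(2)])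
  interpret k: psd M k by (rule k(2))
  have hnull: "tensor_form G hV h l r S = 0" if r: "r \<in> carrier TS" "\<Theta> r r = 0" and S: "S \<in> carrier TS" for r S
  proof -
    have "h (r I) (S J) = 0" if I: "I \<in> W" for I J
      by (rule null[OF TS_closed[OF r(1)] TS_closed[OF S]])
        (rule tensor_form_psd(2)[OF k(2) r(1) r(2)[unfolded \<Theta>_def] I TS_closed[OF r(1)]])
    then show ?thesis unfolding tensor_form_eq by simp
  qed
  have RI: "\<phi> \<in> carrier FS" "\<And>\<psi>. \<psi> \<in> carrier FS \<Longrightarrow> F_form G hV h l \<phi> \<psi> = 0" if "\<phi> \<in> R" for \<phi>
    using that unfolding R_def radical_def by blast+
  have evR: "ev a \<phi> \<in> R" if a: "set_ncpoly a \<subseteq> alg_gens A" and \<phi>: "\<phi> \<in> R" for a \<phi>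
    unfolding R_def radical_def
    using ev_closed[OF a RI(1)[OF \<phi>]] F_form_adjoint[OF h a RI(1)[OF \<phi>]] RI(2)[OF \<phi> ev_closed[OF star_gens[OF a]]] by simp
  have gR: "\<rho> g \<phi> \<in> R" if "g \<in> alg_gens A" "\<phi> \<in> R" for g \<phi>
    using evR[of "Gen g"] that by simp
  \<comment> \<open>The submodule \<open>R\<close> seen in the tensor product, where
    \<open>\<Theta>\<close> lives; evaluation at 1 loses nothing.\<close>
  let ?U = "(\<lambda>\<phi>. \<phi> 1) ` R"
  have UC: "?U \<subseteq> carrier TS" using FS_D(1)[OF RI(1)] by blast
  have U0: "\<zero>\<^bsub>TS\<^esub> \<in> ?U"
    using Q.R_zero unfolding FS_simps by (rule rev_image_eqI) (rule refl)
  have Ua: "x \<oplus>\<^bsub>TS\<^esub> y \<in> ?U" if xy: "x \<in> ?U" "y \<in> ?U" for x y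
  proof -
    obtain \<phi> \<psi> where \<phi>: "\<phi> \<in> R" "x = \<phi> 1" and \<psi>: "\<psi> \<in> R" "y = \<psi> 1" using xy by blast
    show ?thesis
      using Q.R_add[OF \<phi>(1) \<psi>(1)] unfolding FS_simps \<phi>(2) \<psi>(2) by (rule rev_image_eqI) (rule refl)
  qed
  have Us: "a \<odot>\<^bsub>TS\<^esub> x \<in> ?U" if x: "x \<in> ?U" for a x
  proof -
    obtain \<phi> where \<phi>: "\<phi> \<in> R" "x = \<phi> 1" using x by blast
    show ?thesis
      using Q.R_sm[OF \<phi>(1)] unfolding FS_simps \<phi>(2) by (rule rev_image_eqI) (rule refl)
  qed
  obtain S where S: "finite S" "S \<subseteq> carrier M" and val: "\<And>\<phi> J. \<phi> \<in> carrier FS \<Longrightarrow> J \<in> W \<Longrightarrow> \<phi> 1 J \<in> cspan M S"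
    using FS_values_finite[OF adm \<chi>] by blast
  obtain b where b: "\<And>E. \<Theta>.orthonormal E \<Longrightarrow> \<forall>T\<in>E. \<forall>J\<in>W. T J \<in> cspan M S \<Longrightarrow> card E \<le> b"
    using orthonormal_bounded[OF \<Theta>.psd_axioms S] by blast
  have bd: "card E \<le> b" if E: "\<Theta>.orthonormal E" "E \<subseteq> ?U" for E
    using b[OF E(1)] E(2) val[OF RI(1)] by blast
  \<comment> \<open>An orthonormal basis of \<open>R\<close> modulo null vectors, which exists
    because \<open>b\<close> bounds its size.\<close>
  obtain E where EU: "E \<subseteq> ?U" and E: "\<Theta>.orthonormal E" and cov: "\<And>x. x \<in> ?U \<Longrightarrow> \<Theta>.covers E x"
    using \<Theta>.orthonormal_basis_exists[OF UC Ua Us U0 bd] by blast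
  have EC: "f \<in> carrier TS" if "f \<in> E" for f using EU UC that by blast
  have projU: "\<Theta>.proj E x \<in> ?U" for x
    unfolding \<Theta>.proj_def by (rule TS.finsum_mem[OF UC U0 Ua]) (use Us EU in blast)+
  \<comment> \<open>This is \<open>\<Theta>\<close> of the components orthogonal to
    \<open>R\<close>. Written with the sum over \<open>E\<close>, it is sesquilinear by
    inspection.\<close>
  define H where "H \<phi> \<psi> = \<Theta> (\<phi> 1) (\<psi> 1) - (\<Sum>f\<in>E. \<Theta> (\<phi> 1) f * \<Theta> f (\<psi> 1))" for \<phi> \<psi> :: "complex \<Rightarrow> nat list \<Rightarrow> 'x"
  have Hherm: "hermitian_form FS H"
    unfolding hermitian_form_def
  proof (intro ballI allI conjI)
    fix \<phi> \<psi> \<eta> a assume c: "\<phi> \<in> carrier FS" "\<psi> \<in> carrier FS" "\<eta> \<in> carrier FS"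
    note D = c[THEN FS_D(1), of 1]
    have D1: "\<Theta> (\<phi> 1 \<oplus>\<^bsub>TS\<^esub> \<psi> 1) f = \<Theta> (\<phi> 1) f + \<Theta> (\<psi> 1) f" "\<Theta> f (\<phi> 1 \<oplus>\<^bsub>TS\<^esub> \<psi> 1) = \<Theta> f (\<phi> 1) + \<Theta> f (\<psi> 1)"
      "\<Theta> (a \<odot>\<^bsub>TS\<^esub> \<phi> 1) f = a * \<Theta> (\<phi> 1) f" "\<Theta> f (a \<odot>\<^bsub>TS\<^esub> \<phi> 1) = cnj a * \<Theta> f (\<phi> 1)" if "f \<in> carrier TS" for f
      by (rule \<Theta>.H_add(1)[OF D(1,2) that] \<Theta>.H_add(2)[OF D(1,2) that] \<Theta>.H_sm(1)[OF D(1) that] \<Theta>.H_sm(2)[OF D(1) that])+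
    show "H (\<phi> \<oplus>\<^bsub>FS\<^esub> \<psi>) \<eta> = H \<phi> \<eta> + H \<psi> \<eta>" "H \<eta> (\<phi> \<oplus>\<^bsub>FS\<^esub> \<psi>) = H \<eta> \<phi> + H \<eta> \<psi>"
      "H (a \<odot>\<^bsub>FS\<^esub> \<phi>) \<eta> = a * H \<phi> \<eta>" "H \<eta> (a \<odot>\<^bsub>FS\<^esub> \<phi>) = cnj a * H \<eta> \<phi>"
      unfolding H_def FS_simps D1[OF D(3)]
      by (simp_all del: TS_simps add: D1 EC algebra_simps sum.distrib sum_distrib_left)
  qed
  interpret H: sesq FS H by (intro sesq.intro sesq_axioms.intro cvs_FS Hherm)
  have H_eq: "H \<phi> \<psi> = \<Theta> (\<phi> 1) (\<psi> 1) - \<Theta> (\<phi> 1) (\<Theta>.proj E (\<psi> 1))"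
    if c: "\<phi> \<in> carrier FS" "\<psi> \<in> carrier FS" for \<phi> \<psi>
  proof -
    note D = c[THEN FS_D(1), of 1]
    have "\<Theta> f (\<psi> 1) = cnj (\<Theta> (\<psi> 1) f)" if "f \<in> E" for f by (rule \<Theta>.sym[OF D(2) EC[OF that]])
    then show ?thesis unfolding H_def \<Theta>.H_proj(2)[OF E D(2,1)] by (simp add: mult.commute)
  qed
  have R1: "H r \<psi> = 0" if r: "r \<in> R" and \<psi>: "\<psi> \<in> carrier FS" for r \<psi>
  proof -
    have "\<Theta>.covers E (r 1)" using cov r by blast
    then show ?thesis unfolding H_def \<Theta>.covers_def using FS_D(1)[OF \<psi>, of 1] by simp
  qed
  have R2: "H \<psi> r = 0" if r: "r \<in> R" and \<psi>: "\<psi> \<in> carrier FS" for r \<psi>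
  proof -
    note D = FS_D(1)[OF \<psi>, of 1] FS_D(1)[OF RI(1)[OF r], of 1]
    have e: "\<Theta> (\<psi> 1) f = cnj (\<Theta> f (\<psi> 1))" "\<Theta> f (r 1) = cnj (\<Theta> (r 1) f)" if "f \<in> E" for f
      by (rule \<Theta>.sym[OF EC[OF that] D(1)] \<Theta>.sym[OF D(2) EC[OF that]])+
    have "H \<psi> r = cnj (H r \<psi>)"
      unfolding H_def \<Theta>.sym[OF D(2,1)] using e by (simp add: mult.commute)
    then show ?thesis using R1[OF r \<psi>] by simp
  qed
  \<comment> \<open>Orthogonal decomposition inside \<open>FS\<close>: the members of
    \<open>E\<close> are values of elements of \<open>R\<close>, so the projection of
    \<open>\<psi> 1\<close> is such a value too, and the complement comes from an element of
    \<open>FS\<close>.\<close>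
  have split: "\<exists>\<omega>\<in>carrier FS. \<exists>r\<in>R. \<psi> = \<omega> \<oplus>\<^bsub>FS\<^esub> r \<and> r 1 = \<Theta>.proj E (\<psi> 1) \<and> \<omega> 1 = \<psi> 1 \<ominus>\<^bsub>TS\<^esub> \<Theta>.proj E (\<psi> 1)"
    if \<psi>: "\<psi> \<in> carrier FS" for \<psi>
  proof -
    obtain r where r: "r \<in> R" "r 1 = \<Theta>.proj E (\<psi> 1)" using projU[of "\<psi> 1"] by auto
    note rc = RI(1)[OF r(1)]
    have "\<psi> = (\<psi> \<oplus>\<^bsub>FS\<^esub> (- 1) \<odot>\<^bsub>FS\<^esub> r) \<oplus>\<^bsub>FS\<^esub> r"
      unfolding FS.sm_neg[OF rc] FS.M.a_assoc[OF \<psi> FS.M.a_inv_closed[OF rc] rc] FS.M.l_neg[OF rc] FS.M.r_zero[OF \<psi>] ..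
    moreover have "(\<psi> \<oplus>\<^bsub>FS\<^esub> (- 1) \<odot>\<^bsub>FS\<^esub> r) 1 = \<psi> 1 \<ominus>\<^bsub>TS\<^esub> \<Theta>.proj E (\<psi> 1)"
      unfolding FS_simps a_minus_def r(2)[symmetric] TS.sm_neg[OF FS_D(1)[OF rc]] ..
    moreover have "\<psi> \<oplus>\<^bsub>FS\<^esub> (- 1) \<odot>\<^bsub>FS\<^esub> r \<in> carrier FS" by (rule FS.M.a_closed[OF \<psi> FS.sm_closed[OF rc]])
    ultimately show ?thesis using r by blast
  qed
  have \<Theta>F: "\<Theta> (ev a \<phi> 1) (\<psi> 1) = \<Theta> (\<phi> 1) (ev (alg_star A a) \<psi> 1)"
    if "set_ncpoly a \<subseteq> alg_gens A" "\<phi> \<in> carrier FS" "\<psi> \<in> carrier FS" for a \<phi> \<psi>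
    using F_form_adjoint[OF k(1) that] unfolding F_form_def \<Theta>_def .
  have inv: "H (ev a \<phi>) \<psi> = H \<phi> (ev (alg_star A a) \<psi>)"
    if a: "set_ncpoly a \<subseteq> alg_gens A" and \<phi>: "\<phi> \<in> carrier FS" and \<psi>: "\<psi> \<in> carrier FS" for a \<phi> \<psi>
  proof -
    let ?s = "ev (alg_star A a)"
    note s = star_gens[OF a]
    obtain \<omega> r where \<omega>: "\<omega> \<in> carrier FS" "\<omega> 1 = \<psi> 1 \<ominus>\<^bsub>TS\<^esub> \<Theta>.proj E (\<psi> 1)" and r: "r \<in> R"
      and eq: "\<psi> = \<omega> \<oplus>\<^bsub>FS\<^esub> r" using split[OF \<psi>] by blast
    have H\<omega>: "H \<eta> \<psi> = \<Theta> (\<eta> 1) (\<omega> 1)" if \<eta>: "\<eta> \<in> carrier FS" for \<eta>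
      unfolding H_eq[OF \<eta> \<psi>] \<omega>(2)
      by (rule \<Theta>.H_minus(2)[OF FS_D(1)[OF \<psi>] \<Theta>.proj_closed[OF E FS_D(1)[OF \<psi>]] FS_D(1)[OF \<eta>], symmetric])
    \<comment> \<open>The orthogonal complement of \<open>R\<close> is stable:
      \<open>ev (alg_star A a)\<close> is adjoint to \<open>ev a\<close>, which preserves
      \<open>R\<close>.\<close>
    have 0: "\<Theta> f (?s \<omega> 1) = 0" if f: "f \<in> E" for f
    proof -
      obtain \<eta> where \<eta>: "\<eta> \<in> R" "f = \<eta> 1" using EU f by blast
      have "\<Theta> f (?s \<omega> 1) = \<Theta> (ev a \<eta> 1) (\<omega> 1)" unfolding \<eta>(2) \<Theta>F[OF a RI(1)[OF \<eta>(1)] \<omega>(1)] ..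
      also have "\<dots> = H (ev a \<eta>) \<psi>" by (rule H\<omega>[OF ev_closed[OF a RI(1)[OF \<eta>(1)]], symmetric])
      also have "\<dots> = 0" by (rule R1[OF evR[OF a \<eta>(1)] \<psi>])
      finally show ?thesis .
    qed
    have "?s \<psi> = ?s \<omega> \<oplus>\<^bsub>FS\<^esub> ?s r"
      unfolding eq using Q.nc_eval_add[where A="alg_gens A" and \<rho>=\<rho>, OF clinear_act s \<omega>(1) RI(1)[OF r]] .
    then have "H \<phi> (?s \<psi>) = H \<phi> (?s \<omega>) + H \<phi> (?s r)"
      using H.H_add(2)[OF ev_closed[OF s \<omega>(1)] ev_closed[OF s RI(1)[OF r]] \<phi>] by simp
    also have "\<dots> = H \<phi> (?s \<omega>)" using R2[OF evR[OF s r] \<phi>] by simp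
    also have "\<dots> = \<Theta> (\<phi> 1) (?s \<omega> 1)" unfolding H_def using 0 by simp
    also have "\<dots> = H (ev a \<phi>) \<psi>" unfolding H\<omega>[OF ev_closed[OF a \<phi>]] \<Theta>F[OF a \<phi> \<omega>(1)] ..
    finally show ?thesis ..
  qed
  have pos: "H \<phi> \<phi> \<in> \<real> \<and> 0 < Re (H \<phi> \<phi>)" if \<phi>: "\<phi> \<in> carrier FS" "\<phi> \<notin> R" for \<phi>
  proof -
    note D = FS_D(1)[OF \<phi>(1)]
    let ?r = "\<phi> 1 \<ominus>\<^bsub>TS\<^esub> \<Theta>.proj E (\<phi> 1)"
    have pc: "\<Theta>.proj E (\<phi> 1) \<in> carrier TS" by (rule \<Theta>.proj_closed[OF E D])
    have rc: "?r \<in> carrier TS" by (rule TS.M.minus_closed[OF D pc])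
    have e: "H \<phi> \<phi> = \<Theta> ?r ?r" unfolding H_def \<Theta>.residual_norm[OF E D] ..
    \<comment> \<open>If \<open>H\<close> vanishes at \<open>\<phi>\<close>, the residual is a null
      vector; then in the form of \<open>h\<close> the vector \<open>\<phi>\<close> has the same
      products as the element \<open>\<chi>\<close> of \<open>R\<close>, and so it lies in
      \<open>R\<close> itself.\<close>
    have "H \<phi> \<phi> \<noteq> 0"
    proof
      assume "H \<phi> \<phi> = 0"
      then have n: "\<Theta> ?r ?r = 0" using e by simp
      obtain \<chi> where \<chi>: "\<chi> \<in> R" "\<chi> 1 = \<Theta>.proj E (\<phi> 1)" using projU[of "\<phi> 1"] by auto
      have "F_form G hV h l \<phi> \<psi> = 0" if \<psi>: "\<psi> \<in> carrier FS" for \<psi>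
      proof -
        have "tensor_form G hV h l (\<phi> 1) (\<psi> 1) - tensor_form G hV h l (\<chi> 1) (\<psi> 1) = tensor_form G hV h l ?r (\<psi> 1)"
          unfolding \<chi>(2) by (rule t.H_minus(1)[OF D pc FS_D(1)[OF \<psi>], symmetric])
        also have "\<dots> = 0" by (rule hnull[OF rc n FS_D(1)[OF \<psi>]])
        finally show ?thesis using RI(2)[OF \<chi>(1) \<psi>] unfolding F_form_def by simp
      qed
      then show False using \<phi> unfolding R_def radical_def by blast
    qed
    moreover have "H \<phi> \<phi> \<in> \<real>" "0 \<le> Re (H \<phi> \<phi>)" unfolding e using \<Theta>.psd[OF rc] by blast+
    ultimately show ?thesis by (metis Reals_cases Re_complex_of_real of_real_0 order_le_less)
  qed
  show ?thesis
    unfolding unitary_langlands_quotient_def R_def[symmetric]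
  proof (rule Q.unitary_quotientI[where A=A and \<rho>=\<rho> and H=H])
    show "clinear FS FS (\<rho> g)" if "g \<in> alg_gens A" for g by (rule clinear_act[OF that])
    show "\<rho> g x \<in> R" if "g \<in> alg_gens A" "x \<in> R" for g x by (rule gR[OF that])
    show "H r y = 0 \<and> H y r = 0" if "r \<in> R" "y \<in> carrier FS" for r y
      using R1[OF that] R2[OF that] by simp
    show "H x x \<in> \<real> \<and> 0 < Re (H x x)" if "x \<in> carrier FS" "x \<notin> R" for x by (rule pos[OF that])
    show "H (ev a x) y = H x (ev (alg_star A a) y)"
      if "set_ncpoly a \<subseteq> alg_gens A" "x \<in> carrier FS" "y \<in> carrier FS" for a x y by (rule inv[OF that])
  qed (fact w0_gens Hherm)+
qed

end

section \<open>The actions of the VW-algebra and of the Hecke algebra\<close>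

lemma nc_prod_gens: "set_ncpoly (nc_prod (\<lambda>i. Gen (s i)) l) \<subseteq> {s i |i. 1 \<le> i \<and> i \<le> l}"
proof -
  have "set_ncpoly (foldl (\<lambda>a i. a [*] Gen (s i)) b xs) = set_ncpoly b \<union> s ` set xs" for b and xs :: "nat list"
    by (induction xs arbitrary: b) auto
  then show ?thesis unfolding nc_prod_def by auto
qed

text \<open>Partial products are treated by induction with \<open>\<phi>\<close> generalized:
  \<open>nc_eval\<close> applies the last factor first, so the induction hypothesis is taken at the
  image of \<open>\<phi>\<close> under the last generator.\<close>

lemma (in mult_space) nc_eval_w0:
  assumes s: "\<And>i \<phi>. 1 \<le> i \<Longrightarrow> i \<le> l \<Longrightarrow> \<phi> \<in> carrier FS \<Longrightarrow>
      \<rho> (s i) \<phi> = (\<lambda>a. vw_tensor_op G B d P X l (VTheta i) (\<phi> a))"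
    and \<phi>: "\<phi> \<in> carrier FS"
  shows "nc_eval FS \<rho> (nc_prod (\<lambda>i. Gen (s i)) l) \<phi> = (\<lambda>a. wop (tk \<xi>) (\<phi> a))"
proof -
  have "nc_eval FS \<rho> (foldl (\<lambda>a i. a [*] Gen (s i)) (Const 1) [1..<r+1]) \<phi> =
      (\<lambda>a. wop (tens l (\<lambda>m. if m < r then ent \<xi> else dlt)) (\<phi> a))" if "r \<le> l" for r
    using that \<phi>
  proof (induction r arbitrary: \<phi>)
    case 0
    have "wop (tens l (\<lambda>m. dlt)) (\<phi> a) = \<phi> a" for a
      using wop_cong[OF FS_D(1)[OF 0(2)] tens_dlt] wop_dlt[OF FS_D(1)[OF 0(2)]] by simp
    moreover have "1 \<odot>\<^bsub>TS\<^esub> \<phi> a = \<phi> a" for a by (rule TS.sm_one[OF FS_D(1)[OF 0(2)]])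
    ultimately show ?case unfolding FS_simps by (simp add: FS_simps del: TS_simps)
  next
    case (Suc r)
    note D = FS_D(1)[OF Suc(3)]
    have r: "1 \<le> r + 1" "r + 1 \<le> l" using Suc(2) by auto
    have g: "(\<lambda>a. vw_tensor_op G B d P X l (VTheta (r + 1)) (\<phi> a)) \<in> carrier FS"
    proof (rule FS_op[OF _ _ Suc(3)])
      show "clinear TS TS (vw_tensor_op G B d P X l (VTheta (r + 1)))"
        using good_VTheta[OF r] unfolding good_def by blast
      show "tensor_grp G X l k (vw_tensor_op G B d P X l (VTheta (r + 1)) T) =
          vw_tensor_op G B d P X l (VTheta (r + 1)) (tensor_grp G X l k T)" if "k \<in> K_of G" "T \<in> carrier TS" for k T
        using good_VTheta[OF r] that unfolding good_def by blast
    qed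
    have "nc_eval FS \<rho> (foldl (\<lambda>a i. a [*] Gen (s i)) (Const 1) [1..<Suc r+1]) \<phi> =
        nc_eval FS \<rho> (foldl (\<lambda>a i. a [*] Gen (s i)) (Const 1) [1..<r+1])
          (\<lambda>a. vw_tensor_op G B d P X l (VTheta (r + 1)) (\<phi> a))"
      using s[OF r Suc(3)] by simp
    also have "\<dots> = (\<lambda>a. wop (tens l (\<lambda>m. if m < r then ent \<xi> else dlt))
          (vw_tensor_op G B d P X l (VTheta (r + 1)) (\<phi> a)))"
      by (rule Suc.IH[OF _ g]) (use Suc(2) in simp)
    also have "\<dots> = (\<lambda>a. wop (tens l (\<lambda>m. if m < Suc r then ent \<xi> else dlt)) (\<phi> a))"
      unfolding VTheta_eq[OF r D] using wop_xi_power[OF D, of r] Suc(2) by simp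
    finally show ?case .
  qed
  from this[of l] have "nc_eval FS \<rho> (nc_prod (\<lambda>i. Gen (s i)) l) \<phi> =
      (\<lambda>a. wop (tens l (\<lambda>m. if m < l then ent \<xi> else dlt)) (\<phi> a))"
    unfolding nc_prod_def by simp
  also have "\<dots> = (\<lambda>a. wop (tk \<xi>) (\<phi> a))"
    by (intro ext wop_cong FS_D(1)[OF \<phi>]) (simp add: tens_def)
  finally show ?thesis .
qed

context mult_space
begin

lemma vw_tensor_action:
  "tensor_action G B d X l hV P \<mu> (vw_algebra l m0 m1 w) (F_vw_action G B d P l X)"
proof (intro tensor_action.intro tensor_action_axioms.intro mult_space_axioms)
  show "\<exists>f. good f \<and> (\<forall>\<phi>\<in>carrier FS. F_vw_action G B d P l X g \<phi> = (\<lambda>a. f (\<phi> a)))"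
    if "g \<in> alg_gens (vw_algebra l m0 m1 w)" for g
    using vw_good[OF that] unfolding F_vw_action_def by blast
  show "set_ncpoly (alg_w0 (vw_algebra l m0 m1 w)) \<subseteq> alg_gens (vw_algebra l m0 m1 w)"
    using nc_prod_gens[of VTheta l] by (auto simp: vw_algebra_def Let_def)
  show "nc_eval FS (F_vw_action G B d P l X) (alg_w0 (vw_algebra l m0 m1 w)) \<phi> = (\<lambda>a. wop (tk \<xi>) (\<phi> a))"
    if "\<phi> \<in> carrier FS" for \<phi>
    unfolding vw_algebra_def Let_def using nc_eval_w0[of "F_vw_action G B d P l X" VTheta \<phi>] that
    by (simp add: F_vw_action_def del: vw_tensor_op.simps)
qed

text \<open>\<open>\<epsilon>_i\<close> differs from \<open>z_i\<close> by the constant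
  \<open>r\<close>, and a real constant keeps it symmetric.\<close>

lemma hecke_tensor_action:
  assumes r: "cnj r = r"
  shows "tensor_action G B d X l hV P \<mu> (hecke_algebra l c') (F_hecke_action G B d P \<mu> r l X)"
proof (intro tensor_action.intro tensor_action_axioms.intro mult_space_axioms)
  fix g assume "g \<in> alg_gens (hecke_algebra l c')"
  then consider (s) i where "g = HS i" "1 \<le> i" "i < l" | (e) i where "g = HSe i" "1 \<le> i" "i \<le> l"
    | (z) i where "g = HEps i" "1 \<le> i" "i \<le> l"
    unfolding hecke_algebra_def Let_def by auto
  then show "\<exists>f. good f \<and> (\<forall>\<phi>\<in>carrier FS. F_hecke_action G B d P \<mu> r l X g \<phi> = (\<lambda>a. f (\<phi> a)))"
  proof cases
    case s
    then show ?thesis using good_VT[of i] by (auto simp: F_vw_action_def simp del: vw_tensor_op.simps)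
  next
    case e
    then show ?thesis using good_VTheta[of i] by (auto simp: F_vw_action_def simp del: vw_tensor_op.simps)
  next
    case z
    have "good (\<lambda>T. vw_tensor_op G B d P X l (VZ i) T \<oplus>\<^bsub>TS\<^esub> (- r) \<odot>\<^bsub>TS\<^esub> T)"
      by (intro good_add good_VZ good_smult good_id) (use z r in auto)
    then show ?thesis unfolding z(1) F_hecke_action.simps Let_def FS_simps F_vw_action_def by blast
  qed
next
  show "set_ncpoly (alg_w0 (hecke_algebra l c')) \<subseteq> alg_gens (hecke_algebra l c')"
    using nc_prod_gens[of HSe l] by (auto simp: hecke_algebra_def Let_def)
  show "nc_eval FS (F_hecke_action G B d P \<mu> r l X) (alg_w0 (hecke_algebra l c')) \<phi> = (\<lambda>a. wop (tk \<xi>) (\<phi> a))"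
    if "\<phi> \<in> carrier FS" for \<phi>
    unfolding hecke_algebra_def Let_def using nc_eval_w0[of "F_hecke_action G B d P \<mu> r l X" HSe \<phi>] that
    by (simp add: F_vw_action_def del: vw_tensor_op.simps)
qed

end

section \<open>Characters of the maximal compact subgroup\<close>

text \<open>By the Leibniz formula the determinant is a polynomial in the entries.\<close>

lemma mat_continuous_det:
  assumes "\<And>i j. i < m \<Longrightarrow> j < m \<Longrightarrow> mat_continuous_on n S (\<lambda>k. f k i j)"
  shows "mat_continuous_on n S (\<lambda>k. det (mat m m (\<lambda>(i, j). f k i j)))"
proof -
  have "mat_continuous_on n S (\<lambda>k. \<Sum>p\<in>{p. p permutes {0..<m}}. signof p * (\<Prod>i\<in>{0..<m}. f k i (p i)))"
    by (intro mat_continuous_sum mat_continuous_mult mat_continuous_const mat_continuous_prod assms)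
      (auto simp: permutes_in_image)
  then show ?thesis
  proof (rule mat_continuous_cong)
    fix k
    show "(\<Sum>p\<in>{p. p permutes {0..<m}}. signof p * (\<Prod>i\<in>{0..<m}. f k i (p i))) = det (mat m m (\<lambda>(i, j). f k i j))"
      by (subst det_def'[of _ m]) (auto intro!: sum.cong prod.cong simp: permutes_in_image)
  qed
qed

lemma det_mult_sum:
  assumes "\<And>i j. i < m \<Longrightarrow> j < m \<Longrightarrow> h i j = (\<Sum>b<m. f i b * g b j)"
  shows "det (mat m m (\<lambda>(i, j). h i j)) = det (mat m m (\<lambda>(i, j). f i j)) * (det (mat m m (\<lambda>(i, j). g i j)) :: complex)"
proof -
  have "mat m m (\<lambda>(i, j). h i j) = mat m m (\<lambda>(i, j). f i j) * mat m m (\<lambda>(i, j). g i j)"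
    by (rule eq_matI) (auto simp: scalar_prod_def atLeast0LessThan assms)
  then show ?thesis by (simp add: det_mult[of _ m])
qed

lemma sum_lessThan_add:
  fixes m n :: nat shows "(\<Sum>b<m + n. f b) = (\<Sum>b<m. f b) + (\<Sum>b<n. f (m + b) :: complex)"
  by (induction n) (simp_all add: add.assoc)

text \<open>In the off-diagonal blocks the entries of \<open>F * k\<close> and \<open>k * F\<close>
  differ in sign, so these blocks vanish, and the two diagonal blocks multiply separately.\<close>

lemma K_of_OR:
  assumes "k \<in> K_of (OR p q)"
  shows "k \<in> carrier_mat (p + q) (p + q)"
    and "i < p \<Longrightarrow> j < q \<Longrightarrow> k $$ (i, p + j) = 0" and "i < q \<Longrightarrow> j < p \<Longrightarrow> k $$ (p + i, j) = 0"
proof -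
  interpret rgrp "OR p q" .
  let ?F = "form_mat (OR p q)"
  note D = K_D[OF assms]
  show "k \<in> carrier_mat (p + q) (p + q)" using D(1) by simp
  have F: "?F $$ (a, b) = (if a = b then if a < p then 1 else - 1 else 0)" if "a < p + q" "b < p + q" for a b
    using that by auto
  have e: "(?F * k) $$ (a, b) = (if a < p then 1 else - 1) * k $$ (a, b)"
    "(k * ?F) $$ (a, b) = (if b < p then 1 else - 1) * k $$ (a, b)" if lt: "a < p + q" "b < p + q" for a b
  proof -
    have "(?F * k) $$ (a, b) = (\<Sum>c<p + q. ?F $$ (a, c) * k $$ (c, b))"
      using sq_index[OF F_closed D(1), of a b] lt by simp
    also have "\<dots> = (\<Sum>c<p + q. if c = a then (if a < p then 1 else - 1) * k $$ (a, b) else 0)"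
      by (rule sum.cong) (use F lt in \<open>auto simp del: form_mat.simps\<close>)
    finally show "(?F * k) $$ (a, b) = (if a < p then 1 else - 1) * k $$ (a, b)" using lt by simp
    have "(k * ?F) $$ (a, b) = (\<Sum>c<p + q. k $$ (a, c) * ?F $$ (c, b))"
      using sq_index[OF D(1) F_closed, of a b] lt by simp
    also have "\<dots> = (\<Sum>c<p + q. if c = b then (if b < p then 1 else - 1) * k $$ (a, b) else 0)"
      by (rule sum.cong) (use F lt in \<open>auto simp del: form_mat.simps\<close>)
    finally show "(k * ?F) $$ (a, b) = (if b < p then 1 else - 1) * k $$ (a, b)" using lt by simp
  qed
  show "i < p \<Longrightarrow> j < q \<Longrightarrow> k $$ (i, p + j) = 0" "i < q \<Longrightarrow> j < p \<Longrightarrow> k $$ (p + i, j) = 0"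
    using e[of i "p + j"] e[of "p + i" j] D(5) by (simp_all del: form_mat.simps)
qed

text \<open>Comparing entries of \<open>F * k = k * F\<close> gives the block shape with rows
  \<open>(A, B)\<close> and \<open>(-B, A)\<close>.\<close>

lemma K_of_SpR:
  assumes "k \<in> K_of (SpR n)"
  shows "k \<in> carrier_mat (n + n) (n + n)"
    and "i < n \<Longrightarrow> j < n \<Longrightarrow> k $$ (n + i, j) = - k $$ (i, n + j)"
    and "i < n \<Longrightarrow> j < n \<Longrightarrow> k $$ (n + i, n + j) = k $$ (i, j)"
proof -
  interpret rgrp "SpR n" .
  let ?F = "form_mat (SpR n)"
  note D = K_D[OF assms]
  show "k \<in> carrier_mat (n + n) (n + n)" using D(1) by simp
  have F: "?F $$ (a, b) = (if b = n + a then 1 else if a = n + b then - 1 else 0)" if "a < n + n" "b < n + n" for a b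
    using that by auto
  have e: "i < n \<Longrightarrow> (?F * k) $$ (i, b) = k $$ (n + i, b)"
    "i < n \<Longrightarrow> (k * ?F) $$ (a, i) = - k $$ (a, n + i)"
    "i < n \<Longrightarrow> (k * ?F) $$ (a, n + i) = k $$ (a, i)" if lt: "a < n + n" "b < n + n" for a b i
  proof -
    assume i: "i < n"
    have "(?F * k) $$ (i, b) = (\<Sum>c<n + n. ?F $$ (i, c) * k $$ (c, b))"
      using sq_index[OF F_closed D(1), of i b] lt i by simp
    also have "\<dots> = (\<Sum>c<n + n. if c = n + i then k $$ (n + i, b) else 0)"
      by (rule sum.cong) (use F lt i in \<open>auto simp del: form_mat.simps\<close>)
    finally show "(?F * k) $$ (i, b) = k $$ (n + i, b)" using i by simp
    have "(k * ?F) $$ (a, i) = (\<Sum>c<n + n. k $$ (a, c) * ?F $$ (c, i))"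
      using sq_index[OF D(1) F_closed, of a i] lt i by simp
    also have "\<dots> = (\<Sum>c<n + n. if c = n + i then - k $$ (a, n + i) else 0)"
      by (rule sum.cong) (use F lt i in \<open>auto simp del: form_mat.simps\<close>)
    finally show "(k * ?F) $$ (a, i) = - k $$ (a, n + i)" using i by simp
    have "(k * ?F) $$ (a, n + i) = (\<Sum>c<n + n. k $$ (a, c) * ?F $$ (c, n + i))"
      using sq_index[OF D(1) F_closed, of a "n + i"] lt i by simp
    also have "\<dots> = (\<Sum>c<n + n. if c = i then k $$ (a, i) else 0)"
      by (rule sum.cong) (use F lt i in \<open>auto simp del: form_mat.simps\<close>)
    finally show "(k * ?F) $$ (a, n + i) = k $$ (a, i)" using i by simp
  qed
  show "k $$ (n + i, j) = - k $$ (i, n + j)" if "i < n" "j < n"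
    using e(1)[of i j i] e(2)[of i j j] that D(5) by (simp del: form_mat.simps)
  show "k $$ (n + i, n + j) = k $$ (i, j)" if "i < n" "j < n"
    using e(1)[of i "n + j" i] e(3)[of i j j] that D(5) by (simp del: form_mat.simps)
qed

lemma K_character_one: "K_character G (\<lambda>k. 1)"
  by (simp add: K_character_def mat_continuous_const)

lemma K_character_mult:
  "K_character G \<chi> \<Longrightarrow> K_character G \<chi>' \<Longrightarrow> K_character G (\<lambda>k. \<chi> k * \<chi>' k)"
  by (simp add: K_character_def mat_continuous_mult)

lemma K_character_det_first: "K_character (OR p q) (det_first p)"
  unfolding K_character_def
proof (intro conjI ballI)
  have "mat p p (\<lambda>(i, j). 1\<^sub>m (p + q) $$ (i, j)) = (1\<^sub>m p :: complex mat)" by (rule eq_matI) auto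
  then show "det_first p (1\<^sub>m (vdim (OR p q))) = 1" by (simp add: det_first_def)
  fix k k' assume k: "k \<in> K_of (OR p q)" and k': "k' \<in> K_of (OR p q)"
  note D = K_of_OR[OF k] and D' = K_of_OR[OF k']
  show "det_first p (k * k') = det_first p k * det_first p k'"
    unfolding det_first_def
  proof (rule det_mult_sum)
    fix i j assume i: "i < p" and j: "j < p"
    have "(k * k') $$ (i, j) = (\<Sum>b<p + q. k $$ (i, b) * k' $$ (b, j))"
      using index_mult_mat_sum[OF D(1) D'(1), of i j] i j by simp
    then show "(k * k') $$ (i, j) = (\<Sum>b<p. k $$ (i, b) * k' $$ (b, j))"
      using D(2)[OF i] by (simp add: sum_lessThan_add)
  qed
next
  show "mat_continuous_on (vdim (OR p q)) (K_of (OR p q)) (det_first p)"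
    unfolding det_first_def by (intro mat_continuous_det mat_continuous_entry) auto
qed

lemma K_character_det_second: "K_character (OR p q) (det_second p q)"
  unfolding K_character_def
proof (intro conjI ballI)
  have "mat q q (\<lambda>(i, j). 1\<^sub>m (p + q) $$ (p + i, p + j)) = (1\<^sub>m q :: complex mat)" by (rule eq_matI) auto
  then show "det_second p q (1\<^sub>m (vdim (OR p q))) = 1" by (simp add: det_second_def)
  fix k k' assume k: "k \<in> K_of (OR p q)" and k': "k' \<in> K_of (OR p q)"
  note D = K_of_OR[OF k] and D' = K_of_OR[OF k']
  show "det_second p q (k * k') = det_second p q k * det_second p q k'"
    unfolding det_second_def
  proof (rule det_mult_sum)
    fix i j assume i: "i < q" and j: "j < q"
    have "(k * k') $$ (p + i, p + j) = (\<Sum>b<p + q. k $$ (p + i, b) * k' $$ (b, p + j))"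
      using index_mult_mat_sum[OF D(1) D'(1), of "p + i" "p + j"] i j by simp
    then show "(k * k') $$ (p + i, p + j) = (\<Sum>b<q. k $$ (p + i, p + b) * k' $$ (p + b, p + j))"
      using D(3)[OF i] by (simp add: sum_lessThan_add)
  qed
next
  show "mat_continuous_on (vdim (OR p q)) (K_of (OR p q)) (det_second p q)"
    unfolding det_second_def by (intro mat_continuous_det mat_continuous_entry) auto
qed

lemma K_character_det_unitary: "K_character (SpR n) (det_unitary n)"
  unfolding K_character_def
proof (intro conjI ballI)
  have "mat n n (\<lambda>(i, j). 1\<^sub>m (n + n) $$ (i, j) - \<i> * 1\<^sub>m (n + n) $$ (i, n + j)) = (1\<^sub>m n :: complex mat)"
    by (rule eq_matI) auto
  then show "det_unitary n (1\<^sub>m (vdim (SpR n))) = 1" by (simp add: det_unitary_def)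
  fix k k' assume k: "k \<in> K_of (SpR n)" and k': "k' \<in> K_of (SpR n)"
  note D = K_of_SpR[OF k] and D' = K_of_SpR[OF k']
  show "det_unitary n (k * k') = det_unitary n k * det_unitary n k'"
    unfolding det_unitary_def
  proof (rule det_mult_sum)
    fix i j assume i: "i < n" and j: "j < n"
    have e: "(k * k') $$ (i, b) = (\<Sum>b'<n. k $$ (i, b') * k' $$ (b', b)) + (\<Sum>b'<n. k $$ (i, n + b') * k' $$ (n + b', b))"
      if "b < n + n" for b
      using index_mult_mat_sum[OF D(1) D'(1), of i b] i that by (simp add: sum_lessThan_add)
    have "(k * k') $$ (i, j) - \<i> * (k * k') $$ (i, n + j) =
        (\<Sum>b<n. k $$ (i, b) * k' $$ (b, j) + k $$ (i, n + b) * k' $$ (n + b, j)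
          - \<i> * (k $$ (i, b) * k' $$ (b, n + j) + k $$ (i, n + b) * k' $$ (n + b, n + j)))"
      using e[of j] e[of "n + j"] j
      by (simp add: sum.distrib sum_subtractf sum_distrib_left distrib_left)
    \<comment> \<open>The rule \<open>(A - iB)(A' - iB') = (AA' - BB') - i(AB' + BA')\<close>, after
      the lower blocks of \<open>k'\<close> are expressed by the upper ones.\<close>
    also have "\<dots> = (\<Sum>b<n. (k $$ (i, b) - \<i> * k $$ (i, n + b)) * (k' $$ (b, j) - \<i> * k' $$ (b, n + j)))"
      by (rule sum.cong) (use D'(2,3) j in \<open>auto simp: algebra_simps\<close>)
    finally show "(k * k') $$ (i, j) - \<i> * (k * k') $$ (i, n + j) =
        (\<Sum>b<n. (k $$ (i, b) - \<i> * k $$ (i, n + b)) * (k' $$ (b, j) - \<i> * k' $$ (b, n + j)))" .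
  qed
next
  have "mat_continuous_on (vdim (SpR n)) (K_of (SpR n))
      (\<lambda>k. det (mat n n (\<lambda>(i, j). k $$ (i, j) + (- \<i>) * k $$ (i, n + j))))"
    by (intro mat_continuous_det mat_continuous_add mat_continuous_mult mat_continuous_const mat_continuous_entry) auto
  then show "mat_continuous_on (vdim (SpR n)) (K_of (SpR n)) (det_unitary n)"
    unfolding det_unitary_def by simp
qed

lemma \<mu>_char_character:
  "K_character (split_group cs n) (\<mu>_char cs n)" "K_character (split_group cs n) (\<mu>'_char cs n)"
proof -
  have e: "\<mu>_char CaseS n = (\<lambda>k. 1)" "\<mu>_char CaseO1 n = det_second (n + 1) n" "\<mu>_char CaseO2 n = det_first (n + 1)"
    "\<mu>'_char CaseS n = det_unitary n" "\<mu>'_char CaseO1 n = (\<lambda>k. 1)"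
    "\<mu>'_char CaseO2 n = (\<lambda>k. det_first (n + 1) k * det_second (n + 1) n k)"
    by (rule ext, simp)+
  show "K_character (split_group cs n) (\<mu>_char cs n)" "K_character (split_group cs n) (\<mu>'_char cs n)"
    by (cases cs; simp add: e K_character_one K_character_mult K_character_det_first K_character_det_second
        K_character_det_unitary del: \<mu>_char.simps \<mu>'_char.simps)+
qed

lemma r_const_real: "cnj (r_const cs n) = r_const cs n"
  by (cases cs) simp_all

theorem theorem9p30:
  fixes G :: real_group and n :: nat
    and X :: "'x gk_module" and h :: "'x \<Rightarrow> 'x \<Rightarrow> complex"
    and hV :: "complex vec \<Rightarrow> complex vec \<Rightarrow> complex"
    and B :: "complex mat set" and d :: "complex mat \<Rightarrow> complex mat"
    and P :: "nat \<times> nat \<Rightarrow> nat \<times> nat \<Rightarrow> complex"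
    and w :: "nat \<Rightarrow> complex"
  assumes n: "1 \<le> n"
    and G: "G = SpR n \<or> (\<exists>p q. G = OR p q \<and> q \<le> p \<and> p + q = 2 * n + 1)"
    and X: "harish_chandra_module G X"
    and h: "gk_invariant_form G X h"
    and hV: "V_form G hV"
    and B: "killing_dual_bases G B d"
    and P: "trivial_projection G P"
  shows
    "((\<exists>\<mu> k. K_character G \<mu> \<and> 1 \<le> k \<and> k \<le> n \<and>
        \<not> unitary_langlands_quotient (vw_algebra k (vw_m0 G) (vw_m1 G) w)
            (F_space G \<mu> k X) (F_vw_action G B d P k X) (F_form G hV h k))
      \<longrightarrow> \<not> unitary_gk_module G (gk_langlands_quotient X h))
     \<and>
     (\<forall>cs k \<nu>. G = split_group cs n \<and> k \<le> n \<and>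
        gk_subrepresentation G X (principal_series cs n k \<nu>) \<and>
        (\<not> unitary_langlands_quotient (hecke_algebra k (c_\<mu> cs))
             (F_space G (\<mu>_char cs n) k X)
             (F_hecke_action G B d P (\<mu>_char cs n) (r_const cs n) k X) (F_form G hV h k)
         \<or> \<not> unitary_langlands_quotient (hecke_algebra (n - k) (c_\<mu>' cs))
             (F_space G (\<mu>'_char cs n) (n - k) X)
             (F_hecke_action G B d P (\<mu>'_char cs n) (r_const cs n) (n - k) X)
             (F_form G hV h (n - k)))
      \<longrightarrow> \<not> unitary_gk_module G (gk_langlands_quotient X h))"
proof -
  have gk: "is_gk_module G X" and adm: "admissible G X" using X unfolding harish_chandra_module_def by simp_all
  have ms: "mult_space G B d X hV P"
    by (intro mult_space.intro gk_tens.intro gk_tens_axioms.intro casimir.intro gk hV P B)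
  \<comment> \<open>Both parts are proved by contraposition: unitarity of the quotient of
    \<open>X\<close> gives unitarity for every character of \<open>K\<close>, here over the
    VW-algebra and below over the Hecke algebra.\<close>
  have vw: "unitary_langlands_quotient (vw_algebra k (vw_m0 G) (vw_m1 G) w)
        (F_space G \<mu> k X) (F_vw_action G B d P k X) (F_form G hV h k)"
    if "unitary_gk_module G (gk_langlands_quotient X h)" "K_character G \<mu>" for k \<mu>
    by (rule tensor_action.unitary_quotient[OF mult_space.vw_tensor_action[OF ms] adm that(2) h that(1)])
  have hecke: "unitary_langlands_quotient (hecke_algebra k c)
        (F_space G \<mu> k X) (F_hecke_action G B d P \<mu> (r_const cs n) k X) (F_form G hV h k)"
    if "unitary_gk_module G (gk_langlands_quotient X h)" "K_character G \<mu>" for k c \<mu> cs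
    by (rule tensor_action.unitary_quotient[OF mult_space.hecke_tensor_action[OF ms r_const_real] adm that(2) h that(1)])
  show ?thesis using vw hecke \<mu>_char_character by blast
qed

end
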